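(* Let $\Omega$ be the three-edge star graph described in the context, with edge lengths $l_1,l_2,l_3>0$, $l_2\ge l_3$, and let $q$ be a real-valued function on $\Omega$ whose restriction to each edge $e_j$ is continuous. Set $T_*=\max\{\,l_2,\ l_1+l_3\,\}$. Then there exists a constant $C$ depending only on $q,l_1,l_2,l_3$ such that the following holds. For every $T\ge 2T_*$ and every $(\phi^1,\phi^2)\in\mathcal H^1_0\times\mathcal H$ there exist controls $\mathbf f=(f_1,f_2)\in H^1_0(0,T)\times L^2(0,T)$ such that the solution $u^{\mathbf f}$ of the initial boundary value problem $$\partial_{tt}u-\partial_{xx}u+q(x)u=0,\quad x\in e_j,\ j=1,2,3,\ 0<t<T,\qquad u(\cdot,0)=u_t(\cdot,0)=0,$$ $$u_1(v_1,t)=f_1(t),\qquad u_2(v_2,t)=u_3(v_3,t)=0,$$ $$\partial u_2(v_0,t)-\partial u_1(v_0,t)=f_2(t),\quad \partial u_3(v_0,t)-\partial u_1(v_0,t)=0,\quad \sum_{j=1}^3u_j(v_0,t)=0$$ satisfies $$u^{\mathbf f}(\cdot,T)=\phi^1,\qquad u^{\mathbf f}_t(\cdot,T)=\phi^2\quad\text{on }\Omega,$$ and $$\|f_1\|_{H^1(0,T)}+\|f_2\|_{L^2(0,T)}\le C\big(\|\phi^1\|_{\mathcal H^1}+\|\phi^2\|_{\mathcal H}\big).$$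
   Context: The star graph $\Omega$ has a central vertex $v_0$, boundary vertices $v_1,v_2,v_3$, and edges $e_1,e_2,e_3$, where $e_j$ joins $v_0$ and $v_j$ and is identified with the interval $(0,l_j)$. For a function $\phi$ on $\Omega$, $\phi_j$ denotes its restriction to $e_j$. $\partial u_j(v_0,t)$ denotes the spatial derivative of $u$ at $v_0$ along $e_j$ in the direction outward from the vertex $v_0$ (i.e. pointing from $v_0$ into the edge $e_j$). $\mathcal H=L^2(\Omega)$. $\mathcal H^1$ is the space of functions on $\Omega$ whose restriction to each edge $e_j$ lies in $H^1(e_j)$, with norm $\|\phi\|^2_{\mathcal H^1}=\sum_{j=1}^3\big(\|\phi'\|^2_{L^2(e_j)}+\|\phi\|^2_{L^2(e_j)}\big)$. $\mathcal H^1_0$ is the space of $y\in\mathcal H^1$ with $y_1(v_1)=y_2(v_2)=y_3(v_3)=0$ and $\sum_{j=1}^3y_j(v_0)=0$. The solution $u^{\mathbf f}$ is understood in the usual generalized (weak) sense. As usual, $H^1_0(0,T)$ consists of the $H^1(0,T)$ functions vanishing at $0$ and $T$. *)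

theory Defs
  imports "HOL-Analysis.Analysis"
begin

subsection \<open>Lebesgue and Sobolev spaces on an interval (0, l)\<close>

definition L2_space :: "real \<Rightarrow> (real \<Rightarrow> real) set" where
  "L2_space l = {f. set_borel_measurable lebesgue {0<..<l} f \<and>
                    set_integrable lebesgue {0<..<l} (\<lambda>x. (f x)\<^sup>2)}"

definition L2_norm :: "real \<Rightarrow> (real \<Rightarrow> real) \<Rightarrow> real" where
  "L2_norm l f = sqrt (LINT x:{0<..<l}|lebesgue. (f x)\<^sup>2)"

text \<open>Continuously differentiable functions with compact support in the open interval (0, l).\<close>

definition test_function :: "real \<Rightarrow> (real \<Rightarrow> real) \<Rightarrow> bool" where
  "test_function l \<psi> \<longleftrightarrow>
     (\<forall>x. \<psi> differentiable (at x)) \<and> continuous_on UNIV (deriv \<psi>) \<and>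
     (\<exists>a b. 0 < a \<and> b < l \<and> (\<forall>x. x \<notin> {a..b} \<longrightarrow> \<psi> x = 0))"

definition has_weak_deriv :: "real \<Rightarrow> (real \<Rightarrow> real) \<Rightarrow> (real \<Rightarrow> real) \<Rightarrow> bool" where
  "has_weak_deriv l f g \<longleftrightarrow>
     (\<forall>a b. 0 < a \<and> b < l \<longrightarrow>
        set_integrable lebesgue {a..b} f \<and> set_integrable lebesgue {a..b} g) \<and>
     (\<forall>\<psi>. test_function l \<psi> \<longrightarrow>
        (LINT x:{0<..<l}|lebesgue. f x * deriv \<psi> x) =
        - (LINT x:{0<..<l}|lebesgue. g x * \<psi> x))"

text \<open>An element of \<open>H\<^sup>1(0, l)\<close> is represented by its representative that is continuous on the
  closed interval, so that its values at the endpoints are the traces.  Nothing is required of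
  the function outside the closed interval.\<close>

definition H1_space :: "real \<Rightarrow> (real \<Rightarrow> real) set" where
  "H1_space l = {f. continuous_on {0..l} f \<and> f \<in> L2_space l \<and>
                    (\<exists>g \<in> L2_space l. has_weak_deriv l f g)}"

definition H10_space :: "real \<Rightarrow> (real \<Rightarrow> real) set" where
  "H10_space l = {f \<in> H1_space l. f 0 = 0 \<and> f l = 0}"

text \<open>Some representative of the weak derivative; it is determined almost everywhere on (0, l).\<close>

definition weak_deriv :: "real \<Rightarrow> (real \<Rightarrow> real) \<Rightarrow> real \<Rightarrow> real" where
  "weak_deriv l f = (SOME g. g \<in> L2_space l \<and> has_weak_deriv l f g)"

definition H1_norm :: "real \<Rightarrow> (real \<Rightarrow> real) \<Rightarrow> real" where
  "H1_norm l f = sqrt ((L2_norm l (weak_deriv l f))\<^sup>2 + (L2_norm l f)\<^sup>2)"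

subsection \<open>Function spaces on the three-edge star graph\<close>

text \<open>A function on the graph is a family \<open>\<phi> j\<close>, \<open>j \<in> {1, 2, 3}\<close>, of functions on the edges.
  The \<open>j\<close>-th edge is identified with \<open>(0, l j)\<close> in such a way that the endpoint \<open>0\<close> is the central
  vertex and \<open>l j\<close> is the \<open>j\<close>-th boundary vertex.  The derivative at the central vertex pointing
  into the edge is therefore the ordinary derivative at \<open>0\<close>.\<close>

type_synonym graph_fun = "nat \<Rightarrow> real \<Rightarrow> real"

definition graph_L2 :: "(nat \<Rightarrow> real) \<Rightarrow> graph_fun set" where
  "graph_L2 l = {\<phi>. \<forall>j\<in>{1,2,3}. \<phi> j \<in> L2_space (l j)}"

definition graph_L2_inner :: "(nat \<Rightarrow> real) \<Rightarrow> graph_fun \<Rightarrow> graph_fun \<Rightarrow> real" where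
  "graph_L2_inner l \<phi> \<psi> = (\<Sum>j\<in>{1,2,3}. (LINT x:{0<..<l j}|lebesgue. \<phi> j x * \<psi> j x))"

definition graph_L2_norm :: "(nat \<Rightarrow> real) \<Rightarrow> graph_fun \<Rightarrow> real" where
  "graph_L2_norm l \<phi> = sqrt (\<Sum>j\<in>{1,2,3}. (L2_norm (l j) (\<phi> j))\<^sup>2)"

definition graph_H1 :: "(nat \<Rightarrow> real) \<Rightarrow> graph_fun set" where
  "graph_H1 l = {\<phi>. \<forall>j\<in>{1,2,3}. \<phi> j \<in> H1_space (l j)}"

definition graph_weak_deriv :: "(nat \<Rightarrow> real) \<Rightarrow> graph_fun \<Rightarrow> graph_fun" where
  "graph_weak_deriv l \<phi> = (\<lambda>j. weak_deriv (l j) (\<phi> j))"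

definition graph_H1_norm :: "(nat \<Rightarrow> real) \<Rightarrow> graph_fun \<Rightarrow> real" where
  "graph_H1_norm l \<phi> =
     sqrt (\<Sum>j\<in>{1,2,3}. ((L2_norm (l j) (weak_deriv (l j) (\<phi> j)))\<^sup>2 + (L2_norm (l j) (\<phi> j))\<^sup>2))"

definition graph_H10 :: "(nat \<Rightarrow> real) \<Rightarrow> graph_fun set" where
  "graph_H10 l = {y \<in> graph_H1 l. (\<forall>j\<in>{1,2,3}. y j (l j) = 0) \<and> (\<Sum>j\<in>{1,2,3}. y j 0) = 0}"

subsection \<open>Weak solutions of the controlled wave equation\<close>

text \<open>
  \<open>u\<close> is a weak (finite energy) solution on \<open>[0, T]\<close>, with time derivative \<open>v\<close>, of

    \<open>u\<^sub>t\<^sub>t - u\<^sub>x\<^sub>x + q u = 0\<close> on every edge, \<open>u = u\<^sub>t = 0\<close> at time 0,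

    \<open>u\<^sub>1 = f\<^sub>1\<close>, \<open>u\<^sub>2 = 0\<close>, \<open>u\<^sub>3 = 0\<close> at the respective boundary vertices,

    \<open>\<partial>u\<^sub>2 - \<partial>u\<^sub>1 = f\<^sub>2\<close>, \<open>\<partial>u\<^sub>3 - \<partial>u\<^sub>1 = 0\<close>, \<open>u\<^sub>1 + u\<^sub>2 + u\<^sub>3 = 0\<close> at the central vertex.

  The state at time \<open>t\<close> is \<open>u t\<close>, with value \<open>u t j x\<close> at the point \<open>x\<close> of the \<open>j\<close>-th edge.  The
  regularity is \<open>u \<in> C([0,T]; H\<^sup>1) \<inter> C\<^sup>1([0,T]; L\<^sup>2)\<close>, and in this class the solution is unique.

  The conditions on the values of \<open>u\<close> are imposed as such; those on the derivatives at the central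
  vertex are natural conditions, contained in the variational equation: for a smooth solution and
  a test function \<open>\<eta>\<close> in \<open>graph_H10 l\<close>, integration by parts on the edges gives

    \<open>(u\<^sub>t\<^sub>t, \<eta>) + (u\<^sub>x, \<eta>\<^sub>x) + (q u, \<eta>) + \<Sum>\<^sub>j \<partial>u\<^sub>j \<eta>\<^sub>j(0) = 0\<close>,

  and the last sum is \<open>\<partial>u\<^sub>1 (\<eta>\<^sub>1(0) + \<eta>\<^sub>2(0) + \<eta>\<^sub>3(0)) + f\<^sub>2 \<eta>\<^sub>2(0) = f\<^sub>2 \<eta>\<^sub>2(0)\<close>.
\<close>

definition weak_solution ::
  "(nat \<Rightarrow> real) \<Rightarrow> graph_fun \<Rightarrow> real \<Rightarrow> (real \<Rightarrow> real) \<Rightarrow> (real \<Rightarrow> real) \<Rightarrow>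
   (real \<Rightarrow> graph_fun) \<Rightarrow> (real \<Rightarrow> graph_fun) \<Rightarrow> bool" where
  "weak_solution l q T f1 f2 u v \<longleftrightarrow>
     (\<forall>t\<in>{0..T}. u t \<in> graph_H1 l \<and> v t \<in> graph_L2 l) \<and>
     (\<forall>s\<in>{0..T}.
        ((\<lambda>t. graph_H1_norm l (\<lambda>j x. u t j x - u s j x)) \<longlongrightarrow> 0) (at s within {0..T}) \<and>
        ((\<lambda>t. graph_L2_norm l (\<lambda>j x. (u t j x - u s j x) / (t - s) - v s j x)) \<longlongrightarrow> 0)
           (at s within {0..T}) \<and>
        ((\<lambda>t. graph_L2_norm l (\<lambda>j x. v t j x - v s j x)) \<longlongrightarrow> 0) (at s within {0..T})) \<and>
     (\<forall>j\<in>{1,2,3}. (\<forall>x\<in>{0..l j}. u 0 j x = 0) \<and>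
                   (AE x in lebesgue. x \<in> {0<..<l j} \<longrightarrow> v 0 j x = 0)) \<and>
     (\<forall>t\<in>{0..T}. u t 1 (l 1) = f1 t \<and> u t 2 (l 2) = 0 \<and> u t 3 (l 3) = 0 \<and>
                  (\<Sum>j\<in>{1,2,3}. u t j 0) = 0) \<and>
     (\<forall>\<eta>\<in>graph_H10 l.
        has_weak_deriv T (\<lambda>t. graph_L2_inner l (v t) \<eta>)
          (\<lambda>t. - (graph_L2_inner l (graph_weak_deriv l (u t)) (graph_weak_deriv l \<eta>) +
                  graph_L2_inner l (\<lambda>j x. q j x * u t j x) \<eta> +
                  f2 t * \<eta> 2 0)))"

end

theory Submission
  imports Defs
begin

text \<open>Read the space variable as time. A function on a string of length \<open>L\<close> that solves the wave
  equation and vanishes at the end \<open>s = 0\<close> is determined, through d'Alembert's formula and a Duhamel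
  term for the potential, by its slope \<open>p\<close> at that end. Its state \<open>(u, u\<^sub>t)\<close> at a time \<open>t\<^sub>0\<close> involves \<open>p\<close>
  only on the window \<open>\<bar>t - t\<^sub>0\<bar> \<le> L\<close>, and on this window \<open>p\<close> equals the prescribed value of \<open>u\<^sub>s \<plusminus> u\<^sub>t\<close>
  minus a Volterra term in \<open>u\<close>. For \<open>T \<ge> 2 L\<close> the windows around \<open>0\<close> and \<open>T\<close> do not overlap, so the zero
  state at \<open>0\<close> and any state at \<open>T\<close> can be prescribed together: this is a linear fixed point equation
  for \<open>u\<close>, a contraction for a suitable exponential weight. As the weight decays away from \<open>0\<close> and
  \<open>T\<close>, all bounds are uniform in \<open>T\<close>.

  The edge \<open>e\<^sub>2\<close> is such a string; it is steered by its trace \<open>g\<close> at \<open>v\<^sub>0\<close>. The conditions \<open>u\<^sub>1 + u\<^sub>3 = - g\<close>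
  and \<open>\<partial>u\<^sub>3 = \<partial>u\<^sub>1\<close> say that \<open>u\<^sub>3\<close> and \<open>- u\<^sub>1\<close> together are a solution on one string of length
  \<open>l\<^sub>1 + l\<^sub>3\<close> that jumps by \<open>g\<close> at \<open>v\<^sub>0\<close> and has a continuous slope there, so this string is steered in the
  same way. Finally \<open>f\<^sub>1\<close> is the trace of \<open>u\<^sub>1\<close> at \<open>v\<^sub>1\<close>, and \<open>f\<^sub>2\<close> the difference of the slopes at \<open>v\<^sub>0\<close>.\<close>

subsection \<open>Square integrable functions on the line\<close>

text \<open>The datum \<open>p\<close> is only square integrable, yet the controls need traces at
  single points: \<open>f2\<close> is a difference of slopes at the centre and \<open>f1\<close>
  must have a square integrable derivative. With space read as time this hidden regularity comes for
  free: on every line \<open>s = const\<close> slope and velocity consist of translates of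
  \<open>p\<close> and of the derivative of the jump, plus a transported term, so their energies in
  time stay bounded. The same bound makes the trace of \<open>u2\<close> an admissible jump for the
  other string.

  Such a solution need not have second derivatives, and nothing is smoothed to obtain the
  variational equation. The explicit formulas for slope and velocity are tested in time against
  primitives \<open>prim k\<close>, and Fubini moves the time derivative to the test function. The
  tested slope is then absolutely continuous in \<open>s\<close>, which is all that integration by
  parts in space requires.

  The contraction needs a small factor for a string and a potential of any size. It is the
  \<open>1 / lam\<close> gained when the weight is integrated over a window or over the base of a
  cone; \<open>lam\<close> depends only on a bound of the potential and on the total length.\<close>

definition square_integrable :: "(real \<Rightarrow> real) \<Rightarrow> bool" where
  "square_integrable f \<longleftrightarrow> f \<in> borel_measurable borel \<and> integrable lborel (\<lambda>x. (f x)\<^sup>2)"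

definition energy :: "(real \<Rightarrow> real) \<Rightarrow> real" where
  "energy f = (LINT x|lborel. (f x)\<^sup>2)"

lemma square_integrable_measurable [measurable_dest]:
  "square_integrable f \<Longrightarrow> f \<in> borel_measurable borel"
  by (simp add: square_integrable_def)

lemma square_integrableD: "square_integrable f \<Longrightarrow> integrable lborel (\<lambda>x. (f x)\<^sup>2)"
  by (simp add: square_integrable_def)

lemma energy_nonneg [simp]: "0 \<le> energy f"
  by (simp add: energy_def)

lemma square_integrable_bound:
  assumes "square_integrable f" and [measurable]: "g \<in> borel_measurable borel"
    and "\<And>x. \<bar>g x\<bar> \<le> \<bar>f x\<bar>"
  shows "square_integrable g" "energy g \<le> energy f"
proof -
  have le: "(g x)\<^sup>2 \<le> (f x)\<^sup>2" for x
    using assms(3) by (simp add: abs_le_square_iff)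
  have 1: "integrable lborel (\<lambda>x. (g x)\<^sup>2)"
    by (rule Bochner_Integration.integrable_bound[OF square_integrableD[OF assms(1)]])
       (use le in \<open>auto simp: abs_le_square_iff\<close>)
  then show "square_integrable g" by (simp add: square_integrable_def)
  show "energy g \<le> energy f"
    unfolding energy_def by (rule integral_mono[OF 1 square_integrableD[OF assms(1)]]) (rule le)
qed

lemma square_integrable_zero [simp]: "square_integrable (\<lambda>x. 0)"
  by (simp add: square_integrable_def)

lemma energy_zero [simp]: "energy (\<lambda>x. 0) = 0"
  by (simp add: energy_def)

lemma square_integrable_cmult:
  "square_integrable f \<Longrightarrow> square_integrable (\<lambda>x. c * f x)"
  by (auto simp: square_integrable_def power_mult_distrib)

lemma energy_cmult: "energy (\<lambda>x. c * f x) = c\<^sup>2 * energy f"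
  by (simp add: energy_def power_mult_distrib)

lemma energy_uminus [simp]: "energy (\<lambda>x. - f x) = energy f"
  by (simp add: energy_def)

lemma energy_diff_commute: "energy (\<lambda>x. f x - g x) = energy (\<lambda>x. g x - f x)"
  by (simp add: energy_def power2_commute)

lemma sum_sq_le: "((a::real) + b)\<^sup>2 \<le> 2 * a\<^sup>2 + 2 * b\<^sup>2"
proof -
  have "0 \<le> (a - b)\<^sup>2" by simp
  then show ?thesis by (simp add: power2_eq_square algebra_simps)
qed

lemma
  assumes f: "square_integrable f" and g: "square_integrable g"
  shows square_integrable_add: "square_integrable (\<lambda>x. f x + g x)"
    and energy_add_le: "energy (\<lambda>x. f x + g x) \<le> 2 * energy f + 2 * energy g"
proof -
  note [measurable] = square_integrable_measurable[OF f] square_integrable_measurable[OF g]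
  have i: "integrable lborel (\<lambda>x. 2 * (f x)\<^sup>2 + 2 * (g x)\<^sup>2)"
    using square_integrableD[OF f] square_integrableD[OF g] by simp
  have 1: "integrable lborel (\<lambda>x. (f x + g x)\<^sup>2)"
    by (rule Bochner_Integration.integrable_bound[OF i]) (auto intro: sum_sq_le)
  then show "square_integrable (\<lambda>x. f x + g x)" by (simp add: square_integrable_def)
  have "energy (\<lambda>x. f x + g x) \<le> (LINT x|lborel. 2 * (f x)\<^sup>2 + 2 * (g x)\<^sup>2)"
    unfolding energy_def by (rule integral_mono[OF 1 i]) (rule sum_sq_le)
  also have "\<dots> = 2 * energy f + 2 * energy g"
    unfolding energy_def using square_integrableD[OF f] square_integrableD[OF g] by simp
  finally show "energy (\<lambda>x. f x + g x) \<le> 2 * energy f + 2 * energy g" .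
qed

lemma square_integrable_uminus: "square_integrable f \<Longrightarrow> square_integrable (\<lambda>x. - f x)"
  using square_integrable_cmult[of f "-1"] by simp

lemma
  assumes f: "square_integrable f" and g: "square_integrable g"
  shows square_integrable_diff: "square_integrable (\<lambda>x. f x - g x)"
    and energy_diff_le: "energy (\<lambda>x. f x - g x) \<le> 2 * energy f + 2 * energy g"
  using square_integrable_add[OF f square_integrable_uminus[OF g]]
    energy_add_le[OF f square_integrable_uminus[OF g]] by simp_all

lemma square_integrable_indicator:
  assumes "square_integrable f" and [measurable]: "A \<in> sets borel"
  shows "square_integrable (\<lambda>x. indicator A x * f x)" "energy (\<lambda>x. indicator A x * f x) \<le> energy f"
proof -
  note [measurable] = square_integrable_measurable[OF assms(1)]
  have *: "\<And>x. \<bar>indicator A x * f x\<bar> \<le> \<bar>f x\<bar>" by (auto simp: indicator_def)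
  show "square_integrable (\<lambda>x. indicator A x * f x)" "energy (\<lambda>x. indicator A x * f x) \<le> energy f"
    by (rule square_integrable_bound[OF assms(1) _ *], measurable)+
qed

lemma square_integrable_affine:
  assumes "square_integrable f" "c \<noteq> 0"
  shows "square_integrable (\<lambda>x. f (t + c * x))"
proof -
  note [measurable] = square_integrable_measurable[OF assms(1)]
  show ?thesis using lborel_integrable_real_affine[OF square_integrableD[OF assms(1)] assms(2), of t]
    by (simp add: square_integrable_def)
qed

lemma energy_affine: "c \<noteq> 0 \<Longrightarrow> energy (\<lambda>x. f (t + c * x)) = energy f / \<bar>c\<bar>"
  unfolding energy_def
  by (subst (2) lborel_integral_real_affine[where c=c and t=t]) auto

lemma square_integrable_shift:
  "square_integrable f \<Longrightarrow> square_integrable (\<lambda>x. f (x + c))"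
  "square_integrable f \<Longrightarrow> square_integrable (\<lambda>x. f (c + x))"
  "square_integrable f \<Longrightarrow> square_integrable (\<lambda>x. f (x - c))"
  "square_integrable f \<Longrightarrow> square_integrable (\<lambda>x. f (c - x))"
  using square_integrable_affine[of f 1 c] square_integrable_affine[of f 1 "-c"]
    square_integrable_affine[of f "-1" c] by (simp_all add: add.commute)

lemma energy_shift:
  "energy (\<lambda>x. f (x + c)) = energy f" "energy (\<lambda>x. f (c + x)) = energy f"
  "energy (\<lambda>x. f (x - c)) = energy f" "energy (\<lambda>x. f (c - x)) = energy f"
  using energy_affine[of 1 f c] energy_affine[of 1 f "-c"]
    energy_affine[of "-1" f c] by (simp_all add: add.commute)

lemma square_integrable_product:
  assumes f: "square_integrable f" and g: "square_integrable g"
  shows "integrable lborel (\<lambda>x. f x * g x)"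
proof -
  note [measurable] = square_integrable_measurable[OF f] square_integrable_measurable[OF g]
  have i: "integrable lborel (\<lambda>x. (f x)\<^sup>2 + (g x)\<^sup>2)"
    using square_integrableD[OF f] square_integrableD[OF g] by simp
  have *: "\<bar>a * b\<bar> \<le> a\<^sup>2 + b\<^sup>2" for a b :: real
  proof -
    have "0 \<le> (\<bar>a\<bar> - \<bar>b\<bar>)\<^sup>2" "0 \<le> \<bar>a\<bar> * \<bar>b\<bar>" by simp_all
    moreover have "(\<bar>a\<bar> - \<bar>b\<bar>)\<^sup>2 = a\<^sup>2 + b\<^sup>2 - 2 * (\<bar>a\<bar> * \<bar>b\<bar>)"
      by (simp add: power2_diff)
    ultimately have "\<bar>a\<bar> * \<bar>b\<bar> \<le> a\<^sup>2 + b\<^sup>2" by linarith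
    then show ?thesis by (simp add: abs_mult)
  qed
  show ?thesis
    by (rule Bochner_Integration.integrable_bound[OF i]) (auto intro: * simp: abs_mult[symmetric])
qed

text \<open>The quadratic polynomial \<open>energy f + 2 * t * B + t^2 * energy g\<close> is
  nonnegative for all \<open>t\<close>. If \<open>energy g = 0\<close> it is affine, which forces
  \<open>B = 0\<close>; otherwise its minimum at \<open>t = - B / energy g\<close> gives the
  claim.\<close>

lemma Cauchy_Schwarz_energy:
  assumes f: "square_integrable f" and g: "square_integrable g"
  shows "(LINT x|lborel. f x * g x)\<^sup>2 \<le> energy f * energy g"
proof -
  define B where "B = (LINT x|lborel. f x * g x)"
  have q: "0 \<le> energy f + 2 * t * B + t\<^sup>2 * energy g" for t
  proof -
    have "0 \<le> (LINT x|lborel. (f x + t * g x)\<^sup>2)" by simp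
    also have "\<dots> = (LINT x|lborel. (f x)\<^sup>2 + 2 * t * (f x * g x) + t\<^sup>2 * (g x)\<^sup>2)"
      by (intro Bochner_Integration.integral_cong) (auto simp: power2_eq_square algebra_simps)
    also have "\<dots> = energy f + 2 * t * B + t\<^sup>2 * energy g"
      using square_integrableD[OF f] square_integrableD[OF g] square_integrable_product[OF f g]
      by (simp add: energy_def B_def)
    finally show ?thesis .
  qed
  have "B\<^sup>2 \<le> energy f * energy g"
  proof (cases "energy g = 0")
    case True
    have "B = 0"
    proof (rule ccontr)
      assume "B \<noteq> 0"
      have "energy f + 2 * (- (energy f + 1) / (2 * B)) * B = -1"
        using \<open>B \<noteq> 0\<close> by (simp add: field_simps)
      with q[of "- (energy f + 1) / (2 * B)"] True show False by simp
    qed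
    then show ?thesis using True by simp
  next
    case False
    then have p: "0 < energy g" using energy_nonneg[of g] by linarith
    have "energy f + 2 * (- B / energy g) * B + (- B / energy g)\<^sup>2 * energy g = energy f - B\<^sup>2 / energy g"
      using p by (simp add: field_simps power2_eq_square)
    with q[of "- B / energy g"] have "B\<^sup>2 / energy g \<le> energy f" by simp
    then show ?thesis using p by (simp add: field_simps)
  qed
  then show ?thesis by (simp add: B_def)
qed

lemma square_integrable_indicator_interval: "square_integrable (indicator {a..b::real})"
proof -
  have "(\<lambda>x. (indicator {a..b} x)\<^sup>2) = (indicator {a..b::real} :: real \<Rightarrow> real)"
    by (auto simp: indicator_def)
  moreover have "integrable lborel (indicator {a..b::real} :: real \<Rightarrow> real)"
    by (rule integrable_real_indicator) (auto simp: emeasure_lborel_Icc_eq)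
  ultimately show ?thesis by (simp add: square_integrable_def)
qed

lemma energy_indicator_interval: "a \<le> b \<Longrightarrow> energy (indicator {a..b::real}) = b - a"
proof -
  assume "a \<le> b"
  have "(\<lambda>x. (indicator {a..b} x)\<^sup>2) = (indicator {a..b::real} :: real \<Rightarrow> real)"
    by (auto simp: indicator_def)
  then show ?thesis using \<open>a \<le> b\<close> by (simp add: energy_def)
qed

lemma square_integrable_bounded_support:
  assumes [measurable]: "f \<in> borel_measurable borel"
    and "\<And>x. \<bar>f x\<bar> \<le> K" "\<And>x. x \<notin> {a..b} \<Longrightarrow> f x = 0"
  shows "square_integrable f" "a \<le> b \<Longrightarrow> energy f \<le> K\<^sup>2 * (b - a)"
proof -
  have K: "0 \<le> K" using assms(2)[of 0] by linarith
  have *: "square_integrable (\<lambda>x. K * indicator {a..b} x)"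
    by (rule square_integrable_cmult[OF square_integrable_indicator_interval])
  have le: "\<bar>f x\<bar> \<le> \<bar>K * indicator {a..b} x\<bar>" for x
    using assms(2,3)[of x] K by (cases "x \<in> {a..b}") auto
  show "square_integrable f" by (rule square_integrable_bound[OF * assms(1) le])
  show "a \<le> b \<Longrightarrow> energy f \<le> K\<^sup>2 * (b - a)"
    using square_integrable_bound(2)[OF * assms(1) le] by (simp add: energy_cmult energy_indicator_interval)
qed

lemma square_integrable_on_interval:
  assumes "square_integrable f" "A \<in> sets borel" "A \<subseteq> {a..b}"
  shows "integrable lborel (\<lambda>x. indicator A x * f x)"
proof -
  have eq: "indicator {a..b} x * (indicator A x * f x) = indicator A x * f x" for x
    using assms(3) by (auto simp: indicator_def)
  show ?thesis
    using square_integrable_product[OF square_integrable_indicator_interval[of a b] square_integrable_indicator(1)[OF assms(1,2)]]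
    unfolding eq .
qed

section \<open>Continuity of translations in the mean\<close>

lemma square_integrable_approx:
  assumes f: "square_integrable f" and e: "0 < e"
  obtains g M where "continuous_on UNIV g" "\<And>x. x \<notin> {-M..M} \<Longrightarrow> g x = 0" "0 < M"
    "square_integrable g" "energy (\<lambda>x. f x - g x) < e"
proof -
  note [measurable] = square_integrable_measurable[OF f]
  \<comment> \<open>Truncation in height and in support at once: \<open>F M\<close> is bounded with
    bounded support and tends to \<open>f\<close> in the mean by dominated convergence.\<close>
  define F where "F M x = indicator {- real M..real M} x * max (- real M) (min (real M) (f x))" for M x
  have Fle: "\<bar>f x - F M x\<bar> \<le> \<bar>f x\<bar>" for x M
    by (auto simp: F_def indicator_def max_def min_def)
  have lim1: "(\<lambda>M. LINT x|lborel. (f x - F M x)\<^sup>2) \<longlonglongrightarrow> integral\<^sup>L lborel (\<lambda>x::real. 0::real)"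
  proof (rule integral_dominated_convergence[where w="\<lambda>x. (f x)\<^sup>2"])
    show "integrable lborel (\<lambda>x. (f x)\<^sup>2)" by (rule square_integrableD[OF f])
    show "AE x in lborel. (\<lambda>M. (f x - F M x)\<^sup>2) \<longlonglongrightarrow> 0"
    proof (rule AE_I2)
      fix x
      obtain N :: nat where "\<bar>x\<bar> + \<bar>f x\<bar> < N" using reals_Archimedean2 by blast
      then have "\<forall>M\<ge>N. (f x - F M x)\<^sup>2 = 0" by (auto simp: F_def indicator_def max_def min_def)
      then show "(\<lambda>M. (f x - F M x)\<^sup>2) \<longlonglongrightarrow> 0"
        by (intro tendsto_eventually) (auto simp: eventually_sequentially)
    qed
    show "AE x in lborel. norm ((f x - F M x)\<^sup>2) \<le> (f x)\<^sup>2" for M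
      using Fle by (auto simp: abs_le_square_iff)
  qed (auto simp: F_def)
  then have "\<forall>\<^sub>F M in sequentially. (LINT x|lborel. (f x - F M x)\<^sup>2) < e / 4"
    using e by (intro order_tendstoD(2)) auto
  then obtain M where M: "(LINT x|lborel. (f x - F M x)\<^sup>2) < e / 4"
    by (auto simp: eventually_sequentially)
  have FM [measurable]: "F M \<in> borel_measurable borel" by (auto simp: F_def[abs_def])
  have "F M \<in> borel_measurable (lebesgue_on UNIV)"
    unfolding lebesgue_on_UNIV_eq by (rule measurable_completion) (use FM in simp)
  then have "F M measurable_on UNIV"
    by (subst measurable_on_iff_borel_measurable) auto
  then obtain N h where N: "negligible N" and hc: "\<And>n. continuous_on UNIV (h n)"
    and h: "\<And>x. x \<notin> N \<Longrightarrow> (\<lambda>n. h n x) \<longlonglongrightarrow> F M x"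
    by (auto simp: measurable_on_def)
  \<comment> \<open>The approximants \<open>h n\<close> carry no common bound. Clipping to
    \<open>[-M, M]\<close> and multiplying with a cutoff that is 1 on \<open>[-M, M]\<close> and 0
    off \<open>[-(M + 1), M + 1]\<close> makes them dominated. It does not change the limit, since
    \<open>F M\<close> obeys both restrictions.\<close>
  define G where "G n x = max 0 (min 1 (real M + 1 - \<bar>x\<bar>)) * max (- real M) (min (real M) (h n x))" for n x
  have Gc: "continuous_on UNIV (G n)" for n
    unfolding G_def by (intro continuous_intros hc)
  have [measurable]: "G n \<in> borel_measurable borel" for n
    using Gc by (intro borel_measurable_continuous_onI)
  have G0: "G n x = 0" if "x \<notin> {-(real M + 1)..real M + 1}" for n x
    using that by (auto simp: G_def)
  have Fb: "\<bar>F M x\<bar> \<le> real M" for x by (auto simp: F_def indicator_def)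
  have F0: "F M x = 0" if "x \<notin> {-(real M)..real M}" for x
    using that by (auto simp: F_def)
  have Gb: "\<bar>G n x\<bar> \<le> real M" for n x
  proof -
    have c: "\<bar>max (- m) (min m z)\<bar> \<le> m" "\<bar>max 0 (min 1 z)\<bar> \<le> 1" if "0 \<le> m" for m z :: real
      using that by (auto simp: max_def min_def)
    have "\<bar>max 0 (min 1 (real M + 1 - \<bar>x\<bar>))\<bar> \<le> 1" "\<bar>max (- real M) (min (real M) (h n x))\<bar> \<le> real M"
      by (rule c(2)[of 0], simp, rule c(1), simp)
    then have "\<bar>G n x\<bar> \<le> 1 * real M" unfolding G_def abs_mult by (intro mult_mono) auto
    then show ?thesis by simp
  qed
  have Gsq: "square_integrable (G n)" for n
    by (rule square_integrable_bounded_support[of _ "real M" "-(real M + 1)" "real M + 1"])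
       (use Gb G0 in auto)
  have Fsq: "square_integrable (F M)"
    by (rule square_integrable_bounded_support[of _ "real M" "-(real M)" "real M"])
       (use Fb F0 in auto)
  have lim2: "(\<lambda>n. LINT x|lborel. (F M x - G n x)\<^sup>2) \<longlonglongrightarrow> integral\<^sup>L lborel (\<lambda>x::real. 0::real)"
  proof (rule integral_dominated_convergence[where w="\<lambda>x. (2 * real M)\<^sup>2 * indicator {-(real M + 1)..real M + 1} x"])
    have "N \<in> null_sets lebesgue" using N by (simp add: negligible_iff_null_sets)
    then have "AE x in lebesgue. x \<notin> N" by (rule AE_not_in)
    then have "AE x in lborel. x \<notin> N" by (simp add: AE_completion_iff)
    then show "AE x in lborel. (\<lambda>n. (F M x - G n x)\<^sup>2) \<longlonglongrightarrow> 0"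
    proof eventually_elim
      case (elim x)
      have "(\<lambda>n. G n x) \<longlonglongrightarrow> max 0 (min 1 (real M + 1 - \<bar>x\<bar>)) * max (- real M) (min (real M) (F M x))"
        unfolding G_def by (intro tendsto_intros h elim)
      also have "max 0 (min 1 (real M + 1 - \<bar>x\<bar>)) * max (- real M) (min (real M) (F M x)) = F M x"
        by (cases "x \<in> {-(real M)..real M}") (use Fb[of x] F0[of x] in \<open>auto simp: max_def min_def\<close>)
      finally have "(\<lambda>n. (F M x - G n x)\<^sup>2) \<longlonglongrightarrow> (F M x - F M x)\<^sup>2" by (intro tendsto_intros)
      then show ?case by simp
    qed
    show "AE x in lborel. norm ((F M x - G n x)\<^sup>2) \<le> (2 * real M)\<^sup>2 * indicator {-(real M + 1)..real M + 1} x" for n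
    proof (rule AE_I2)
      fix x
      have "\<bar>F M x - G n x\<bar> \<le> \<bar>2 * real M\<bar>" using Gb[of n x] Fb[of x] by linarith
      then have "(F M x - G n x)\<^sup>2 \<le> (2 * real M)\<^sup>2" by (simp only: abs_le_square_iff)
      then show "norm ((F M x - G n x)\<^sup>2) \<le> (2 * real M)\<^sup>2 * indicator {-(real M + 1)..real M + 1} x"
        using G0[of x n] F0[of x] by (cases "x \<in> {-(real M + 1)..real M + 1}") auto
    qed
  qed auto
  then have "\<forall>\<^sub>F n in sequentially. (LINT x|lborel. (F M x - G n x)\<^sup>2) < e / 4"
    using e by (intro order_tendstoD(2)) auto
  then obtain n where n: "(LINT x|lborel. (F M x - G n x)\<^sup>2) < e / 4"
    by (auto simp: eventually_sequentially)
  have "energy (\<lambda>x. f x - G n x) \<le> 2 * energy (\<lambda>x. f x - F M x) + 2 * energy (\<lambda>x. F M x - G n x)"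
    using energy_add_le[OF square_integrable_diff[OF f Fsq] square_integrable_diff[OF Fsq Gsq]] by simp
  also have "\<dots> < e" using M n by (simp add: energy_def)
  finally show ?thesis using that[OF Gc, of "real M + 1" n] G0 Gsq by auto
qed

lemma continuous_compact_support_translation:
  fixes g :: "real \<Rightarrow> real"
  assumes g: "continuous_on UNIV g" and M: "0 < M" "\<And>x. x \<notin> {-M..M} \<Longrightarrow> g x = 0" and e: "0 < e"
  shows "\<exists>d>0. \<forall>h. \<bar>h\<bar> < d \<longrightarrow> energy (\<lambda>x. g (x + h) - g x) < e"
proof -
  \<comment> \<open>A bound for the increment. For shifts below 1 the increment is supported in an
    interval of length \<open>2 * M + 2\<close>, so its energy is at most a quarter of
    \<open>e\<close>.\<close>
  define k where "k = sqrt (e / (4 * (2 * M + 2)))"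
  have k: "0 < k" using e M by (simp add: k_def)
  have *: "(sqrt (e / (4 * D)))\<^sup>2 * D = e / 4" if "0 < D" for D using that e by simp
  have k2: "k\<^sup>2 * (2 * M + 2) = e / 4"
    unfolding k_def by (rule *) (use M in simp)
  have "uniformly_continuous_on {-(M+2)..M+2} g"
    by (rule compact_uniformly_continuous) (auto intro: continuous_on_subset[OF g])
  then obtain d where d: "0 < d" "\<And>x y. x \<in> {-(M+2)..M+2} \<Longrightarrow> y \<in> {-(M+2)..M+2} \<Longrightarrow> dist y x < d \<Longrightarrow> dist (g y) (g x) < k"
    using k unfolding uniformly_continuous_on_def by metis
  have [measurable]: "g \<in> borel_measurable borel"
    using g by (intro borel_measurable_continuous_onI)
  show ?thesis
  proof (intro exI conjI allI impI)
    show "0 < min d 1" using d by simp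
    fix h :: real assume h: "\<bar>h\<bar> < min d 1"
    have z: "g (x + h) - g x = 0" if "x \<notin> {-(M+1)..M+1}" for x
    proof -
      have "x \<notin> {-M..M}" "x + h \<notin> {-M..M}" using that h by auto
      then show ?thesis using M(2) by simp
    qed
    have b: "\<bar>g (x + h) - g x\<bar> \<le> k" for x
    proof (cases "x \<in> {-(M+1)..M+1}")
      case True
      then have "x \<in> {-(M+2)..M+2}" "x + h \<in> {-(M+2)..M+2}" using h by auto
      then show ?thesis using d(2)[of x "x + h"] h by (simp add: dist_real_def)
    qed (use z k in auto)
    have "energy (\<lambda>x. g (x + h) - g x) \<le> k\<^sup>2 * ((M + 1) - (-(M + 1)))"
      by (rule square_integrable_bounded_support(2)) (use b z M in auto)
    also have "\<dots> = k\<^sup>2 * (2 * M + 2)" by simp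
    also have "\<dots> < e" using e unfolding k2 by simp
    finally show "energy (\<lambda>x. g (x + h) - g x) < e" .
  qed
qed

text \<open>Source of the continuity in time of the states: along characteristics the state at
  another time is, up to the potential term, made of translates of fixed square integrable
  functions. The property passes from continuous functions of compact support to all others by
  approximation.\<close>

lemma energy_translation_continuous:
  assumes f: "square_integrable f" and e: "0 < e"
  shows "\<exists>d>0. \<forall>h. \<bar>h\<bar> < d \<longrightarrow> energy (\<lambda>x. f (x + h) - f x) < e"
proof -
  \<comment> \<open>Two uses of \<open>energy_add_le\<close> produce the factors 4, 4 and 2, so the
    tolerances \<open>e / 16\<close>, \<open>e / 16\<close> and \<open>e / 4\<close> add up to
    \<open>e\<close>.\<close>
  obtain g M where g: "continuous_on UNIV g" "\<And>x. x \<notin> {-M..M} \<Longrightarrow> g x = 0" "0 < M"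
    "square_integrable g" "energy (\<lambda>x. f x - g x) < e / 16"
    using square_integrable_approx[OF f, of "e / 16"] e by auto
  obtain d where d: "d > 0" "\<And>h. \<bar>h\<bar> < d \<Longrightarrow> energy (\<lambda>x. g (x + h) - g x) < e / 4"
    using continuous_compact_support_translation[OF g(1,3,2), of "e / 4"] e by auto
  show ?thesis
  proof (intro exI conjI allI impI)
    show "0 < d" by fact
    fix h assume h: "\<bar>h\<bar> < d"
    let ?u = "\<lambda>x. f (x + h) - g (x + h)" let ?v = "\<lambda>x. g (x + h) - g x" let ?w = "\<lambda>x. g x - f x"
    have u: "square_integrable ?u" and v: "square_integrable ?v" and w: "square_integrable ?w"
      using f g(4) by (auto intro!: square_integrable_diff square_integrable_shift)
    have "energy (\<lambda>x. f (x + h) - f x) = energy (\<lambda>x. (?u x + ?w x) + ?v x)" by (simp add: algebra_simps)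
    also have "\<dots> \<le> 2 * energy (\<lambda>x. ?u x + ?w x) + 2 * energy ?v"
      by (rule energy_add_le[OF square_integrable_add[OF u w] v])
    also have "\<dots> \<le> 2 * (2 * energy ?u + 2 * energy ?w) + 2 * energy ?v"
      using energy_add_le[OF u w] by simp
    also have "energy ?u = energy (\<lambda>x. f x - g x)" using energy_shift(1)[of "\<lambda>x. f x - g x" h] by simp
    also have "energy ?w = energy (\<lambda>x. f x - g x)" by (rule energy_diff_commute)
    finally show "energy (\<lambda>x. f (x + h) - f x) < e" using g(5) d(2)[OF h] by simp
  qed
qed

subsection \<open>Primitives of integrable functions\<close>

text \<open>A primitive from minus infinity has no base point, so it commutes with translations
  (\<open>prim_shift\<close>) and serves time and space alike. For a function that vanishes off
  \<open>(0, l)\<close> it is the primitive that starts at 0.\<close>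

definition prim :: "(real \<Rightarrow> real) \<Rightarrow> real \<Rightarrow> real" where
  "prim f x = (LINT y|lborel. indicator {..x} y * f y)"

lemma indicator_times: "indicator A x * y = (if x \<in> A then y else (0::real))"
  by (simp add: indicator_def)

lemma integrable_indicator:
  fixes f :: "real \<Rightarrow> real"
  assumes "integrable lborel f" "A \<in> sets borel"
  shows "integrable lborel (\<lambda>x. indicator A x * f x)"
  using integrable_mult_indicator[of A lborel f] assms by simp

lemma prim_diff:
  assumes f: "integrable lborel f" and ab: "a \<le> b"
  shows "prim f b - prim f a = (LINT y|lborel. indicator {a<..b} y * f y)"
proof -
  have "prim f b - prim f a = (LINT y|lborel. indicator {..b} y * f y - indicator {..a} y * f y)"
    unfolding prim_def by (subst Bochner_Integration.integral_diff) (auto intro!: integrable_indicator f)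
  also have "\<dots> = (LINT y|lborel. indicator {a<..b} y * f y)"
    using ab by (intro Bochner_Integration.integral_cong) (auto simp: indicator_def)
  finally show ?thesis .
qed

lemma AE_lborel_neq: "AE x in lborel. x \<noteq> (c::real)"
  by (rule AE_lborel_singleton)

lemma prim_diff_open:
  assumes f: "integrable lborel f" and ab: "a \<le> b"
  shows "prim f b - prim f a = (LINT y|lborel. indicator {a<..<b} y * f y)"
  unfolding prim_diff[OF assms]
proof (rule integral_cong_AE)
  show "AE x in lborel. indicator {a<..b} x * f x = indicator {a<..<b} x * f x"
    using AE_lborel_neq[of b] by eventually_elim (auto simp: indicator_def)
qed (use f in measurable)

lemma prim_le:
  assumes f: "integrable lborel f" and ab: "a \<le> b"
  shows "\<bar>prim f b - prim f a\<bar> \<le> (LINT y|lborel. indicator {a<..<b} y * \<bar>f y\<bar>)"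
proof -
  have "\<bar>prim f b - prim f a\<bar> \<le> (LINT y|lborel. \<bar>indicator {a<..<b} y * f y\<bar>)"
    unfolding prim_diff_open[OF assms] by (rule integral_abs_bound)
  then show ?thesis by (simp add: abs_mult)
qed

lemma prim_bound: "integrable lborel f \<Longrightarrow> \<bar>prim f x\<bar> \<le> (LINT y|lborel. \<bar>f y\<bar>)"
proof -
  assume f: "integrable lborel f"
  have "\<bar>prim f x\<bar> \<le> (LINT y|lborel. \<bar>indicator {..x} y * f y\<bar>)"
    unfolding prim_def by (rule integral_abs_bound)
  also have "\<dots> \<le> (LINT y|lborel. \<bar>f y\<bar>)"
    by (intro integral_mono integrable_abs integrable_indicator f) (auto simp: indicator_def)
  finally show ?thesis .
qed

lemma prim_add: "integrable lborel f \<Longrightarrow> integrable lborel g \<Longrightarrow> prim (\<lambda>x. f x + g x) x = prim f x + prim g x"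
  unfolding prim_def
  by (subst Bochner_Integration.integral_add[symmetric]) (auto intro!: integrable_indicator simp: distrib_left)

lemma prim_diff_fun: "integrable lborel f \<Longrightarrow> integrable lborel g \<Longrightarrow> prim (\<lambda>x. f x - g x) x = prim f x - prim g x"
  unfolding prim_def
  by (subst Bochner_Integration.integral_diff[symmetric]) (auto intro!: integrable_indicator simp: right_diff_distrib)

lemma prim_cmult: "prim (\<lambda>x. c * f x) x = c * prim f x"
proof -
  have "(LINT y|lborel. indicator {..x} y * (c * f y)) = (LINT y|lborel. c * (indicator {..x} y * f y))"
    by (intro Bochner_Integration.integral_cong) auto
  then show ?thesis unfolding prim_def by simp
qed

lemma prim_shift: "prim (\<lambda>x. f (x + c)) x = prim f (x + c)"
  unfolding prim_def
  by (subst (2) lborel_integral_real_affine[where c=1 and t=c])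
     (auto intro!: Bochner_Integration.integral_cong simp: indicator_def add.commute)

lemma prim_continuous:
  assumes f: "integrable lborel f"
  shows "continuous_on UNIV (prim f)"
proof -
  have "isCont (prim f) x" for x
    unfolding continuous_at_sequentially
  proof (intro allI impI)
    fix X assume X: "X \<longlonglongrightarrow> x"
    have "(\<lambda>n. prim f (X n)) \<longlonglongrightarrow> prim f x"
      unfolding prim_def
    proof (rule integral_dominated_convergence[where w="\<lambda>y. \<bar>f y\<bar>"])
      show "AE y in lborel. (\<lambda>n. indicator {..X n} y * f y) \<longlonglongrightarrow> indicator {..x} y * f y"
        using AE_lborel_neq[of x]
      proof eventually_elim
        case (elim y)
        then consider "y < x" | "x < y" by linarith
        then have "\<forall>\<^sub>F n in sequentially. indicator {..X n} y * f y = indicator {..x} y * f y"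
        proof cases
          case 1
          with X have "\<forall>\<^sub>F n in sequentially. y < X n" by (rule order_tendstoD)
          then show ?thesis by eventually_elim (use 1 in auto)
        next
          case 2
          with X have "\<forall>\<^sub>F n in sequentially. X n < y" by (rule order_tendstoD)
          then show ?thesis by eventually_elim (use 2 in auto)
        qed
        then show ?case by (rule tendsto_eventually)
      qed
    qed (use f in \<open>auto simp: indicator_def\<close>)
    then show "(prim f \<circ> X) \<longlonglongrightarrow> prim f x" by (simp add: o_def)
  qed
  then show ?thesis by (simp add: continuous_at_imp_continuous_on)
qed

lemma integrable_prim_mult:
  assumes f: "integrable lborel f" and g: "integrable lborel g"
  shows "integrable lborel (\<lambda>x. prim f x * g x)"
proof (rule Bochner_Integration.integrable_bound[where f="\<lambda>x. (LINT y|lborel. \<bar>f y\<bar>) * g x"])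
  have [measurable]: "prim f \<in> borel_measurable borel"
    using prim_continuous[OF f] by (intro borel_measurable_continuous_onI)
  show "(\<lambda>x. prim f x * g x) \<in> borel_measurable lborel" using g by measurable
  show "AE x in lborel. norm (prim f x * g x) \<le> norm ((LINT y|lborel. \<bar>f y\<bar>) * g x)"
    using prim_bound[OF f] by (auto simp: abs_mult intro!: mult_right_mono)
qed (use g in auto)

lemma integrable_pair_mult:
  fixes f g :: "real \<Rightarrow> real"
  assumes f: "integrable lborel f" and g: "integrable lborel g"
  shows "integrable (lborel \<Otimes>\<^sub>M lborel) (\<lambda>(x,y). f x * g y)"
proof (rule lborel_pair.Fubini_integrable)
  show "(\<lambda>(x,y). f x * g y) \<in> borel_measurable (lborel \<Otimes>\<^sub>M lborel)" using f g by measurable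
  show "integrable lborel (\<lambda>x. LINT y|lborel. norm (case (x, y) of (x, y) \<Rightarrow> f x * g y))"
    using f by (simp add: abs_mult)
  show "AE x in lborel. integrable lborel (\<lambda>y. case (x, y) of (x, y) \<Rightarrow> f x * g y)"
    using g by simp
qed

text \<open>The product is a double integral over the square \<open>y, z \<le> x\<close>. Cutting it
  along the diagonal, a null set, and integrating each triangle in its larger variable last gives
  the two terms of the product rule.\<close>

lemma prim_mult:
  assumes f: "integrable lborel f" and g: "integrable lborel g"
  shows "prim f x * prim g x = prim (\<lambda>y. prim f y * g y + f y * prim g y) x"
proof -
  let ?I = "\<lambda>y. indicator {..x} y :: real"
  have i: "integrable (lborel \<Otimes>\<^sub>M lborel) (\<lambda>(y,z). (?I y * f y) * (?I z * g z))"
    by (intro integrable_pair_mult integrable_indicator f g) auto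
  let ?k1 = "\<lambda>(y,z). if z \<le> y then (?I y * f y) * (?I z * g z) else 0"
  let ?k2 = "\<lambda>(y,z). if z \<le> y then 0 else (?I y * f y) * (?I z * g z)"
  note [measurable] = borel_measurable_integrable[OF f] borel_measurable_integrable[OF g]
  have i1: "integrable (lborel \<Otimes>\<^sub>M lborel) ?k1" by (rule Bochner_Integration.integrable_bound[OF i]) auto
  have i2: "integrable (lborel \<Otimes>\<^sub>M lborel) ?k2" by (rule Bochner_Integration.integrable_bound[OF i]) auto
  have "prim f x * prim g x = (LINT y|lborel. (LINT z|lborel. (?I y * f y) * (?I z * g z)))"
    by (simp add: prim_def)
  also have "\<dots> = (LINT p|(lborel \<Otimes>\<^sub>M lborel). (case p of (y,z) \<Rightarrow> (?I y * f y) * (?I z * g z)))"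
    using lborel_pair.integral_fst[OF i] by simp
  also have "\<dots> = (LINT p|(lborel \<Otimes>\<^sub>M lborel). ?k1 p + ?k2 p)"
    by (intro Bochner_Integration.integral_cong) auto
  also have "\<dots> = (LINT p|(lborel \<Otimes>\<^sub>M lborel). ?k1 p) + (LINT p|(lborel \<Otimes>\<^sub>M lborel). ?k2 p)"
    by (rule Bochner_Integration.integral_add[OF i1 i2])
  also have "(LINT p|(lborel \<Otimes>\<^sub>M lborel). ?k1 p) = (LINT y|lborel. (LINT z|lborel. ?k1 (y,z)))"
    using lborel_pair.integral_fst[OF i1] by simp
  also have "\<dots> = (LINT y|lborel. ?I y * (f y * prim g y))"
  proof (intro Bochner_Integration.integral_cong refl)
    fix y
    have "(LINT z|lborel. ?k1 (y,z)) = (LINT z|lborel. (?I y * f y) * (indicator {..y} z * g z))"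
      by (intro Bochner_Integration.integral_cong) (auto simp: indicator_def)
    then show "(LINT z|lborel. ?k1 (y,z)) = ?I y * (f y * prim g y)" by (simp add: prim_def)
  qed
  also have "(LINT p|(lborel \<Otimes>\<^sub>M lborel). ?k2 p) = (LINT z|lborel. (LINT y|lborel. ?k2 (y,z)))"
    using lborel_pair.integral_snd[of "\<lambda>y z. ?k2 (y,z)"] i2 by simp
  also have "\<dots> = (LINT z|lborel. ?I z * (prim f z * g z))"
  proof (intro Bochner_Integration.integral_cong refl)
    fix z
    have "(LINT y|lborel. ?k2 (y,z)) = (LINT y|lborel. (?I z * g z) * (indicator {..z} y * f y))"
    proof (rule integral_cong_AE)
      show "AE y in lborel. ?k2 (y,z) = (?I z * g z) * (indicator {..z} y * f y)"
        using AE_lborel_neq[of z] by eventually_elim (auto simp: indicator_def)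
    qed auto
    then show "(LINT y|lborel. ?k2 (y,z)) = ?I z * (prim f z * g z)" by (simp add: prim_def)
  qed
  finally have "prim f x * prim g x = (LINT y|lborel. ?I y * (f y * prim g y)) + (LINT z|lborel. ?I z * (prim f z * g z))" .
  also have "\<dots> = (LINT y|lborel. ?I y * (f y * prim g y) + ?I y * (prim f y * g y))"
    using integrable_prim_mult[OF f g] integrable_prim_mult[OF g f]
    by (intro Bochner_Integration.integral_add[symmetric] integrable_indicator) (auto simp: mult.commute)
  finally show ?thesis by (simp add: prim_def algebra_simps)
qed

text \<open>The positive and the negative part of \<open>f\<close> are densities of two finite
  measures that agree on all half lines, hence everywhere; densities are unique almost
  everywhere.\<close>

lemma AE_zero_if_prim_zero:
  assumes f: "integrable lborel f" and z: "\<And>x. prim f x = 0"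
  shows "AE x in lborel. f x = 0"
proof -
  note [measurable] = borel_measurable_integrable[OF f]
  define P where "P x = max 0 (f x)" for x
  define N where "N x = max 0 (- f x)" for x
  have fPN: "f x = P x - N x" for x by (simp add: P_def N_def)
  have P: "integrable lborel P" and N: "integrable lborel N"
    using f by (auto simp: P_def[abs_def] N_def[abs_def])
  note [measurable] = borel_measurable_integrable[OF P] borel_measurable_integrable[OF N]
  \<comment> \<open>The comparison of measures uses the half lines \<open>{x<..}\<close>, while
    \<open>prim\<close> sees \<open>{..x}\<close>; the vanishing total integral passes from one to
    the other.\<close>
  have tot: "(LINT x|lborel. f x) = 0"
  proof -
    have "(\<lambda>n. prim f (real n)) \<longlonglongrightarrow> (LINT x|lborel. f x)"
      unfolding prim_def
    proof (rule integral_dominated_convergence[where w="\<lambda>y. \<bar>f y\<bar>"])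
      show "AE y in lborel. (\<lambda>n. indicator {..real n} y * f y) \<longlonglongrightarrow> f y"
      proof (rule AE_I2)
        fix y :: real
        obtain n :: nat where "y < n" using reals_Archimedean2 by blast
        then have "\<forall>m\<ge>n. indicator {..real m} y * f y = f y" by auto
        then show "(\<lambda>n. indicator {..real n} y * f y) \<longlonglongrightarrow> f y"
          by (intro tendsto_eventually) (auto simp: eventually_sequentially)
      qed
    qed (use f in \<open>auto simp: indicator_def\<close>)
    then show ?thesis using z by (simp add: LIMSEQ_const_iff)
  qed
  have em: "emeasure (density lborel (\<lambda>x. ennreal (h x))) {x<..} = ennreal (LINT y|lborel. indicator {x<..} y * h y)"
    if h: "integrable lborel h" "\<And>x. 0 \<le> h x" for h :: "real \<Rightarrow> real" and x
  proof -
    note [measurable] = borel_measurable_integrable[OF h(1)]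
    have "emeasure (density lborel (\<lambda>x. ennreal (h x))) {x<..} = (\<integral>\<^sup>+ y. ennreal (h y) * indicator {x<..} y \<partial>lborel)"
      by (subst emeasure_density) (simp_all add: borel_open)
    also have "\<dots> = (\<integral>\<^sup>+ y. ennreal (indicator {x<..} y * h y) \<partial>lborel)"
      by (intro nn_integral_cong) (auto simp: indicator_def)
    also have "\<dots> = ennreal (LINT y|lborel. indicator {x<..} y * h y)"
      by (intro nn_integral_eq_integral integrable_indicator h) (auto simp: h)
    finally show ?thesis .
  qed
  have "density lborel (\<lambda>x. ennreal (P x)) = density lborel (\<lambda>x. ennreal (N x))"
  proof (rule measure_eqI_lessThan)
    fix x
    have "(LINT y|lborel. indicator {x<..} y * P y) - (LINT y|lborel. indicator {x<..} y * N y)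
        = (LINT y|lborel. indicator {x<..} y * P y - indicator {x<..} y * N y)"
      by (intro Bochner_Integration.integral_diff[symmetric] integrable_indicator P N) auto
    also have "\<dots> = (LINT y|lborel. f y - indicator {..x} y * f y)"
      by (intro Bochner_Integration.integral_cong) (auto simp: indicator_def fPN)
    also have "\<dots> = 0"
      using tot z[of x] f by (subst Bochner_Integration.integral_diff) (auto intro!: integrable_indicator simp: prim_def)
    finally have "(LINT y|lborel. indicator {x<..} y * P y) = (LINT y|lborel. indicator {x<..} y * N y)" by simp
    then show "emeasure (density lborel (\<lambda>x. ennreal (P x))) {x<..} = emeasure (density lborel (\<lambda>x. ennreal (N x))) {x<..}"
      by (subst em[OF P], simp add: P_def, subst em[OF N], simp add: N_def) simp
    show "emeasure (density lborel (\<lambda>x. ennreal (P x))) {x<..} < \<infinity>"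
      by (subst em[OF P]) (simp_all add: P_def)
  qed auto
  then have "AE x in lborel. ennreal (P x) = ennreal (N x)"
    by (subst (asm) sigma_finite_measure.density_unique_iff[OF sigma_finite_lborel]) auto
  then show ?thesis
  proof eventually_elim
    case (elim x)
    then have "P x = N x" by (simp add: P_def N_def)
    then show ?case by (simp add: fPN)
  qed
qed

lemma prim_deriv:
  assumes d: "\<And>x. (F has_real_derivative f x) (at x)" and c: "continuous_on UNIV f"
    and z: "\<And>x. x \<notin> {a..b} \<Longrightarrow> F x = 0"
  shows "integrable lborel f" "F = prim f" "\<And>x. x \<notin> {a..b} \<Longrightarrow> f x = 0"
proof -
  show f0: "f x = 0" if "x \<notin> {a..b}" for x
  proof -
    have "open (- {a..b})" by auto
    then have "\<forall>\<^sub>F y in nhds x. y \<in> - {a..b}" using that by (intro eventually_nhds_in_open) auto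
    then have "\<forall>\<^sub>F y in nhds x. F y = 0" by eventually_elim (use z in auto)
    then have "(F has_real_derivative 0) (at x)"
      by (subst DERIV_cong_ev[OF refl _ refl]) auto
    then show ?thesis using d[of x] DERIV_unique by blast
  qed
  have fe: "f x = indicator {a..b} x *\<^sub>R f x" for x using f0[of x] by (auto simp: indicator_def)
  have "integrable lborel (\<lambda>x. indicator {a..b} x *\<^sub>R f x)"
    by (rule borel_integrable_compact) (auto intro: continuous_on_subset[OF c])
  moreover have "(\<lambda>x. indicator {a..b} x *\<^sub>R f x) = f" using fe by (intro ext) simp
  ultimately show i: "integrable lborel f" by metis
  show "F = prim f"
  proof
    fix x
    define m where "m = min x a - 1"
    have m: "m \<le> x" "m < a" by (auto simp: m_def)
    have "F x - F m = (LINT y|lborel. f y * indicator {m..x} y)"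
      using integral_FTC_Icc_real[OF m(1), of F f] d c by (simp add: continuous_on_eq_continuous_at)
    also have "\<dots> = prim f x"
      unfolding prim_def using f0 m by (intro Bochner_Integration.integral_cong) (auto simp: indicator_def)
    finally show "F x = prim f x" using z[of m] m by simp
  qed
qed

subsection \<open>Integration along characteristics\<close>

text \<open>Source of the factor \<open>1 / lam\<close> behind the contraction. The end
  \<open>w\<close> may be negative, as it will be \<open>\<bar>s\<bar> + mu t\<close>.\<close>

lemma exp_integral:
  assumes "0 < (lam::real)"
  shows "integrable lborel (\<lambda>x. indicator {0<..<w} x * exp (lam * x))"
    and "(LINT x|lborel. indicator {0<..<w} x * exp (lam * x)) \<le> exp (lam * w) / lam"
proof -
  have i: "integrable lborel (\<lambda>x. indicator {0..w} x *\<^sub>R exp (lam * x))"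
    by (rule borel_integrable_compact[OF compact_Icc]) (intro continuous_intros)
  show i1: "integrable lborel (\<lambda>x. indicator {0<..<w} x * exp (lam * x))"
    by (rule Bochner_Integration.integrable_bound[OF i]) (auto simp: indicator_def)
  show "(LINT x|lborel. indicator {0<..<w} x * exp (lam * x)) \<le> exp (lam * w) / lam"
  proof (cases "0 \<le> w")
    case True
    have "(LINT x|lborel. indicator {0<..<w} x * exp (lam * x)) \<le> (LINT x|lborel. indicator {0..w} x *\<^sub>R exp (lam * x))"
      by (rule integral_mono[OF i1 i]) (auto simp: indicator_def)
    also have "\<dots> = (LINT x|lborel. exp (lam * x) * indicator {0..w} x)" by (simp add: mult.commute)
    also have "\<dots> = exp (lam * w) / lam - exp (lam * 0) / lam"
      by (rule integral_FTC_Icc_real[where F="\<lambda>x. exp (lam * x) / lam"])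
         (use True assms in \<open>auto intro!: derivative_eq_intros continuous_intros\<close>)
    also have "\<dots> \<le> exp (lam * w) / lam" using assms by simp
    finally show ?thesis .
  next
    case False
    then have "{0<..<w} = {}" by auto
    then show ?thesis using assms by simp
  qed
qed

lemma integrable_exp_abs:
  assumes "0 < (lam::real)"
  shows "integrable lborel (\<lambda>x. exp (- lam * \<bar>x - c\<bar>))"
    "(LINT x|lborel. exp (- lam * \<bar>x - c\<bar>)) = (LINT x|lborel. exp (- lam * \<bar>x\<bar>))"
proof -
  have "integrable lborel (\<lambda>x. indicator {0..} x *\<^sub>R exp (- lam * x))"
  proof (rule integrableI_bounded)
    have "((\<lambda>x. - exp (- lam * x) / lam) \<longlongrightarrow> - 0 / lam) at_top"
      using assms
      by (intro tendsto_intros filterlim_compose[OF exp_at_bot] filterlim_tendsto_neg_mult_at_bot[OF tendsto_const] filterlim_ident) auto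
    then have "(\<integral>\<^sup>+x. ennreal (exp (- lam * x)) * indicator {0..} x \<partial>lborel) = 0 - (- exp (- lam * 0) / lam)"
      by (intro nn_integral_FTC_atLeast) (use assms in \<open>auto intro!: derivative_eq_intros\<close>)
    moreover have "(\<integral>\<^sup>+x. ennreal (exp (- lam * x)) * indicator {0..} x \<partial>lborel)
        = (\<integral>\<^sup>+x. ennreal (norm (indicator {0..} x *\<^sub>R exp (- lam * x))) \<partial>lborel)"
      by (intro nn_integral_cong) (auto simp: indicator_def)
    ultimately show "(\<integral>\<^sup>+x. ennreal (norm (indicator {0..} x *\<^sub>R exp (- lam * x))) \<partial>lborel) < \<infinity>"
      by (metis ennreal_less_top infinity_ennreal_def)
  qed auto
  then have 1: "integrable lborel (\<lambda>x. indicator {0..} x * exp (- lam * x))" by simp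
  have 2: "integrable lborel (\<lambda>x. indicator {0..} (0 + (-1) * x) * exp (- lam * (0 + (-1) * x)))"
    by (rule lborel_integrable_real_affine[OF 1]) simp
  have 3: "integrable lborel (\<lambda>x. exp (- lam * \<bar>x\<bar>))"
    by (rule Bochner_Integration.integrable_bound[OF Bochner_Integration.integrable_add[OF 1 2]])
       (auto simp: indicator_def abs_if)
  show "integrable lborel (\<lambda>x. exp (- lam * \<bar>x - c\<bar>))"
    using lborel_integrable_real_affine[OF 3, of 1 "-c"] by simp
  show "(LINT x|lborel. exp (- lam * \<bar>x - c\<bar>)) = (LINT x|lborel. exp (- lam * \<bar>x\<bar>))"
    by (subst (2) lborel_integral_real_affine[where c=1 and t="-c"]) auto
qed

text \<open>d'Alembert's formula in the space direction, for the wave with value 0 and slope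
  \<open>f\<close> at \<open>s = 0\<close>; for negative \<open>s\<close> it is the odd
  continuation.\<close>

definition half_diff :: "(real \<Rightarrow> real) \<Rightarrow> real \<Rightarrow> real \<Rightarrow> real" where
  "half_diff f s t = (prim f (t + s) - prim f (t - s)) / 2"

lemma half_diff_le:
  assumes f: "integrable lborel f"
  shows "\<bar>half_diff f s t\<bar> \<le> (LINT y|lborel. indicator {t - \<bar>s\<bar><..<t + \<bar>s\<bar>} y * \<bar>f y\<bar>) / 2"
  using prim_le[OF f, of "t - \<bar>s\<bar>" "t + \<bar>s\<bar>"]
  by (cases "0 \<le> s") (auto simp: half_diff_def abs_minus_commute)

lemma continuous_half_diff:
  assumes f: "integrable lborel f"
  shows "continuous_on UNIV (\<lambda>(s,t). half_diff f s t)"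
proof -
  have *: "continuous_on A (\<lambda>x. prim f (h x))" if "continuous_on A h" for h :: "real \<times> real \<Rightarrow> real" and A
    by (rule continuous_on_compose2[OF prim_continuous[OF f] that]) auto
  show ?thesis unfolding half_diff_def split_def by (intro continuous_intros * ballI) simp_all
qed

text \<open>The integral of \<open>Q Z\<close> along the characteristic of direction \<open>e = \<plusminus>1\<close>, and half the one over the
  backward cone of \<open>(s, t)\<close>; in the pair \<open>(s, t)\<close> the first entry is the space variable.\<close>

definition transp :: "(real \<Rightarrow> real) \<Rightarrow> (real \<times> real \<Rightarrow> real) \<Rightarrow> real \<Rightarrow> real \<Rightarrow> real \<Rightarrow> real" where
  "transp Q Z e s t = (LINT y|lborel. indicator {0<..<s} y * (Q y * Z (y, t + e * (s - y))))"

definition duhamel :: "(real \<Rightarrow> real) \<Rightarrow> (real \<times> real \<Rightarrow> real) \<Rightarrow> real \<Rightarrow> real \<Rightarrow> real" where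
  "duhamel Q Z s t = (LINT y|lborel. indicator {0<..<s} y * (Q y * half_diff (\<lambda>x. Z (y, x)) (s - y) t))"

text \<open>\<open>Q\<close> is continued by zero, so that a string may be followed to all
  \<open>s\<close>. \<open>Lam\<close> is only an upper bound of \<open>L\<close>: two strings of
  different lengths can then share \<open>lam\<close> and the weight in time, as they must when a
  trace of the first enters the second as a jump.\<close>

locale wave_weight =
  fixes L B Lam lam T :: real and Q :: "real \<Rightarrow> real"
  assumes Q_meas [measurable]: "Q \<in> borel_measurable borel"
    and Q_bound: "\<And>y. \<bar>Q y\<bar> \<le> B" and Q_zero: "\<And>y. y \<notin> {0..L} \<Longrightarrow> Q y = 0"
    and L_pos: "0 < L" and L_le: "L \<le> Lam" and T_ge: "2 * L \<le> T"
    and lam_ge: "6 * B * Lam < lam" and lam_ge1: "1 \<le> lam"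
begin

lemma B_nonneg: "0 \<le> B" using Q_bound[of 0] by linarith

lemma lam_pos: "0 < lam" using lam_ge1 by linarith

text \<open>Three contributions proportional to \<open>B * L / lam\<close> make up the norm of the
  linear part of the fixed point map, see \<open>couple_le\<close>; the constant in
  \<open>lam_ge\<close> is made for this bound.\<close>

lemma BL_le: "3 * B * L / lam \<le> 1 / 2"
proof -
  have "6 * B * L \<le> 6 * B * Lam" using B_nonneg L_le by (intro mult_left_mono) auto
  then show ?thesis using lam_ge lam_pos by (simp add: field_simps)
qed

text \<open>\<open>mu\<close> equals \<open>\<bar>t - t\<^sub>0\<bar>\<close> on the two windows and is 1-Lipschitz, so that \<open>\<bar>s\<bar> + mu t\<close> decreases along backward
  characteristics; it tends to \<open>-\<infinity>\<close> as \<open>t \<rightarrow> \<plusminus>\<infinity>\<close>, which makes \<open>exp (lam * mu t)\<close> integrable with a bound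
  independent of \<open>T\<close>.\<close>

definition mu :: "real \<Rightarrow> real" where
  "mu t = Lam - \<bar>min \<bar>t\<bar> \<bar>t - T\<bar> - Lam\<bar>"

lemma mu_Lipschitz: "mu t' \<le> mu t + \<bar>t' - t\<bar>"
  unfolding mu_def by linarith

text \<open>As \<open>T \<ge> 2 * L\<close>, on the window around \<open>t0\<close> no other of the
  times 0 and \<open>T\<close> is nearer than \<open>t0\<close>, and the distance does not exceed
  \<open>Lam\<close>, beyond which \<open>mu\<close> turns down.\<close>

lemma mu_window: "t0 \<in> {0,T} \<Longrightarrow> \<bar>x\<bar> \<le> L \<Longrightarrow> mu (t0 + x) = \<bar>x\<bar>"
  using L_le T_ge L_pos unfolding mu_def by auto

lemma mu_le: "mu t \<le> Lam" unfolding mu_def by simp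

lemma mu_at [simp]: "mu 0 = 0" "mu T = 0"
  using mu_window[of 0 0] mu_window[of T 0] L_pos by auto

lemma mu_continuous: "continuous_on UNIV mu"
  unfolding mu_def[abs_def] by (intro continuous_intros)

lemma mu_measurable [measurable]: "mu \<in> borel_measurable borel"
  using mu_continuous by (rule borel_measurable_continuous_onI)

definition wt :: "real \<Rightarrow> real \<Rightarrow> real" where
  "wt s t = exp (lam * (\<bar>s\<bar> + mu t))"

lemma wt_pos [simp]: "0 < wt s t" "0 \<le> wt s t" by (auto simp: wt_def)

lemma wt_mono: "\<bar>s\<bar> + \<bar>t - t'\<bar> \<le> \<bar>s'\<bar> \<Longrightarrow> wt s t \<le> wt s' t'"
  unfolding wt_def using mu_Lipschitz[of t t'] lam_pos by (auto intro!: mult_left_mono)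


lemma wt_eq: "wt s t = exp (lam * \<bar>s\<bar>) * exp (lam * mu t)"
  by (simp add: wt_def distrib_left exp_add)

lemma wt_le: "wt s t \<le> exp (lam * (\<bar>s\<bar> + Lam))"
  unfolding wt_def using mu_le[of t] lam_pos by simp

text \<open>\<open>mu\<close> is at most \<open>2 * Lam\<close> minus the distance to the nearer of
  0 and \<open>T\<close>. The weight is thus dominated by one exponential peak at each of the two
  times, and its mass does not see the gap between them.\<close>

lemma exp_mu_le: "exp (lam * mu t) \<le> exp (2 * lam * Lam) * (exp (- lam * \<bar>t - 0\<bar>) + exp (- lam * \<bar>t - T\<bar>))"
proof -
  have "mu t \<le> 2 * Lam - min \<bar>t\<bar> \<bar>t - T\<bar>" unfolding mu_def by linarith
  then have "lam * mu t \<le> lam * (2 * Lam - min \<bar>t\<bar> \<bar>t - T\<bar>)" using lam_pos by (intro mult_left_mono) auto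
  then have "exp (lam * mu t) \<le> exp (2 * lam * Lam) * exp (- lam * min \<bar>t\<bar> \<bar>t - T\<bar>)"
    by (simp add: exp_add[symmetric] algebra_simps)
  also have "exp (- lam * min \<bar>t\<bar> \<bar>t - T\<bar>) \<le> exp (- lam * \<bar>t - 0\<bar>) + exp (- lam * \<bar>t - T\<bar>)"
    by (auto simp: min_def)
  finally show ?thesis by simp
qed

lemma integrable_exp_mu: "integrable lborel (\<lambda>t. exp (lam * mu t))"
proof (rule Bochner_Integration.integrable_bound)
  show "integrable lborel (\<lambda>t. exp (2 * lam * Lam) * (exp (- lam * \<bar>t - 0\<bar>) + exp (- lam * \<bar>t - T\<bar>)))"
    by (rule integrable_mult_right[OF Bochner_Integration.integrable_add[OF integrable_exp_abs(1)[OF lam_pos] integrable_exp_abs(1)[OF lam_pos]]])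
qed (use exp_mu_le in \<open>auto intro!: AE_I2\<close>)

text \<open>\<open>T\<close> does not occur here. Every energy estimate in time of a weighted
  function passes through this number, which is how the final constant becomes independent of
  \<open>T\<close>.\<close>

definition wt_mass :: real where
  "wt_mass = exp (2 * lam * Lam) * (2 * (LINT x|lborel. exp (- lam * \<bar>x\<bar>)))"

lemma integral_exp_mu: "(LINT t|lborel. exp (lam * mu t)) \<le> wt_mass"
proof -
  have "(LINT t|lborel. exp (lam * mu t)) \<le> (LINT t|lborel. exp (2 * lam * Lam) * (exp (- lam * \<bar>t - 0\<bar>) + exp (- lam * \<bar>t - T\<bar>)))"
    by (rule integral_mono[OF integrable_exp_mu integrable_mult_right[OF Bochner_Integration.integrable_add[OF integrable_exp_abs(1)[OF lam_pos] integrable_exp_abs(1)[OF lam_pos]]] exp_mu_le])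
  also have "\<dots> = wt_mass"
    unfolding wt_mass_def integral_mult_right_zero
    by (subst Bochner_Integration.integral_add[OF integrable_exp_abs(1)[OF lam_pos] integrable_exp_abs(1)[OF lam_pos]])
      (simp only: integrable_exp_abs(2)[OF lam_pos] mult_2)
  finally show ?thesis .
qed

text \<open>Membership in the ball of radius \<open>K\<close> for the weighted sup norm. The radius
  stays explicit because it has to be traced back to the norms of the data. Measurability takes the
  place of continuity because the solution with its jump must be covered.\<close>

definition weighted :: "(real \<times> real \<Rightarrow> real) \<Rightarrow> real \<Rightarrow> bool" where
  "weighted Z K \<longleftrightarrow> Z \<in> borel_measurable (borel \<Otimes>\<^sub>M borel) \<and> 0 \<le> K \<and> (\<forall>s t. \<bar>Z (s, t)\<bar> \<le> K * wt s t)"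

lemma weighted_measurable [measurable_dest]: "weighted Z K \<Longrightarrow> Z \<in> borel_measurable (borel \<Otimes>\<^sub>M borel)"
  by (simp add: weighted_def)

lemma weightedD: "weighted Z K \<Longrightarrow> \<bar>Z (s, t)\<bar> \<le> K * wt s t" "weighted Z K \<Longrightarrow> 0 \<le> K"
  by (simp_all add: weighted_def)

lemma weighted_slice_integrable:
  assumes Z: "weighted Z K"
  shows "integrable lborel (\<lambda>t. Z (s, t))"
proof (rule Bochner_Integration.integrable_bound)
  show "integrable lborel (\<lambda>t. K * exp (lam * \<bar>s\<bar>) * exp (lam * mu t))"
    by (intro integrable_mult_right integrable_exp_mu)
  show "(\<lambda>t. Z (s, t)) \<in> borel_measurable lborel" using weighted_measurable[OF Z] by measurable
  show "AE t in lborel. norm (Z (s, t)) \<le> norm (K * exp (lam * \<bar>s\<bar>) * exp (lam * mu t))"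
    using weightedD[OF Z] by (intro AE_I2) (simp add: wt_eq abs_mult mult.assoc)
qed

section \<open>Weighted bounds for integrals along characteristics and over cones\<close>

lemma transp_integrand_le:
  assumes Z: "weighted Z K" and e: "\<bar>e\<bar> = 1"
  shows "\<bar>indicator {0<..<s} y * (Q y * Z (y, t + e * (s - y)))\<bar> \<le> indicator {0..L} y * (B * K * wt s t)"
proof (cases "0 < y \<and> y < s \<and> y \<in> {0..L}")
  case True
  have "\<bar>y\<bar> + \<bar>(t + e * (s - y)) - t\<bar> \<le> \<bar>s\<bar>" using True e by (simp add: abs_mult)
  then have "wt y (t + e * (s - y)) \<le> wt s t" by (rule wt_mono)
  then have "\<bar>Z (y, t + e * (s - y))\<bar> \<le> K * wt s t"
    using weightedD[OF Z] by (meson mult_left_mono order_trans)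
  then have "\<bar>Q y\<bar> * \<bar>Z (y, t + e * (s - y))\<bar> \<le> B * (K * wt s t)"
    using Q_bound B_nonneg by (intro mult_mono) auto
  then show ?thesis using True by (simp add: abs_mult mult.assoc)
next
  case False
  then show ?thesis using Q_zero[of y] weightedD(2)[OF Z] B_nonneg by (auto simp: indicator_def)
qed

lemma transp_integrable:
  assumes Z: "weighted Z K" and e: "\<bar>e\<bar> = 1"
  shows "integrable lborel (\<lambda>y. indicator {0<..<s} y * (Q y * Z (y, t + e * (s - y))))"
proof (rule Bochner_Integration.integrable_bound)
  show "integrable lborel (\<lambda>y. indicator {0..L} y * (B * K * wt s t))"
    by (intro integrable_mult_left integrable_real_indicator) (auto simp: emeasure_lborel_Icc_eq)
  show "AE y in lborel. norm (indicator {0<..<s} y * (Q y * Z (y, t + e * (s - y)))) \<le> norm (indicator {0..L} y * (B * K * wt s t))"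
    using transp_integrand_le[OF Z e] by (intro AE_I2) (smt (verit) real_norm_def)
  show "(\<lambda>y. indicator {0<..<s} y * (Q y * Z (y, t + e * (s - y)))) \<in> borel_measurable lborel"
    using weighted_measurable[OF Z] by measurable
qed

text \<open>On the backward characteristic the weight is largest at the tip, so the integral costs
  only the factor \<open>B * L\<close>. There is no gain \<open>1 / lam\<close> at this point; it
  comes when the transported term is integrated over a window.\<close>

lemma transp_le:
  assumes Z: "weighted Z K" and e: "\<bar>e\<bar> = 1"
  shows "\<bar>transp Q Z e s t\<bar> \<le> B * L * K * wt s t"
proof -
  have "\<bar>transp Q Z e s t\<bar> \<le> (LINT y|lborel. \<bar>indicator {0<..<s} y * (Q y * Z (y, t + e * (s - y)))\<bar>)"
    unfolding transp_def by (rule integral_abs_bound)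
  also have "\<dots> \<le> (LINT y|lborel. indicator {0..L} y * (B * K * wt s t))"
    by (intro integral_mono integrable_abs transp_integrable[OF assms] transp_integrand_le[OF assms]
        integrable_mult_left integrable_real_indicator) (auto simp: emeasure_lborel_Icc_eq)
  also have "\<dots> = B * L * K * wt s t" using L_pos by simp
  finally show ?thesis .
qed

lemma transp_measurable [measurable]:
  assumes [measurable]: "Z \<in> borel_measurable (borel \<Otimes>\<^sub>M borel)"
  shows "(\<lambda>p. transp Q Z e (fst p) (snd p)) \<in> borel_measurable (borel \<Otimes>\<^sub>M borel)"
  unfolding transp_def indicator_times greaterThanLessThan_iff by measurable

lemma transp_diff:
  assumes "weighted Z K" "weighted Z' K'" "\<bar>e\<bar> = 1"
  shows "transp Q (\<lambda>p. Z p - Z' p) e s t = transp Q Z e s t - transp Q Z' e s t"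
  unfolding transp_def
  by (rule trans[OF _ Bochner_Integration.integral_diff[OF transp_integrable[OF assms(1,3)] transp_integrable[OF assms(2,3)]]])
     (intro Bochner_Integration.integral_cong refl, simp add: algebra_simps)

text \<open>On the base of the cone the weight at \<open>(y, x)\<close> is at most the weight at
  \<open>(y, t)\<close> times \<open>exp (lam * \<bar>x - t\<bar>)\<close>. Each half of the base
  contributes an exponential integral, which yields \<open>1 / lam\<close> and restores the weight
  of the tip \<open>(s, t)\<close>.\<close>

lemma half_diff_weighted_le:
  assumes Z: "weighted Z K" and y: "0 \<le> y" "y \<le> s"
  shows "\<bar>half_diff (\<lambda>x. Z (y, x)) (s - y) t\<bar> \<le> K / lam * wt s t"
proof -
  let ?c = "K * exp (lam * (y + mu t))"
  have i: "integrable lborel (\<lambda>x. indicator {0<..<s-y} x * exp (lam * x))" by (rule exp_integral[OF lam_pos])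
  have i1: "integrable lborel (\<lambda>x. indicator {0<..<s-y} (- t + 1 * x) * exp (lam * (- t + 1 * x)))"
    by (rule lborel_integrable_real_affine[OF i]) simp
  have i2: "integrable lborel (\<lambda>x. indicator {0<..<s-y} (t + (-1) * x) * exp (lam * (t + (-1) * x)))"
    by (rule lborel_integrable_real_affine[OF i]) simp
  have "2 * \<bar>half_diff (\<lambda>x. Z (y, x)) (s - y) t\<bar> \<le> (LINT x|lborel. indicator {t - (s - y)<..<t + (s - y)} x * \<bar>Z (y, x)\<bar>)"
    using half_diff_le[OF weighted_slice_integrable[OF Z], of y "s - y" t] y by simp
  also have "\<dots> \<le> (LINT x|lborel. ?c * (indicator {0<..<s-y} (- t + 1 * x) * exp (lam * (- t + 1 * x))
      + indicator {0<..<s-y} (t + (-1) * x) * exp (lam * (t + (-1) * x))))"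
  proof (rule integral_mono_AE)
    show "AE x in lborel. indicator {t - (s - y)<..<t + (s - y)} x * \<bar>Z (y, x)\<bar> \<le>
       ?c * (indicator {0<..<s-y} (- t + 1 * x) * exp (lam * (- t + 1 * x))
      + indicator {0<..<s-y} (t + (-1) * x) * exp (lam * (t + (-1) * x)))"
      using AE_lborel_neq[of t]
    proof eventually_elim
      case (elim x)
      have "\<bar>Z (y, x)\<bar> \<le> K * wt y x" by (rule weightedD(1)[OF Z])
      also have "\<dots> \<le> K * (exp (lam * (y + mu t)) * exp (lam * \<bar>x - t\<bar>))"
      proof (rule mult_left_mono[OF _ weightedD(2)[OF Z]])
        have "lam * (\<bar>y\<bar> + mu x) \<le> lam * (y + mu t + \<bar>x - t\<bar>)"
          using mu_Lipschitz[of x t] lam_pos y by (intro mult_left_mono) auto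
        then show "wt y x \<le> exp (lam * (y + mu t)) * exp (lam * \<bar>x - t\<bar>)"
          by (simp add: wt_def exp_add[symmetric] distrib_left)
      qed
      finally have *: "\<bar>Z (y, x)\<bar> \<le> ?c * exp (lam * \<bar>x - t\<bar>)" by simp
      consider "x < t" | "t < x" using elim by linarith
      then show ?case by cases (use * weightedD(2)[OF Z] in \<open>auto simp: indicator_def algebra_simps\<close>)
    qed
  next
    show "integrable lborel (\<lambda>x. indicator {t - (s - y)<..<t + (s - y)} x * \<bar>Z (y, x)\<bar>)"
      by (intro integrable_indicator integrable_abs weighted_slice_integrable[OF Z]) simp
    show "integrable lborel (\<lambda>x. ?c * (indicator {0<..<s-y} (- t + 1 * x) * exp (lam * (- t + 1 * x))
      + indicator {0<..<s-y} (t + (-1) * x) * exp (lam * (t + (-1) * x))))"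
      by (intro integrable_mult_right Bochner_Integration.integrable_add i1 i2)
  qed
  also have "\<dots> = ?c * ((LINT x|lborel. indicator {0<..<s-y} (- t + 1 * x) * exp (lam * (- t + 1 * x)))
      + (LINT x|lborel. indicator {0<..<s-y} (t + (-1) * x) * exp (lam * (t + (-1) * x))))"
    using i1 i2 by simp
  also have "\<dots> = ?c * (2 * (LINT x|lborel. indicator {0<..<s-y} x * exp (lam * x)))"
    using lborel_integral_real_affine[of 1 "\<lambda>x. indicator {0<..<s-y} x * exp (lam * x)" "-t"]
      lborel_integral_real_affine[of "-1" "\<lambda>x. indicator {0<..<s-y} x * exp (lam * x)" "t"] by simp
  also have "\<dots> \<le> ?c * (2 * (exp (lam * (s - y)) / lam))"
    using exp_integral(2)[OF lam_pos, of "s-y"] weightedD(2)[OF Z] by (intro mult_left_mono) auto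
  also have "\<dots> = 2 * (K / lam * wt s t)"
    using y by (simp add: wt_def exp_add[symmetric] algebra_simps flip: exp_add)
  finally show ?thesis by simp
qed

lemma half_diff_measurable:
  assumes Z: "weighted Z K"
  shows "(\<lambda>y. half_diff (\<lambda>x. Z (y, x)) (s - y) t) \<in> borel_measurable borel"
proof -
  note [measurable] = weighted_measurable[OF Z]
  have "(\<lambda>y. prim (\<lambda>x. Z (y, x)) (t + c * (s - y))) \<in> borel_measurable borel" for c
    unfolding prim_def indicator_times atMost_iff by measurable
  from this[of 1] this[of "-1"]
  have [measurable]: "(\<lambda>y. prim (\<lambda>x. Z (y, x)) (t + (s - y))) \<in> borel_measurable borel"
    "(\<lambda>y. prim (\<lambda>x. Z (y, x)) (t - (s - y))) \<in> borel_measurable borel" by (simp_all add: algebra_simps)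
  show ?thesis unfolding half_diff_def by measurable
qed

lemma duhamel_integrand_le:
  assumes Z: "weighted Z K"
  shows "\<bar>indicator {0<..<s} y * (Q y * half_diff (\<lambda>x. Z (y, x)) (s - y) t)\<bar> \<le> indicator {0..L} y * (B * (K / lam * wt s t))"
proof (cases "0 < y \<and> y < s \<and> y \<in> {0..L}")
  case True
  have "\<bar>Q y\<bar> * \<bar>half_diff (\<lambda>x. Z (y, x)) (s - y) t\<bar> \<le> B * (K / lam * wt s t)"
    using Q_bound B_nonneg half_diff_weighted_le[OF Z] True by (intro mult_mono) auto
  then show ?thesis using True by (simp add: abs_mult)
next
  case False
  then show ?thesis using Q_zero[of y] weightedD(2)[OF Z] B_nonneg lam_pos by (auto simp: indicator_def)
qed

lemma duhamel_integrable:
  assumes Z: "weighted Z K"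
  shows "integrable lborel (\<lambda>y. indicator {0<..<s} y * (Q y * half_diff (\<lambda>x. Z (y, x)) (s - y) t))"
proof (rule Bochner_Integration.integrable_bound)
  show "integrable lborel (\<lambda>y. indicator {0..L} y * (B * (K / lam * wt s t)))"
    by (intro integrable_mult_left integrable_real_indicator) (auto simp: emeasure_lborel_Icc_eq)
  show "AE y in lborel. norm (indicator {0<..<s} y * (Q y * half_diff (\<lambda>x. Z (y, x)) (s - y) t)) \<le> norm (indicator {0..L} y * (B * (K / lam * wt s t)))"
    using duhamel_integrand_le[OF Z] by (intro AE_I2) (smt (verit) real_norm_def)
  note [measurable] = half_diff_measurable[OF Z]
  show "(\<lambda>y. indicator {0<..<s} y * (Q y * half_diff (\<lambda>x. Z (y, x)) (s - y) t)) \<in> borel_measurable lborel"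
    by measurable
qed

lemma duhamel_le:
  assumes Z: "weighted Z K"
  shows "\<bar>duhamel Q Z s t\<bar> \<le> B * L * K / lam * wt s t"
proof -
  have "\<bar>duhamel Q Z s t\<bar> \<le> (LINT y|lborel. \<bar>indicator {0<..<s} y * (Q y * half_diff (\<lambda>x. Z (y, x)) (s - y) t)\<bar>)"
    unfolding duhamel_def by (rule integral_abs_bound)
  also have "\<dots> \<le> (LINT y|lborel. indicator {0..L} y * (B * (K / lam * wt s t)))"
    by (intro integral_mono integrable_abs duhamel_integrable[OF assms] duhamel_integrand_le[OF assms]
        integrable_mult_left integrable_real_indicator) (auto simp: emeasure_lborel_Icc_eq)
  also have "\<dots> = B * L * K / lam * wt s t" using L_pos by simp
  finally show ?thesis .
qed

lemma duhamel_diff: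
  assumes Z: "weighted Z K" "weighted Z' K'"
  shows "duhamel Q (\<lambda>p. Z p - Z' p) s t = duhamel Q Z s t - duhamel Q Z' s t"
proof -
  have "half_diff (\<lambda>x. Z (y, x) - Z' (y, x)) r t = half_diff (\<lambda>x. Z (y, x)) r t - half_diff (\<lambda>x. Z' (y, x)) r t" for y r
    unfolding half_diff_def by (simp add: prim_diff_fun weighted_slice_integrable[OF Z(1)] weighted_slice_integrable[OF Z(2)] field_simps)
  note * = this
  show ?thesis unfolding duhamel_def
    by (rule trans[OF _ Bochner_Integration.integral_diff[OF duhamel_integrable[OF Z(1)] duhamel_integrable[OF Z(2)]]])
       (intro Bochner_Integration.integral_cong refl, simp add: * right_diff_distrib)
qed

text \<open>\<open>Z\<close> may jump: it enters only through primitives of its slices, which are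
  continuous, and the moving limit of integration matters only at \<open>y = s\<close>. Dominated
  convergence applies because a convergent sequence of points has bounded space coordinates.\<close>

lemma continuous_duhamel:
  assumes Z: "weighted Z K"
  shows "continuous_on UNIV (\<lambda>(s,t). duhamel Q Z s t)"
proof -
  have "isCont (\<lambda>(s,t). duhamel Q Z s t) p" for p
    unfolding continuous_at_sequentially
  proof (intro allI impI)
    fix X assume X: "X \<longlonglongrightarrow> p"
    obtain s t where p: "p = (s, t)" by (cases p)
    define S where "S n = fst (X n)" for n
    define R where "R n = snd (X n)" for n
    have S: "S \<longlonglongrightarrow> s" and R: "R \<longlonglongrightarrow> t" using tendsto_fst[OF X] tendsto_snd[OF X] by (auto simp: p S_def[abs_def] R_def[abs_def])
    obtain M where M: "\<And>n. \<bar>S n\<bar> \<le> M" using convergent_imp_Bseq[OF convergentI[OF S]] by (auto simp: Bseq_def)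
    have "(\<lambda>n. duhamel Q Z (S n) (R n)) \<longlonglongrightarrow> duhamel Q Z s t"
      unfolding duhamel_def
    proof (rule integral_dominated_convergence[where w="\<lambda>y. indicator {0..L} y * (B * (K / lam * exp (lam * (M + Lam))))"])
      show "AE y in lborel. (\<lambda>n. indicator {0<..<S n} y * (Q y * half_diff (\<lambda>x. Z (y, x)) (S n - y) (R n))) \<longlonglongrightarrow>
              indicator {0<..<s} y * (Q y * half_diff (\<lambda>x. Z (y, x)) (s - y) t)"
        using AE_lborel_neq[of s]
      proof eventually_elim
        case (elim y)
        have "continuous_on UNIV (\<lambda>p. half_diff (\<lambda>x. Z (y, x)) (fst p) (snd p))"
          using continuous_half_diff[OF weighted_slice_integrable[OF Z]] by (simp add: split_def)
        then have c: "isCont (\<lambda>p. half_diff (\<lambda>x. Z (y, x)) (fst p) (snd p)) (s - y, t)"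
          by (simp add: continuous_on_eq_continuous_at)
        have "(\<lambda>n. (S n - y, R n)) \<longlonglongrightarrow> (s - y, t)" by (intro tendsto_intros S R)
        from isCont_tendsto_compose[OF c this]
        have 1: "(\<lambda>n. half_diff (\<lambda>x. Z (y, x)) (S n - y) (R n)) \<longlonglongrightarrow> half_diff (\<lambda>x. Z (y, x)) (s - y) t" by simp
        consider "y < s" | "s < y" using elim by linarith
        then have "\<forall>\<^sub>F n in sequentially. indicator {0<..<S n} y = (indicator {0<..<s} y :: real)"
        proof cases
          case 1
          with S have "\<forall>\<^sub>F n in sequentially. y < S n" by (rule order_tendstoD)
          then show ?thesis by eventually_elim (use 1 in \<open>auto simp: indicator_def\<close>)
        next
          case 2
          with S have "\<forall>\<^sub>F n in sequentially. S n < y" by (rule order_tendstoD)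
          then show ?thesis by eventually_elim (use 2 in \<open>auto simp: indicator_def\<close>)
        qed
        then have 2: "(\<lambda>n. indicator {0<..<S n} y) \<longlonglongrightarrow> (indicator {0<..<s} y :: real)" by (rule tendsto_eventually)
        show ?case by (intro tendsto_intros 1 2)
      qed
      show "AE y in lborel. norm (indicator {0<..<S n} y * (Q y * half_diff (\<lambda>x. Z (y, x)) (S n - y) (R n)))
           \<le> indicator {0..L} y * (B * (K / lam * exp (lam * (M + Lam))))" for n
      proof (rule AE_I2)
        fix y
        have "wt (S n) (R n) \<le> exp (lam * (\<bar>S n\<bar> + Lam))" by (rule wt_le)
        also have "\<dots> \<le> exp (lam * (M + Lam))" using M[of n] lam_pos by simp
        finally have "indicator {0..L} y * (B * (K / lam * wt (S n) (R n))) \<le> indicator {0..L} y * (B * (K / lam * exp (lam * (M + Lam))))"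
          using B_nonneg weightedD(2)[OF Z] lam_pos by (intro mult_left_mono) auto
        then show "norm (indicator {0<..<S n} y * (Q y * half_diff (\<lambda>x. Z (y, x)) (S n - y) (R n)))
           \<le> indicator {0..L} y * (B * (K / lam * exp (lam * (M + Lam))))"
          using duhamel_integrand_le[OF Z, of "S n" y "R n"] by simp
      qed
      show "integrable lborel (\<lambda>y. indicator {0..L} y * (B * (K / lam * exp (lam * (M + Lam)))))"
        by (intro integrable_mult_left integrable_real_indicator) (auto simp: emeasure_lborel_Icc_eq)
      show "(\<lambda>y. indicator {0<..<S n} y * (Q y * half_diff (\<lambda>x. Z (y, x)) (S n - y) (R n))) \<in> borel_measurable lborel" for n
        using duhamel_integrable[OF Z] by (rule borel_measurable_integrable)
      show "(\<lambda>y. indicator {0<..<s} y * (Q y * half_diff (\<lambda>x. Z (y, x)) (s - y) t)) \<in> borel_measurable lborel"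
        using duhamel_integrable[OF Z] by (rule borel_measurable_integrable)
    qed
    then show "((\<lambda>(s,t). duhamel Q Z s t) \<circ> X) \<longlonglongrightarrow> (case p of (s, t) \<Rightarrow> duhamel Q Z s t)"
      by (simp add: p o_def S_def R_def split_def)
  qed
  then show ?thesis by (simp add: continuous_at_imp_continuous_on)
qed


subsection \<open>The control of a string as a fixed point\<close>

text \<open>\<open>window J\<close> is the function on the line whose value at \<open>t\<^sub>0 + e x\<close>, for \<open>t\<^sub>0 \<in> {0, T}\<close>, \<open>e = \<plusminus>1\<close> and
  \<open>0 < x < L\<close>, is \<open>J t\<^sub>0 e x\<close>, and which vanishes elsewhere.\<close>

definition piece :: "real \<Rightarrow> real \<Rightarrow> (real \<Rightarrow> real) \<Rightarrow> real \<Rightarrow> real" where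
  "piece t0 e J t = indicator {0<..<L} (e * (t - t0)) * J (e * (t - t0))"

definition window :: "(real \<Rightarrow> real \<Rightarrow> real \<Rightarrow> real) \<Rightarrow> real \<Rightarrow> real" where
  "window J t = (\<Sum>t0\<in>{0,T}. \<Sum>e\<in>{1,-1}. piece t0 e (J t0 e) t)"

lemma T_pos: "0 < T" using T_ge L_pos by linarith

lemma sum4: "(\<Sum>t0\<in>{0,T}. \<Sum>e\<in>{1,-1::real}. (f t0 e :: real)) = f 0 1 + f 0 (-1) + (f T 1 + f T (-1))"
  using T_pos by simp

text \<open>The four half windows at 0 and \<open>T\<close> are open and, as
  \<open>T \<ge> 2 * L\<close>, disjoint, so exactly one summand survives. Here the length of the
  control time makes the conditions at 0 and at \<open>T\<close> compatible.\<close>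

lemma window_at:
  assumes "t0 \<in> {0,T}" "e \<in> {1,-1}" "0 < x" "x < L"
  shows "window J (t0 + e * x) = J t0 e x"
  using assms T_ge unfolding window_def sum4 by (auto simp: piece_def indicator_def)

section \<open>Slopes given on the windows, and the linear part of the fixed point map\<close>

definition on_window :: "(real \<Rightarrow> real) \<Rightarrow> real \<Rightarrow> real" where
  "on_window J x = indicator {0<..<L} x * J x"

lemma piece_eq: "piece t0 e J t = on_window J (- e * t0 + e * t)"
  by (simp add: piece_def on_window_def algebra_simps)

lemma piece_integrable:
  assumes "e \<in> {1,-1}" "integrable lborel (on_window J)"
  shows "integrable lborel (piece t0 e J)"
proof -
  have "integrable lborel (\<lambda>t. on_window J (- e * t0 + e * t))"
    by (rule lborel_integrable_real_affine[OF assms(2)]) (use assms(1) in auto)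
  then show ?thesis by (simp add: piece_eq[abs_def])
qed

lemma window_integrable:
  assumes "\<And>t0 e. t0 \<in> {0,T} \<Longrightarrow> e \<in> {1,-1} \<Longrightarrow> integrable lborel (on_window (J t0 e))"
  shows "integrable lborel (window J)"
  unfolding window_def[abs_def] by (intro Bochner_Integration.integrable_sum piece_integrable assms) auto

text \<open>A point of the window at distance \<open>x\<close> from \<open>t0\<close> has
  \<open>mu\<close> equal to \<open>x\<close>. If it lies in the base of the cone of
  \<open>(s, t)\<close>, the Lipschitz bound gives \<open>x < \<bar>s\<bar> + mu t\<close>. So the
  cone sees only an initial part of the window, whose length is the one in the exponent of
  \<open>wt s t\<close>.\<close>

lemma piece_window_le:
  assumes t0: "t0 \<in> {0,T}" and e: "e \<in> {1,-1}" and J: "integrable lborel (on_window J)"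
  shows "(LINT y|lborel. indicator {t - \<bar>s\<bar><..<t + \<bar>s\<bar>} y * \<bar>piece t0 e J y\<bar>)
    \<le> (LINT x|lborel. indicator {0<..<\<bar>s\<bar> + mu t} x * \<bar>on_window J x\<bar>)"
proof -
  have ee: "e * e = 1" "\<bar>e\<bar> = 1" "e \<noteq> 0" using e by auto
  have "(LINT y|lborel. indicator {t - \<bar>s\<bar><..<t + \<bar>s\<bar>} y * \<bar>piece t0 e J y\<bar>)
      = (LINT x|lborel. indicator {t - \<bar>s\<bar><..<t + \<bar>s\<bar>} (t0 + e * x) * \<bar>piece t0 e J (t0 + e * x)\<bar>)"
    by (subst lborel_integral_real_affine[OF ee(3), of _ t0]) (simp add: ee)
  also have "\<dots> = (LINT x|lborel. indicator {t - \<bar>s\<bar><..<t + \<bar>s\<bar>} (t0 + e * x) * \<bar>on_window J x\<bar>)"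
  proof (intro Bochner_Integration.integral_cong refl)
    fix x
    have "- e * t0 + e * (t0 + e * x) = (e * e) * x" by (simp add: algebra_simps)
    also have "\<dots> = x" by (simp add: ee)
    finally have "piece t0 e J (t0 + e * x) = on_window J x"
      unfolding piece_eq by (rule arg_cong)
    then show "indicator {t - \<bar>s\<bar><..<t + \<bar>s\<bar>} (t0 + e * x) * \<bar>piece t0 e J (t0 + e * x)\<bar>
       = indicator {t - \<bar>s\<bar><..<t + \<bar>s\<bar>} (t0 + e * x) * \<bar>on_window J x\<bar>" by simp
  qed
  also have "\<dots> \<le> (LINT x|lborel. indicator {0<..<\<bar>s\<bar> + mu t} x * \<bar>on_window J x\<bar>)"
  proof (rule integral_mono)
    have m: "{x. t0 + e * x \<in> {t - \<bar>s\<bar><..<t + \<bar>s\<bar>}} \<in> sets borel" by measurable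
    have "(\<lambda>x. indicator {t - \<bar>s\<bar><..<t + \<bar>s\<bar>} (t0 + e * x) * \<bar>on_window J x\<bar>)
       = (\<lambda>x. indicator {x. t0 + e * x \<in> {t - \<bar>s\<bar><..<t + \<bar>s\<bar>}} x * \<bar>on_window J x\<bar>)"
      by (auto simp: indicator_def)
    then show "integrable lborel (\<lambda>x. indicator {t - \<bar>s\<bar><..<t + \<bar>s\<bar>} (t0 + e * x) * \<bar>on_window J x\<bar>)"
      using integrable_indicator[OF integrable_abs[OF J] m] by simp
    show "integrable lborel (\<lambda>x. indicator {0<..<\<bar>s\<bar> + mu t} x * \<bar>on_window J x\<bar>)"
      by (intro integrable_indicator integrable_abs J) auto
    fix x
    show "indicator {t - \<bar>s\<bar><..<t + \<bar>s\<bar>} (t0 + e * x) * \<bar>on_window J x\<bar> \<le> indicator {0<..<\<bar>s\<bar> + mu t} x * \<bar>on_window J x\<bar>"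
    proof (cases "x \<in> {0<..<L} \<and> t0 + e * x \<in> {t - \<bar>s\<bar><..<t + \<bar>s\<bar>}")
      case True
      have "\<bar>e * x\<bar> = x" using True ee by (simp add: abs_mult)
      then have "mu (t0 + e * x) = x" using mu_window[OF t0, of "e * x"] True by simp
      moreover have "mu (t0 + e * x) \<le> mu t + \<bar>(t0 + e * x) - t\<bar>" by (rule mu_Lipschitz)
      moreover have "\<bar>(t0 + e * x) - t\<bar> < \<bar>s\<bar>" using True by auto
      ultimately have "x < \<bar>s\<bar> + mu t" by linarith
      then show ?thesis using True by simp
    next
      case False
      then show ?thesis by (auto simp: on_window_def indicator_def)
    qed
  qed
  finally show ?thesis .
qed

text \<open>Four pieces, and the factor one half of d'Alembert's formula, give
  \<open>2 * m\<close>.\<close>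

lemma half_diff_window_le:
  assumes J: "\<And>t0 e. t0 \<in> {0,T} \<Longrightarrow> e \<in> {1,-1} \<Longrightarrow> integrable lborel (on_window (J t0 e))"
    and m: "\<And>t0 e. t0 \<in> {0,T} \<Longrightarrow> e \<in> {1,-1} \<Longrightarrow>
      (LINT x|lborel. indicator {0<..<\<bar>s\<bar> + mu t} x * \<bar>on_window (J t0 e) x\<bar>) \<le> m"
  shows "\<bar>half_diff (window J) s t\<bar> \<le> 2 * m"
proof -
  let ?I = "\<lambda>y. indicator {t - \<bar>s\<bar><..<t + \<bar>s\<bar>} y :: real"
  have i: "integrable lborel (\<lambda>y. ?I y * \<bar>piece t0 e (J t0 e) y\<bar>)" if "t0 \<in> {0,T}" "e \<in> {1,-1}" for t0 e
    using that by (intro integrable_indicator integrable_abs piece_integrable J) auto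
  have "2 * \<bar>half_diff (window J) s t\<bar> \<le> (LINT y|lborel. ?I y * \<bar>window J y\<bar>)"
    using half_diff_le[of "window J" s t] window_integrable[of J] J by simp
  also have "\<dots> \<le> (LINT y|lborel. (\<Sum>t0\<in>{0,T}. \<Sum>e\<in>{1,-1}. ?I y * \<bar>piece t0 e (J t0 e) y\<bar>))"
  proof (rule integral_mono)
    show "integrable lborel (\<lambda>y. ?I y * \<bar>window J y\<bar>)"
      by (intro integrable_indicator integrable_abs window_integrable J) auto
    show "integrable lborel (\<lambda>y. (\<Sum>t0\<in>{0,T}. \<Sum>e\<in>{1,-1}. ?I y * \<bar>piece t0 e (J t0 e) y\<bar>))"
      by (intro Bochner_Integration.integrable_sum i)
    fix y
    have "\<bar>window J y\<bar> \<le> (\<Sum>t0\<in>{0,T}. \<Sum>e\<in>{1,-1}. \<bar>piece t0 e (J t0 e) y\<bar>)"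
      unfolding window_def sum4 by linarith
    then show "?I y * \<bar>window J y\<bar> \<le> (\<Sum>t0\<in>{0,T}. \<Sum>e\<in>{1,-1}. ?I y * \<bar>piece t0 e (J t0 e) y\<bar>)"
      unfolding sum_distrib_left[symmetric] by (rule mult_left_mono) simp
  qed
  also have "\<dots> = (\<Sum>t0\<in>{0,T}. \<Sum>e\<in>{1,-1}. (LINT y|lborel. ?I y * \<bar>piece t0 e (J t0 e) y\<bar>))"
    by (subst Bochner_Integration.integral_sum, intro Bochner_Integration.integrable_sum i, assumption+)
       (intro sum.cong refl Bochner_Integration.integral_sum i, assumption+)
  also have "\<dots> \<le> (\<Sum>t0\<in>{0,T}. \<Sum>e\<in>{1,-1::real}. m)"
    by (intro sum_mono order_trans[OF piece_window_le m] J) auto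
  also have "\<dots> = 4 * m" unfolding sum4 by simp
  finally show ?thesis by simp
qed

text \<open>The linear part of the fixed point map: the Volterra terms, subtracted from the slope at
  \<open>s = 0\<close> on the windows, send out a free wave, and the potential acts through the
  Duhamel term.\<close>

definition couple :: "(real \<times> real \<Rightarrow> real) \<Rightarrow> real \<Rightarrow> real \<Rightarrow> real" where
  "couple Z s t = half_diff (window (\<lambda>t0 e x. - transp Q Z e x t0)) s t + duhamel Q Z s t"

lemma on_window_transp_integrable:
  assumes Z: "weighted Z K" and e: "\<bar>e\<bar> = 1"
  shows "integrable lborel (on_window (\<lambda>x. transp Q Z e x t0))"
proof (rule Bochner_Integration.integrable_bound)
  note [measurable] = weighted_measurable[OF Z]
  show "integrable lborel (\<lambda>x. indicator {0..L} x * (B * L * K * exp (lam * (L + Lam))))"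
    by (intro integrable_mult_left integrable_real_indicator) (auto simp: emeasure_lborel_Icc_eq)
  have "(\<lambda>x. transp Q Z e (fst (x, t0)) (snd (x, t0))) \<in> borel_measurable borel"
    by measurable
  then have [measurable]: "(\<lambda>x. transp Q Z e x t0) \<in> borel_measurable borel" by simp
  show "on_window (\<lambda>x. transp Q Z e x t0) \<in> borel_measurable lborel"
    unfolding on_window_def[abs_def] by measurable
  show "AE x in lborel. norm (on_window (\<lambda>x. transp Q Z e x t0) x) \<le> norm (indicator {0..L} x * (B * L * K * exp (lam * (L + Lam))))"
  proof (rule AE_I2)
    fix x
    show "norm (on_window (\<lambda>x. transp Q Z e x t0) x) \<le> norm (indicator {0..L} x * (B * L * K * exp (lam * (L + Lam))))"
    proof (cases "x \<in> {0<..<L}")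
      case True
      have "\<bar>transp Q Z e x t0\<bar> \<le> B * L * K * wt x t0" by (rule transp_le[OF Z e])
      also have "\<dots> \<le> B * L * K * exp (lam * (L + Lam))"
      proof (rule mult_left_mono)
        have "wt x t0 \<le> exp (lam * (\<bar>x\<bar> + Lam))" by (rule wt_le)
        also have "\<dots> \<le> exp (lam * (L + Lam))" using True lam_pos by simp
        finally show "wt x t0 \<le> exp (lam * (L + Lam))" .
      qed (use B_nonneg L_pos weightedD(2)[OF Z] in simp)
      finally show ?thesis using True by (simp add: on_window_def)
    next
      case False then show ?thesis by (simp add: on_window_def)
    qed
  qed
qed

text \<open>At the times 0 and \<open>T\<close> the function \<open>mu\<close> vanishes, so on the
  windows the transported term is at most a multiple of \<open>exp (lam * x)\<close>; its integral
  up to \<open>\<bar>s\<bar> + mu t\<close> reproduces \<open>wt s t\<close> with a factor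
  \<open>1 / lam\<close>. This part counts twice, the Duhamel term once, and \<open>BL_le\<close>
  turns the sum into \<open>1 / 2\<close>.\<close>

lemma couple_le:
  assumes Z: "weighted Z K"
  shows "\<bar>couple Z s t\<bar> \<le> K / 2 * wt s t"
proof -
  have BLK: "0 \<le> B * L * K" using B_nonneg L_pos weightedD(2)[OF Z] by simp
  have "\<bar>half_diff (window (\<lambda>t0 e x. - transp Q Z e x t0)) s t\<bar> \<le> 2 * (B * L * K / lam * wt s t)"
  proof (rule half_diff_window_le)
    fix t0 e :: real assume t0: "t0 \<in> {0,T}" and "e \<in> {1,-1}"
    then have e: "\<bar>e\<bar> = 1" by auto
    have eq: "on_window (\<lambda>x. - transp Q Z e x t0) = (\<lambda>x. - on_window (\<lambda>x. transp Q Z e x t0) x)"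
      by (simp add: on_window_def fun_eq_iff)
    show i: "integrable lborel (on_window (\<lambda>x. - transp Q Z e x t0))"
      unfolding eq using on_window_transp_integrable[OF Z e] by simp
    have "(LINT x|lborel. indicator {0<..<\<bar>s\<bar> + mu t} x * \<bar>on_window (\<lambda>x. - transp Q Z e x t0) x\<bar>)
      \<le> (LINT x|lborel. B * L * K * (indicator {0<..<\<bar>s\<bar> + mu t} x * exp (lam * x)))"
    proof (rule integral_mono)
      show "integrable lborel (\<lambda>x. indicator {0<..<\<bar>s\<bar> + mu t} x * \<bar>on_window (\<lambda>x. - transp Q Z e x t0) x\<bar>)"
        by (intro integrable_indicator integrable_abs i) auto
      show "integrable lborel (\<lambda>x. B * L * K * (indicator {0<..<\<bar>s\<bar> + mu t} x * exp (lam * x)))"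
        by (intro integrable_mult_right exp_integral lam_pos)
      fix x
      have "\<bar>transp Q Z e x t0\<bar> \<le> B * L * K * exp (lam * x)" if "0 < x"
        using transp_le[OF Z e, of x t0] that t0 by (auto simp: wt_def)
      then show "indicator {0<..<\<bar>s\<bar> + mu t} x * \<bar>on_window (\<lambda>x. - transp Q Z e x t0) x\<bar>
         \<le> B * L * K * (indicator {0<..<\<bar>s\<bar> + mu t} x * exp (lam * x))"
        using BLK by (auto simp: indicator_def on_window_def)
    qed
    also have "\<dots> = B * L * K * (LINT x|lborel. indicator {0<..<\<bar>s\<bar> + mu t} x * exp (lam * x))" by simp
    also have "\<dots> \<le> B * L * K * (exp (lam * (\<bar>s\<bar> + mu t)) / lam)"
      by (intro mult_left_mono exp_integral lam_pos BLK)
    finally show "(LINT x|lborel. indicator {0<..<\<bar>s\<bar> + mu t} x * \<bar>on_window (\<lambda>x. - transp Q Z e x t0) x\<bar>) \<le> B * L * K / lam * wt s t"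
      by (simp add: wt_def)
  qed
  then have "\<bar>couple Z s t\<bar> \<le> 2 * (B * L * K / lam * wt s t) + B * L * K / lam * wt s t"
    unfolding couple_def by (intro order_trans[OF abs_triangle_ineq] add_mono duhamel_le[OF Z])
  also have "\<dots> = (3 * B * L / lam) * (K * wt s t)" by simp
  also have "\<dots> \<le> (1 / 2) * (K * wt s t)"
    by (rule mult_right_mono[OF BL_le]) (use weightedD(2)[OF Z] in auto)
  finally show ?thesis by simp
qed

lemma window_transp_integrable:
  assumes "weighted Z K"
  shows "integrable lborel (window (\<lambda>t0 e x. - transp Q Z e x t0))"
proof (rule window_integrable)
  fix t0 e :: real assume "t0 \<in> {0,T}" "e \<in> {1,-1}"
  moreover from this have "\<bar>e\<bar> = 1" by auto
  moreover have "on_window (\<lambda>x. - transp Q Z e x t0) = (\<lambda>x. - on_window (\<lambda>x. transp Q Z e x t0) x)"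
    by (simp add: on_window_def fun_eq_iff)
  ultimately show "integrable lborel (on_window (\<lambda>x. - transp Q Z e x t0))"
    using on_window_transp_integrable[OF assms] by simp
qed

lemma couple_diff:
  assumes Z: "weighted Z K" "weighted Z' K'"
  shows "couple (\<lambda>p. Z p - Z' p) s t = couple Z s t - couple Z' s t"
proof -
  have e: "e \<in> {1,-1} \<Longrightarrow> \<bar>e\<bar> = 1" for e :: real by auto
  have 1: "window (\<lambda>t0 e x. - transp Q (\<lambda>p. Z p - Z' p) e x t0) =
     (\<lambda>t. window (\<lambda>t0 e x. - transp Q Z e x t0) t - window (\<lambda>t0 e x. - transp Q Z' e x t0) t)"
    by (intro ext, unfold window_def piece_def sum4) (simp add: transp_diff[OF Z] algebra_simps)
  show ?thesis unfolding couple_def duhamel_diff[OF Z] 1 half_diff_def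
    by (simp add: prim_diff_fun[OF window_transp_integrable[OF Z(1)] window_transp_integrable[OF Z(2)]] field_simps)
qed

lemma continuous_couple:
  assumes Z: "weighted Z K"
  shows "continuous_on UNIV (\<lambda>(s,t). couple Z s t)"
  using continuous_half_diff[OF window_transp_integrable[OF Z]] continuous_duhamel[OF Z]
  unfolding couple_def split_def by (rule continuous_on_add)

text \<open>The free wave that jumps by \<open>g\<close> at \<open>s = a\<close> and vanishes for \<open>s < a\<close> is
  \<open>(g (t + (s - a)) + g (t - (s - a))) / 2\<close> for \<open>s > a\<close>. Subtracting the jump itself leaves a continuous
  function, so that the unknown of the fixed point equation is continuous.\<close>

definition jump :: "(real \<Rightarrow> real) \<Rightarrow> real \<Rightarrow> real \<Rightarrow> real \<Rightarrow> real" where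
  "jump g a s t = (g (t + max 0 (s - a)) + g (t - max 0 (s - a))) / 2 - g t"

lemma jump_le:
  assumes g: "\<And>t. \<bar>g t\<bar> \<le> G * exp (lam * mu t)" and a: "0 \<le> a"
  shows "\<bar>jump g a s t\<bar> \<le> 2 * G * wt s t"
proof -
  have G: "0 \<le> G" using g[of 0] by (simp add: abs_le_iff)
  define r where "r = max 0 (s - a)"
  have r: "0 \<le> r" "r \<le> \<bar>s\<bar>" using a by (auto simp: r_def)
  have b: "\<bar>g x\<bar> \<le> G * wt s t" if "\<bar>x - t\<bar> \<le> r" for x
  proof -
    have "mu x \<le> \<bar>s\<bar> + mu t" using mu_Lipschitz[of x t] that r by linarith
    then have "exp (lam * mu x) \<le> wt s t" using lam_pos by (simp add: wt_def)
    then show ?thesis using g[of x] G by (meson mult_left_mono order_trans)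
  qed
  have *: "\<bar>(x + y) / 2 - z\<bar> \<le> 2 * c" if "\<bar>x\<bar> \<le> c" "\<bar>y\<bar> \<le> c" "\<bar>z\<bar> \<le> c" for x y z c :: real
    using that by (simp add: abs_le_iff field_simps)
  have "\<bar>jump g a s t\<bar> \<le> 2 * (G * wt s t)"
    unfolding jump_def r_def[symmetric] by (rule *; rule b) (use r in auto)
  then show ?thesis by simp
qed

lemma continuous_jump:
  assumes g: "continuous_on UNIV g"
  shows "continuous_on UNIV (\<lambda>(s,t). jump g a s t)"
proof -
  have *: "continuous_on A (\<lambda>x. g (h x))" if "continuous_on A h" for h :: "real \<times> real \<Rightarrow> real" and A
    by (rule continuous_on_compose2[OF g that]) auto
  show ?thesis unfolding jump_def split_def by (intro continuous_intros * ballI) simp_all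
qed

definition with_jump :: "(real \<times> real \<Rightarrow> real) \<Rightarrow> (real \<Rightarrow> real) \<Rightarrow> real \<Rightarrow> real \<times> real \<Rightarrow> real" where
  "with_jump Y g a p = Y p + indicator {a<..} (fst p) * g (snd p)"

lemma weighted_with_jump:
  assumes Y: "weighted Y K" and g: "\<And>t. \<bar>g t\<bar> \<le> G * exp (lam * mu t)" and [measurable]: "g \<in> borel_measurable borel"
  shows "weighted (with_jump Y g a) (K + G)"
  unfolding weighted_def
proof (intro conjI allI)
  note [measurable] = weighted_measurable[OF Y]
  have G: "0 \<le> G" using g[of 0] by (simp add: abs_le_iff)
  show "0 \<le> K + G" using G weightedD(2)[OF Y] by simp
  show "with_jump Y g a \<in> borel_measurable (borel \<Otimes>\<^sub>M borel)"
    unfolding with_jump_def[abs_def] indicator_times greaterThan_iff by measurable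
  fix s t
  have "exp (lam * mu t) \<le> wt s t" using lam_pos by (simp add: wt_def)
  then have "\<bar>g t\<bar> \<le> G * wt s t" using g[of t] G by (meson mult_left_mono order_trans)
  moreover have "\<bar>indicator {a<..} s * g t\<bar> \<le> \<bar>g t\<bar>" by (auto simp: indicator_def)
  ultimately show "\<bar>with_jump Y g a (s, t)\<bar> \<le> (K + G) * wt s t"
    using weightedD(1)[OF Y, of s t] unfolding with_jump_def by (simp add: distrib_right)
qed

text \<open>Banach's theorem for the quotient \<open>V\<close> of the unknown and the weight, a
  bounded continuous function. With \<open>n\<close> the norm of \<open>V\<close>, the data
  contribute at most \<open>2 * M + 2 * G\<close> and the linear part at most half of
  \<open>n + G\<close>, the bound of the function with its jump. Solving
  \<open>n \<le> 2 * M + 2 * G + (n + G) / 2\<close> is the origin of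
  \<open>4 * M + 5 * G\<close>.\<close>

lemma control_fixpoint:
  assumes E: "\<And>t0 e. t0 \<in> {0,T} \<Longrightarrow> e \<in> {1,-1} \<Longrightarrow> integrable lborel (on_window (E t0 e))"
    and M: "\<And>t0 e. t0 \<in> {0,T} \<Longrightarrow> e \<in> {1,-1} \<Longrightarrow> (LINT x|lborel. \<bar>on_window (E t0 e) x\<bar>) \<le> M"
    and gc: "continuous_on UNIV g" and g: "\<And>t. \<bar>g t\<bar> \<le> G * exp (lam * mu t)" and a: "0 \<le> a"
  obtains Y where "weighted Y (4 * M + 5 * G)" "continuous_on UNIV Y"
    "\<And>s t. Y (s, t) = jump g a s t
      + half_diff (window (\<lambda>t0 e x. E t0 e x - transp Q (with_jump Y g a) e x t0)) s t
      + duhamel Q (with_jump Y g a) s t"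
proof -
  have gm [measurable]: "g \<in> borel_measurable borel"
    using gc by (rule borel_measurable_continuous_onI)
  have G: "0 \<le> G" using g[of 0] by (simp add: abs_le_iff)
  have M0: "0 \<le> M" using M[of 0 1] by (rule order_trans[rotated]) auto
  have wE: "integrable lborel (window E)" by (rule window_integrable) (rule E)
  define D where "D s t = jump g a s t + half_diff (window E) s t" for s t
  have D_le: "\<bar>D s t\<bar> \<le> (2 * M + 2 * G) * wt s t" for s t
  proof -
    have "\<bar>half_diff (window E) s t\<bar> \<le> 2 * (M * wt s t)"
    proof (rule half_diff_window_le[OF E])
      fix t0 e :: real assume te: "t0 \<in> {0,T}" "e \<in> {1,-1}"
      show "(LINT x|lborel. indicator {0<..<\<bar>s\<bar> + mu t} x * \<bar>on_window (E t0 e) x\<bar>) \<le> M * wt s t"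
      proof (cases "0 < \<bar>s\<bar> + mu t")
        case True
        have "(LINT x|lborel. indicator {0<..<\<bar>s\<bar> + mu t} x * \<bar>on_window (E t0 e) x\<bar>) \<le> (LINT x|lborel. \<bar>on_window (E t0 e) x\<bar>)"
          using te by (intro integral_mono integrable_indicator integrable_abs E) (auto simp: indicator_def)
        also have "\<dots> \<le> M * 1" using M[OF te] by simp
        also have "\<dots> \<le> M * wt s t" using True lam_pos M0 by (intro mult_left_mono) (auto simp: wt_def)
        finally show ?thesis .
      next
        case False
        then have "{0<..<\<bar>s\<bar> + mu t} = {}" by auto
        then show ?thesis using M0 by simp
      qed
    qed auto
    then show ?thesis unfolding D_def using jump_le[OF g a, of s t] by (simp add: distrib_right)
  qed
  have D_cont: "continuous_on UNIV (\<lambda>(s,t). D s t)"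
    using continuous_jump[OF gc] continuous_half_diff[OF wE]
    unfolding D_def split_def by (rule continuous_on_add)
  define W where "W p = wt (fst p) (snd p)" for p
  have W_cont: "continuous_on UNIV W" unfolding W_def wt_def
    by (intro continuous_intros continuous_on_compose2[OF mu_continuous]) auto
  have W_pos: "0 < W p" for p by (simp add: W_def)
  define Yof where "Yof V p = W p * apply_bcontfun V p" for V p
  have Yof_cont: "continuous_on UNIV (Yof V)" for V
    unfolding Yof_def[abs_def] by (intro continuous_intros W_cont) auto
  have Yof_w: "weighted (Yof V) (norm V)" for V
    unfolding weighted_def
  proof (intro conjI allI)
    show "Yof V \<in> borel_measurable (borel \<Otimes>\<^sub>M borel)"
      using borel_measurable_continuous_onI[OF Yof_cont] by (simp only: borel_prod)
    show "\<bar>Yof V (s, t)\<bar> \<le> norm V * wt s t" for s t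
      using norm_bounded[of V "(s,t)"] by (simp add: Yof_def W_def abs_mult mult.commute)
  qed simp
  define S where "S V p = D (fst p) (snd p) + couple (with_jump (Yof V) g a) (fst p) (snd p)" for V p
  have Uw: "weighted (with_jump (Yof V) g a) (norm V + G)" for V
    by (rule weighted_with_jump[OF Yof_w g gm])
  have S_le: "\<bar>S V p\<bar> \<le> (2 * M + 2 * G + (norm V + G) / 2) * W p" for V p
  proof -
    have "\<bar>S V p\<bar> \<le> (2 * M + 2 * G) * wt (fst p) (snd p) + (norm V + G) / 2 * wt (fst p) (snd p)"
      unfolding S_def by (intro order_trans[OF abs_triangle_ineq] add_mono D_le couple_le Uw)
    then show ?thesis by (simp only: W_def distrib_right)
  qed
  have S_cont: "continuous_on UNIV (\<lambda>p. S V p / W p)" for V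
    using D_cont continuous_couple[OF Uw[of V]] W_pos unfolding S_def split_def
    by (intro continuous_intros W_cont) (use W_pos in \<open>auto simp: less_le\<close>)
  have S_b: "norm (S V p / W p) \<le> 2 * M + 2 * G + (norm V + G) / 2" for V p
    using S_le[of V p] W_pos[of p] by (simp add: field_simps)
  have S_in: "(\<lambda>p. S V p / W p) \<in> bcontfun" for V
    by (rule bcontfun_normI[OF S_cont S_b])
  define F where "F V = Bcontfun (\<lambda>p. S V p / W p)" for V
  have F_app: "apply_bcontfun (F V) p = S V p / W p" for V p
    unfolding F_def by (simp add: Bcontfun_inverse[OF S_in])
  have "dist (F V) (F V') \<le> 1 / 2 * dist V V'" for V V'
  proof (rule dist_bound)
    fix p
    \<comment> \<open>The jump and the data cancel in differences, so only the linear part acts on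
      \<open>V - V'\<close>.\<close>
    have eq: "(\<lambda>p. with_jump (Yof V) g a p - with_jump (Yof V') g a p) = Yof (V - V')"
      by (simp add: with_jump_def Yof_def fun_eq_iff right_diff_distrib)
    have "S V p - S V' p = couple (Yof (V - V')) (fst p) (snd p)"
      unfolding S_def eq[symmetric] couple_diff[OF Uw[of V] Uw[of V']] by simp
    then have "\<bar>S V p - S V' p\<bar> \<le> norm (V - V') / 2 * W p"
      using couple_le[OF Yof_w[of "V - V'"], of "fst p" "snd p"] by (simp add: W_def)
    then have "\<bar>S V p - S V' p\<bar> / W p \<le> norm (V - V') / 2" using W_pos[of p] by (simp add: pos_divide_le_eq)
    moreover have "\<bar>S V p / W p - S V' p / W p\<bar> = \<bar>S V p - S V' p\<bar> / W p"
      using W_pos[of p] by (simp add: diff_divide_distrib[symmetric])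
    ultimately show "dist (apply_bcontfun (F V) p) (apply_bcontfun (F V') p) \<le> 1 / 2 * dist V V'"
      by (simp add: F_app dist_norm)
  qed
  then obtain V where V: "F V = V"
    using banach_fix_type[of "1/2" F] by auto
  have YS: "Yof V p = S V p" for p
    using F_app[of V p] W_pos[of p] unfolding V Yof_def by simp
  have nV: "norm V \<le> 4 * M + 5 * G"
  proof -
    have "norm V \<le> 2 * M + 2 * G + (norm V + G) / 2"
      by (rule norm_bound) (use S_b[of V] F_app[of V] V in simp)
    then show ?thesis by (simp add: field_simps)
  qed
  show ?thesis
  proof (rule that)
    show "weighted (Yof V) (4 * M + 5 * G)"
      unfolding weighted_def
    proof (intro conjI allI)
      show "0 \<le> 4 * M + 5 * G" using M0 G by simp
      fix s t
      have "\<bar>Yof V (s, t)\<bar> \<le> norm V * wt s t" by (rule weightedD(1)[OF Yof_w])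
      also have "\<dots> \<le> (4 * M + 5 * G) * wt s t" by (rule mult_right_mono[OF nV]) simp
      finally show "\<bar>Yof V (s, t)\<bar> \<le> (4 * M + 5 * G) * wt s t" .
    qed (rule weighted_measurable[OF Yof_w])
    show "continuous_on UNIV (Yof V)" by (rule Yof_cont)
    fix s t
    let ?U = "with_jump (Yof V) g a"
    have w: "window (\<lambda>t0 e x. E t0 e x - transp Q ?U e x t0) = (\<lambda>x. window E x + window (\<lambda>t0 e x. - transp Q ?U e x t0) x)"
      unfolding window_def piece_def sum4 by (simp add: fun_eq_iff algebra_simps)
    have "half_diff (window (\<lambda>t0 e x. E t0 e x - transp Q ?U e x t0)) s t
      = half_diff (window E) s t + half_diff (window (\<lambda>t0 e x. - transp Q ?U e x t0)) s t"
      unfolding half_diff_def w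
      by (simp add: prim_add[OF wE window_transp_integrable[OF Uw]] field_simps)
    then show "Yof V (s, t) = jump g a s t
      + half_diff (window (\<lambda>t0 e x. E t0 e x - transp Q ?U e x t0)) s t
      + duhamel Q ?U s t"
      using YS[of "(s, t)"] by (simp add: S_def D_def couple_def)
  qed
qed

end

subsection \<open>The Duhamel term\<close>

lemma
  fixes F :: "real \<times> real \<Rightarrow> real"
  assumes F: "F \<in> borel_measurable (borel \<Otimes>\<^sub>M borel)"
    and f: "integrable lborel f" and g: "integrable lborel g"
    and le: "\<And>x y. \<bar>F (x, y)\<bar> \<le> f x * g y"
  shows Fubini_bound: "(LINT x|lborel. LINT y|lborel. F (x, y)) = (LINT y|lborel. LINT x|lborel. F (x, y))"
    and integrable_inner1: "integrable lborel (\<lambda>x. LINT y|lborel. F (x, y))"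
    and integrable_inner2: "integrable lborel (\<lambda>y. LINT x|lborel. F (x, y))"
proof -
  have i: "integrable (lborel \<Otimes>\<^sub>M lborel) F"
  proof (rule Bochner_Integration.integrable_bound[OF integrable_pair_mult[OF f g]])
    have "sets (lborel \<Otimes>\<^sub>M lborel) = sets ((borel :: real measure) \<Otimes>\<^sub>M (borel :: real measure))"
      by (rule sets_pair_measure_cong) auto
    then show "F \<in> borel_measurable (lborel \<Otimes>\<^sub>M lborel)"
      using F measurable_cong_sets by blast
    show "AE p in lborel \<Otimes>\<^sub>M lborel. norm (F p) \<le> norm (case p of (x, y) \<Rightarrow> f x * g y)"
      by (intro AE_I2) (auto simp: split_def intro: order_trans[OF le abs_ge_self])
  qed
  have i': "integrable (lborel \<Otimes>\<^sub>M lborel) (case_prod (\<lambda>x y. F (x, y)))" using i by simp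
  show "(LINT x|lborel. LINT y|lborel. F (x, y)) = (LINT y|lborel. LINT x|lborel. F (x, y))"
    using lborel_pair.Fubini_integral[OF i'] by simp
  show "integrable lborel (\<lambda>x. LINT y|lborel. F (x, y))"
    using lborel_pair.integrable_fst'[OF i] by simp
  show "integrable lborel (\<lambda>y. LINT x|lborel. F (x, y))"
    using lborel_pair.integrable_snd[OF i'] by simp
qed

lemma integrable_indicator_const:
  "integrable lborel (\<lambda>x::real. c * indicator {a<..<b} x :: real)"
  by (intro integrable_mult_right integrable_real_indicator)
     (use emeasure_lborel_box_finite[of a b] in \<open>auto simp: box_real\<close>)


text \<open>Substitution \<open>r = y + x\<close> and Fubini on the triangle
  \<open>0 < y < r < s\<close>. An integral over \<open>y\<close> of slices of the cone becomes an
  integral over \<open>r\<close> of integrals along a characteristic that ends at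
  \<open>r\<close>.\<close>

lemma triangle_swap:
  fixes c :: "real \<times> real \<Rightarrow> real"
  assumes c [measurable]: "c \<in> borel_measurable (borel \<Otimes>\<^sub>M borel)"
    and le: "\<And>y x. 0 < y \<Longrightarrow> y < s \<Longrightarrow> 0 < x \<Longrightarrow> x < s \<Longrightarrow> \<bar>c (y, x)\<bar> \<le> M" and M: "0 \<le> M"
  shows "(LINT y|lborel. indicator {0<..<s} y * (LINT x|lborel. indicator {0<..<s - y} x * c (y, x)))
      = (LINT r|lborel. indicator {0<..<s} r * (LINT y|lborel. indicator {0<..<r} y * c (y, r - y)))"
    and "integrable lborel (\<lambda>r. indicator {0<..<s} r * (LINT y|lborel. indicator {0<..<r} y * c (y, r - y)))"
proof -
  define F where "F p = (if 0 < fst p \<and> fst p < snd p \<and> snd p < s then c (fst p, snd p - fst p) else 0)" for p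
  have F: "F \<in> borel_measurable (borel \<Otimes>\<^sub>M borel)" unfolding F_def by measurable
  have Fle: "\<bar>F (y, r)\<bar> \<le> (M * indicator {0<..<s} y) * (1 * indicator {0<..<s} r)" for y r
    using le[of y "r - y"] M by (auto simp: F_def indicator_def)
  note B = F integrable_indicator_const integrable_indicator_const Fle
  have 1: "indicator {0<..<s} y * (LINT x|lborel. indicator {0<..<s - y} x * c (y, x)) = (LINT r|lborel. F (y, r))" for y
  proof -
    have "(LINT x|lborel. indicator {0<..<s - y} x * c (y, x)) = (LINT r|lborel. indicator {0<..<s - y} (- y + 1 * r) * c (y, - y + 1 * r))"
      by (subst lborel_integral_real_affine[where c=1 and t="-y"]) auto
    then have "indicator {0<..<s} y * (LINT x|lborel. indicator {0<..<s - y} x * c (y, x))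
       = (LINT r|lborel. indicator {0<..<s} y * (indicator {0<..<s - y} (- y + 1 * r) * c (y, - y + 1 * r)))" by simp
    also have "\<dots> = (LINT r|lborel. F (y, r))"
      by (intro Bochner_Integration.integral_cong refl) (auto simp: F_def indicator_def)
    finally show ?thesis .
  qed
  have 2: "indicator {0<..<s} r * (LINT y|lborel. indicator {0<..<r} y * c (y, r - y)) = (LINT y|lborel. F (y, r))" for r
  proof -
    have "indicator {0<..<s} r * (LINT y|lborel. indicator {0<..<r} y * c (y, r - y))
      = (LINT y|lborel. indicator {0<..<s} r * (indicator {0<..<r} y * c (y, r - y)))" by simp
    also have "\<dots> = (LINT y|lborel. F (y, r))"
      by (intro Bochner_Integration.integral_cong refl) (auto simp: F_def indicator_def)
    finally show ?thesis .
  qed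
  show "(LINT y|lborel. indicator {0<..<s} y * (LINT x|lborel. indicator {0<..<s - y} x * c (y, x)))
      = (LINT r|lborel. indicator {0<..<s} r * (LINT y|lborel. indicator {0<..<r} y * c (y, r - y)))"
    unfolding 1 2 by (rule Fubini_bound[OF B])
  show "integrable lborel (\<lambda>r. indicator {0<..<s} r * (LINT y|lborel. indicator {0<..<r} y * c (y, r - y)))"
    unfolding 2 by (rule integrable_inner2[OF B])
qed

lemma prim_shift_diff:
  assumes f: "integrable lborel f" and r: "0 \<le> r" and e: "e \<in> {1,-1}"
  shows "e * (prim f (t + e * r) - prim f t) = (LINT x|lborel. indicator {0<..<r} x * f (t + e * x))"
proof -
  have e0: "e \<noteq> 0" "\<bar>e\<bar> = 1" using e by auto
  have "e * (prim f (t + e * r) - prim f t) = (LINT y|lborel. indicator {min t (t + e * r)<..<max t (t + e * r)} y * f y)"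
    using prim_diff_open[OF f, of t "t + r"] prim_diff_open[OF f, of "t - r" t] r e by auto
  also have "\<dots> = (LINT x|lborel. indicator {min t (t + e * r)<..<max t (t + e * r)} (t + e * x) * f (t + e * x))"
    by (subst lborel_integral_real_affine[OF e0(1), of _ t]) (simp add: e0)
  also have "\<dots> = (LINT x|lborel. indicator {0<..<r} x * f (t + e * x))"
    using e r by (intro Bochner_Integration.integral_cong refl) (auto simp: indicator_def)
  finally show ?thesis .
qed

lemma half_diff_eq:
  assumes f: "integrable lborel f" and r: "0 \<le> r"
  shows "half_diff f r t = (LINT x|lborel. indicator {0<..<r} x * ((f (t + x) + f (t - x)) / 2))"
    "integrable lborel (\<lambda>x. indicator {0<..<r} x * ((f (t + x) + f (t - x)) / 2))"
proof -
  have i1: "integrable lborel (\<lambda>x. indicator {0<..<r} x * f (t + 1 * x))"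
    by (intro integrable_indicator lborel_integrable_real_affine f) auto
  have i2: "integrable lborel (\<lambda>x. indicator {0<..<r} x * f (t + (-1) * x))"
    by (intro integrable_indicator lborel_integrable_real_affine f) auto
  have eq: "indicator {0<..<r} x * ((f (t + x) + f (t - x)) / 2)
     = (indicator {0<..<r} x * f (t + 1 * x) + indicator {0<..<r} x * f (t + (-1) * x)) / 2" for x
    by (simp add: field_simps)
  show "integrable lborel (\<lambda>x. indicator {0<..<r} x * ((f (t + x) + f (t - x)) / 2))"
    unfolding eq by (intro integrable_divide Bochner_Integration.integrable_add i1 i2)
  have "half_diff f r t = (1 * (prim f (t + 1 * r) - prim f t) + (-1) * (prim f (t + (-1) * r) - prim f t)) / 2"
    by (simp add: half_diff_def)
  also have "\<dots> = (LINT x|lborel. indicator {0<..<r} x * ((f (t + x) + f (t - x)) / 2))"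
    unfolding eq by (subst (1 2) prim_shift_diff[OF f r]) (use i1 i2 in simp_all)
  finally show "half_diff f r t = (LINT x|lborel. indicator {0<..<r} x * ((f (t + x) + f (t - x)) / 2))" .
qed

text \<open>The shifted function solves a one-way wave equation in \<open>(r, t)\<close>. Testing it
  in time against \<open>prim k\<close> and integrating in \<open>r\<close> moves the time
  derivative to the test function, so \<open>f\<close> need only be integrable.\<close>

lemma shift_test:
  assumes f: "integrable lborel f" and k: "integrable lborel k" and kb: "\<And>x. \<bar>k x\<bar> \<le> M"
    and r: "0 \<le> r" and e: "e \<in> {1,-1}"
  shows "(LINT t|lborel. f (t + e * r) * prim k t)
     = (LINT t|lborel. f t * prim k t) - e * (LINT x|lborel. indicator {0<..<r} x * (LINT t|lborel. f (t + e * x) * k t))"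
    and "integrable lborel (\<lambda>x. indicator {0<..<r} x * (LINT t|lborel. f (t + e * x) * k t))"
proof -
  note [measurable] = borel_measurable_integrable[OF f] borel_measurable_integrable[OF k]
  have ee: "e * e = 1" "-e \<in> {1,-1}" using e by auto
  have sh: "(LINT t|lborel. h (t + e * x) * g t) = (LINT y|lborel. h y * g (y - e * x))" for h g :: "real \<Rightarrow> real" and x
    by (subst lborel_integral_real_affine[of 1 _ "- e * x"]) (auto simp: algebra_simps)
  define F where "F p = indicator {0<..<r} (fst p) * (f (snd p) * k (snd p - e * fst p))" for p
  have F: "F \<in> borel_measurable (borel \<Otimes>\<^sub>M borel)"
    unfolding F_def indicator_times greaterThanLessThan_iff by measurable
  have Fle: "\<bar>F (x, y)\<bar> \<le> (M * indicator {0<..<r} x) * \<bar>f y\<bar>" for x y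
    using mult_left_mono[OF kb[of "y - e * x"], of "\<bar>f y\<bar>"]
    by (auto simp: F_def indicator_def abs_mult mult.commute)
  note B = F integrable_indicator_const integrable_abs[OF f] Fle
  have in1: "indicator {0<..<r} x * (LINT t|lborel. f (t + e * x) * k t) = (LINT y|lborel. F (x, y))" for x
    unfolding sh F_def by simp
  show "integrable lborel (\<lambda>x. indicator {0<..<r} x * (LINT t|lborel. f (t + e * x) * k t))"
    unfolding in1 by (rule integrable_inner1[OF B])
  have bk: "integrable lborel (\<lambda>t. f t * prim k t)"
    using integrable_prim_mult[OF k f] by (simp add: mult.commute)
  have pk: "prim k (y - e * r) = prim k y - e * (LINT x|lborel. indicator {0<..<r} x * k (y - e * x))" for y
    using arg_cong[OF prim_shift_diff[OF k r ee(2), of y], of "\<lambda>z. - e * z"] ee(1)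
    by (simp add: mult.assoc[symmetric])
  have "(LINT t|lborel. f (t + e * r) * prim k t) = (LINT y|lborel. f y * prim k y - e * (LINT x|lborel. F (x, y)))"
    unfolding sh
  proof (intro Bochner_Integration.integral_cong refl)
    fix y
    have "(LINT x|lborel. F (x, y)) = (LINT x|lborel. f y * (indicator {0<..<r} x * k (y - e * x)))"
      unfolding F_def by (intro Bochner_Integration.integral_cong) auto
    then show "f y * prim k (y - e * r) = f y * prim k y - e * (LINT x|lborel. F (x, y))"
      unfolding pk by (simp add: algebra_simps)
  qed
  also have "\<dots> = (LINT t|lborel. f t * prim k t) - e * (LINT y|lborel. LINT x|lborel. F (x, y))"
    using integrable_inner2[OF B] bk by simp
  also have "(LINT y|lborel. LINT x|lborel. F (x, y)) = (LINT x|lborel. LINT y|lborel. F (x, y))"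
    by (rule Fubini_bound[OF B, symmetric])
  finally show "(LINT t|lborel. f (t + e * r) * prim k t)
     = (LINT t|lborel. f t * prim k t) - e * (LINT x|lborel. indicator {0<..<r} x * (LINT t|lborel. f (t + e * x) * k t))"
    unfolding in1 .
qed

context wave_weight begin

lemma weighted_abs_le:
  assumes Z: "weighted Z K" and "\<bar>y\<bar> \<le> s"
  shows "\<bar>Z (y, t)\<bar> \<le> K * exp (lam * (s + Lam))"
proof -
  have "wt y t \<le> exp (lam * (\<bar>y\<bar> + Lam))" by (rule wt_le)
  also have "\<dots> \<le> exp (lam * (s + Lam))" using assms(2) lam_pos by simp
  finally show ?thesis using weightedD[OF Z] by (meson mult_left_mono order_trans)
qed

text \<open>Slicing the backward cone parallel to its sides instead of parallel to the time axis, by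
  \<open>triangle_swap\<close>, exhibits the two transported terms. Their mean is the derivative of
  the Duhamel term in \<open>s\<close>, here in integrated form.\<close>

lemma duhamel_eq_space:
  assumes Z: "weighted Z K" and s: "0 \<le> s"
  shows "duhamel Q Z s t = (LINT r|lborel. indicator {0<..<s} r * ((transp Q Z 1 r t + transp Q Z (-1) r t) / 2))"
    "integrable lborel (\<lambda>r. indicator {0<..<s} r * ((transp Q Z 1 r t + transp Q Z (-1) r t) / 2))"
proof -
  note [measurable] = weighted_measurable[OF Z]
  define c where "c p = Q (fst p) * ((Z (fst p, t + snd p) + Z (fst p, t - snd p)) / 2)" for p
  have c: "c \<in> borel_measurable (borel \<Otimes>\<^sub>M borel)" unfolding c_def by measurable
  define M where "M = B * (K * exp (lam * (s + Lam)))"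
  have M: "0 \<le> M" using B_nonneg weightedD(2)[OF Z] by (simp add: M_def)
  have cle: "\<bar>c (y, x)\<bar> \<le> M" if "0 < y" "y < s" for y x
  proof -
    have "\<bar>(Z (y, t + x) + Z (y, t - x)) / 2\<bar> \<le> K * exp (lam * (s + Lam))"
      using weighted_abs_le[OF Z, of y s "t + x"] weighted_abs_le[OF Z, of y s "t - x"] that by auto
    then show ?thesis using Q_bound[of y] B_nonneg unfolding c_def M_def abs_mult fst_conv snd_conv
      by (intro mult_mono) auto
  qed
  note S = triangle_swap[OF c cle M, of s]
  have 1: "(LINT y|lborel. indicator {0<..<r} y * c (y, r - y)) = (transp Q Z 1 r t + transp Q Z (-1) r t) / 2" for r
  proof -
    have "(LINT y|lborel. indicator {0<..<r} y * c (y, r - y))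
      = (LINT y|lborel. (indicator {0<..<r} y * (Q y * Z (y, t + 1 * (r - y))) + indicator {0<..<r} y * (Q y * Z (y, t + (-1) * (r - y)))) / 2)"
      by (intro Bochner_Integration.integral_cong refl) (simp add: c_def field_simps)
    also have "\<dots> = (transp Q Z 1 r t + transp Q Z (-1) r t) / 2"
    proof -
      have "integrable lborel (\<lambda>y. indicator {0<..<r} y * (Q y * Z (y, t + 1 * (r - y))))"
        "integrable lborel (\<lambda>y. indicator {0<..<r} y * (Q y * Z (y, t + (-1) * (r - y))))"
        by (rule transp_integrable[OF Z], simp)+
      then show ?thesis unfolding transp_def
        by (simp only: integral_divide_zero Bochner_Integration.integral_add)
    qed
    finally show ?thesis .
  qed
  have 2: "duhamel Q Z s t = (LINT y|lborel. indicator {0<..<s} y * (LINT x|lborel. indicator {0<..<s - y} x * c (y, x)))"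
    unfolding duhamel_def
  proof (intro Bochner_Integration.integral_cong refl)
    fix y
    show "indicator {0<..<s} y * (Q y * half_diff (\<lambda>x. Z (y, x)) (s - y) t) = indicator {0<..<s} y * (LINT x|lborel. indicator {0<..<s - y} x * c (y, x))"
    proof (cases "y \<in> {0<..<s}")
      case True
      have "Q y * half_diff (\<lambda>x. Z (y, x)) (s - y) t = (LINT x|lborel. Q y * (indicator {0<..<s - y} x * ((Z (y, t + x) + Z (y, t - x)) / 2)))"
        using True by (subst half_diff_eq(1)[OF weighted_slice_integrable[OF Z]]) auto
      also have "\<dots> = (LINT x|lborel. indicator {0<..<s - y} x * c (y, x))"
        by (intro Bochner_Integration.integral_cong refl) (simp add: c_def)
      finally show ?thesis by simp
    qed simp
  qed
  show "duhamel Q Z s t = (LINT r|lborel. indicator {0<..<s} r * ((transp Q Z 1 r t + transp Q Z (-1) r t) / 2))"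
    unfolding 2 1[symmetric] by (rule S(1)) auto
  show "integrable lborel (\<lambda>r. indicator {0<..<s} r * ((transp Q Z 1 r t + transp Q Z (-1) r t) / 2))"
    unfolding 1[symmetric] by (rule S(2)) auto
qed

text \<open>Squaring doubles the exponent of the weight. One factor is bounded by
  \<open>exp (lam * Lam)\<close>, the other is integrated in time, which leaves
  \<open>wt_mass\<close>.\<close>

lemma
  assumes Z: "weighted Z K" and e: "e \<in> {1,-1}" and s: "0 \<le> s"
  shows transp_time_integrable: "integrable lborel (transp Q Z e s)"
    and transp_time_square: "square_integrable (transp Q Z e s)"
    and transp_time_energy: "energy (transp Q Z e s) \<le> (B * L * K)\<^sup>2 * exp (2 * lam * s) * exp (lam * Lam) * wt_mass"
proof -
  note [measurable] = weighted_measurable[OF Z]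
  have e1: "\<bar>e\<bar> = 1" using e by auto
  have "(\<lambda>t. transp Q Z e (fst (s, t)) (snd (s, t))) \<in> borel_measurable borel" by measurable
  then have m [measurable]: "transp Q Z e s \<in> borel_measurable borel" by simp
  have BLK: "0 \<le> B * L * K" using B_nonneg L_pos weightedD(2)[OF Z] by simp
  have le: "\<bar>transp Q Z e s t\<bar> \<le> B * L * K * exp (lam * s) * exp (lam * mu t)" for t
    using transp_le[OF Z e1, of s t] s by (simp add: wt_eq mult.assoc)
  have i: "integrable lborel (\<lambda>t. B * L * K * exp (lam * s) * exp (lam * mu t))"
    by (intro integrable_mult_right integrable_exp_mu)
  show "integrable lborel (transp Q Z e s)"
    by (rule Bochner_Integration.integrable_bound[OF i]) (use le in \<open>auto intro!: AE_I2 intro: order_trans[OF _ abs_ge_self]\<close>)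
  have le2: "(transp Q Z e s t)\<^sup>2 \<le> (B * L * K)\<^sup>2 * exp (2 * lam * s) * exp (lam * Lam) * exp (lam * mu t)" for t
  proof -
    have "\<bar>transp Q Z e s t\<bar>\<^sup>2 \<le> (B * L * K * exp (lam * s) * exp (lam * mu t))\<^sup>2"
      by (rule power_mono[OF le]) simp
    also have "\<dots> = (B * L * K)\<^sup>2 * exp (2 * lam * s) * (exp (lam * mu t) * exp (lam * mu t))"
    proof -
      have "exp (2 * lam * s) = (exp (lam * s))\<^sup>2" by (simp add: power2_eq_square exp_add[symmetric])
      then show ?thesis by (simp add: power_mult_distrib power2_eq_square)
    qed
    also have "\<dots> \<le> (B * L * K)\<^sup>2 * exp (2 * lam * s) * (exp (lam * Lam) * exp (lam * mu t))"
      using mu_le[of t] lam_pos by (intro mult_left_mono mult_right_mono) auto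
    finally show ?thesis by (simp add: mult.assoc)
  qed
  have i2: "integrable lborel (\<lambda>t. (B * L * K)\<^sup>2 * exp (2 * lam * s) * exp (lam * Lam) * exp (lam * mu t))"
    by (intro integrable_mult_right integrable_exp_mu)
  have i3: "integrable lborel (\<lambda>t. (transp Q Z e s t)\<^sup>2)"
    by (rule Bochner_Integration.integrable_bound[OF i2]) (use le2 in \<open>auto intro!: AE_I2 intro: order_trans[OF _ abs_ge_self]\<close>)
  then show "square_integrable (transp Q Z e s)" by (simp add: square_integrable_def)
  have "energy (transp Q Z e s) \<le> (LINT t|lborel. (B * L * K)\<^sup>2 * exp (2 * lam * s) * exp (lam * Lam) * exp (lam * mu t))"
    unfolding energy_def by (rule integral_mono[OF i3 i2 le2])
  also have "\<dots> = (B * L * K)\<^sup>2 * exp (2 * lam * s) * exp (lam * Lam) * (LINT t|lborel. exp (lam * mu t))" by simp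
  also have "\<dots> \<le> (B * L * K)\<^sup>2 * exp (2 * lam * s) * exp (lam * Lam) * wt_mass"
    using integral_exp_mu by (intro mult_left_mono) auto
  finally show "energy (transp Q Z e s) \<le> (B * L * K)\<^sup>2 * exp (2 * lam * s) * exp (lam * Lam) * wt_mass" .
qed

lemma
  assumes Z: "weighted Z K" and e: "e \<in> {1,-1}" and h: "h \<in> borel_measurable borel" and hb: "\<And>t. \<bar>h t\<bar> \<le> N"
  shows transp_pairing: "(LINT t|lborel. transp Q Z e s t * h t)
      = (LINT y|lborel. indicator {0<..<s} y * (Q y * (LINT t|lborel. Z (y, t + e * (s - y)) * h t)))"
proof -
  note [measurable] = weighted_measurable[OF Z] h
  have e1: "\<bar>e\<bar> = 1" using e by auto
  have N: "0 \<le> N" using hb[of 0] by linarith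
  define F where "F p = (if 0 < fst p \<and> fst p < s then Q (fst p) * (Z (fst p, snd p + e * (s - fst p)) * h (snd p)) else 0)" for p
  have F: "F \<in> borel_measurable (borel \<Otimes>\<^sub>M borel)" unfolding F_def by measurable
  have Fle: "\<bar>F (y, t)\<bar> \<le> indicator {0..L} y * (B * K * exp (lam * \<bar>s\<bar>) * N * exp (lam * mu t))" for y t
  proof -
    have "F (y, t) = (indicator {0<..<s} y * (Q y * Z (y, t + e * (s - y)))) * h t"
      by (auto simp: F_def indicator_def)
    then have "\<bar>F (y, t)\<bar> = \<bar>indicator {0<..<s} y * (Q y * Z (y, t + e * (s - y)))\<bar> * \<bar>h t\<bar>"
      by (simp only: abs_mult)
    also have "\<dots> \<le> (indicator {0..L} y * (B * K * wt s t)) * N"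
      by (intro mult_mono transp_integrand_le[OF Z e1] hb) (use B_nonneg weightedD(2)[OF Z] in auto)
    finally have "\<bar>F (y, t)\<bar> \<le> (indicator {0..L} y * (B * K * wt s t)) * N" .
    then show ?thesis by (simp add: wt_eq mult_ac)
  qed
  have i1: "integrable lborel (indicator {0..L} :: real \<Rightarrow> real)"
    by (intro integrable_real_indicator) (auto simp: emeasure_lborel_Icc_eq)
  have i2: "integrable lborel (\<lambda>t. B * K * exp (lam * \<bar>s\<bar>) * N * exp (lam * mu t))"
    by (intro integrable_mult_right integrable_exp_mu)
  have "(LINT t|lborel. transp Q Z e s t * h t) = (LINT t|lborel. LINT y|lborel. F (y, t))"
  proof (intro Bochner_Integration.integral_cong refl)
    fix t
    have "transp Q Z e s t * h t = (LINT y|lborel. (indicator {0<..<s} y * (Q y * Z (y, t + e * (s - y)))) * h t)"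
      unfolding transp_def by simp
    also have "\<dots> = (LINT y|lborel. F (y, t))"
      by (intro Bochner_Integration.integral_cong refl) (auto simp: F_def indicator_def)
    finally show "transp Q Z e s t * h t = (LINT y|lborel. F (y, t))" .
  qed
  also have "\<dots> = (LINT y|lborel. LINT t|lborel. F (y, t))" by (rule Fubini_bound[OF F i1 i2 Fle, symmetric])
  also have "\<dots> = (LINT y|lborel. indicator {0<..<s} y * (Q y * (LINT t|lborel. Z (y, t + e * (s - y)) * h t)))"
    by (intro Bochner_Integration.integral_cong refl) (auto simp: F_def indicator_def)
  finally show ?thesis .
qed

text \<open>The integral over a slice of the cone is a difference of two time primitives. Exchanging
  these with the integral in \<open>y\<close> shows that the derivative in \<open>t\<close> is half
  the difference of the transported terms.\<close>

lemma duhamel_eq_time: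
  assumes Z: "weighted Z K" and s: "0 \<le> s"
  shows "duhamel Q Z s t = prim (\<lambda>x. (transp Q Z 1 s x - transp Q Z (-1) s x) / 2) t"
proof -
  note [measurable] = weighted_measurable[OF Z]
  let ?h = "\<lambda>x. indicator {..t} x :: real"
  have sl: "integrable lborel (\<lambda>x. ?h x * Z (y, x + c))" for y c
    using lborel_integrable_real_affine[OF weighted_slice_integrable[OF Z, of y], of 1 c]
    by (intro integrable_indicator) (auto simp: add.commute)
  have pr: "(LINT x|lborel. Z (y, x + c) * ?h x) = prim (\<lambda>x. Z (y, x)) (t + c)" for y c
  proof -
    have "prim (\<lambda>x. Z (y, x)) (t + c) = prim (\<lambda>x. Z (y, x + c)) t" by (rule prim_shift[symmetric])
    then show ?thesis unfolding prim_def by (simp add: mult.commute)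
  qed
  have "prim (\<lambda>x. (transp Q Z 1 s x - transp Q Z (-1) s x) / 2) t
     = (LINT x|lborel. (transp Q Z 1 s x * ?h x - transp Q Z (-1) s x * ?h x) / 2)"
    unfolding prim_def by (intro Bochner_Integration.integral_cong refl) (simp add: algebra_simps)
  also have "\<dots> = ((LINT x|lborel. transp Q Z 1 s x * ?h x) - (LINT x|lborel. transp Q Z (-1) s x * ?h x)) / 2"
    using integrable_indicator[OF transp_time_integrable[OF Z _ s], of 1 "{..t}"] integrable_indicator[OF transp_time_integrable[OF Z _ s], of "-1" "{..t}"]
    by (simp add: mult.commute)
  also have "\<dots> = ((LINT y|lborel. indicator {0<..<s} y * (Q y * prim (\<lambda>x. Z (y, x)) (t + 1 * (s - y))))
      - (LINT y|lborel. indicator {0<..<s} y * (Q y * prim (\<lambda>x. Z (y, x)) (t + (-1) * (s - y))))) / 2"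
    by (subst transp_pairing[OF Z, where N=1], simp, simp, simp add: indicator_def, subst transp_pairing[OF Z, where N=1], simp, simp, simp add: indicator_def)
       (simp only: pr)
  also have "\<dots> = duhamel Q Z s t"
  proof -
    have m: "(\<lambda>y. prim (\<lambda>x. Z (y, x)) (t + c * (s - y))) \<in> borel_measurable borel" for c
      unfolding prim_def indicator_times atMost_iff by measurable
    have i: "integrable lborel (\<lambda>y. indicator {0<..<s} y * (Q y * prim (\<lambda>x. Z (y, x)) (t + c * (s - y))))" for c
    proof (rule Bochner_Integration.integrable_bound)
      let ?C = "K * exp (lam * s) * wt_mass"
      show "integrable lborel (\<lambda>y. (B * ?C) * indicator {0<..<s} y)" by (rule integrable_indicator_const)
      show "(\<lambda>y. indicator {0<..<s} y * (Q y * prim (\<lambda>x. Z (y, x)) (t + c * (s - y)))) \<in> borel_measurable lborel"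
        using m[of c] by measurable
      have "\<bar>prim (\<lambda>x. Z (y, x)) x0\<bar> \<le> ?C" if "0 < y" "y < s" for y x0
      proof -
        have "\<bar>prim (\<lambda>x. Z (y, x)) x0\<bar> \<le> (LINT x|lborel. \<bar>Z (y, x)\<bar>)"
          by (rule prim_bound[OF weighted_slice_integrable[OF Z]])
        also have "\<dots> \<le> (LINT x|lborel. K * exp (lam * s) * exp (lam * mu x))"
        proof (intro integral_mono integrable_abs weighted_slice_integrable[OF Z] integrable_mult_right integrable_exp_mu)
          fix x
          have "\<bar>Z (y, x)\<bar> \<le> K * (exp (lam * y) * exp (lam * mu x))" using weightedD(1)[OF Z, of y x] that by (simp add: wt_eq)
          also have "\<dots> \<le> K * (exp (lam * s) * exp (lam * mu x))"
            using that lam_pos weightedD(2)[OF Z] by (intro mult_left_mono mult_right_mono) auto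
          finally show "\<bar>Z (y, x)\<bar> \<le> K * exp (lam * s) * exp (lam * mu x)" by simp
        qed
        also have "\<dots> = K * exp (lam * s) * (LINT x|lborel. exp (lam * mu x))" by simp
        also have "\<dots> \<le> ?C" using integral_exp_mu weightedD(2)[OF Z] by (intro mult_left_mono) auto
        finally show ?thesis .
      qed
      note pb = this
      have "\<bar>Q y * prim (\<lambda>x. Z (y, x)) x0\<bar> \<le> B * ?C" if "0 < y" "y < s" for y x0
        unfolding abs_mult using Q_bound B_nonneg pb that by (intro mult_mono) auto
      then show "AE y in lborel. norm (indicator {0<..<s} y * (Q y * prim (\<lambda>x. Z (y, x)) (t + c * (s - y)))) \<le> norm ((B * ?C) * indicator {0<..<s} y)"
        by (intro AE_I2) (auto simp: indicator_def intro: order_trans[OF _ abs_ge_self])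
    qed
    show ?thesis unfolding duhamel_def half_diff_def
      by (subst Bochner_Integration.integral_diff[symmetric, OF i i], subst integral_divide_zero[symmetric])
         (intro Bochner_Integration.integral_cong refl, simp add: algebra_simps diff_divide_distrib)
  qed
  finally show ?thesis by simp
qed

text \<open>The transported term \<open>z\<close> solves the one-way equation
  \<open>z_s - e z_t = Q Z\<close>. The form tested in time and integrated in \<open>s\<close>
  follows from \<open>shift_test\<close> on every slice of \<open>Z\<close> and a change of the
  order of integration.\<close>

lemma transp_weak:
  assumes Z: "weighted Z K" and e: "e \<in> {1,-1}" and s: "0 \<le> s"
    and k: "integrable lborel k" and kb: "\<And>x. \<bar>k x\<bar> \<le> M"
  shows "(LINT t|lborel. transp Q Z e s t * prim k t)
     = (LINT y|lborel. indicator {0<..<s} y * (Q y * (LINT t|lborel. Z (y, t) * prim k t)))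
       - e * (LINT r|lborel. indicator {0<..<s} r * (LINT t|lborel. transp Q Z e r t * k t))"
    and "integrable lborel (\<lambda>y. indicator {0<..<s} y * (Q y * (LINT t|lborel. Z (y, t) * prim k t)))"
    and "integrable lborel (\<lambda>r. indicator {0<..<s} r * (LINT t|lborel. transp Q Z e r t * k t))"
proof -
  note [measurable] = weighted_measurable[OF Z] borel_measurable_integrable[OF k]
  have e1: "\<bar>e\<bar> = 1" using e by auto
  have M: "0 \<le> M" using kb[of 0] by linarith
  have pk [measurable]: "prim k \<in> borel_measurable borel"
    using prim_continuous[OF k] by (rule borel_measurable_continuous_onI)
  define N where "N = (LINT y|lborel. \<bar>k y\<bar>)"
  have N: "0 \<le> N" by (simp add: N_def)
  have pb: "\<bar>prim k t\<bar> \<le> N" for t unfolding N_def by (rule prim_bound[OF k])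
  define W where "W = K * exp (lam * (s + Lam))"
  have W: "0 \<le> W" using weightedD(2)[OF Z] by (simp add: W_def)
  define c where "c p = Q (fst p) * (LINT t|lborel. Z (fst p, t + e * snd p) * k t)" for p
  have c: "c \<in> borel_measurable (borel \<Otimes>\<^sub>M borel)"
    unfolding c_def by measurable
  have cle: "\<bar>c (y, x)\<bar> \<le> B * (W * N)" if y: "0 < y" "y < s" for y x
  proof -
    have "\<bar>LINT t|lborel. Z (y, t + e * x) * k t\<bar> \<le> (LINT t|lborel. \<bar>Z (y, t + e * x) * k t\<bar>)"
      by (rule integral_abs_bound)
    also have "\<dots> \<le> (LINT t|lborel. W * \<bar>k t\<bar>)"
    proof (rule Bochner_Integration.integral_mono')
      show "integrable lborel (\<lambda>t. W * \<bar>k t\<bar>)" using k by simp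
      show "\<bar>Z (y, t + e * x) * k t\<bar> \<le> W * \<bar>k t\<bar>" for t
        unfolding abs_mult W_def using weighted_abs_le[OF Z, of y s] y by (intro mult_right_mono) auto
    qed (use W in simp)
    also have "\<dots> = W * N" by (simp add: N_def)
    finally show ?thesis unfolding c_def abs_mult fst_conv snd_conv using Q_bound B_nonneg by (intro mult_mono) auto
  qed
  have WN: "0 \<le> B * (W * N)" using B_nonneg W N by simp
  note S = triangle_swap[OF c cle WN, of s]
  have inner: "(LINT t|lborel. transp Q Z e r t * k t) = (LINT y|lborel. indicator {0<..<r} y * c (y, r - y))" for r
    unfolding c_def fst_conv snd_conv by (rule transp_pairing[OF Z e _ kb]) measurable
  show "integrable lborel (\<lambda>r. indicator {0<..<s} r * (LINT t|lborel. transp Q Z e r t * k t))"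
    unfolding inner by (rule S(2)) auto
  have zint: "integrable lborel (\<lambda>t. Z (y, t) * prim k t)" for y
    using integrable_prim_mult[OF k weighted_slice_integrable[OF Z, of y]] by (simp add: mult.commute)
  show i0: "integrable lborel (\<lambda>y. indicator {0<..<s} y * (Q y * (LINT t|lborel. Z (y, t) * prim k t)))"
  proof (rule Bochner_Integration.integrable_bound)
    let ?C = "N * (K * exp (lam * s) * wt_mass)"
    show "integrable lborel (\<lambda>y. (B * ?C) * indicator {0<..<s} y)" by (rule integrable_indicator_const)
    have "(\<lambda>y. LINT t|lborel. Z (y, t) * prim k t) \<in> borel_measurable borel"
      by measurable
    then show "(\<lambda>y. indicator {0<..<s} y * (Q y * (LINT t|lborel. Z (y, t) * prim k t))) \<in> borel_measurable lborel"
      by measurable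
    have *: "\<bar>LINT t|lborel. Z (y, t) * prim k t\<bar> \<le> ?C" if y: "0 < y" "y < s" for y
    proof -
      have "\<bar>LINT t|lborel. Z (y, t) * prim k t\<bar> \<le> (LINT t|lborel. \<bar>Z (y, t) * prim k t\<bar>)"
        by (rule integral_abs_bound)
      also have "\<dots> \<le> (LINT t|lborel. N * (K * exp (lam * s)) * exp (lam * mu t))"
      proof (rule integral_mono[OF integrable_abs[OF zint]])
        show "integrable lborel (\<lambda>t. N * (K * exp (lam * s)) * exp (lam * mu t))"
          by (intro integrable_mult_right integrable_exp_mu)
        fix t
        have "\<bar>Z (y, t)\<bar> \<le> K * (exp (lam * y) * exp (lam * mu t))" using weightedD(1)[OF Z, of y t] y by (simp add: wt_eq)
        also have "\<dots> \<le> K * (exp (lam * s) * exp (lam * mu t))"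
          using y lam_pos weightedD(2)[OF Z] by (intro mult_left_mono mult_right_mono) auto
        finally have "\<bar>Z (y, t)\<bar> * \<bar>prim k t\<bar> \<le> (K * (exp (lam * s) * exp (lam * mu t))) * N"
          using pb weightedD(2)[OF Z] by (intro mult_mono) auto
        then show "\<bar>Z (y, t) * prim k t\<bar> \<le> N * (K * exp (lam * s)) * exp (lam * mu t)"
          by (simp add: abs_mult mult_ac)
      qed
      also have "\<dots> = N * (K * exp (lam * s)) * (LINT t|lborel. exp (lam * mu t))" by simp
      also have "\<dots> \<le> N * (K * exp (lam * s)) * wt_mass"
        using integral_exp_mu weightedD(2)[OF Z] N by (intro mult_left_mono) auto
      finally show ?thesis by (simp add: mult.assoc)
    qed
    have "\<bar>Q y * (LINT t|lborel. Z (y, t) * prim k t)\<bar> \<le> B * ?C" if "0 < y" "y < s" for y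
      unfolding abs_mult using Q_bound B_nonneg * that by (intro mult_mono) auto
    then show "AE y in lborel. norm (indicator {0<..<s} y * (Q y * (LINT t|lborel. Z (y, t) * prim k t))) \<le> norm ((B * ?C) * indicator {0<..<s} y)"
      by (intro AE_I2) (auto simp: indicator_def intro: order_trans[OF _ abs_ge_self])
  qed
  let ?I = "\<lambda>y. LINT x|lborel. indicator {0<..<s - y} x * c (y, x)"
  \<comment> \<open>The slice at \<open>y\<close> has been shifted by \<open>e * (s - y)\<close> on
    arrival at \<open>s\<close>. \<open>shift_test\<close> undoes the shift at the price of an
    integral that \<open>triangle_swap\<close> collects into transported terms.\<close>
  have key: "indicator {0<..<s} y * (Q y * (LINT t|lborel. Z (y, t + e * (s - y)) * prim k t))
     = indicator {0<..<s} y * (Q y * (LINT t|lborel. Z (y, t) * prim k t)) - e * (indicator {0<..<s} y * ?I y)" for y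
  proof (cases "y \<in> {0<..<s}")
    case True
    have eq1: "(LINT t|lborel. Z (y, t + e * (s - y)) * prim k t) = (LINT t|lborel. Z (y, t) * prim k t)
       - e * (LINT x|lborel. indicator {0<..<s - y} x * (LINT t|lborel. Z (y, t + e * x) * k t))"
      using shift_test(1)[OF weighted_slice_integrable[OF Z, of y] k kb _ e, of "s - y"] True by simp
    have "?I y = (LINT x|lborel. Q y * (indicator {0<..<s - y} x * (LINT t|lborel. Z (y, t + e * x) * k t)))"
      by (intro Bochner_Integration.integral_cong refl) (simp add: c_def)
    then have eq2: "?I y = Q y * (LINT x|lborel. indicator {0<..<s - y} x * (LINT t|lborel. Z (y, t + e * x) * k t))"
      by simp
    show ?thesis unfolding eq1 eq2 by (simp add: right_diff_distrib)
  qed simp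
  have i1: "integrable lborel (\<lambda>y. indicator {0<..<s} y * ?I y)"
  proof (rule Bochner_Integration.integrable_bound)
    show "integrable lborel (\<lambda>y. (B * (W * N) * s) * indicator {0<..<s} y)" by (rule integrable_indicator_const)
    have "(\<lambda>y. ?I y) \<in> borel_measurable borel"
      using c unfolding indicator_times greaterThanLessThan_iff by measurable
    then show "(\<lambda>y. indicator {0<..<s} y * ?I y) \<in> borel_measurable lborel" by measurable
    have "\<bar>?I y\<bar> \<le> B * (W * N) * s" if y: "0 < y" "y < s" for y
    proof -
      have "\<bar>?I y\<bar> \<le> (LINT x|lborel. \<bar>indicator {0<..<s - y} x * c (y, x)\<bar>)" by (rule integral_abs_bound)
      also have "\<dots> \<le> (LINT x|lborel. B * (W * N) * indicator {0<..<s} x)"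
        by (rule Bochner_Integration.integral_mono'[OF integrable_indicator_const])
           (use cle[OF y] y WN in \<open>auto simp: indicator_def\<close>)
      also have "\<dots> = B * (W * N) * s" using s by simp
      finally show ?thesis .
    qed
    then show "AE y in lborel. norm (indicator {0<..<s} y * ?I y) \<le> norm ((B * (W * N) * s) * indicator {0<..<s} y)"
      by (intro AE_I2) (auto simp: indicator_def intro: order_trans[OF _ abs_ge_self])
  qed
  have "(LINT t|lborel. transp Q Z e s t * prim k t)
     = (LINT y|lborel. indicator {0<..<s} y * (Q y * (LINT t|lborel. Z (y, t + e * (s - y)) * prim k t)))"
    by (rule transp_pairing[OF Z e pk pb])
  also have "\<dots> = (LINT y|lborel. indicator {0<..<s} y * (Q y * (LINT t|lborel. Z (y, t) * prim k t)))
       - e * (LINT y|lborel. indicator {0<..<s} y * ?I y)"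
    unfolding key using i0 i1 by simp
  also have "(LINT y|lborel. indicator {0<..<s} y * ?I y) = (LINT r|lborel. indicator {0<..<s} r * (LINT t|lborel. transp Q Z e r t * k t))"
    unfolding inner by (rule S(1)) auto
  finally show "(LINT t|lborel. transp Q Z e s t * prim k t)
     = (LINT y|lborel. indicator {0<..<s} y * (Q y * (LINT t|lborel. Z (y, t) * prim k t)))
       - e * (LINT r|lborel. indicator {0<..<s} r * (LINT t|lborel. transp Q Z e r t * k t))" .
qed

end

subsection \<open>Solutions on a string\<close>

lemma integrable_mult_bounded:
  fixes f h :: "real \<Rightarrow> real"
  assumes f: "integrable lborel f" and [measurable]: "h \<in> borel_measurable borel" and hb: "\<And>x. \<bar>h x\<bar> \<le> M"
  shows "integrable lborel (\<lambda>x. f x * h x)"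
proof (rule Bochner_Integration.integrable_bound[where f="\<lambda>x. M * f x"])
  note [measurable] = borel_measurable_integrable[OF f]
  show "integrable lborel (\<lambda>x. M * f x)" using f by simp
  show "(\<lambda>x. f x * h x) \<in> borel_measurable lborel" by measurable
  have "\<bar>h x\<bar> * \<bar>f x\<bar> \<le> \<bar>M\<bar> * \<bar>f x\<bar>" for x
    using hb[of x] by (intro mult_right_mono) auto
  then show "AE x in lborel. norm (f x * h x) \<le> norm (M * f x)"
    by (intro AE_I2) (simp add: abs_mult mult.commute)
qed

lemma energy_translation_tendsto:
  assumes f: "square_integrable f" and e: "e \<in> {1,-1}"
  shows "((\<lambda>t. energy (\<lambda>s. f (t + e * (s - c)) - f (t0 + e * (s - c)))) \<longlongrightarrow> 0) (at t0)"
proof -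
  have e0: "e \<noteq> 0" "\<bar>e\<bar> = 1" using e by auto
  have eq: "energy (\<lambda>s. f (t + e * (s - c)) - f (t0 + e * (s - c))) = energy (\<lambda>x. f (x + (t - t0)) - f x)" for t
  proof -
    have "energy (\<lambda>s. f (t + e * (s - c)) - f (t0 + e * (s - c)))
      = energy (\<lambda>s. (\<lambda>x. f (x + (t - t0)) - f x) ((t0 - e * c) + e * s))"
      by (rule arg_cong[where f=energy]) (simp add: fun_eq_iff algebra_simps)
    also have "\<dots> = energy (\<lambda>x. f (x + (t - t0)) - f x)"
      by (subst energy_affine[OF e0(1)]) (simp add: e0)
    finally show ?thesis .
  qed
  show ?thesis unfolding eq tendsto_iff
  proof (intro allI impI)
    fix r :: real assume "0 < r"
    from energy_translation_continuous[OF f this] obtain d where d: "0 < d" "\<And>h. \<bar>h\<bar> < d \<Longrightarrow> energy (\<lambda>x. f (x + h) - f x) < r" by blast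
    show "\<forall>\<^sub>F x in at t0. dist (energy (\<lambda>xa. f (xa + (x - t0)) - f xa)) 0 < r"
      unfolding eventually_at using d by (intro exI[of _ d]) (auto simp: dist_real_def)
  qed
qed

context wave_weight begin

section \<open>Continuity in time of the transported term\<close>

lemma continuous_transp_time:
  assumes Z: "weighted Z K" and e: "e \<in> {1,-1}" and c: "\<And>y. continuous_on UNIV (\<lambda>t. Z (y, t))"
  shows "isCont (transp Q Z e s) t"
  unfolding continuous_at_sequentially
proof (intro allI impI)
  fix X assume X: "X \<longlonglongrightarrow> t"
  have e1: "\<bar>e\<bar> = 1" using e by auto
  have "(\<lambda>n. transp Q Z e s (X n)) \<longlonglongrightarrow> transp Q Z e s t"
    unfolding transp_def
  proof (rule integral_dominated_convergence[where w="\<lambda>y. indicator {0..L} y * (B * K * exp (lam * (\<bar>s\<bar> + Lam)))"])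
    show "integrable lborel (\<lambda>y. indicator {0..L} y * (B * K * exp (lam * (\<bar>s\<bar> + Lam))))"
      by (intro integrable_mult_left integrable_real_indicator) (auto simp: emeasure_lborel_Icc_eq)
    show "AE y in lborel. norm (indicator {0<..<s} y * (Q y * Z (y, X n + e * (s - y)))) \<le> indicator {0..L} y * (B * K * exp (lam * (\<bar>s\<bar> + Lam)))" for n
    proof (rule AE_I2)
      fix y
      have "norm (indicator {0<..<s} y * (Q y * Z (y, X n + e * (s - y)))) \<le> indicator {0..L} y * (B * K * wt s (X n))"
        using transp_integrand_le[OF Z e1] by simp
      also have "\<dots> \<le> indicator {0..L} y * (B * K * exp (lam * (\<bar>s\<bar> + Lam)))"
        using wt_le weightedD(2)[OF Z] B_nonneg by (intro mult_left_mono) auto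
      finally show "norm (indicator {0<..<s} y * (Q y * Z (y, X n + e * (s - y)))) \<le> indicator {0..L} y * (B * K * exp (lam * (\<bar>s\<bar> + Lam)))" .
    qed
    show "AE y in lborel. (\<lambda>n. indicator {0<..<s} y * (Q y * Z (y, X n + e * (s - y)))) \<longlonglongrightarrow> indicator {0<..<s} y * (Q y * Z (y, t + e * (s - y)))"
    proof (rule AE_I2)
      fix y
      have "isCont (\<lambda>t. Z (y, t)) (t + e * (s - y))" using c by (simp add: continuous_on_eq_continuous_at)
      moreover have "(\<lambda>n. X n + e * (s - y)) \<longlonglongrightarrow> t + e * (s - y)" by (intro tendsto_intros X)
      ultimately have "(\<lambda>n. Z (y, X n + e * (s - y))) \<longlonglongrightarrow> Z (y, t + e * (s - y))" by (rule isCont_tendsto_compose)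
      then show "(\<lambda>n. indicator {0<..<s} y * (Q y * Z (y, X n + e * (s - y)))) \<longlonglongrightarrow> indicator {0<..<s} y * (Q y * Z (y, t + e * (s - y)))"
        by (intro tendsto_intros)
    qed
  qed (rule borel_measurable_integrable[OF transp_integrable[OF Z e1]])+
  then show "(transp Q Z e s \<circ> X) \<longlonglongrightarrow> transp Q Z e s t" by (simp add: o_def)
qed

lemma transp_space_bound:
  assumes Z: "weighted Z K" and e: "e \<in> {1,-1}" and s: "s \<in> {0<..<L}"
  shows "\<bar>transp Q Z e s t\<bar> \<le> B * L * K * exp (lam * (L + Lam))"
proof -
  have "\<bar>transp Q Z e s t\<bar> \<le> B * L * K * wt s t" using e by (intro transp_le[OF Z]) auto
  also have "\<dots> \<le> B * L * K * exp (lam * (L + Lam))"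
  proof (rule mult_left_mono)
    have "wt s t \<le> exp (lam * (\<bar>s\<bar> + Lam))" by (rule wt_le)
    also have "\<dots> \<le> exp (lam * (L + Lam))" using s lam_pos by simp
    finally show "wt s t \<le> exp (lam * (L + Lam))" .
  qed (use B_nonneg L_pos weightedD(2)[OF Z] in simp)
  finally show ?thesis .
qed

lemma transp_slice_measurable:
  assumes Z: "weighted Z K"
  shows "(\<lambda>s. transp Q Z e s t) \<in> borel_measurable borel"
proof -
  note [measurable] = weighted_measurable[OF Z]
  have "(\<lambda>s. transp Q Z e (fst (s, t)) (snd (s, t))) \<in> borel_measurable borel" by measurable
  then show ?thesis by simp
qed

lemma transp_space_square:
  assumes Z: "weighted Z K" and e: "e \<in> {1,-1}"
  shows "square_integrable (\<lambda>s. indicator {0<..<L} s * transp Q Z e s t)"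
proof (rule square_integrable_bounded_support(1)[where a=0 and b=L and K="B * L * K * exp (lam * (L + Lam))"])
  show "(\<lambda>s. indicator {0<..<L} s * transp Q Z e s t) \<in> borel_measurable borel"
    using transp_slice_measurable[OF Z] by measurable
  show "\<bar>indicator {0<..<L} s * transp Q Z e s t\<bar> \<le> B * L * K * exp (lam * (L + Lam))" for s
  proof (cases "s \<in> {0<..<L}")
    case True
    then show ?thesis using transp_space_bound[OF Z e True, of t] by simp
  next
    case False
    then show ?thesis using B_nonneg L_pos weightedD(2)[OF Z] by simp
  qed
qed auto

lemma transp_space_tendsto:
  assumes Z: "weighted Z K" and e: "e \<in> {1,-1}" and c: "\<And>y. continuous_on UNIV (\<lambda>t. Z (y, t))"
  shows "((\<lambda>t. energy (\<lambda>s. indicator {0<..<L} s * (transp Q Z e s t - transp Q Z e s t0))) \<longlongrightarrow> 0) (at t0)"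
proof -
  let ?C = "B * L * K * exp (lam * (L + Lam))"
  have "isCont (\<lambda>t. energy (\<lambda>s. indicator {0<..<L} s * (transp Q Z e s t - transp Q Z e s t0))) t0"
    unfolding continuous_at_sequentially
  proof (intro allI impI)
    fix X assume X: "X \<longlonglongrightarrow> t0"
    have "(\<lambda>n. LINT s|lborel. (indicator {0<..<L} s * (transp Q Z e s (X n) - transp Q Z e s t0))\<^sup>2) \<longlonglongrightarrow> integral\<^sup>L lborel (\<lambda>s::real. 0::real)"
    proof (rule integral_dominated_convergence[where w="\<lambda>s. (2 * ?C)\<^sup>2 * indicator {0<..<L} s"])
      show "integrable lborel (\<lambda>s. (2 * ?C)\<^sup>2 * indicator {0<..<L} s)" by (rule integrable_indicator_const)
      show "AE s in lborel. (\<lambda>n. (indicator {0<..<L} s * (transp Q Z e s (X n) - transp Q Z e s t0))\<^sup>2) \<longlonglongrightarrow> 0"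
      proof (rule AE_I2)
        fix s
        have "(\<lambda>n. transp Q Z e s (X n)) \<longlonglongrightarrow> transp Q Z e s t0"
          by (rule isCont_tendsto_compose[OF continuous_transp_time[OF Z e c] X])
        then have "(\<lambda>n. (indicator {0<..<L} s * (transp Q Z e s (X n) - transp Q Z e s t0))\<^sup>2) \<longlonglongrightarrow> (indicator {0<..<L} s * (transp Q Z e s t0 - transp Q Z e s t0))\<^sup>2"
          by (intro tendsto_intros)
        then show "(\<lambda>n. (indicator {0<..<L} s * (transp Q Z e s (X n) - transp Q Z e s t0))\<^sup>2) \<longlonglongrightarrow> 0" by simp
      qed
      show "AE s in lborel. norm ((indicator {0<..<L} s * (transp Q Z e s (X n) - transp Q Z e s t0))\<^sup>2) \<le> (2 * ?C)\<^sup>2 * indicator {0<..<L} s" for n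
      proof (rule AE_I2)
        fix s
        show "norm ((indicator {0<..<L} s * (transp Q Z e s (X n) - transp Q Z e s t0))\<^sup>2) \<le> (2 * ?C)\<^sup>2 * indicator {0<..<L} s"
        proof (cases "s \<in> {0<..<L}")
          case True
          have "\<bar>transp Q Z e s (X n) - transp Q Z e s t0\<bar> \<le> \<bar>2 * ?C\<bar>"
            using transp_space_bound[OF Z e True, of "X n"] transp_space_bound[OF Z e True, of t0] by linarith
          then show ?thesis using True by (simp only: abs_le_square_iff) simp
        qed simp
      qed
    qed (use transp_slice_measurable[OF Z] in measurable)
    then show "((\<lambda>t. energy (\<lambda>s. indicator {0<..<L} s * (transp Q Z e s t - transp Q Z e s t0))) \<circ> X) \<longlonglongrightarrow> energy (\<lambda>s. indicator {0<..<L} s * (transp Q Z e s t0 - transp Q Z e s t0))"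
      by (simp add: o_def energy_def)
  qed
  then show ?thesis by (simp add: isCont_def)
qed

end

text \<open>Here \<open>p\<close> is any integrable and square integrable slope, and
  \<open>Y_eq\<close> is an explicit formula for the solution. Nothing in the locale refers to a
  target state; the windows have disappeared into \<open>p\<close>. In \<open>g_prim\<close> the
  derivative \<open>g1\<close> enters through differences because \<open>prim\<close> has no base
  point.\<close>

locale wave_string = wave_weight L B Lam lam T Q
  for L B Lam lam T :: real and Q :: "real \<Rightarrow> real" +
  fixes a G K :: real and p g g1 :: "real \<Rightarrow> real" and Y :: "real \<times> real \<Rightarrow> real"
  assumes a_nonneg: "0 \<le> a"
    and p_sq: "square_integrable p" and p_int: "integrable lborel p"
    and g1_sq: "square_integrable g1" and g1_int: "integrable lborel g1"
    and g_prim: "\<And>t. g t = g 0 + (prim g1 t - prim g1 0)"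
    and g_le: "\<And>t. \<bar>g t\<bar> \<le> G * exp (lam * mu t)"
    and Y_w: "weighted Y K" and Y_cont: "continuous_on UNIV Y"
    and Y_eq: "\<And>s t. Y (s, t) = jump g a s t + half_diff p s t + duhamel Q (with_jump Y g a) s t"
begin

text \<open>\<open>U\<close> is the solution, \<open>slope\<close> and \<open>vel\<close> are its derivatives in \<open>s\<close> and \<open>t\<close>, and \<open>ray e\<close> is
  \<open>U\<^sub>s + e U\<^sub>t\<close>.\<close>

abbreviation U :: "real \<times> real \<Rightarrow> real" where "U \<equiv> with_jump Y g a"

definition ray :: "real \<Rightarrow> real \<Rightarrow> real \<Rightarrow> real" where
  "ray e s t = p (t + e * s) + e * (indicator {a<..} s * g1 (t + e * (s - a))) + transp Q U e s t"

definition slope :: "real \<Rightarrow> real \<Rightarrow> real" where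
  "slope s t = (ray 1 s t + ray (-1) s t) / 2"

definition vel :: "real \<Rightarrow> real \<Rightarrow> real" where
  "vel s t = (ray 1 s t - ray (-1) s t) / 2"

lemma g_cont: "continuous_on UNIV g"
proof -
  have "continuous_on UNIV (\<lambda>t. g 0 + (prim g1 t - prim g1 0))"
    by (intro continuous_intros prim_continuous g1_int)
  moreover have "(\<lambda>t. g 0 + (prim g1 t - prim g1 0)) = g" by (intro ext) (rule g_prim[symmetric])
  ultimately show ?thesis by (simp only:)
qed

lemma g_diff: "g x - g y = prim g1 x - prim g1 y"
  using arg_cong2[OF g_prim[of x] g_prim[of y], of minus] by (simp only: add_diff_cancel_left diff_diff_eq2 diff_add_cancel)

lemma g_meas [measurable]: "g \<in> borel_measurable borel"
  using g_cont by (rule borel_measurable_continuous_onI)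


lemma U_w: "weighted U (K + G)"
  by (rule weighted_with_jump[OF Y_w g_le g_meas])

lemma p_meas [measurable]: "p \<in> borel_measurable borel" by (rule square_integrable_measurable[OF p_sq])
lemma g1_meas [measurable]: "g1 \<in> borel_measurable borel" by (rule square_integrable_measurable[OF g1_sq])
lemma U_meas [measurable]: "U \<in> borel_measurable (borel \<Otimes>\<^sub>M borel)" by (rule weighted_measurable[OF U_w])

lemma U_cont: "continuous_on UNIV (\<lambda>t. U (s, t))"
  unfolding with_jump_def fst_conv snd_conv
  by (intro continuous_intros g_cont continuous_on_compose2[OF Y_cont]) auto

lemma ray_measurable [measurable]: "(\<lambda>q. ray e (fst q) (snd q)) \<in> borel_measurable (borel \<Otimes>\<^sub>M borel)"
  unfolding ray_def indicator_times greaterThan_iff by measurable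

lemma slope_measurable [measurable]: "(\<lambda>q. slope (fst q) (snd q)) \<in> borel_measurable (borel \<Otimes>\<^sub>M borel)"
  unfolding slope_def by measurable

lemma vel_measurable [measurable]: "(\<lambda>q. vel (fst q) (snd q)) \<in> borel_measurable (borel \<Otimes>\<^sub>M borel)"
  unfolding vel_def by measurable


text \<open>Translations preserve the energy, so the contribution of \<open>p\<close> and
  \<open>g1\<close> has the same bound on every line \<open>s = const\<close>; only the bound for
  the transported term depends on \<open>s\<close>. This hidden regularity gives slopes and
  velocities at the vertices a meaning as square integrable functions of time.\<close>

lemma
  assumes e: "e \<in> {1,-1}" and s: "0 \<le> s"
  shows ray_integrable: "integrable lborel (ray e s)"
    and ray_square: "square_integrable (ray e s)"
    and ray_energy: "energy (ray e s) \<le> 4 * energy p + 4 * energy g1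
      + 2 * ((B * L * (K + G))\<^sup>2 * exp (2 * lam * s) * exp (lam * Lam) * wt_mass)"
proof -
  have eq: "ray e s = (\<lambda>t. (p (t + e * s) + (e * indicator {a<..} s) * g1 (t + e * (s - a))) + transp Q U e s t)"
    by (simp add: ray_def fun_eq_iff)
  have i1: "integrable lborel (\<lambda>t. p (t + e * s))" "integrable lborel (\<lambda>t. g1 (t + e * (s - a)))"
    using lborel_integrable_real_affine[OF p_int, of 1 "e * s"] lborel_integrable_real_affine[OF g1_int, of 1 "e * (s - a)"]
    by (simp_all add: add.commute)
  show "integrable lborel (ray e s)"
    unfolding eq by (intro Bochner_Integration.integrable_add integrable_mult_right i1 transp_time_integrable[OF U_w e s])
  have s1: "square_integrable (\<lambda>t. p (t + e * s))" by (rule square_integrable_shift[OF p_sq])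
  have s2: "square_integrable (\<lambda>t. (e * indicator {a<..} s) * g1 (t + e * (s - a)))"
    by (intro square_integrable_cmult square_integrable_shift g1_sq)
  note s12 = square_integrable_add[OF s1 s2]
  note s3 = transp_time_square[OF U_w e s]
  show "square_integrable (ray e s)" unfolding eq by (rule square_integrable_add[OF s12 s3])
  have "energy (ray e s) \<le> 2 * energy (\<lambda>t. p (t + e * s) + (e * indicator {a<..} s) * g1 (t + e * (s - a))) + 2 * energy (transp Q U e s)"
    unfolding eq by (rule energy_add_le[OF s12 s3])
  also have "energy (\<lambda>t. p (t + e * s) + (e * indicator {a<..} s) * g1 (t + e * (s - a))) \<le> 2 * energy p + 2 * energy g1"
  proof -
    have "energy (\<lambda>t. (e * indicator {a<..} s) * g1 (t + e * (s - a))) \<le> 1 * energy g1"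
      unfolding energy_cmult energy_shift(1) by (rule mult_right_mono) (use e in \<open>auto simp: indicator_def\<close>)
    then show ?thesis using energy_add_le[OF s1 s2] by (simp add: energy_shift)
  qed
  finally show "energy (ray e s) \<le> 4 * energy p + 4 * energy g1
      + 2 * ((B * L * (K + G))\<^sup>2 * exp (2 * lam * s) * exp (lam * Lam) * wt_mass)"
    using transp_time_energy[OF U_w e s] by simp
qed

lemma
  assumes s: "0 \<le> s"
  shows slope_square: "square_integrable (slope s)" and vel_square: "square_integrable (vel s)"
    and vel_integrable: "integrable lborel (vel s)"
    and slope_energy: "energy (slope s) \<le> 4 * energy p + 4 * energy g1 + 2 * ((B * L * (K + G))\<^sup>2 * exp (2 * lam * s) * exp (lam * Lam) * wt_mass)"
    and vel_energy: "energy (vel s) \<le> 4 * energy p + 4 * energy g1 + 2 * ((B * L * (K + G))\<^sup>2 * exp (2 * lam * s) * exp (lam * Lam) * wt_mass)"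
proof -
  have e: "(1::real) \<in> {1,-1}" "(-1::real) \<in> {1,-1}" by auto
  have sl: "slope s = (\<lambda>t. (1/2) * (ray 1 s t + ray (-1) s t))" and ve: "vel s = (\<lambda>t. (1/2) * (ray 1 s t - ray (-1) s t))"
    by (auto simp: slope_def vel_def)
  note S = ray_square[OF e(1) s] ray_square[OF e(2) s]
  show "square_integrable (slope s)" unfolding sl by (intro square_integrable_cmult square_integrable_add S)
  show "square_integrable (vel s)" unfolding ve by (intro square_integrable_cmult square_integrable_diff S)

  show "integrable lborel (vel s)" unfolding ve by (intro integrable_mult_right Bochner_Integration.integrable_diff ray_integrable e s)
  have R2: "(1/2)\<^sup>2 * (2 * x + 2 * x) = x" for x :: real by (simp add: power2_eq_square)
  let ?R = "4 * energy p + 4 * energy g1 + 2 * ((B * L * (K + G))\<^sup>2 * exp (2 * lam * s) * exp (lam * Lam) * wt_mass)"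
  have "energy (slope s) \<le> (1/2)\<^sup>2 * (2 * energy (ray 1 s) + 2 * energy (ray (-1) s))"
    unfolding sl energy_cmult by (intro mult_left_mono energy_add_le S) auto
  also have "\<dots> \<le> (1/2)\<^sup>2 * (2 * ?R + 2 * ?R)" by (intro mult_left_mono add_mono ray_energy e s) auto
  finally show "energy (slope s) \<le> ?R" by (simp only: R2)
  have "energy (vel s) \<le> (1/2)\<^sup>2 * (2 * energy (ray 1 s) + 2 * energy (ray (-1) s))"
    unfolding ve energy_cmult by (intro mult_left_mono energy_diff_le S) auto
  also have "\<dots> \<le> (1/2)\<^sup>2 * (2 * ?R + 2 * ?R)" by (intro mult_left_mono add_mono ray_energy e s) auto
  finally show "energy (vel s) \<le> ?R" by (simp only: R2)
qed

text \<open>Beyond \<open>a\<close> the free wave with value \<open>g\<close> and slope 0 at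
  \<open>a\<close> has as derivative in \<open>s\<close> half the difference of \<open>g1\<close> at
  the two ends of the base. By \<open>a_nonneg\<close> the part of \<open>(0, s)\<close> beyond
  \<open>a\<close> is a translate of \<open>(0, max 0 (s - a))\<close>.\<close>

lemma jump_eq_space:
  "jump g a s t = (LINT r|lborel. indicator {0<..<s} r * (indicator {a<..} r * ((g1 (t + (r - a)) - g1 (t - (r - a))) / 2)))"
  "integrable lborel (\<lambda>r. indicator {0<..<s} r * (indicator {a<..} r * ((g1 (t + (r - a)) - g1 (t - (r - a))) / 2)))"
proof -
  define m where "m = max 0 (s - a)"
  have m: "0 \<le> m" by (simp add: m_def)
  define c where "c x = (g1 (t + 1 * x) - g1 (t + (-1) * x)) / 2" for x
  have i1: "integrable lborel (\<lambda>x. indicator {0<..<m} x * g1 (t + 1 * x))"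
    by (intro integrable_indicator lborel_integrable_real_affine g1_int) auto
  have i2: "integrable lborel (\<lambda>x. indicator {0<..<m} x * g1 (t + (-1) * x))"
    by (intro integrable_indicator lborel_integrable_real_affine g1_int) auto
  have eq: "indicator {0<..<m} x * c x = (indicator {0<..<m} x * g1 (t + 1 * x) - indicator {0<..<m} x * g1 (t + (-1) * x)) / 2" for x
    by (simp add: c_def right_diff_distrib)
  have ic: "integrable lborel (\<lambda>x. indicator {0<..<m} x * c x)"
    unfolding eq by (intro integrable_divide Bochner_Integration.integrable_diff i1 i2)
  have conv: "indicator {0<..<s} r * (indicator {a<..} r * ((g1 (t + (r - a)) - g1 (t - (r - a))) / 2))
     = indicator {0<..<m} (- a + 1 * r) * c (- a + 1 * r)" for r
  proof -
    have "c (- a + 1 * r) = (g1 (t + (r - a)) - g1 (t - (r - a))) / 2"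
      unfolding c_def by (intro arg_cong2[where f="\<lambda>x y. (g1 x - g1 y) / 2"]) auto
    then show ?thesis using a_nonneg by (auto simp: indicator_def m_def)
  qed
  have "jump g a s t = (1 * (prim g1 (t + 1 * m) - prim g1 t) - (-1) * (prim g1 (t + (-1) * m) - prim g1 t)) / 2"
  proof -
    have "jump g a s t = ((g (t + m) - g t) + (g (t - m) - g t)) / 2"
      unfolding jump_def m_def[symmetric] by (simp add: field_simps)
    then show ?thesis unfolding g_diff by simp
  qed
  also have "\<dots> = (LINT x|lborel. indicator {0<..<m} x * c x)"
    unfolding eq by (subst (1 2) prim_shift_diff[OF g1_int m]) (use i1 i2 in simp_all)
  also have "\<dots> = (LINT r|lborel. indicator {0<..<m} (- a + 1 * r) * c (- a + 1 * r))"
    by (subst lborel_integral_real_affine[where c=1 and t="-a"]) auto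
  finally show "jump g a s t = (LINT r|lborel. indicator {0<..<s} r * (indicator {a<..} r * ((g1 (t + (r - a)) - g1 (t - (r - a))) / 2)))"
    unfolding conv .
  show "integrable lborel (\<lambda>r. indicator {0<..<s} r * (indicator {a<..} r * ((g1 (t + (r - a)) - g1 (t - (r - a))) / 2)))"
    unfolding conv by (rule lborel_integrable_real_affine[OF ic]) simp
qed

text \<open>The jump at \<open>a\<close> has been removed from \<open>Y\<close>, so \<open>Y\<close>
  is a primitive of the slope right through \<open>a\<close>; for \<open>U\<close> this would take a
  point mass at \<open>a\<close>.\<close>

lemma Y_space:
  assumes s: "0 \<le> s"
  shows "Y (s, t) = (LINT r|lborel. indicator {0<..<s} r * slope r t)"
    and "integrable lborel (\<lambda>r. indicator {0<..<s} r * slope r t)"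
proof -
  note i = jump_eq_space(2)[of s t] half_diff_eq(2)[OF p_int s, of t] duhamel_eq_space(2)[OF U_w s, of t]
  have eq: "indicator {0<..<s} r * slope r t
    = indicator {0<..<s} r * (indicator {a<..} r * ((g1 (t + (r - a)) - g1 (t - (r - a))) / 2))
    + indicator {0<..<s} r * ((p (t + r) + p (t - r)) / 2)
    + indicator {0<..<s} r * ((transp Q U 1 r t + transp Q U (-1) r t) / 2)" for r
    by (simp add: slope_def ray_def field_simps)
  show "integrable lborel (\<lambda>r. indicator {0<..<s} r * slope r t)"
    unfolding eq by (intro Bochner_Integration.integrable_add i)
  show "Y (s, t) = (LINT r|lborel. indicator {0<..<s} r * slope r t)"
    unfolding eq Y_eq jump_eq_space(1)[of s t] half_diff_eq(1)[OF p_int s, of t] duhamel_eq_space(1)[OF U_w s, of t]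
    by (simp only: Bochner_Integration.integral_add Bochner_Integration.integrable_add i)
qed

text \<open>In time the jump has to be put back. For \<open>s > a\<close> the sum of
  \<open>jump\<close> and \<open>g\<close> is the mean of two translates of \<open>g\<close>, and
  its time derivative is the mean of the translates of \<open>g1\<close> that occurs in
  \<open>vel\<close>.\<close>

lemma U_time:
  assumes s: "0 \<le> s"
  shows "U (s, t) = U (s, 0) + (prim (vel s) t - prim (vel s) 0)"
proof -
  have e: "(1::real) \<in> {1,-1}" "(-1::real) \<in> {1,-1}" by auto
  define h where "h x = (p (x + s) - p (x + (- s))) / 2" for x
  define j where "j x = indicator {a<..} s * ((g1 (x + (s - a)) + g1 (x + (- (s - a)))) / 2)" for x
  define d where "d x = (transp Q U 1 s x - transp Q U (-1) s x) / 2" for x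
  have sp: "integrable lborel (\<lambda>x. f (x + c))" if "integrable lborel f" for f :: "real \<Rightarrow> real" and c
    using lborel_integrable_real_affine[OF that, of 1 c] by (simp add: add.commute)
  have ih: "integrable lborel h" unfolding h_def by (intro integrable_divide Bochner_Integration.integrable_diff sp p_int)
  have ij: "integrable lborel j" unfolding j_def
    by (intro integrable_mult_right integrable_divide Bochner_Integration.integrable_add sp g1_int)
  have id: "integrable lborel d" unfolding d_def
    by (intro integrable_divide Bochner_Integration.integrable_diff transp_time_integrable[OF U_w] e s)
  have v: "vel s = (\<lambda>x. (h x + j x) + d x)"
    by (auto simp: vel_def ray_def h_def j_def d_def fun_eq_iff field_simps)
  have pv: "prim (vel s) x = prim h x + prim j x + prim d x" for x
    unfolding v by (simp add: prim_add ih ij id)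
  have ph: "prim h x = half_diff p s x" for x
  proof -
    have "h = (\<lambda>x. (1/2) * (p (x + s) - p (x + (- s))))" by (simp add: h_def fun_eq_iff)
    then show ?thesis
      by (simp only: prim_cmult prim_diff_fun[OF sp[OF p_int] sp[OF p_int]] prim_shift half_diff_def) simp
  qed
  have pj: "prim j x = indicator {a<..} s * ((prim g1 (x + (s - a)) + prim g1 (x + (- (s - a)))) / 2)" for x
  proof -
    have "j = (\<lambda>x. (indicator {a<..} s / 2) * (g1 (x + (s - a)) + g1 (x + (- (s - a)))))" by (simp add: j_def fun_eq_iff)
    then show ?thesis
      by (simp only: prim_cmult prim_add[OF sp[OF g1_int] sp[OF g1_int]] prim_shift) (simp only: times_divide_eq_left times_divide_eq_right)?
  qed
  have pd: "prim d x = duhamel Q U s x" for x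
    unfolding duhamel_eq_time[OF U_w s] d_def ..

  have jj: "jump g a s t + indicator {a<..} s * g t - (jump g a s 0 + indicator {a<..} s * g 0) = prim j t - prim j 0"
  proof (cases "a < s")
    case True
    have "jump g a s t + g t - (jump g a s 0 + g 0)
      = ((g (t + (s - a)) - g (0 + (s - a))) + (g (t + (- (s - a))) - g (0 + (- (s - a))))) / 2"
      using True by (simp add: jump_def field_simps)
    also have "\<dots> = prim j t - prim j 0" unfolding g_diff pj using True by (simp add: field_simps)
    finally show ?thesis using True by simp
  next
    case False
    then show ?thesis by (simp add: pj jump_def)
  qed
  have yt: "Y (s, x) = jump g a s x + prim h x + prim d x" for x
    unfolding ph pd by (rule Y_eq)
  have "U (s, t) - U (s, 0) = Y (s, t) - Y (s, 0) + indicator {a<..} s * g t - indicator {a<..} s * g 0"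
    by (simp add: with_jump_def)
  also have "\<dots> = prim (vel s) t - prim (vel s) 0"
    unfolding yt pv using jj by simp
  finally show ?thesis by simp
qed

lemma ray_pairing:
  assumes e: "e \<in> {1,-1}" and s: "0 \<le> s" and h: "h \<in> borel_measurable borel" and hb: "\<And>t. \<bar>h t\<bar> \<le> M"
  shows "(LINT t|lborel. ray e s t * h t) = (LINT t|lborel. p (t + e * s) * h t)
    + e * (indicator {a<..} s * (LINT t|lborel. g1 (t + e * (s - a)) * h t)) + (LINT t|lborel. transp Q U e s t * h t)"
proof -
  have i1: "integrable lborel (\<lambda>t. p (t + e * s))" "integrable lborel (\<lambda>t. g1 (t + e * (s - a)))"
    using lborel_integrable_real_affine[OF p_int, of 1 "e * s"] lborel_integrable_real_affine[OF g1_int, of 1 "e * (s - a)"]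
    by (simp_all add: add.commute)
  note I = integrable_mult_bounded[OF i1(1) h hb] integrable_mult_bounded[OF i1(2) h hb] integrable_mult_bounded[OF transp_time_integrable[OF U_w e s] h hb]
  have eq: "ray e s t * h t = p (t + e * s) * h t + (e * indicator {a<..} s) * (g1 (t + e * (s - a)) * h t) + transp Q U e s t * h t" for t
    by (simp add: ray_def algebra_simps)
  show ?thesis unfolding eq using I by simp
qed

text \<open>Half the sum over \<open>e\<close> of the one-way equations for the three terms of
  \<open>ray e\<close>. The result is the wave equation \<open>U_ss = Q U + U_tt\<close>, tested in
  time against \<open>prim k\<close> and integrated in \<open>s\<close>.\<close>

lemma slope_weak:
  assumes s: "0 \<le> s" and k: "integrable lborel k" and kb: "\<And>x. \<bar>k x\<bar> \<le> M"
  shows "(LINT t|lborel. slope s t * prim k t) = (LINT t|lborel. p t * prim k t)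
      + (LINT r|lborel. indicator {0<..<s} r * (Q r * (LINT t|lborel. U (r, t) * prim k t) - (LINT t|lborel. vel r t * k t)))"
    and "integrable lborel (\<lambda>r. indicator {0<..<s} r * (Q r * (LINT t|lborel. U (r, t) * prim k t) - (LINT t|lborel. vel r t * k t)))"
proof -
  have e: "(1::real) \<in> {1,-1}" "(-1::real) \<in> {1,-1}" by auto
  have pk: "prim k \<in> borel_measurable borel"
    using prim_continuous[OF k] by (rule borel_measurable_continuous_onI)
  have km: "k \<in> borel_measurable borel" using borel_measurable_integrable[OF k] by simp
  note pb = prim_bound[OF k]
  define I :: "real \<Rightarrow> real" where "I r = indicator {0<..<s} r" for r
  define P where "P e r = (LINT t|lborel. p (t + e * r) * k t)" for e r
  define J where "J e r = indicator {a<..} r * (LINT t|lborel. g1 (t + e * (r - a)) * k t)" for e r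
  define D where "D e r = (LINT t|lborel. transp Q U e r t * k t)" for e r
  define V where "V r = Q r * (LINT t|lborel. U (r, t) * prim k t)" for r
  have iP: "integrable lborel (\<lambda>r. I r * P e r)" if "e \<in> {1,-1}" for e
    unfolding I_def P_def by (rule shift_test(2)[OF p_int k kb s that])
  have iD: "integrable lborel (\<lambda>r. I r * D e r)" if "e \<in> {1,-1}" for e
    unfolding I_def D_def by (rule transp_weak(3)[OF U_w that s k kb])
  have iV: "integrable lborel (\<lambda>r. I r * V r)"
    unfolding I_def V_def by (rule transp_weak(2)[OF U_w e(1) s k kb])
  define m where "m = max 0 (s - a)"
  have m: "0 \<le> m" by (simp add: m_def)
  have J_conv: "I r * J e r = indicator {0<..<m} (- a + 1 * r) * (LINT t|lborel. g1 (t + e * (- a + 1 * r)) * k t)" for e r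
    using a_nonneg by (auto simp: I_def J_def indicator_def m_def algebra_simps)
  have iJ: "integrable lborel (\<lambda>r. I r * J e r)" if "e \<in> {1,-1}" for e
    unfolding J_conv by (rule lborel_integrable_real_affine[OF shift_test(2)[OF g1_int k kb m that]]) simp
  have J_int: "(LINT r|lborel. I r * J e r) = (LINT x|lborel. indicator {0<..<m} x * (LINT t|lborel. g1 (t + e * x) * k t))" for e
    unfolding J_conv by (subst (2) lborel_integral_real_affine[where c=1 and t="-a"]) auto
  have rp: "(LINT t|lborel. ray e r t * k t) = P e r + e * J e r + D e r" if "e \<in> {1,-1}" "0 \<le> r" for e r
    unfolding P_def J_def D_def by (rule ray_pairing[OF that km kb])
  \<comment> \<open>The third term on the right comes from the jump at \<open>a\<close>. It is odd
    in \<open>e\<close> and cancels in the sum over \<open>e\<close>, which is why the slope does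
    not jump.\<close>
  have main: "(LINT t|lborel. ray e s t * prim k t) = (LINT t|lborel. p t * prim k t) - e * (LINT r|lborel. I r * P e r)
      + e * (indicator {a<..} s * (LINT t|lborel. g1 t * prim k t)) - (LINT r|lborel. I r * J e r)
      + (LINT r|lborel. I r * V r) - e * (LINT r|lborel. I r * D e r)" if e: "e \<in> {1,-1}" for e
  proof -
    have 1: "(LINT t|lborel. p (t + e * s) * prim k t) = (LINT t|lborel. p t * prim k t) - e * (LINT r|lborel. I r * P e r)"
      unfolding I_def P_def by (rule shift_test(1)[OF p_int k kb s e])
    have 2: "e * (indicator {a<..} s * (LINT t|lborel. g1 (t + e * (s - a)) * prim k t))
      = e * (indicator {a<..} s * (LINT t|lborel. g1 t * prim k t)) - (LINT r|lborel. I r * J e r)"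
    proof (cases "a < s")
      case True
      then have ms: "m = s - a" by (simp add: m_def)
      have ee: "e * (e * x) = x" for x using e by auto
      show ?thesis unfolding J_int using shift_test(1)[OF g1_int k kb m e] True
        by (simp add: ms right_diff_distrib ee)
    next
      case False
      then have "m = 0" by (simp add: m_def)
      then show ?thesis unfolding J_int using False by simp
    qed
    have 3: "(LINT t|lborel. transp Q U e s t * prim k t) = (LINT r|lborel. I r * V r) - e * (LINT r|lborel. I r * D e r)"
      unfolding I_def V_def D_def by (rule transp_weak(1)[OF U_w e s k kb])
    show ?thesis unfolding ray_pairing[OF e s pk pb] 1 2 3 by simp
  qed
  have vp: "(LINT t|lborel. vel r t * k t) = ((P 1 r + J 1 r + D 1 r) - (P (-1) r - J (-1) r + D (-1) r)) / 2" if r: "0 \<le> r" for r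
  proof -
    have "(LINT t|lborel. vel r t * k t) = (LINT t|lborel. (ray 1 r t * k t - ray (-1) r t * k t) / 2)"
      by (intro Bochner_Integration.integral_cong refl) (simp add: vel_def left_diff_distrib)
    also have "\<dots> = ((LINT t|lborel. ray 1 r t * k t) - (LINT t|lborel. ray (-1) r t * k t)) / 2"
      using integrable_mult_bounded[OF ray_integrable[OF e(1) r] km kb] integrable_mult_bounded[OF ray_integrable[OF e(2) r] km kb] by simp
    finally show ?thesis unfolding rp[OF e(1) r] rp[OF e(2) r] by simp
  qed
  have sp: "(LINT t|lborel. slope s t * prim k t) = ((LINT t|lborel. ray 1 s t * prim k t) + (LINT t|lborel. ray (-1) s t * prim k t)) / 2"
  proof -
    have "(LINT t|lborel. slope s t * prim k t) = (LINT t|lborel. (ray 1 s t * prim k t + ray (-1) s t * prim k t) / 2)"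
      by (intro Bochner_Integration.integral_cong refl) (simp add: slope_def distrib_right)
    then show ?thesis
      using integrable_mult_bounded[OF ray_integrable[OF e(1) s] pk pb] integrable_mult_bounded[OF ray_integrable[OF e(2) s] pk pb] by simp
  qed
  have integrand: "indicator {0<..<s} r * (Q r * (LINT t|lborel. U (r, t) * prim k t) - (LINT t|lborel. vel r t * k t))
     = I r * V r - (I r * P 1 r + I r * J 1 r + I r * D 1 r - (I r * P (-1) r - I r * J (-1) r + I r * D (-1) r)) / 2" for r
  proof (cases "r \<in> {0<..<s}")
    case True
    then show ?thesis using vp[of r] by (simp add: I_def V_def)
  qed (simp add: I_def)
  note ii = iP[OF e(1)] iP[OF e(2)] iJ[OF e(1)] iJ[OF e(2)] iD[OF e(1)] iD[OF e(2)] iV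
  show "integrable lborel (\<lambda>r. indicator {0<..<s} r * (Q r * (LINT t|lborel. U (r, t) * prim k t) - (LINT t|lborel. vel r t * k t)))"
    unfolding integrand by (intro Bochner_Integration.integrable_diff Bochner_Integration.integrable_add integrable_divide ii)
  have "(LINT r|lborel. indicator {0<..<s} r * (Q r * (LINT t|lborel. U (r, t) * prim k t) - (LINT t|lborel. vel r t * k t)))
    = (LINT r|lborel. I r * V r) - ((LINT r|lborel. I r * P 1 r) + (LINT r|lborel. I r * J 1 r) + (LINT r|lborel. I r * D 1 r)
      - ((LINT r|lborel. I r * P (-1) r) - (LINT r|lborel. I r * J (-1) r) + (LINT r|lborel. I r * D (-1) r))) / 2"
    unfolding integrand using ii by simp
  then show "(LINT t|lborel. slope s t * prim k t) = (LINT t|lborel. p t * prim k t)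
      + (LINT r|lborel. indicator {0<..<s} r * (Q r * (LINT t|lborel. U (r, t) * prim k t) - (LINT t|lborel. vel r t * k t)))"
    unfolding sp main[OF e(1)] main[OF e(2)] by (simp add: field_simps)
qed

section \<open>Slope and velocity as square integrable functions of space, continuous in
  time\<close>

lemma ray_space_square:
  assumes e: "e \<in> {1,-1}"
  shows "square_integrable (\<lambda>s. indicator {0<..<L} s * ray e s t)"
proof -
  have e0: "e \<noteq> 0" using e by auto
  have "square_integrable (\<lambda>s. indicator {0<..<L} s * (p (t + e * s) + (e * (indicator {a<..} s * g1 ((t - e * a) + e * s)))) + indicator {0<..<L} s * transp Q U e s t)"
    by (intro square_integrable_add square_integrable_indicator(1) square_integrable_cmult square_integrable_affine p_sq g1_sq transp_space_square[OF U_w e] e0) auto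
  then show ?thesis by (simp add: ray_def algebra_simps)
qed

lemma ray_tendsto:
  assumes e: "e \<in> {1,-1}"
  shows "((\<lambda>t. energy (\<lambda>s. indicator {0<..<L} s * (ray e s t - ray e s t0))) \<longlongrightarrow> 0) (at t0)"
proof -
  have e0: "e \<noteq> 0" using e by auto
  let ?f = "\<lambda>t s. p (t + e * (s - 0)) - p (t0 + e * (s - 0))"
  let ?h = "\<lambda>t s. g1 (t + e * (s - a)) - g1 (t0 + e * (s - a))"
  let ?k = "\<lambda>t s. indicator {0<..<L} s * (transp Q U e s t - transp Q U e s t0)"
  have aff: "square_integrable (\<lambda>s. f (t + e * (s - c)))" if "square_integrable f" for f t c
    using square_integrable_affine[OF that e0, of "t - e * c"] by (simp add: algebra_simps)
  have sf: "square_integrable (?f t)" for t by (intro square_integrable_diff aff p_sq)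
  have sh: "square_integrable (?h t)" for t by (intro square_integrable_diff aff g1_sq)
  have sk: "square_integrable (?k t)" for t
    using square_integrable_diff[OF transp_space_square[OF U_w e, of t] transp_space_square[OF U_w e, of t0]] by (simp add: right_diff_distrib)
  have le: "energy (\<lambda>s. indicator {0<..<L} s * (ray e s t - ray e s t0)) \<le> 4 * energy (?f t) + 4 * energy (?h t) + 2 * energy (?k t)" for t
  proof -
    let ?F = "\<lambda>s. indicator {0<..<L} s * ?f t s"
    let ?H = "\<lambda>s. e * (indicator {0<..<L} s * (indicator {a<..} s * ?h t s))"
    have SF: "square_integrable ?F" by (intro square_integrable_indicator(1) sf) auto
    have SH0: "square_integrable (\<lambda>s. indicator {a<..} s * ?h t s)" by (intro square_integrable_indicator(1) sh) auto
    have SH: "square_integrable ?H" by (intro square_integrable_cmult square_integrable_indicator(1) SH0) auto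
    have "energy ?H = energy (\<lambda>s. indicator {0<..<L} s * (indicator {a<..} s * ?h t s))" unfolding energy_cmult using e by auto
    also have "\<dots> \<le> energy (\<lambda>s. indicator {a<..} s * ?h t s)" by (rule square_integrable_indicator(2)[OF SH0]) auto
    also have "\<dots> \<le> energy (?h t)" by (rule square_integrable_indicator(2)[OF sh]) auto
    finally have EH: "energy ?H \<le> energy (?h t)" .
    have EF: "energy ?F \<le> energy (?f t)" by (rule square_integrable_indicator(2)[OF sf]) auto
    have "(\<lambda>s. indicator {0<..<L} s * (ray e s t - ray e s t0)) = (\<lambda>s. (?F s + ?H s) + ?k t s)"
      by (simp add: ray_def fun_eq_iff algebra_simps)
    then have "energy (\<lambda>s. indicator {0<..<L} s * (ray e s t - ray e s t0)) = energy (\<lambda>s. (?F s + ?H s) + ?k t s)" by (simp only:)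
    also have "\<dots> \<le> 2 * energy (\<lambda>s. ?F s + ?H s) + 2 * energy (?k t)"
      by (rule energy_add_le[OF square_integrable_add[OF SF SH] sk])
    also have "\<dots> \<le> 2 * (2 * energy ?F + 2 * energy ?H) + 2 * energy (?k t)"
      using energy_add_le[OF SF SH] by simp
    finally show ?thesis using EF EH by simp
  qed
  have "((\<lambda>t. 4 * energy (?f t) + 4 * energy (?h t) + 2 * energy (?k t)) \<longlongrightarrow> 4 * 0 + 4 * 0 + 2 * 0) (at t0)"
    by (intro tendsto_intros energy_translation_tendsto[OF p_sq e] energy_translation_tendsto[OF g1_sq e] transp_space_tendsto[OF U_w e U_cont])
  then have lim: "((\<lambda>t. 4 * energy (?f t) + 4 * energy (?h t) + 2 * energy (?k t)) \<longlongrightarrow> 0) (at t0)" by simp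
  show ?thesis
    by (rule tendsto_sandwich[OF _ _ tendsto_const lim]) (use le in auto)
qed

lemma
  shows slope_space_square: "square_integrable (\<lambda>s. indicator {0<..<L} s * slope s t)"
    and vel_space_square: "square_integrable (\<lambda>s. indicator {0<..<L} s * vel s t)"
    and slope_tendsto: "((\<lambda>t. energy (\<lambda>s. indicator {0<..<L} s * (slope s t - slope s t0))) \<longlongrightarrow> 0) (at t0)"
    and vel_tendsto: "((\<lambda>t. energy (\<lambda>s. indicator {0<..<L} s * (vel s t - vel s t0))) \<longlongrightarrow> 0) (at t0)"
proof -
  have e: "(1::real) \<in> {1,-1}" "(-1::real) \<in> {1,-1}" by auto
  note S = ray_space_square[OF e(1)] ray_space_square[OF e(2)]
  have "square_integrable (\<lambda>s. (1/2) * (indicator {0<..<L} s * ray 1 s t + indicator {0<..<L} s * ray (-1) s t))"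
    by (intro square_integrable_cmult square_integrable_add S)
  then show "square_integrable (\<lambda>s. indicator {0<..<L} s * slope s t)"
    by (rule back_subst[where P=square_integrable]) (simp add: slope_def fun_eq_iff field_simps)
  have "square_integrable (\<lambda>s. (1/2) * (indicator {0<..<L} s * ray 1 s t - indicator {0<..<L} s * ray (-1) s t))"
    by (intro square_integrable_cmult square_integrable_diff S)
  then show "square_integrable (\<lambda>s. indicator {0<..<L} s * vel s t)"
    by (rule back_subst[where P=square_integrable]) (simp add: vel_def fun_eq_iff field_simps)
  let ?d = "\<lambda>e t s. indicator {0<..<L} s * (ray e s t - ray e s t0)"
  have d: "square_integrable (?d e t)" if "e \<in> {1,-1}" for e t
    using square_integrable_diff[OF ray_space_square[OF that, of t] ray_space_square[OF that, of t0]] by (simp add: right_diff_distrib)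
  have "((\<lambda>t. (1/2)\<^sup>2 * (2 * energy (?d 1 t) + 2 * energy (?d (-1) t))) \<longlongrightarrow> (1/2)\<^sup>2 * (2 * 0 + 2 * 0)) (at t0)"
    by (intro tendsto_intros ray_tendsto e)
  then have lim: "((\<lambda>t. (1/2)\<^sup>2 * (2 * energy (?d 1 t) + 2 * energy (?d (-1) t))) \<longlongrightarrow> 0) (at t0)" by simp
  have 1: "energy (\<lambda>s. indicator {0<..<L} s * (slope s t - slope s t0)) \<le> (1/2)\<^sup>2 * (2 * energy (?d 1 t) + 2 * energy (?d (-1) t))" for t
  proof -
    have "energy (\<lambda>s. indicator {0<..<L} s * (slope s t - slope s t0)) = energy (\<lambda>s. (1/2) * (?d 1 t s + ?d (-1) t s))"
      by (rule arg_cong[where f=energy]) (simp add: slope_def fun_eq_iff field_simps)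
    also have "\<dots> \<le> (1/2)\<^sup>2 * (2 * energy (?d 1 t) + 2 * energy (?d (-1) t))"
      unfolding energy_cmult by (intro mult_left_mono energy_add_le d e) auto
    finally show ?thesis .
  qed
  show "((\<lambda>t. energy (\<lambda>s. indicator {0<..<L} s * (slope s t - slope s t0))) \<longlongrightarrow> 0) (at t0)"
    by (rule tendsto_sandwich[OF _ _ tendsto_const lim]) (use 1 in auto)
  have 2: "energy (\<lambda>s. indicator {0<..<L} s * (vel s t - vel s t0)) \<le> (1/2)\<^sup>2 * (2 * energy (?d 1 t) + 2 * energy (?d (-1) t))" for t
  proof -
    have "energy (\<lambda>s. indicator {0<..<L} s * (vel s t - vel s t0)) = energy (\<lambda>s. (1/2) * (?d 1 t s - ?d (-1) t s))"
      by (rule arg_cong[where f=energy]) (simp add: vel_def fun_eq_iff field_simps)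
    also have "\<dots> \<le> (1/2)\<^sup>2 * (2 * energy (?d 1 t) + 2 * energy (?d (-1) t))"
      unfolding energy_cmult by (intro mult_left_mono energy_diff_le d e) auto
    finally show ?thesis .
  qed
  show "((\<lambda>t. energy (\<lambda>s. indicator {0<..<L} s * (vel s t - vel s t0))) \<longlongrightarrow> 0) (at t0)"
    by (rule tendsto_sandwich[OF _ _ tendsto_const lim]) (use 2 in auto)
qed

end

subsection \<open>Borel representatives and absolutely continuous functions\<close>

text \<open>Turns set integrals for \<open>lebesgue\<close> into integrals of Borel functions for
  \<open>lborel\<close>, where Fubini and affine substitutions are at hand.\<close>

lemma
  fixes f F :: "real \<Rightarrow> real"
  assumes F: "F \<in> borel_measurable borel" and ae: "AE x in lebesgue. indicator A x *\<^sub>R f x = F x"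
  shows set_integrable_lebesgue_iff: "set_integrable lebesgue A f \<longleftrightarrow> integrable lborel F"
    and set_integral_lebesgue_eq: "(LINT x:A|lebesgue. f x) = (LINT x|lborel. F x)"
    and set_measurable_lebesgue: "set_borel_measurable lebesgue A f"
proof -
  have Fl: "F \<in> borel_measurable lebesgue"
    by (rule measurable_completion) (use F in simp)
  have G: "(\<lambda>x. indicator A x *\<^sub>R f x) \<in> borel_measurable lebesgue"
    by (rule borel_measurable_AE[OF Fl]) (use ae in \<open>auto simp: eq_commute\<close>)
  then show "set_borel_measurable lebesgue A f" by (simp add: set_borel_measurable_def)
  have Fb: "F \<in> borel_measurable lborel" using F by simp
  show "set_integrable lebesgue A f \<longleftrightarrow> integrable lborel F"
    unfolding set_integrable_def integrable_cong_AE[OF G Fl ae] by (rule integrable_completion[OF Fb])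
  show "(LINT x:A|lebesgue. f x) = (LINT x|lborel. F x)"
    unfolding set_lebesgue_integral_def integral_cong_AE[OF G Fl ae] by (rule integral_completion[OF Fb])
qed

text \<open>Functions on an edge are Lebesgue measurable and arbitrary off the interval. A Borel
  representative that is zero off the open interval can be integrated, translated and reflected on
  the whole line, so that several edges can be laid along one string.\<close>

definition interval_rep :: "real \<Rightarrow> (real \<Rightarrow> real) \<Rightarrow> (real \<Rightarrow> real) \<Rightarrow> bool" where
  "interval_rep l f h \<longleftrightarrow> h \<in> borel_measurable borel \<and> (\<forall>x. x \<notin> {0<..<l} \<longrightarrow> h x = 0) \<and>
     (AE x in lebesgue. x \<in> {0<..<l} \<longrightarrow> f x = h x)"

lemma interval_rep_measurable [measurable_dest]: "interval_rep l f h \<Longrightarrow> h \<in> borel_measurable borel"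
  by (simp add: interval_rep_def)

lemma interval_rep_zero: "interval_rep l f h \<Longrightarrow> x \<notin> {0<..<l} \<Longrightarrow> h x = 0"
  by (simp add: interval_rep_def)

lemma interval_rep_AE: "interval_rep l f h \<Longrightarrow> AE x in lebesgue. x \<in> {0<..<l} \<longrightarrow> f x = h x"
  by (simp add: interval_rep_def)

lemma interval_rep_indicator:
  assumes "(\<lambda>x. indicator {0<..<l} x * f x) \<in> borel_measurable borel"
  shows "interval_rep l f (\<lambda>x. indicator {0<..<l} x * f x)"
  using assms by (auto simp: interval_rep_def)

lemma interval_rep_self:
  assumes "h \<in> borel_measurable borel" "\<And>x. x \<notin> {0<..<l} \<Longrightarrow> h x = 0"
  shows "interval_rep l h h"
  using assms by (simp add: interval_rep_def)

lemma interval_rep_continuous: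
  assumes "continuous_on {0..l} f"
  shows "interval_rep l f (\<lambda>x. indicator {0<..<l} x * f x)"
proof (rule interval_rep_indicator)
  have "(\<lambda>x. indicator {0<..<l} x *\<^sub>R f x) \<in> borel_measurable borel"
    by (rule borel_measurable_continuous_on_indicator) (auto intro: continuous_on_subset[OF assms])
  then show "(\<lambda>x. indicator {0<..<l} x * f x) \<in> borel_measurable borel" by simp
qed

lemma interval_rep_pairing:
  assumes "interval_rep l f h" "interval_rep l f' h'"
  shows "(LINT x:{0<..<l}|lebesgue. f x * f' x) = (LINT x|lborel. h x * h' x)"
proof (rule set_integral_lebesgue_eq)
  show "(\<lambda>x. h x * h' x) \<in> borel_measurable borel"
    using assms[THEN interval_rep_measurable] by measurable
  show "AE x in lebesgue. indicator {0<..<l} x *\<^sub>R (f x * f' x) = h x * h' x"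
    using interval_rep_AE[OF assms(1)] interval_rep_AE[OF assms(2)]
  proof eventually_elim
    case (elim x)
    then show ?case using interval_rep_zero[OF assms(1), of x] by (cases "x \<in> {0<..<l}") auto
  qed
qed

lemma
  assumes "interval_rep l f h"
  shows L2_space_rep: "f \<in> L2_space l \<longleftrightarrow> square_integrable h"
    and L2_norm_rep: "L2_norm l f = sqrt (energy h)"
proof -
  note m = interval_rep_measurable[OF assms]
  have ae: "AE x in lebesgue. indicator {0<..<l} x *\<^sub>R f x = h x"
    using interval_rep_AE[OF assms]
    by eventually_elim (use interval_rep_zero[OF assms] in \<open>auto simp: indicator_def\<close>)
  have ae2: "AE x in lebesgue. indicator {0<..<l} x *\<^sub>R (f x)\<^sup>2 = (h x)\<^sup>2"
    using interval_rep_AE[OF assms]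
    by eventually_elim (use interval_rep_zero[OF assms] in \<open>auto simp: indicator_def\<close>)
  have m2: "(\<lambda>x. (h x)\<^sup>2) \<in> borel_measurable borel" using m by measurable
  show "f \<in> L2_space l \<longleftrightarrow> square_integrable h"
    using set_measurable_lebesgue[OF m ae] set_integrable_lebesgue_iff[OF m2 ae2] m
    by (simp add: L2_space_def square_integrable_def)
  show "L2_norm l f = sqrt (energy h)"
    unfolding L2_norm_def energy_def set_integral_lebesgue_eq[OF m2 ae2] ..
qed

lemma L2_space_obtain:
  assumes "f \<in> L2_space l"
  obtains h where "interval_rep l f h" "square_integrable h"
proof -
  have "(\<lambda>x. indicator {0<..<l} x *\<^sub>R f x) \<in> borel_measurable (completion lborel)"
    using assms by (simp add: L2_space_def set_borel_measurable_def)
  then obtain h where h: "h \<in> borel_measurable lborel" "AE x in lborel. indicator {0<..<l} x *\<^sub>R f x = h x"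
    using completion_ex_borel_measurable_real by blast
  have hb [measurable]: "h \<in> borel_measurable borel" using h(1) by simp
  have "interval_rep l f (\<lambda>x. indicator {0<..<l} x * h x)"
    unfolding interval_rep_def
  proof (intro conjI allI impI)
    show "(\<lambda>x. indicator {0<..<l} x * h x) \<in> borel_measurable borel" by measurable
    show "AE x in lebesgue. x \<in> {0<..<l} \<longrightarrow> f x = indicator {0<..<l} x * h x"
      using AE_completion[OF h(2)] by eventually_elim auto
  qed auto
  with L2_space_rep[OF this] assms that show ?thesis by blast
qed

section \<open>Test functions, and functions with a weak derivative as primitives\<close>

lemma prim_has_derivative:
  assumes k: "integrable lborel k" and c: "continuous_on UNIV k"
  shows "(prim k has_real_derivative k x) (at x)"
proof -
  define a where "a = x - 1" define b where "b = x + 1"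
  have ab: "a < x" "x < b" by (auto simp: a_def b_def)
  have cab: "continuous_on {a..b} k" by (rule continuous_on_subset[OF c]) simp
  have eq: "prim k y = prim k a + integral {a..y} k" if "y \<in> {a..b}" for y
  proof -
    have "set_integrable lborel {a..y} k"
      unfolding set_integrable_def using integrable_indicator[OF k, of "{a..y}"] by simp
    then have "integral {a..y} k = (LINT x:{a..y}|lborel. k x)" by (rule set_borel_integral_eq_integral(2)[symmetric])
    also have "\<dots> = (LINT x|lborel. indicator {a<..y} x * k x)"
      unfolding set_lebesgue_integral_def
    proof (rule integral_cong_AE)
      show "AE z in lborel. indicator {a..y} z *\<^sub>R k z = indicator {a<..y} z * k z"
        using AE_lborel_neq[of a] by eventually_elim (auto simp: indicator_def)
    qed (use k in measurable)
    also have "\<dots> = prim k y - prim k a" using that by (intro prim_diff[OF k, symmetric]) auto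
    finally show ?thesis by simp
  qed
  have "((\<lambda>y. prim k a + integral {a..y} k) has_real_derivative (0 + k x)) (at x within {a..b})"
    by (intro DERIV_add DERIV_const integral_has_real_derivative cab) (use ab in auto)
  then have "((\<lambda>y. prim k a + integral {a..y} k) has_real_derivative k x) (at x)"
    using ab by (simp add: at_within_Icc_at)
  moreover have "\<forall>\<^sub>F y in nhds x. prim k y = prim k a + integral {a..y} k"
    using eventually_nhds_in_open[of "{a<..<b}" x] ab by (auto elim!: eventually_mono intro!: eq)
  ultimately show ?thesis by (subst DERIV_cong_ev[OF refl _ refl]) auto
qed

lemma continuous_interval_bounded:
  fixes f :: "real \<Rightarrow> real"
  assumes "continuous_on {a..b} f"
  shows "\<exists>M. \<forall>x\<in>{a..b}. \<bar>f x\<bar> \<le> M"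
  using compact_imp_bounded[OF compact_continuous_image[OF assms compact_Icc]]
  by (auto simp: bounded_iff)

text \<open>Every identity tested in time is stated for \<open>prim k\<close>; this brings the test
  functions of the weak formulation into that form, together with the support of
  \<open>k\<close>.\<close>

lemma test_function_prim:
  assumes "test_function l \<psi>"
  obtains k a b where "deriv \<psi> = k" "\<psi> = prim k" "integrable lborel k" "square_integrable k"
    "0 < a" "b < l" "\<And>x. x \<notin> {a..b} \<Longrightarrow> \<psi> x = 0" "\<And>x. x \<notin> {a..b} \<Longrightarrow> k x = 0"
    "continuous_on UNIV k"
proof -
  obtain a b where ab: "0 < a" "b < l" "\<And>x. x \<notin> {a..b} \<Longrightarrow> \<psi> x = 0"
    using assms unfolding test_function_def by blast
  have d: "(\<psi> has_real_derivative deriv \<psi> x) (at x)" for x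
    using assms unfolding test_function_def by (simp add: DERIV_deriv_iff_real_differentiable)
  have c: "continuous_on UNIV (deriv \<psi>)" using assms by (simp add: test_function_def)
  have P: "integrable lborel (deriv \<psi>)" "\<psi> = prim (deriv \<psi>)" "x \<notin> {a..b} \<Longrightarrow> deriv \<psi> x = 0" for x
    using prim_deriv[of \<psi> "deriv \<psi>" a b] d c ab(3) by blast+
  obtain M where M: "\<And>x. x \<in> {a..b} \<Longrightarrow> \<bar>deriv \<psi> x\<bar> \<le> M"
    using continuous_interval_bounded[OF continuous_on_subset[OF c], of a b] by blast
  have sq: "square_integrable (deriv \<psi>)"
  proof (rule square_integrable_bounded_support(1)[where K="max 0 M" and a=a and b=b])
    show "deriv \<psi> \<in> borel_measurable borel" using P(1) by (auto dest: borel_measurable_integrable)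
    show "\<bar>deriv \<psi> x\<bar> \<le> max 0 M" for x using M[of x] P(3)[of x] by (cases "x \<in> {a..b}") auto
  qed (rule P(3))
  show ?thesis
  proof (rule that[of "deriv \<psi>" a b])
    show "deriv \<psi> = deriv \<psi>" ..
    show "\<psi> = prim (deriv \<psi>)" by (rule P(2))
    show "integrable lborel (deriv \<psi>)" by (rule P(1))
    show "square_integrable (deriv \<psi>)" by (rule sq)
    show "0 < a" "b < l" by (rule ab)+
    show "\<psi> x = 0" if "x \<notin> {a..b}" for x by (rule ab(3)[OF that])
    show "deriv \<psi> x = 0" if "x \<notin> {a..b}" for x by (rule P(3)[OF that])
    show "continuous_on UNIV (deriv \<psi>)" by (rule c)
  qed
qed

lemma test_function_bounded:
  assumes "continuous_on UNIV k" "\<And>x. x \<notin> {a..b} \<Longrightarrow> k x = (0::real)"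
  obtains M where "\<And>x::real. \<bar>k x\<bar> \<le> M"
proof -
  obtain M where M: "\<And>x. x \<in> {a..b} \<Longrightarrow> \<bar>k x\<bar> \<le> M"
    using continuous_interval_bounded[OF continuous_on_subset[OF assms(1)], of a b] by blast
  have "\<bar>k x\<bar> \<le> max 0 M" for x using M[of x] assms(2)[of x] by (cases "x \<in> {a..b}") auto
  then show ?thesis by (rule that)
qed

text \<open>The working form of membership in \<open>H1_space\<close>: absolute continuity on
  \<open>[0, l]\<close> with square integrable derivative \<open>h\<close>. As \<open>h\<close>
  vanishes off the interval, \<open>prim h\<close> starts at 0.\<close>

definition ac_rep :: "real \<Rightarrow> (real \<Rightarrow> real) \<Rightarrow> (real \<Rightarrow> real) \<Rightarrow> bool" where
  "ac_rep l f h \<longleftrightarrow> square_integrable h \<and> (\<forall>x. x \<notin> {0<..<l} \<longrightarrow> h x = 0) \<and>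
     (\<forall>x\<in>{0..l}. f x = f 0 + prim h x)"

lemma square_integrable_supported:
  assumes "square_integrable h" "\<And>x. x \<notin> {0<..<l} \<Longrightarrow> h x = 0"
  shows "integrable lborel h" "x \<le> 0 \<Longrightarrow> prim h x = 0"
proof -
  have "integrable lborel (\<lambda>x. indicator {0..l} x * h x)"
    by (rule square_integrable_on_interval[OF assms(1)]) auto
  moreover have "(\<lambda>x. indicator {0..l} x * h x) = h"
  proof
    fix x
    show "indicator {0..l} x * h x = h x"
      using assms(2)[of x] by (cases "x \<in> {0<..<l}") auto
  qed
  ultimately show i: "integrable lborel h" by simp
  show "prim h x = 0" if "x \<le> 0"
  proof -
    have "(\<lambda>y. indicator {..x} y * h y) = (\<lambda>y. 0)"
      using assms(2) that by (auto simp: fun_eq_iff indicator_def)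
    then show ?thesis by (simp add: prim_def)
  qed
qed

lemma ac_repD:
  assumes "ac_rep l f h"
  shows "square_integrable h" "\<And>x. x \<notin> {0<..<l} \<Longrightarrow> h x = 0" "\<And>x. x \<in> {0..l} \<Longrightarrow> f x = f 0 + prim h x"
    "integrable lborel h"
  using assms square_integrable_supported(1)[of h l] unfolding ac_rep_def by blast+

lemma ac_rep_continuous:
  assumes "ac_rep l f h"
  shows "continuous_on {0..l} f"
proof -
  have "continuous_on {0..l} (\<lambda>x. f 0 + prim h x)"
    by (intro continuous_intros continuous_on_subset[OF prim_continuous[OF ac_repD(4)[OF assms]]]) auto
  then show ?thesis by (rule continuous_on_eq) (rule ac_repD(3)[OF assms, symmetric])
qed

lemma continuous_interval_square:
  assumes "continuous_on {0..l} (f :: real \<Rightarrow> real)"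
  shows "square_integrable (\<lambda>x. indicator {0<..<l} x * f x)"
proof -
  obtain M where M: "\<And>x. x \<in> {0..l} \<Longrightarrow> \<bar>f x\<bar> \<le> M"
    using continuous_interval_bounded[OF assms] by blast
  show ?thesis
  proof (rule square_integrable_bounded_support(1)[where K="max 0 M" and a=0 and b=l])
    show "(\<lambda>x. indicator {0<..<l} x * f x) \<in> borel_measurable borel"
      using interval_rep_measurable[OF interval_rep_continuous[OF assms]] .
    show "\<bar>indicator {0<..<l} x * f x\<bar> \<le> max 0 M" for x
      using M[of x] by (cases "x \<in> {0<..<l}") auto
  qed auto
qed

lemma prim_total:
  assumes "integrable lborel h" "\<And>x. x \<notin> {0<..<l} \<Longrightarrow> h x = 0" "l \<le> x"
  shows "prim h x = (LINT y|lborel. h y)"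
  unfolding prim_def
  by (intro Bochner_Integration.integral_cong refl) (use assms in \<open>auto simp: indicator_def\<close>)

text \<open>The product rule \<open>prim_mult\<close> at \<open>l\<close>, where
  \<open>prim k\<close> vanishes, so that no boundary term remains.\<close>

lemma prim_pairing:
  assumes h: "integrable lborel h" and k: "integrable lborel k" and kl: "\<And>x. x \<notin> {0<..<l} \<Longrightarrow> k x = 0" "\<And>x. x \<notin> {0<..<l} \<Longrightarrow> prim k x = 0"
  shows "(LINT x|lborel. prim h x * k x) = - (LINT x|lborel. h x * prim k x)"
proof -
  let ?F = "\<lambda>y. prim h y * k y + h y * prim k y"
  have i1: "integrable lborel (\<lambda>y. prim h y * k y)" by (rule integrable_prim_mult[OF h k])
  have i2: "integrable lborel (\<lambda>y. h y * prim k y)" using integrable_prim_mult[OF k h] by (simp add: mult.commute)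
  have "0 = prim h l * prim k l" using kl(2)[of l] by simp
  also have "\<dots> = prim ?F l" by (rule prim_mult[OF h k])
  also have "\<dots> = (LINT y|lborel. ?F y)"
    by (rule prim_total) (use i1 i2 kl in auto)
  also have "\<dots> = (LINT x|lborel. prim h x * k x) + (LINT x|lborel. h x * prim k x)"
    using i1 i2 by simp
  finally show ?thesis by simp
qed

text \<open>The lemma of du Bois-Reymond: test with the primitive of \<open>chi (w - c)\<close>, where \<open>chi\<close> is a bump
  function and \<open>c\<close> the mean of \<open>w\<close> with respect to \<open>chi\<close>.\<close>

lemma weak_deriv_const:
  fixes w :: "real \<Rightarrow> real"
  assumes w: "continuous_on {0..l} w"
    and z: "\<And>\<psi>. test_function l \<psi> \<Longrightarrow> (LINT x|lborel. indicator {0<..<l} x * w x * deriv \<psi> x) = 0"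
    and x: "x \<in> {0<..<l}" and y: "y \<in> {0<..<l}" and xy: "x < y"
  shows "w x = w y"
proof -
  \<comment> \<open>The bump lives on \<open>(al, be)\<close>, which contains \<open>x\<close> and
    \<open>y\<close> and has its closure in \<open>(0, l)\<close>.\<close>
  define al where "al = x / 2" define be where "be = (y + l) / 2"
  have ab: "0 < al" "al < x" "y < be" "be < l" using x y by (auto simp: al_def be_def)
  define W where "W t = w (max 0 (min l t))" for t
  have W: "continuous_on UNIV W"
    unfolding W_def by (rule continuous_on_compose2[OF w]) (use x in \<open>auto intro!: continuous_intros\<close>)
  have WW: "W t = w t" if "t \<in> {0..l}" for t using that by (simp add: W_def)
  define chi where "chi t = max 0 ((t - al) * (be - t))" for t
  have chi_c: "continuous_on UNIV chi" unfolding chi_def by (intro continuous_intros)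
  have chi_pos: "0 < chi t" if "t \<in> {al<..<be}" for t using that by (auto simp: chi_def)
  have chi_0: "chi t = 0" if "t \<notin> {al..be}" for t
  proof -
    have "t < al \<or> be < t" using that by auto
    then have "(t - al) * (be - t) \<le> 0" using ab x y xy by (auto simp: mult_le_0_iff)
    then show ?thesis by (simp add: chi_def)
  qed
  have chi_nn: "0 \<le> chi t" for t by (simp add: chi_def)
  have int: "integrable lborel (\<lambda>t. chi t * h t)" if "continuous_on UNIV h" for h
  proof -
    have "integrable lborel (\<lambda>t. indicator {al..be} t *\<^sub>R (chi t * h t))"
      by (rule borel_integrable_compact[OF compact_Icc]) (intro continuous_intros continuous_on_subset[OF chi_c] continuous_on_subset[OF that] subset_UNIV)
    moreover have "(\<lambda>t. indicator {al..be} t *\<^sub>R (chi t * h t)) = (\<lambda>t. chi t * h t)"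
      using chi_0 by (auto simp: fun_eq_iff indicator_def)
    ultimately show ?thesis by simp
  qed
  have ichi: "integrable lborel chi" using int[of "\<lambda>_. 1"] by simp
  \<comment> \<open>A nonnegative integrable function of integral 0 has a vanishing primitive, and
    where it is continuous it is the derivative of it. The factor \<open>r\<close> is free because
    the claim is used twice, for \<open>chi\<close> itself and for \<open>chi\<close> times the
    square of \<open>W - c\<close>.\<close>
  have zero: "chi t = 0" if nn: "\<And>t. 0 \<le> h t" "continuous_on UNIV h" "integrable lborel h" "(LINT t|lborel. h t) = 0" "h = (\<lambda>t. chi t * r t)" "r t \<noteq> 0" for h r t
  proof -
    have "prim h u = 0" for u
    proof -
      have "prim h u \<le> (LINT t|lborel. h t)" unfolding prim_def
        by (intro integral_mono integrable_indicator nn) (use nn(1) in \<open>auto simp: indicator_def\<close>)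
      moreover have "0 \<le> prim h u" unfolding prim_def
        by (rule Bochner_Integration.integral_nonneg) (use nn(1) in \<open>auto simp: indicator_def\<close>)
      ultimately show ?thesis using nn(4) by simp
    qed
    then have "prim h = (\<lambda>_. 0)" by auto
    then have "((\<lambda>_. 0) has_real_derivative h t) (at t)" using prim_has_derivative[OF nn(3,2), of t] by simp
    then have "h t = 0" using DERIV_const DERIV_unique by blast
    then show ?thesis using nn(5,6) by auto
  qed
  have m0: "(LINT t|lborel. chi t) \<noteq> 0"
  proof
    assume "(LINT t|lborel. chi t) = 0"
    from zero[OF chi_nn chi_c ichi this, of "\<lambda>_. 1" x] have "chi x = 0" by simp
    then show False using chi_pos[of x] ab xy by auto
  qed
  define c where "c = (LINT t|lborel. chi t * W t) / (LINT t|lborel. chi t)"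
  define k where "k t = chi t * (W t - c)" for t
  have kc: "continuous_on UNIV k" unfolding k_def by (intro continuous_intros chi_c W)
  have ki: "integrable lborel k" unfolding k_def by (rule int) (intro continuous_intros W)
  have k0: "k t = 0" if "t \<notin> {al..be}" for t using chi_0[OF that] by (simp add: k_def)
  \<comment> \<open>Integral 0 gives \<open>prim k\<close> compact support in \<open>(0, l)\<close>,
    so that it is a test function; \<open>c\<close> is chosen for this.\<close>
  have ktot: "(LINT t|lborel. k t) = 0"
  proof -
    have "(LINT t|lborel. k t) = (LINT t|lborel. chi t * W t - chi t * c)" by (simp add: k_def right_diff_distrib)
    also have "\<dots> = (LINT t|lborel. chi t * W t) - (LINT t|lborel. chi t) * c"
      using int[OF W] ichi by simp
    also have "\<dots> = 0" using m0 by (simp add: c_def)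
    finally show ?thesis .
  qed
  have dk: "(prim k has_real_derivative k t) (at t)" for t by (rule prim_has_derivative[OF ki kc])
  have dk': "deriv (prim k) = k" by (rule ext) (rule DERIV_imp_deriv[OF dk])
  have p0: "prim k t = 0" if t: "t \<notin> {al..be}" for t
  proof -
    consider "t < al" | "be < t" using t by force
    then show ?thesis
    proof cases
      case 1
      then have "(\<lambda>u. indicator {..t} u * k u) = (\<lambda>u. 0)" using k0 by (auto simp: fun_eq_iff indicator_def)
      then show ?thesis by (simp add: prim_def)
    next
      case 2
      then have "(\<lambda>u. indicator {..t} u * k u) = k" using k0 by (auto simp: fun_eq_iff indicator_def)
      then show ?thesis using ktot by (simp add: prim_def)
    qed
  qed
  have "test_function l (prim k)"
    unfolding test_function_def dk'
  proof (intro conjI)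
    show "\<forall>t. prim k differentiable at t" using dk real_differentiable_def by blast
    show "\<exists>a b. 0 < a \<and> b < l \<and> (\<forall>x. x \<notin> {a..b} \<longrightarrow> prim k x = 0)"
      by (rule exI[of _ al], rule exI[of _ be]) (use ab p0 in auto)
  qed (rule kc)
  from z[OF this] have "(LINT t|lborel. indicator {0<..<l} t * w t * k t) = 0" by (simp add: dk')
  moreover have "(\<lambda>t. indicator {0<..<l} t * w t * k t) = (\<lambda>t. W t * k t)"
  proof
    fix t
    show "indicator {0<..<l} t * w t * k t = W t * k t"
    proof (cases "t \<in> {al..be}")
      case True
      then have "t \<in> {0<..<l}" using ab by auto
      then show ?thesis using WW[of t] by simp
    qed (simp add: k0)
  qed
  ultimately have Wk: "(LINT t|lborel. W t * k t) = 0" by simp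
  have kW: "integrable lborel (\<lambda>t. W t * k t)"
    using int[of "\<lambda>t. (W t - c) * W t"] W by (simp add: k_def mult_ac continuous_intros)
  have "(LINT t|lborel. chi t * (W t - c)\<^sup>2) = (LINT t|lborel. W t * k t - c * k t)"
    by (simp add: k_def power2_eq_square algebra_simps)
  also have "\<dots> = 0" using kW ki Wk ktot by simp
  finally have sq0: "(LINT t|lborel. chi t * (W t - c)\<^sup>2) = 0" .
  have "W t = c" if t: "t \<in> {al<..<be}" for t
  proof (rule ccontr)
    assume "W t \<noteq> c"
    then have r: "(W t - c)\<^sup>2 \<noteq> 0" by simp
    have "chi t = 0"
      by (rule zero[of "\<lambda>t. chi t * (W t - c)\<^sup>2" "\<lambda>t. (W t - c)\<^sup>2"])
         (use chi_nn sq0 r in \<open>auto intro!: continuous_intros chi_c W int mult_nonneg_nonneg\<close>)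
    with chi_pos[OF t] show False by simp
  qed
  from this[of x] this[of y] show ?thesis using WW[of x] WW[of y] x y ab xy by auto
qed

text \<open>The difference \<open>f - prim h\<close> has weak derivative 0. Hence it is constant on
  the open interval by \<open>weak_deriv_const\<close>, and on the closed one by continuity, which
  ties the traces of \<open>f\<close> at the endpoints to \<open>h\<close>.\<close>

lemma has_weak_deriv_imp_ac:
  assumes l: "0 < l" and f: "continuous_on {0..l} f" and g: "g \<in> L2_space l" and wd: "has_weak_deriv l f g"
    and h: "interval_rep l g h"
  shows "ac_rep l f h"
proof -
  have hs: "square_integrable h" using g L2_space_rep[OF h] by simp
  have hz: "\<And>x. x \<notin> {0<..<l} \<Longrightarrow> h x = 0" by (rule interval_rep_zero[OF h])
  have hi: "integrable lborel h" by (rule square_integrable_supported(1)[OF hs hz])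
  define w where "w x = f x - prim h x" for x
  have wc: "continuous_on {0..l} w"
    unfolding w_def by (intro continuous_intros f continuous_on_subset[OF prim_continuous[OF hi]]) auto
  have z: "(LINT x|lborel. indicator {0<..<l} x * w x * deriv \<psi> x) = 0" if tf: "test_function l \<psi>" for \<psi>
  proof -
    obtain k a b where k: "deriv \<psi> = k" "\<psi> = prim k" "integrable lborel k" "square_integrable k"
      "0 < a" "b < l" "\<And>x. x \<notin> {a..b} \<Longrightarrow> \<psi> x = 0" "\<And>x. x \<notin> {a..b} \<Longrightarrow> k x = 0" "continuous_on UNIV k"
      using test_function_prim[OF tf] by metis
    have k0: "k x = 0" "\<psi> x = 0" if "x \<notin> {0<..<l}" for x using k(5-8) that by auto
    have km: "k \<in> borel_measurable borel" "\<psi> \<in> borel_measurable borel"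
      using k(4) prim_continuous[OF k(3)] by (auto simp: k(2) square_integrable_def intro: borel_measurable_continuous_onI)
    have "(LINT x:{0<..<l}|lebesgue. f x * deriv \<psi> x) = - (LINT x:{0<..<l}|lebesgue. g x * \<psi> x)"
      using wd tf by (simp add: has_weak_deriv_def)
    then have 1: "(LINT x|lborel. (indicator {0<..<l} x * f x) * k x) = - (LINT x|lborel. h x * \<psi> x)"
      using interval_rep_pairing[OF interval_rep_continuous[OF f] interval_rep_self[OF km(1) k0(1)]]
        interval_rep_pairing[OF h interval_rep_self[OF km(2) k0(2)]] by (simp add: k(1))
    have 2: "(LINT x|lborel. prim h x * k x) = - (LINT x|lborel. h x * \<psi> x)"
      using prim_pairing[OF hi k(3) k0(1)] k0(2) by (simp add: k(2))
    have i1: "integrable lborel (\<lambda>x. (indicator {0<..<l} x * f x) * k x)"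
      by (rule square_integrable_product[OF continuous_interval_square[OF f] k(4)])
    have i2: "integrable lborel (\<lambda>x. prim h x * k x)" by (rule integrable_prim_mult[OF hi k(3)])
    have "(\<lambda>x. indicator {0<..<l} x * w x * deriv \<psi> x) = (\<lambda>x. (indicator {0<..<l} x * f x) * k x - prim h x * k x)"
      using k0(1) by (auto simp: fun_eq_iff w_def k(1) indicator_def algebra_simps)
    then show ?thesis using i1 i2 1 2 by simp
  qed
  have cst: "w x = w y" if "x \<in> {0<..<l}" "y \<in> {0<..<l}" for x y
    using weak_deriv_const[OF wc z, of x y] weak_deriv_const[OF wc z, of y x] that by (cases x y rule: linorder_cases) auto
  define c where "c = w (l / 2)"
  have wi: "w x = c" if "x \<in> {0<..<l}" for x unfolding c_def by (rule cst[OF that]) (use l in auto)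
  have wcl: "w x = c" if "x \<in> {0..l}" for x
  proof -
    have "closure {0<..<l} = {0..l}" using l by simp
    then show ?thesis
      using continuous_constant_on_closure[of "{0<..<l}" w c x] wc wi that by auto
  qed
  have p0: "prim h 0 = 0" by (rule square_integrable_supported(2)[OF hs, of l]) (use hz in auto)
  have "f x = f 0 + prim h x" if "x \<in> {0..l}" for x
  proof -
    have "w x = w 0" using wcl[OF that] wcl[of 0] l by simp
    then have "f x - prim h x = f 0 - prim h 0" unfolding w_def .
    then show ?thesis unfolding p0 by linarith
  qed
  then show ?thesis using hs hz unfolding ac_rep_def by blast
qed

lemma H1_space_ac:
  assumes "0 < l" "f \<in> H1_space l"
  obtains h where "ac_rep l f h"
proof -
  from assms(2) obtain g where g: "continuous_on {0..l} f" "g \<in> L2_space l" "has_weak_deriv l f g"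
    by (auto simp: H1_space_def)
  obtain h where "interval_rep l g h" using L2_space_obtain[OF g(2)] by metis
  then show ?thesis using that has_weak_deriv_imp_ac[OF assms(1) g] by blast
qed

lemma ac_rep_has_weak_deriv:
  assumes l: "0 < l" and f: "ac_rep l f h"
  shows "has_weak_deriv l f h" "f \<in> H1_space l" "h \<in> L2_space l"
proof -
  note D = ac_repD[OF f]
  have fc: "continuous_on {0..l} f" by (rule ac_rep_continuous[OF f])
  have hb: "h \<in> borel_measurable borel" by (rule square_integrable_measurable[OF D(1)])
  show h2: "h \<in> L2_space l" using L2_space_rep[OF interval_rep_self[OF hb D(2)]] D(1) by simp
  have f2: "f \<in> L2_space l" using L2_space_rep[OF interval_rep_continuous[OF fc]] continuous_interval_square[OF fc] by simp
  show wd: "has_weak_deriv l f h"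
    unfolding has_weak_deriv_def
  proof (intro conjI allI impI)
    fix a b :: real assume ab: "0 < a \<and> b < l"
    have s: "(\<lambda>x. indicator {a..b} x *\<^sub>R f x) \<in> borel_measurable borel"
      by (rule borel_measurable_continuous_on_indicator) (use ab in \<open>auto intro: continuous_on_subset[OF fc]\<close>)
    show "set_integrable lebesgue {a..b} f"
      unfolding set_integrable_lebesgue_iff[OF s AE_I2[OF refl]]
      by (rule borel_integrable_compact[OF compact_Icc]) (use ab in \<open>auto intro: continuous_on_subset[OF fc]\<close>)
    have s: "(\<lambda>x. indicator {a..b} x * h x) \<in> borel_measurable borel" using hb by measurable
    show "set_integrable lebesgue {a..b} h"
      by (subst set_integrable_lebesgue_iff[OF s]) (auto intro!: integrable_indicator D(4))
  next
    fix \<psi> assume tf: "test_function l \<psi>"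
    obtain k a b where k: "deriv \<psi> = k" "\<psi> = prim k" "integrable lborel k" "square_integrable k"
      "0 < a" "b < l" "\<And>x. x \<notin> {a..b} \<Longrightarrow> \<psi> x = 0" "\<And>x. x \<notin> {a..b} \<Longrightarrow> k x = 0" "continuous_on UNIV k"
      using test_function_prim[OF tf] by metis
    have k0: "k x = 0" "\<psi> x = 0" if "x \<notin> {0<..<l}" for x using k(5-8) that by auto
    have km: "k \<in> borel_measurable borel" "\<psi> \<in> borel_measurable borel"
      using k(4) prim_continuous[OF k(3)] by (auto simp: k(2) square_integrable_def intro: borel_measurable_continuous_onI)
    have ktot: "(LINT x|lborel. k x) = 0" using prim_total[OF k(3) k0(1), of l] k0(2)[of l] by (simp add: k(2))
    have eq: "(\<lambda>x. (indicator {0<..<l} x * f x) * k x) = (\<lambda>x. f 0 * k x + prim h x * k x)"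
    proof
      fix x
      show "(indicator {0<..<l} x * f x) * k x = f 0 * k x + prim h x * k x"
        using D(3)[of x] k0(1)[of x] by (cases "x \<in> {0<..<l}") (auto simp: algebra_simps)
    qed
    have "(LINT x:{0<..<l}|lebesgue. f x * deriv \<psi> x) = (LINT x|lborel. (indicator {0<..<l} x * f x) * k x)"
      using interval_rep_pairing[OF interval_rep_continuous[OF fc] interval_rep_self[OF km(1) k0(1)]] by (simp add: k(1))
    also have "\<dots> = (LINT x|lborel. prim h x * k x)"
      unfolding eq using k(3) integrable_prim_mult[OF D(4) k(3)] ktot by simp
    also have "\<dots> = - (LINT x|lborel. h x * \<psi> x)"
      using prim_pairing[OF D(4) k(3) k0(1)] k0(2) by (simp add: k(2))
    also have "(LINT x|lborel. h x * \<psi> x) = (LINT x:{0<..<l}|lebesgue. h x * \<psi> x)"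
      using interval_rep_pairing[OF interval_rep_self[OF hb D(2)] interval_rep_self[OF km(2) k0(2)]] by simp
    finally show "(LINT x:{0<..<l}|lebesgue. f x * deriv \<psi> x) = - (LINT x:{0<..<l}|lebesgue. h x * \<psi> x)" .
  qed
  show "f \<in> H1_space l" using fc f2 wd h2 by (auto simp: H1_space_def)
qed

lemma ac_rep_unique:
  assumes f: "ac_rep l f h" "ac_rep l f h'"
  shows "AE x in lborel. h x = h' x"
proof -
  note D = ac_repD[OF f(1)] and D' = ac_repD[OF f(2)]
  have d0: "prim h x = prim h' x" if "x \<in> {0..l}" for x using D(3)[OF that] D'(3)[OF that] by simp
  have "prim (\<lambda>x. h x - h' x) x = 0" for x
  proof (cases "x \<le> 0 \<or> l < 0")
    case True
    then have "(\<lambda>y. indicator {..x} y * (h y - h' y)) = (\<lambda>y. 0)"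
      using D(2) D'(2) by (auto simp: fun_eq_iff indicator_def)
    then show ?thesis by (simp add: prim_def)
  next
    case False
    show ?thesis
    proof (cases "x \<le> l")
      case True
      then show ?thesis using d0[of x] False by (simp add: prim_diff_fun[OF D(4) D'(4)])
    next
      case x: False
      have "prim h x = prim h l" "prim h' x = prim h' l"
        using prim_total[OF D(4) D(2), of x] prim_total[OF D(4) D(2), of l] prim_total[OF D'(4) D'(2), of x] prim_total[OF D'(4) D'(2), of l] x by auto
      then show ?thesis using d0[of l] False by (simp add: prim_diff_fun[OF D(4) D'(4)])
    qed
  qed
  then have "AE x in lborel. h x - h' x = 0"
    using AE_zero_if_prim_zero[of "\<lambda>x. h x - h' x"] D(4) D'(4) by auto
  then show ?thesis by eventually_elim simp
qed

text \<open>\<open>weak_deriv\<close> picks some representative; by \<open>ac_rep_unique\<close>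
  every choice agrees with \<open>h\<close> almost everywhere on the interval. Norms and inner
  products that contain it can then be computed with \<open>h\<close>.\<close>

lemma weak_deriv_rep:
  assumes l: "0 < l" and f: "ac_rep l f h"
  shows "interval_rep l (weak_deriv l f) h"
proof -
  note W = ac_rep_has_weak_deriv[OF assms]
  have ex: "\<exists>g. g \<in> L2_space l \<and> has_weak_deriv l f g" using W by blast
  have wd: "weak_deriv l f \<in> L2_space l" "has_weak_deriv l f (weak_deriv l f)"
    using someI_ex[OF ex] by (auto simp: weak_deriv_def)
  obtain h' where h': "interval_rep l (weak_deriv l f) h'" using L2_space_obtain[OF wd(1)] by metis
  have "ac_rep l f h'" by (rule has_weak_deriv_imp_ac[OF l ac_rep_continuous[OF f] wd h'])
  from AE_completion[OF ac_rep_unique[OF f this]]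
  have "AE x in lebesgue. x \<in> {0<..<l} \<longrightarrow> weak_deriv l f x = h x"
    using interval_rep_AE[OF h'] by eventually_elim auto
  then show ?thesis using ac_repD(1,2)[OF f] by (auto simp: interval_rep_def dest: square_integrable_measurable)
qed

lemma ac_rep_diff:
  assumes "ac_rep l f h" "ac_rep l f' h'"
  shows "ac_rep l (\<lambda>x. f x - f' x) (\<lambda>x. h x - h' x)"
  unfolding ac_rep_def
proof (intro conjI allI impI ballI)
  note D = ac_repD[OF assms(1)] and D' = ac_repD[OF assms(2)]
  show "square_integrable (\<lambda>x. h x - h' x)" by (rule square_integrable_diff[OF D(1) D'(1)])
  show "h x - h' x = 0" if "x \<notin> {0<..<l}" for x using D(2)[OF that] D'(2)[OF that] by simp
  show "f x - f' x = f 0 - f' 0 + prim (\<lambda>x. h x - h' x) x" if "x \<in> {0..l}" for x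
    unfolding D(3)[OF that] D'(3)[OF that] prim_diff_fun[OF D(4) D'(4)] by simp
qed

subsection \<open>Finite energy solutions on an edge\<close>

lemma abs_product_integral_le:
  assumes "square_integrable f" "square_integrable g"
  shows "(LINT x|lborel. \<bar>f x * g x\<bar>) \<le> sqrt (energy f * energy g)"
proof -
  have s: "square_integrable (\<lambda>x. \<bar>f x\<bar>)" "square_integrable (\<lambda>x. \<bar>g x\<bar>)"
    using assms by (auto simp: square_integrable_def)
  have e: "energy (\<lambda>x. \<bar>f x\<bar>) = energy f" "energy (\<lambda>x. \<bar>g x\<bar>) = energy g"
    by (simp_all add: energy_def)
  have "\<bar>LINT x|lborel. \<bar>f x\<bar> * \<bar>g x\<bar>\<bar> \<le> sqrt (energy f * energy g)"
    using Cauchy_Schwarz_energy[OF s] unfolding e by (simp add: real_le_rsqrt)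
  then show ?thesis by (simp add: abs_mult)
qed

text \<open>Fubini for \<open>z x * r t x * k t\<close>. The Cauchy-Schwarz inequality in time
  bounds the inner integral uniformly in \<open>x\<close>; this is the purpose of the bounds
  \<open>N\<close> for the energies on the lines \<open>x = const\<close>.\<close>

lemma
  fixes r :: "real \<Rightarrow> real \<Rightarrow> real"
  assumes z: "square_integrable z" "\<And>x. x \<notin> {0<..<l} \<Longrightarrow> z x = 0"
    and r: "(\<lambda>p. r (fst p) (snd p)) \<in> borel_measurable (borel \<Otimes>\<^sub>M borel)"
    and rs: "\<And>x. x \<in> {0<..<l} \<Longrightarrow> square_integrable (\<lambda>t. r t x)"
    and rN: "\<And>x. x \<in> {0<..<l} \<Longrightarrow> energy (\<lambda>t. r t x) \<le> N"
    and k: "square_integrable k"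
  shows pairing_integrable: "integrable lborel (\<lambda>t. (LINT x|lborel. z x * r t x) * k t)"
    and pairing_swap: "(LINT t|lborel. (LINT x|lborel. z x * r t x) * k t) = (LINT x|lborel. z x * (LINT t|lborel. r t x * k t))"
    and pairing_integrable2: "integrable lborel (\<lambda>x. z x * (LINT t|lborel. r t x * k t))"
proof -
  note [measurable] = square_integrable_measurable[OF z(1)] square_integrable_measurable[OF k] r
  have zi: "integrable lborel z" by (rule square_integrable_supported(1)[OF z])
  define F where "F p = z (fst p) * r (snd p) (fst p) * k (snd p)" for p
  have "(\<lambda>p. (\<lambda>p. r (fst p) (snd p)) (snd p, fst p)) \<in> borel_measurable (borel \<Otimes>\<^sub>M borel)"
    by (rule measurable_compose[OF _ r]) measurable
  then have r' [measurable]: "(\<lambda>p. r (snd p) (fst p)) \<in> borel_measurable (borel \<Otimes>\<^sub>M borel)" by simp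
  have Fb: "F \<in> borel_measurable (borel \<Otimes>\<^sub>M borel)" unfolding F_def by measurable
  have "sets (lborel \<Otimes>\<^sub>M lborel) = sets ((borel :: real measure) \<Otimes>\<^sub>M (borel :: real measure))"
    by (rule sets_pair_measure_cong) auto
  then have Fm [measurable]: "F \<in> borel_measurable (lborel \<Otimes>\<^sub>M lborel)" using Fb measurable_cong_sets by blast
  have rk: "integrable lborel (\<lambda>t. r t x * k t)" if "x \<in> {0<..<l}" for x
    by (rule square_integrable_product[OF rs[OF that] k])
  have inner: "integrable lborel (\<lambda>t. F (x, t))" for x
  proof (cases "x \<in> {0<..<l}")
    case True
    then show ?thesis using rk[OF True] by (simp add: F_def mult.assoc)
  qed (simp add: F_def z(2))
  have Fle: "(LINT t|lborel. norm (F (x, t))) \<le> \<bar>z x\<bar> * sqrt (N * energy k)" for x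
  proof (cases "x \<in> {0<..<l}")
    case True
    have "(LINT t|lborel. norm (F (x, t))) = \<bar>z x\<bar> * (LINT t|lborel. \<bar>r t x * k t\<bar>)"
      by (simp add: F_def abs_mult mult.assoc)
    also have "\<dots> \<le> \<bar>z x\<bar> * sqrt (energy (\<lambda>t. r t x) * energy k)"
      by (intro mult_left_mono abs_product_integral_le rs[OF True] k) auto
    also have "\<dots> \<le> \<bar>z x\<bar> * sqrt (N * energy k)"
      by (intro mult_left_mono real_sqrt_le_mono mult_right_mono rN[OF True]) auto
    finally show ?thesis .
  qed (simp add: F_def z(2))
  have iF: "integrable (lborel \<Otimes>\<^sub>M lborel) F"
  proof (rule lborel_pair.Fubini_integrable[OF Fm])
    show "integrable lborel (\<lambda>x. LINT t|lborel. norm (F (x, t)))"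
    proof (rule Bochner_Integration.integrable_bound)
      show "integrable lborel (\<lambda>x. \<bar>z x\<bar> * sqrt (N * energy k))" using zi by simp
      show "(\<lambda>x. LINT t|lborel. norm (F (x, t))) \<in> borel_measurable lborel"
        by (rule lborel.borel_measurable_lebesgue_integral) (use Fm in simp)
      have "0 \<le> (LINT t|lborel. norm (F (x, t)))" for x by simp
      then show "AE x in lborel. norm (LINT t|lborel. norm (F (x, t))) \<le> norm (\<bar>z x\<bar> * sqrt (N * energy k))"
        using Fle by (intro AE_I2) (auto intro: order_trans[OF _ abs_ge_self])
    qed
  qed (use inner in simp)
  have iF': "integrable (lborel \<Otimes>\<^sub>M lborel) (case_prod (\<lambda>x t. F (x, t)))" using iF by simp
  have e1: "(LINT x|lborel. F (x, t)) = (LINT x|lborel. z x * r t x) * k t" for t by (simp add: F_def)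
  have e2: "(LINT t|lborel. F (x, t)) = z x * (LINT t|lborel. r t x * k t)" for x by (simp add: F_def mult.assoc)
  show "integrable lborel (\<lambda>t. (LINT x|lborel. z x * r t x) * k t)"
    using lborel_pair.integrable_snd[OF iF'] by (simp add: e1)
  show "integrable lborel (\<lambda>x. z x * (LINT t|lborel. r t x * k t))"
    using lborel_pair.integrable_fst'[OF iF] by (simp add: e2)
  show "(LINT t|lborel. (LINT x|lborel. z x * r t x) * k t) = (LINT x|lborel. z x * (LINT t|lborel. r t x * k t))"
    using lborel_pair.Fubini_integral[OF iF'] by (simp add: e1 e2)
qed

lemma ac_product:
  assumes h: "integrable lborel h" "\<And>x. x \<notin> {0<..<l} \<Longrightarrow> h x = 0"
    and n: "integrable lborel n" "\<And>x. x \<notin> {0<..<l} \<Longrightarrow> n x = 0"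
  shows "(LINT x|lborel. (c + prim h x) * n x) + (LINT x|lborel. h x * (d + prim n x))
    = (c + prim h l) * (d + prim n l) - c * d"
proof -
  have i1: "integrable lborel (\<lambda>x. prim h x * n x)" by (rule integrable_prim_mult[OF h(1) n(1)])
  have i2: "integrable lborel (\<lambda>x. h x * prim n x)" using integrable_prim_mult[OF n(1) h(1)] by (simp add: mult.commute)
  have H: "prim h l = (LINT x|lborel. h x)" by (rule prim_total[OF h]) auto
  have N: "prim n l = (LINT x|lborel. n x)" by (rule prim_total[OF n]) auto
  have "prim h l * prim n l = (LINT x|lborel. prim h x * n x + h x * prim n x)"
    unfolding prim_mult[OF h(1) n(1)] by (rule prim_total) (use i1 i2 h n in auto)
  also have "\<dots> = (LINT x|lborel. prim h x * n x) + (LINT x|lborel. h x * prim n x)" using i1 i2 by simp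
  finally have P: "prim h l * prim n l = \<dots>" .
  have "(LINT x|lborel. (c + prim h x) * n x) = c * prim n l + (LINT x|lborel. prim h x * n x)"
    using i1 n(1) by (simp add: distrib_right N)
  moreover have "(LINT x|lborel. h x * (d + prim n x)) = prim h l * d + (LINT x|lborel. h x * prim n x)"
    using i2 h(1) by (simp add: distrib_left H)
  ultimately show ?thesis using P by (simp add: algebra_simps)
qed

text \<open>A solution \<open>u\<close> on one edge, as a function of time and space, with \<open>w = u\<^sub>x\<close> and \<open>v = u\<^sub>t\<close>. The wave equation
  \<open>w\<^sub>x = q u + v\<^sub>t\<close> is only tested against functions \<open>prim k\<close> of time, and integrated in space.\<close>

locale edge_wave =
  fixes l :: real and q :: "real \<Rightarrow> real" and u w v :: "real \<Rightarrow> real \<Rightarrow> real" and N :: real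
  assumes l_pos: "0 < l" and q_cont: "continuous_on {0..l} q"
    and u_cont: "continuous_on UNIV (\<lambda>p. u (fst p) (snd p))"
    and w_meas: "(\<lambda>p. w (fst p) (snd p)) \<in> borel_measurable (borel \<Otimes>\<^sub>M borel)"
    and v_meas: "(\<lambda>p. v (fst p) (snd p)) \<in> borel_measurable (borel \<Otimes>\<^sub>M borel)"
    and w_sq: "\<And>t. square_integrable (\<lambda>x. indicator {0<..<l} x * w t x)"
    and v_sq: "\<And>t. square_integrable (\<lambda>x. indicator {0<..<l} x * v t x)"
    and u_space: "\<And>t x. x \<in> {0..l} \<Longrightarrow> u t x = u t 0 + prim (\<lambda>x. indicator {0<..<l} x * w t x) x"
    and v_int: "\<And>x. x \<in> {0<..<l} \<Longrightarrow> integrable lborel (\<lambda>t. v t x)"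
    and u_time: "\<And>t x. x \<in> {0<..<l} \<Longrightarrow> u t x = u 0 x + (prim (\<lambda>t. v t x) t - prim (\<lambda>t. v t x) 0)"
    and u_time_sq: "\<And>x. x \<in> {0<..<l} \<Longrightarrow> square_integrable (\<lambda>t. u t x)"
    and w_time_sq: "\<And>x. x \<in> {0<..<l} \<Longrightarrow> square_integrable (\<lambda>t. w t x)"
    and v_time_sq: "\<And>x. x \<in> {0<..<l} \<Longrightarrow> square_integrable (\<lambda>t. v t x)"
    and u_time_energy: "\<And>x. x \<in> {0<..<l} \<Longrightarrow> energy (\<lambda>t. u t x) \<le> N"
    and w_time_energy: "\<And>x. x \<in> {0<..<l} \<Longrightarrow> energy (\<lambda>t. w t x) \<le> N"
    and v_time_energy: "\<And>x. x \<in> {0<..<l} \<Longrightarrow> energy (\<lambda>t. v t x) \<le> N"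
    and w_lim: "\<And>t0. ((\<lambda>t. energy (\<lambda>x. indicator {0<..<l} x * (w t x - w t0 x))) \<longlongrightarrow> 0) (at t0)"
    and v_lim: "\<And>t0. ((\<lambda>t. energy (\<lambda>x. indicator {0<..<l} x * (v t x - v t0 x))) \<longlongrightarrow> 0) (at t0)"
    and weak: "\<And>k M x. integrable lborel k \<Longrightarrow> (\<And>y. \<bar>k y\<bar> \<le> M) \<Longrightarrow> x \<in> {0..l} \<Longrightarrow>
      (LINT t|lborel. w t x * prim k t) = (LINT t|lborel. w t 0 * prim k t)
       + prim (\<lambda>y. indicator {0<..<l} y * (q y * (LINT t|lborel. u t y * prim k t) - (LINT t|lborel. v t y * k t))) x"
    and weak_int: "\<And>k M. integrable lborel k \<Longrightarrow> (\<And>y. \<bar>k y\<bar> \<le> M) \<Longrightarrow>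
      integrable lborel (\<lambda>y. indicator {0<..<l} y * (q y * (LINT t|lborel. u t y * prim k t) - (LINT t|lborel. v t y * k t)))"
begin

abbreviation ind :: "real \<Rightarrow> real" where "ind \<equiv> indicator {0<..<l}"

section \<open>The states of an edge and their continuity in time\<close>

lemma u_ac: "ac_rep l (u t) (\<lambda>x. ind x * w t x)"
  unfolding ac_rep_def
proof (intro conjI ballI allI impI)
  show "square_integrable (\<lambda>x. ind x * w t x)" by (rule w_sq)
  show "u t x = u t 0 + prim (\<lambda>x. ind x * w t x) x" if "x \<in> {0..l}" for x by (rule u_space[OF that])
qed simp

lemma u_H1: "u t \<in> H1_space l" by (rule ac_rep_has_weak_deriv(2)[OF l_pos u_ac])

lemma v_rep: "interval_rep l (v t) (\<lambda>x. ind x * v t x)"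
  by (rule interval_rep_indicator) (rule square_integrable_measurable[OF v_sq])

lemma v_L2: "v t \<in> L2_space l" using L2_space_rep[OF v_rep] v_sq by simp

lemma u_slice_cont: "continuous_on S (\<lambda>x. u t x)" "continuous_on S (\<lambda>t. u t x)"
proof -
  show "continuous_on S (\<lambda>x. u t x)"
    using continuous_on_compose2[OF u_cont continuous_on_Pair[OF continuous_on_const[of S t] continuous_on_id]] by simp
  show "continuous_on S (\<lambda>t. u t x)"
    using continuous_on_compose2[OF u_cont continuous_on_Pair[OF continuous_on_id continuous_on_const[of S x]]] by simp
qed

lemma u_rep: "interval_rep l (u t) (\<lambda>x. ind x * u t x)"
  by (rule interval_rep_continuous[OF u_slice_cont(1)])

lemma u_lim: "((\<lambda>t. energy (\<lambda>x. ind x * (u t x - u t0 x))) \<longlongrightarrow> 0) (at t0)"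
proof -
  let ?S = "{t0 - 1..t0 + 1} \<times> {0..l}"
  have "continuous_on ?S (\<lambda>p. u (fst p) (snd p) - u t0 (snd p))"
    by (intro continuous_intros continuous_on_subset[OF u_cont] continuous_on_compose2[OF u_slice_cont(1)[of UNIV]]) auto
  then have uc: "uniformly_continuous_on ?S (\<lambda>p. u (fst p) (snd p) - u t0 (snd p))"
    by (intro compact_uniformly_continuous compact_Times) auto
  show ?thesis unfolding tendsto_iff
  proof (intro allI impI)
    fix e :: real assume e: "0 < e"
    \<comment> \<open>Chosen so that increments of size at most \<open>r\<close> on an interval of
      length \<open>l\<close> have energy at most \<open>e / 2\<close>.\<close>
    define r where "r = sqrt (e / (2 * l))"
    have r: "0 < r" using e l_pos by (simp add: r_def)
    have r2: "r\<^sup>2 * (l - 0) = e / 2" using e l_pos by (simp add: r_def)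
    obtain d where d: "0 < d" "\<And>p p'. p \<in> ?S \<Longrightarrow> p' \<in> ?S \<Longrightarrow> dist p' p < d \<Longrightarrow>
        dist (u (fst p') (snd p') - u t0 (snd p')) (u (fst p) (snd p) - u t0 (snd p)) < r"
      using uc r unfolding uniformly_continuous_on_def by metis
    show "\<forall>\<^sub>F t in at t0. dist (energy (\<lambda>x. ind x * (u t x - u t0 x))) 0 < e"
      unfolding eventually_at
    proof (intro exI[of _ "min d 1"] conjI ballI impI)
      show "0 < min d 1" using d by simp
      fix t assume t: "t \<noteq> t0 \<and> dist t t0 < min d 1"
      have b: "\<bar>ind x * (u t x - u t0 x)\<bar> \<le> r" for x
      proof (cases "x \<in> {0<..<l}")
        case True
        then have "dist (u t x - u t0 x) (u t0 x - u t0 x) < r"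
          using d(2)[of "(t0, x)" "(t, x)"] t by (auto simp: dist_Pair_Pair dist_real_def abs_less_iff)
        then show ?thesis using True by (simp add: dist_real_def)
      qed (use r in simp)
      have "energy (\<lambda>x. ind x * (u t x - u t0 x)) \<le> r\<^sup>2 * (l - 0)"
      proof (rule square_integrable_bounded_support(2))
        show "(\<lambda>x. ind x * (u t x - u t0 x)) \<in> borel_measurable borel"
          using interval_rep_measurable[OF u_rep, of t] interval_rep_measurable[OF u_rep, of t0] by (simp add: right_diff_distrib)
      qed (use b l_pos in auto)
      then show "dist (energy (\<lambda>x. ind x * (u t x - u t0 x))) 0 < e" using r2 e by simp
    qed
  qed
qed

lemma H1_lim:
  "((\<lambda>t. (L2_norm l (weak_deriv l (\<lambda>x. u t x - u s x)))\<^sup>2 + (L2_norm l (\<lambda>x. u t x - u s x))\<^sup>2) \<longlongrightarrow> 0) (at s)"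
proof -
  have 1: "(L2_norm l (weak_deriv l (\<lambda>x. u t x - u s x)))\<^sup>2 = energy (\<lambda>x. ind x * (w t x - w s x))" for t
  proof -
    have "interval_rep l (weak_deriv l (\<lambda>x. u t x - u s x)) (\<lambda>x. ind x * w t x - ind x * w s x)"
      by (rule weak_deriv_rep[OF l_pos ac_rep_diff[OF u_ac u_ac]])
    from L2_norm_rep[OF this] show ?thesis by (simp add: right_diff_distrib)
  qed
  have 2: "(L2_norm l (\<lambda>x. u t x - u s x))\<^sup>2 = energy (\<lambda>x. ind x * (u t x - u s x))" for t
  proof -
    have "interval_rep l (\<lambda>x. u t x - u s x) (\<lambda>x. ind x * (u t x - u s x))"
      by (rule interval_rep_continuous) (intro continuous_intros u_slice_cont)
    from L2_norm_rep[OF this] show ?thesis by simp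
  qed
  show ?thesis unfolding 1 2 using tendsto_add[OF w_lim u_lim] by simp
qed

lemma L2_lim: "((\<lambda>t. (L2_norm l (\<lambda>x. v t x - v s x))\<^sup>2) \<longlongrightarrow> 0) (at s)"
proof -
  have 1: "(L2_norm l (\<lambda>x. v t x - v s x))\<^sup>2 = energy (\<lambda>x. ind x * (v t x - v s x))" for t
  proof -
    have "interval_rep l (\<lambda>x. v t x - v s x) (\<lambda>x. ind x * (v t x - v s x))"
      by (rule interval_rep_indicator)
         (use square_integrable_measurable[OF v_sq, of t] square_integrable_measurable[OF v_sq, of s] in \<open>simp add: right_diff_distrib\<close>)
    from L2_norm_rep[OF this] show ?thesis by simp
  qed
  show ?thesis unfolding 1 by (rule v_lim)
qed

text \<open>For each \<open>x\<close> the difference quotient minus \<open>v s x\<close> is the mean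
  of \<open>v r x - v s x\<close> over the times \<open>r\<close> between \<open>s\<close> and
  \<open>t\<close>. The Cauchy-Schwarz inequality bounds its square by the mean of the squares, and
  Fubini turns the integral in \<open>x\<close> into a mean of energies, each at most
  \<open>e\<close>.\<close>

lemma quotient_energy_le:
  assumes ts: "t \<noteq> s" and e: "\<And>r. \<bar>r - s\<bar> \<le> \<bar>t - s\<bar> \<Longrightarrow> energy (\<lambda>x. ind x * (v r x - v s x)) \<le> e"
  shows "energy (\<lambda>x. ind x * ((u t x - u s x) / (t - s) - v s x)) \<le> e"
proof -
  define d where "d = \<bar>t - s\<bar>"
  have d: "0 < d" using ts by (simp add: d_def)
  define a where "a = min s t" define b where "b = max s t"
  have ab: "a \<le> b" "b - a = d" by (auto simp: a_def b_def d_def)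
  have abr: "\<bar>r - s\<bar> \<le> \<bar>t - s\<bar>" if "r \<in> {a..b}" for r using that by (auto simp: a_def b_def)
  have e0: "0 \<le> e" using e[of s] by simp
  define I where "I r = (indicator {a..b} r :: real)" for r
  have sqv: "square_integrable (\<lambda>r. I r * (v r x - v s x))" if x: "x \<in> {0<..<l}" for x
  proof -
    have "square_integrable (\<lambda>r. I r * v r x - v s x * I r)"
      unfolding I_def by (intro square_integrable_diff square_integrable_indicator(1) v_time_sq[OF x] square_integrable_cmult square_integrable_indicator_interval) auto
    then show ?thesis by (simp add: algebra_simps)
  qed
  have pt: "((u t x - u s x) / (t - s) - v s x)\<^sup>2 \<le> energy (\<lambda>r. I r * (v r x - v s x)) / d" if x: "x \<in> {0<..<l}" for x
  proof -
    have iv: "integrable lborel (\<lambda>r. I r * v r x)" unfolding I_def by (intro integrable_indicator v_int[OF x]) auto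
    have iI: "integrable lborel I" unfolding I_def[abs_def]
      by (intro integrable_real_indicator) (auto simp: emeasure_lborel_Icc_eq)
    have Itot: "(LINT r|lborel. I r) = d" using ab by (simp add: I_def)
    have diff: "u t x - u s x = prim (\<lambda>r. v r x) t - prim (\<lambda>r. v r x) s"
      using u_time[OF x, of t] u_time[OF x, of s] by linarith
    have pab: "prim (\<lambda>r. v r x) b - prim (\<lambda>r. v r x) a = (LINT r|lborel. I r * v r x)"
      unfolding prim_diff[OF v_int[OF x] ab(1)]
    proof (rule integral_cong_AE)
      show "AE r in lborel. indicator {a<..b} r * v r x = I r * v r x"
        using AE_lborel_neq[of a] by eventually_elim (auto simp: I_def indicator_def)
    qed (use v_int[OF x] iv in \<open>auto dest: borel_measurable_integrable\<close>)
    have "(u t x - u s x) / (t - s) = (LINT r|lborel. I r * v r x) / d"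
      unfolding diff pab[symmetric] using ts by (auto simp: a_def b_def d_def min_def max_def field_simps abs_if)
    then have "(u t x - u s x) / (t - s) - v s x = ((LINT r|lborel. I r * v r x) - (LINT r|lborel. I r) * v s x) / d"
      using d Itot by (simp add: field_simps)
    also have "(LINT r|lborel. I r * v r x) - (LINT r|lborel. I r) * v s x = (LINT r|lborel. I r * v r x - I r * v s x)"
      using iv iI by simp
    \<comment> \<open>The indicator is doubled because Cauchy-Schwarz will be applied to
      \<open>I\<close> and to the difference cut off by \<open>I\<close>.\<close>
    also have "\<dots> = (LINT r|lborel. I r * (I r * (v r x - v s x)))"
      by (intro Bochner_Integration.integral_cong refl) (auto simp: I_def indicator_def)
    finally have eq: "(u t x - u s x) / (t - s) - v s x = (LINT r|lborel. I r * (I r * (v r x - v s x))) / d" .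
    have sI: "square_integrable I" unfolding I_def[abs_def] by (rule square_integrable_indicator_interval)
    have eI: "energy I = d" unfolding I_def[abs_def] using energy_indicator_interval[OF ab(1)] ab(2) by simp
    have "(LINT r|lborel. I r * (I r * (v r x - v s x)))\<^sup>2 \<le> d * energy (\<lambda>r. I r * (v r x - v s x))"
      using Cauchy_Schwarz_energy[OF sI sqv[OF x]] by (simp add: eI)
    then have "(LINT r|lborel. I r * (I r * (v r x - v s x)))\<^sup>2 / d\<^sup>2 \<le> d * energy (\<lambda>r. I r * (v r x - v s x)) / d\<^sup>2"
      by (intro divide_right_mono) auto
    then show ?thesis unfolding eq power_divide using d by (simp add: power2_eq_square)
  qed
  define F where "F p = (I (fst p) * (ind (snd p) * (v (fst p) (snd p) - v s (snd p))))\<^sup>2" for p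
  have [measurable]: "(\<lambda>p. ind (snd p) * v s (snd p)) \<in> borel_measurable ((borel :: real measure) \<Otimes>\<^sub>M borel)"
    using measurable_compose[OF measurable_snd square_integrable_measurable[OF v_sq[of s]], of "borel :: real measure"] by simp
  note [measurable] = v_meas
  have indm [measurable]: "(\<lambda>p. ind (snd p)) \<in> borel_measurable ((borel :: real measure) \<Otimes>\<^sub>M borel)"
    by (rule measurable_compose[OF measurable_snd]) measurable
  have Im [measurable]: "(\<lambda>p. I (fst p)) \<in> borel_measurable ((borel :: real measure) \<Otimes>\<^sub>M (borel :: real measure))"
    unfolding I_def by (rule measurable_compose[OF measurable_fst]) measurable
  have "F = (\<lambda>p. (I (fst p) * (ind (snd p) * v (fst p) (snd p) - ind (snd p) * v s (snd p)))\<^sup>2)"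
    by (simp add: F_def fun_eq_iff right_diff_distrib)
  then have Fb: "F \<in> borel_measurable (borel \<Otimes>\<^sub>M borel)" by simp
  have "sets (lborel \<Otimes>\<^sub>M lborel) = sets ((borel :: real measure) \<Otimes>\<^sub>M (borel :: real measure))"
    by (rule sets_pair_measure_cong) auto
  then have Fm [measurable]: "F \<in> borel_measurable (lborel \<Otimes>\<^sub>M lborel)" using Fb measurable_cong_sets by blast
  have Fin: "(LINT x|lborel. F (r, x)) = (I r)\<^sup>2 * energy (\<lambda>x. ind x * (v r x - v s x))" for r
    by (simp add: F_def energy_def power_mult_distrib)
  have I2: "(I r)\<^sup>2 = I r" for r by (simp add: I_def indicator_def)
  have sqx: "square_integrable (\<lambda>x. ind x * (v r x - v s x))" for r
    using square_integrable_diff[OF v_sq[of r] v_sq[of s]] by (simp add: right_diff_distrib)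
  have Finle: "I r * energy (\<lambda>x. ind x * (v r x - v s x)) \<le> e * indicator {a..b} r" for r
    using e[OF abr, of r] e0 by (auto simp: I_def indicator_def)
  have ie: "integrable lborel (\<lambda>r. e * indicator {a..b} r)"
    by (intro integrable_mult_right integrable_real_indicator) (auto simp: emeasure_lborel_Icc_eq)
  have iin: "integrable lborel (\<lambda>r. LINT x|lborel. norm (F (r, x)))"
  proof (rule Bochner_Integration.integrable_bound[OF ie])
    show "(\<lambda>r. LINT x|lborel. norm (F (r, x))) \<in> borel_measurable lborel"
      by (rule lborel.borel_measurable_lebesgue_integral) (use Fm in simp)
    have nF: "norm (F (r, x)) = F (r, x)" for r x by (simp add: F_def)
    have "norm (LINT x|lborel. norm (F (r, x))) \<le> norm (e * indicator {a..b} r)" for r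
    proof -
      have "norm (LINT x|lborel. norm (F (r, x))) = I r * energy (\<lambda>x. ind x * (v r x - v s x))"
        unfolding nF Fin I2 by (simp add: I_def abs_mult)
      also have "\<dots> \<le> norm (e * indicator {a..b} r)"
        using Finle[of r] by (rule order_trans) simp
      finally show ?thesis .
    qed
    then show "AE r in lborel. norm (LINT x|lborel. norm (F (r, x))) \<le> norm (e * indicator {a..b} r)"
      by (intro AE_I2)
  qed
  have iF: "integrable (lborel \<Otimes>\<^sub>M lborel) F"
  proof (rule lborel_pair.Fubini_integrable[OF Fm iin])
    have "integrable lborel (\<lambda>x. F (r, x))" for r
      using square_integrableD[OF sqx[of r]] by (simp add: F_def power_mult_distrib)
    then show "AE r in lborel. integrable lborel (\<lambda>x. F (r, x))" by simp
  qed
  have iF': "integrable (lborel \<Otimes>\<^sub>M lborel) (case_prod (\<lambda>x t. F (x, t)))" using iF by simp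
  have Fin2: "(LINT r|lborel. F (r, x)) = ind x * energy (\<lambda>r. I r * (v r x - v s x))" for x
  proof -
    have "(LINT r|lborel. F (r, x)) = (LINT r|lborel. ind x * (I r * (v r x - v s x))\<^sup>2)"
      by (intro Bochner_Integration.integral_cong refl) (auto simp: F_def power_mult_distrib indicator_def)
    then show ?thesis by (simp add: energy_def)
  qed
  have i2: "integrable lborel (\<lambda>x. ind x * energy (\<lambda>r. I r * (v r x - v s x)))"
    using lborel_pair.integrable_snd[OF iF'] by (simp add: Fin2)
  have "energy (\<lambda>x. ind x * ((u t x - u s x) / (t - s) - v s x)) \<le> (LINT x|lborel. ind x * energy (\<lambda>r. I r * (v r x - v s x)) / d)"
    unfolding energy_def[of "\<lambda>x. ind x * ((u t x - u s x) / (t - s) - v s x)"]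
  proof (rule Bochner_Integration.integral_mono')
    show "integrable lborel (\<lambda>x. ind x * energy (\<lambda>r. I r * (v r x - v s x)) / d)" using i2 by simp
    show "(ind x * ((u t x - u s x) / (t - s) - v s x))\<^sup>2 \<le> ind x * energy (\<lambda>r. I r * (v r x - v s x)) / d" for x
      using pt[of x] by (cases "x \<in> {0<..<l}") auto
    show "0 \<le> ind x * energy (\<lambda>r. I r * (v r x - v s x)) / d" for x using d by simp
  qed
  also have "\<dots> = (LINT x|lborel. LINT r|lborel. F (r, x)) / d" by (simp add: Fin2)
  also have "(LINT x|lborel. LINT r|lborel. F (r, x)) = (LINT r|lborel. LINT x|lborel. F (r, x))"
    using lborel_pair.Fubini_integral[OF iF'] by simp
  also have "\<dots> \<le> (LINT r|lborel. e * indicator {a..b} r)"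
  proof (rule Bochner_Integration.integral_mono'[OF ie])
    show "(LINT x|lborel. F (r, x)) \<le> e * indicator {a..b} r" for r unfolding Fin I2 by (rule Finle)
    show "0 \<le> e * indicator {a..b} r" for r using e0 by simp
  qed
  also have "\<dots> = e * d" using ab by simp
  finally show ?thesis using d by (simp add: field_simps)
qed

lemma quotient_lim:
  "((\<lambda>t. (L2_norm l (\<lambda>x. (u t x - u s x) / (t - s) - v s x))\<^sup>2) \<longlongrightarrow> 0) (at s)"
proof -
  have 1: "(L2_norm l (\<lambda>x. (u t x - u s x) / (t - s) - v s x))\<^sup>2 = energy (\<lambda>x. ind x * ((u t x - u s x) / (t - s) - v s x))" for t
  proof -
    note [measurable] = interval_rep_measurable[OF u_rep, of t] interval_rep_measurable[OF u_rep, of s] square_integrable_measurable[OF v_sq, of s]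
    have "(\<lambda>x. (ind x * u t x - ind x * u s x) / (t - s) - ind x * v s x) \<in> borel_measurable borel" by measurable
    moreover have "(\<lambda>x. (ind x * u t x - ind x * u s x) / (t - s) - ind x * v s x) = (\<lambda>x. ind x * ((u t x - u s x) / (t - s) - v s x))"
      by (simp add: fun_eq_iff indicator_def)
    ultimately have "interval_rep l (\<lambda>x. (u t x - u s x) / (t - s) - v s x) (\<lambda>x. ind x * ((u t x - u s x) / (t - s) - v s x))"
      by (intro interval_rep_indicator) simp
    from L2_norm_rep[OF this] show ?thesis by simp
  qed
  show ?thesis unfolding 1 tendsto_iff
  proof (intro allI impI)
    fix e :: real assume e: "0 < e"
    have "\<forall>\<^sub>F t in at s. dist (energy (\<lambda>x. ind x * (v t x - v s x))) 0 < e / 2"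
      using v_lim[of s] e unfolding tendsto_iff by (meson half_gt_zero)
    then obtain d where d: "0 < d" "\<And>t. t \<noteq> s \<Longrightarrow> dist t s < d \<Longrightarrow> energy (\<lambda>x. ind x * (v t x - v s x)) < e / 2"
      unfolding eventually_at by auto
    show "\<forall>\<^sub>F t in at s. dist (energy (\<lambda>x. ind x * ((u t x - u s x) / (t - s) - v s x))) 0 < e"
      unfolding eventually_at
    proof (intro exI[of _ d] conjI ballI impI)
      fix t assume t: "t \<noteq> s \<and> dist t s < d"
      have "energy (\<lambda>x. ind x * ((u t x - u s x) / (t - s) - v s x)) \<le> e / 2"
      proof (rule quotient_energy_le)
        fix r assume r: "\<bar>r - s\<bar> \<le> \<bar>t - s\<bar>"
        show "energy (\<lambda>x. ind x * (v r x - v s x)) \<le> e / 2"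
          using d(2)[of r] r t e by (cases "r = s") (auto simp: dist_real_def)
      qed (use t in simp)
      then show "dist (energy (\<lambda>x. ind x * ((u t x - u s x) / (t - s) - v s x))) 0 < e" using e by simp
    qed (use d in simp)
  qed
qed

section \<open>The variational equation on one edge\<close>

lemma
  assumes eta: "ac_rep l \<eta> h"
  shows v_pairing_eq: "(LINT x:{0<..<l}|lebesgue. v t x * \<eta> x) = (LINT x|lborel. (ind x * \<eta> x) * v t x)"
    and w_pairing_eq: "(LINT x:{0<..<l}|lebesgue. weak_deriv l (u t) x * weak_deriv l \<eta> x) = (LINT x|lborel. h x * w t x)"
    and u_pairing_eq: "(LINT x:{0<..<l}|lebesgue. q x * u t x * \<eta> x) = (LINT x|lborel. (ind x * (q x * \<eta> x)) * u t x)"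
proof -
  have er: "interval_rep l \<eta> (\<lambda>x. ind x * \<eta> x)" by (rule interval_rep_continuous[OF ac_rep_continuous[OF eta]])
  show "(LINT x:{0<..<l}|lebesgue. v t x * \<eta> x) = (LINT x|lborel. (ind x * \<eta> x) * v t x)"
    unfolding interval_rep_pairing[OF v_rep er]
    by (intro Bochner_Integration.integral_cong refl) (auto simp: indicator_def)
  show "(LINT x:{0<..<l}|lebesgue. weak_deriv l (u t) x * weak_deriv l \<eta> x) = (LINT x|lborel. h x * w t x)"
    unfolding interval_rep_pairing[OF weak_deriv_rep[OF l_pos u_ac] weak_deriv_rep[OF l_pos eta]]
  proof (intro Bochner_Integration.integral_cong refl)
    fix x show "ind x * w t x * h x = h x * w t x"
      using ac_repD(2)[OF eta, of x] by (cases "x \<in> {0<..<l}") auto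
  qed
  have qr: "interval_rep l (\<lambda>x. q x * u t x) (\<lambda>x. ind x * (q x * u t x))"
    by (rule interval_rep_continuous) (intro continuous_intros q_cont u_slice_cont)
  show "(LINT x:{0<..<l}|lebesgue. q x * u t x * \<eta> x) = (LINT x|lborel. (ind x * (q x * \<eta> x)) * u t x)"
    unfolding interval_rep_pairing[OF qr er]
    by (intro Bochner_Integration.integral_cong refl) (auto simp: indicator_def)
qed

lemma
  assumes eta: "ac_rep l \<eta> h" and k: "square_integrable k"
  shows v_pairing_integrable: "integrable lborel (\<lambda>t. (LINT x:{0<..<l}|lebesgue. v t x * \<eta> x) * k t)"
    and w_pairing_integrable: "integrable lborel (\<lambda>t. (LINT x:{0<..<l}|lebesgue. weak_deriv l (u t) x * weak_deriv l \<eta> x) * k t)"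
    and u_pairing_integrable: "integrable lborel (\<lambda>t. (LINT x:{0<..<l}|lebesgue. q x * u t x * \<eta> x) * k t)"
    and v_pairing: "(LINT t|lborel. (LINT x:{0<..<l}|lebesgue. v t x * \<eta> x) * k t) = (LINT x|lborel. (ind x * \<eta> x) * (LINT t|lborel. v t x * k t))"
    and w_pairing: "(LINT t|lborel. (LINT x:{0<..<l}|lebesgue. weak_deriv l (u t) x * weak_deriv l \<eta> x) * k t) = (LINT x|lborel. h x * (LINT t|lborel. w t x * k t))"
    and u_pairing: "(LINT t|lborel. (LINT x:{0<..<l}|lebesgue. q x * u t x * \<eta> x) * k t) = (LINT x|lborel. (ind x * (q x * \<eta> x)) * (LINT t|lborel. u t x * k t))"
    and u_pairing_integrable2: "integrable lborel (\<lambda>x. (ind x * (q x * \<eta> x)) * (LINT t|lborel. u t x * k t))"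
proof -
  have ec: "continuous_on {0..l} \<eta>" by (rule ac_rep_continuous[OF eta])
  have e1: "square_integrable (\<lambda>x. ind x * \<eta> x)" by (rule continuous_interval_square[OF ec])
  have e2: "square_integrable (\<lambda>x. ind x * (q x * \<eta> x))"
    by (rule continuous_interval_square) (intro continuous_intros q_cont ec)
  have u_meas: "(\<lambda>p. u (fst p) (snd p)) \<in> borel_measurable (borel \<Otimes>\<^sub>M borel)"
    using borel_measurable_continuous_onI[OF u_cont] by (simp only: borel_prod)
  have z1: "\<And>x. x \<notin> {0<..<l} \<Longrightarrow> ind x * \<eta> x = 0" and z2: "\<And>x. x \<notin> {0<..<l} \<Longrightarrow> ind x * (q x * \<eta> x) = 0" by auto
  note Pv = pairing_integrable[OF e1 z1 v_meas v_time_sq v_time_energy k] pairing_swap[OF e1 z1 v_meas v_time_sq v_time_energy k]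
  note Pw = pairing_integrable[OF ac_repD(1,2)[OF eta] w_meas w_time_sq w_time_energy k] pairing_swap[OF ac_repD(1,2)[OF eta] w_meas w_time_sq w_time_energy k]
  note Pu = pairing_integrable[OF e2 z2 u_meas u_time_sq u_time_energy k] pairing_swap[OF e2 z2 u_meas u_time_sq u_time_energy k]
    pairing_integrable2[OF e2 z2 u_meas u_time_sq u_time_energy k]
  show "integrable lborel (\<lambda>t. (LINT x:{0<..<l}|lebesgue. v t x * \<eta> x) * k t)"
    unfolding v_pairing_eq[OF eta] by (rule Pv(1))
  show "integrable lborel (\<lambda>t. (LINT x:{0<..<l}|lebesgue. weak_deriv l (u t) x * weak_deriv l \<eta> x) * k t)"
    unfolding w_pairing_eq[OF eta] by (rule Pw(1))
  show "integrable lborel (\<lambda>t. (LINT x:{0<..<l}|lebesgue. q x * u t x * \<eta> x) * k t)"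
    unfolding u_pairing_eq[OF eta] by (rule Pu(1))
  show "(LINT t|lborel. (LINT x:{0<..<l}|lebesgue. v t x * \<eta> x) * k t) = (LINT x|lborel. (ind x * \<eta> x) * (LINT t|lborel. v t x * k t))"
    unfolding v_pairing_eq[OF eta] by (rule Pv(2))
  show "(LINT t|lborel. (LINT x:{0<..<l}|lebesgue. weak_deriv l (u t) x * weak_deriv l \<eta> x) * k t) = (LINT x|lborel. h x * (LINT t|lborel. w t x * k t))"
    unfolding w_pairing_eq[OF eta] by (rule Pw(2))
  show "(LINT t|lborel. (LINT x:{0<..<l}|lebesgue. q x * u t x * \<eta> x) * k t) = (LINT x|lborel. (ind x * (q x * \<eta> x)) * (LINT t|lborel. u t x * k t))"
    unfolding u_pairing_eq[OF eta] by (rule Pu(2))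
  show "integrable lborel (\<lambda>x. (ind x * (q x * \<eta> x)) * (LINT t|lborel. u t x * k t))" by (rule Pu(3))
qed

text \<open>At a fixed time \<open>w\<close> need not have a derivative in \<open>x\<close>. Tested
  in time, however, it becomes the function \<open>m\<close>, which is absolutely continuous with
  derivative \<open>n\<close>, while \<open>\<eta>\<close> has the derivative \<open>h\<close>. The
  product rule for the two is the variational equation with the boundary terms at both ends.\<close>

lemma edge_identity:
  assumes eta: "ac_rep l \<eta> h" and k: "square_integrable k" "integrable lborel k" "\<And>y. \<bar>k y\<bar> \<le> M"
    and pk: "square_integrable (prim k)"
  shows "(LINT t|lborel. (LINT x:{0<..<l}|lebesgue. v t x * \<eta> x) * k t)
    = (LINT t|lborel. (LINT x:{0<..<l}|lebesgue. weak_deriv l (u t) x * weak_deriv l \<eta> x) * prim k t)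
    + (LINT t|lborel. (LINT x:{0<..<l}|lebesgue. q x * u t x * \<eta> x) * prim k t)
    - (\<eta> l * (LINT t|lborel. w t l * prim k t) - \<eta> 0 * (LINT t|lborel. w t 0 * prim k t))"
proof -
  define m where "m x = (LINT t|lborel. w t x * prim k t)" for x
  define n where "n y = ind y * (q y * (LINT t|lborel. u t y * prim k t) - (LINT t|lborel. v t y * k t))" for y
  have n: "integrable lborel n" unfolding n_def by (rule weak_int[OF k(2,3)])
  have n0: "n x = 0" if "x \<notin> {0<..<l}" for x using that by (simp add: n_def)
  have mx: "m x = m 0 + prim n x" if "x \<in> {0..l}" for x
    unfolding m_def n_def by (rule weak[OF k(2,3) that])
  note D = ac_repD[OF eta]
  have prod: "(LINT x|lborel. (\<eta> 0 + prim h x) * n x) + (LINT x|lborel. h x * (m 0 + prim n x))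
    = (\<eta> 0 + prim h l) * (m 0 + prim n l) - \<eta> 0 * m 0"
    by (rule ac_product[OF D(4,2) n n0])
  have l0: "l \<in> {0..l}" using l_pos by simp
  have 1: "(LINT x|lborel. (\<eta> 0 + prim h x) * n x) = (LINT x|lborel. \<eta> x * n x)"
  proof (intro Bochner_Integration.integral_cong refl)
    fix x show "(\<eta> 0 + prim h x) * n x = \<eta> x * n x"
    proof (cases "x \<in> {0<..<l}")
      case True
      then show ?thesis using arg_cong[OF D(3)[of x], of "\<lambda>z. z * n x"] by auto
    qed (simp add: n0)
  qed
  have 2: "(LINT x|lborel. h x * (m 0 + prim n x)) = (LINT x|lborel. h x * m x)"
  proof (intro Bochner_Integration.integral_cong refl)
    fix x show "h x * (m 0 + prim n x) = h x * m x"
    proof (cases "x \<in> {0<..<l}")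
      case True
      then show ?thesis using arg_cong[OF mx[of x], of "\<lambda>z. h x * z"] by auto
    qed (simp add: D(2))
  qed
  have ien: "integrable lborel (\<lambda>x. \<eta> x * n x)"
  proof -
    have "integrable lborel (\<lambda>x. \<eta> 0 * n x + prim h x * n x)" using n integrable_prim_mult[OF D(4) n] by simp
    moreover have "\<eta> 0 * n x + prim h x * n x = \<eta> x * n x" for x
    proof (cases "x \<in> {0<..<l}")
      case True
      then show ?thesis using arg_cong[OF D(3)[of x], of "\<lambda>z. z * n x"] by (auto simp: distrib_right)
    qed (simp add: n0)
    ultimately show ?thesis by simp
  qed
  have 3: "(LINT x|lborel. (ind x * \<eta> x) * (LINT t|lborel. v t x * k t))
     = (LINT x|lborel. (ind x * (q x * \<eta> x)) * (LINT t|lborel. u t x * prim k t) - \<eta> x * n x)"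
    by (intro Bochner_Integration.integral_cong refl) (simp add: n_def algebra_simps indicator_def)
  have "(LINT x|lborel. (ind x * \<eta> x) * (LINT t|lborel. v t x * k t))
    = (LINT x|lborel. (ind x * (q x * \<eta> x)) * (LINT t|lborel. u t x * prim k t)) - (LINT x|lborel. \<eta> x * n x)"
    unfolding 3 using u_pairing_integrable2[OF eta pk] ien by simp
  moreover have "(LINT x|lborel. \<eta> x * n x) + (LINT x|lborel. h x * m x) = \<eta> l * m l - \<eta> 0 * m 0"
    using prod D(3)[OF l0] mx[OF l0] unfolding 1 2 by simp
  ultimately show ?thesis
    unfolding v_pairing[OF eta k(1)] w_pairing[OF eta pk] u_pairing[OF eta pk] m_def by linarith
qed

end

subsection \<open>Exact control of a string\<close>

lemma prim_indicator_interval: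
  assumes i: "integrable lborel (\<lambda>y. indicator {0<..<l} y * h y)" and x: "x \<in> {0..l}"
  shows "prim (\<lambda>y. indicator {0<..<l} y * h y) x = (LINT y|lborel. indicator {0<..<x} y * h y)"
  unfolding prim_def
proof (rule integral_cong_AE)
  show "AE y in lborel. indicator {..x} y * (indicator {0<..<l} y * h y) = indicator {0<..<x} y * h y"
    using AE_lborel_neq[of x] by eventually_elim (use x in \<open>auto simp: indicator_def\<close>)
  have "(\<lambda>y. indicator {0<..<x} y * (indicator {0<..<l} y * h y)) \<in> borel_measurable lborel"
    by (rule borel_measurable_integrable[OF integrable_indicator[OF i]]) simp
  moreover have "(\<lambda>y. indicator {0<..<x} y * (indicator {0<..<l} y * h y)) = (\<lambda>y. indicator {0<..<x} y * h y)"
    using x by (auto simp: fun_eq_iff indicator_def)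
  ultimately show "(\<lambda>y. indicator {0<..<x} y * h y) \<in> borel_measurable lborel" by simp
qed (rule borel_measurable_integrable[OF integrable_indicator[OF i]], simp)

text \<open>Passage from the coordinate \<open>s\<close> of a string to the coordinate
  \<open>x\<close> of an edge on it; for \<open>d = -1\<close> the edge runs against the
  string.\<close>

lemma primitive_change:
  fixes f Phi :: "real \<Rightarrow> real"
  assumes Phi: "\<And>s. 0 \<le> s \<Longrightarrow> Phi s = C + (LINT r|lborel. indicator {0<..<s} r * f r)"
    and i: "\<And>s. 0 \<le> s \<Longrightarrow> integrable lborel (\<lambda>r. indicator {0<..<s} r * f r)"
    and c: "0 \<le> c" "0 \<le> c + d * x" "0 \<le> x" and d: "d \<in> {1,-1}"
  shows "Phi (c + d * x) - Phi c = d * (LINT y|lborel. indicator {0<..<x} y * f (c + d * y))"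
    and "integrable lborel (\<lambda>y. indicator {0<..<x} y * f (c + d * y))"
proof -
  define s where "s = max c (c + d * x)"
  define F where "F r = indicator {0<..<s} r * f r" for r
  have s: "0 \<le> s" using c by (simp add: s_def le_max_iff_disj)
  have iF: "integrable lborel F" unfolding F_def using i[OF s] by simp
  have F0: "Phi r = C + prim F r" if "r \<in> {0..s}" for r
    unfolding F_def using prim_indicator_interval[OF i[OF s] that] Phi[of r] that by simp
  have "d * (prim F (c + d * x) - prim F c) = (LINT y|lborel. indicator {0<..<x} y * F (c + d * y))"
    by (rule prim_shift_diff[OF iF c(3) d])
  moreover have eq: "(\<lambda>y. indicator {0<..<x} y * F (c + d * y)) = (\<lambda>y. indicator {0<..<x} y * f (c + d * y))"
  proof
    fix y show "indicator {0<..<x} y * F (c + d * y) = indicator {0<..<x} y * f (c + d * y)"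
      using c d by (auto simp: F_def s_def indicator_def)
  qed
  moreover have "d * d = 1" using d by auto
  ultimately show "Phi (c + d * x) - Phi c = d * (LINT y|lborel. indicator {0<..<x} y * f (c + d * y))"
  proof -
    have "Phi (c + d * x) - Phi c = prim F (c + d * x) - prim F c"
      using F0[of c] F0[of "c + d * x"] c by (simp add: s_def)
    also have "\<dots> = (d * d) * (prim F (c + d * x) - prim F c)" using \<open>d * d = 1\<close> by simp
    also have "\<dots> = d * (LINT y|lborel. indicator {0<..<x} y * F (c + d * y))"
      unfolding prim_shift_diff[OF iF c(3) d, symmetric] by simp
    finally show ?thesis unfolding eq .
  qed
  have "integrable lborel (\<lambda>y. indicator {0<..<x} y * F (c + d * y))"
    by (intro integrable_indicator lborel_integrable_real_affine iF) (use d in auto)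
  then show "integrable lborel (\<lambda>y. indicator {0<..<x} y * f (c + d * y))" unfolding eq .
qed

lemma
  assumes f: "square_integrable (\<lambda>s. indicator {0<..<L} s * f s)" and d: "d \<in> {1,-1}"
    and m: "\<And>x. x \<in> {0<..<l} \<Longrightarrow> c + d * x \<in> {0<..<L}"
  shows square_integrable_sub: "square_integrable (\<lambda>x. indicator {0<..<l} x * f (c + d * x))"
    and energy_sub: "energy (\<lambda>x. indicator {0<..<l} x * f (c + d * x)) \<le> energy (\<lambda>s. indicator {0<..<L} s * f s)"
proof -
  have d0: "d \<noteq> 0" "\<bar>d\<bar> = 1" using d by auto
  have eq: "(\<lambda>x. indicator {0<..<l} x * f (c + d * x)) = (\<lambda>x. indicator {0<..<l} x * (\<lambda>s. indicator {0<..<L} s * f s) (c + d * x))"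
    using m by (auto simp: fun_eq_iff indicator_def)
  note S = square_integrable_affine[OF f d0(1), of c]
  show "square_integrable (\<lambda>x. indicator {0<..<l} x * f (c + d * x))"
    unfolding eq by (rule square_integrable_indicator(1)[OF S]) simp
  have "energy (\<lambda>x. indicator {0<..<l} x * f (c + d * x)) \<le> energy (\<lambda>x. (\<lambda>s. indicator {0<..<L} s * f s) (c + d * x))"
    unfolding eq by (rule square_integrable_indicator(2)[OF S]) simp
  also have "\<dots> = energy (\<lambda>s. indicator {0<..<L} s * f s)" by (subst energy_affine[OF d0(1)]) (simp add: d0)
  finally show "energy (\<lambda>x. indicator {0<..<l} x * f (c + d * x)) \<le> energy (\<lambda>s. indicator {0<..<L} s * f s)" .
qed

context wave_weight begin

lemma
  assumes Z: "weighted Z K"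
  shows weighted_slice_square: "square_integrable (\<lambda>t. Z (s, t))"
    and weighted_slice_energy: "energy (\<lambda>t. Z (s, t)) \<le> K\<^sup>2 * exp (2 * lam * \<bar>s\<bar>) * exp (lam * Lam) * wt_mass"
proof -
  note [measurable] = weighted_measurable[OF Z]
  have le2: "(Z (s, t))\<^sup>2 \<le> K\<^sup>2 * exp (2 * lam * \<bar>s\<bar>) * exp (lam * Lam) * exp (lam * mu t)" for t
  proof -
    have "\<bar>Z (s, t)\<bar>\<^sup>2 \<le> (K * (exp (lam * \<bar>s\<bar>) * exp (lam * mu t)))\<^sup>2"
      by (rule power_mono) (use weightedD(1)[OF Z, of s t] in \<open>simp_all add: wt_eq\<close>)
    also have "\<dots> = K\<^sup>2 * exp (2 * lam * \<bar>s\<bar>) * (exp (lam * mu t) * exp (lam * mu t))"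
    proof -
      have "exp (2 * lam * \<bar>s\<bar>) = (exp (lam * \<bar>s\<bar>))\<^sup>2" by (simp add: power2_eq_square exp_add[symmetric])
      then show ?thesis by (simp add: power_mult_distrib power2_eq_square)
    qed
    also have "\<dots> \<le> K\<^sup>2 * exp (2 * lam * \<bar>s\<bar>) * (exp (lam * Lam) * exp (lam * mu t))"
      using mu_le[of t] lam_pos by (intro mult_left_mono mult_right_mono) auto
    finally show ?thesis by (simp add: mult.assoc)
  qed
  have i2: "integrable lborel (\<lambda>t. K\<^sup>2 * exp (2 * lam * \<bar>s\<bar>) * exp (lam * Lam) * exp (lam * mu t))"
    by (intro integrable_mult_right integrable_exp_mu)
  have i3: "integrable lborel (\<lambda>t. (Z (s, t))\<^sup>2)"
    by (rule Bochner_Integration.integrable_bound[OF i2]) (use le2 in \<open>auto intro!: AE_I2 intro: order_trans[OF _ abs_ge_self]\<close>)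
  have "(\<lambda>t. Z (s, t)) \<in> borel_measurable borel" by measurable
  then show "square_integrable (\<lambda>t. Z (s, t))" using i3 by (simp add: square_integrable_def)
  have "energy (\<lambda>t. Z (s, t)) \<le> (LINT t|lborel. K\<^sup>2 * exp (2 * lam * \<bar>s\<bar>) * exp (lam * Lam) * exp (lam * mu t))"
    unfolding energy_def by (rule integral_mono[OF i3 i2 le2])
  also have "\<dots> = K\<^sup>2 * exp (2 * lam * \<bar>s\<bar>) * exp (lam * Lam) * (LINT t|lborel. exp (lam * mu t))" by simp
  also have "\<dots> \<le> K\<^sup>2 * exp (2 * lam * \<bar>s\<bar>) * exp (lam * Lam) * wt_mass"
    using integral_exp_mu by (intro mult_left_mono) auto
  finally show "energy (\<lambda>t. Z (s, t)) \<le> K\<^sup>2 * exp (2 * lam * \<bar>s\<bar>) * exp (lam * Lam) * wt_mass" .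
qed

lemma wt_mass_nonneg: "0 \<le> wt_mass"
proof -
  have "0 \<le> (LINT t|lborel. exp (lam * mu t))" by simp
  then show ?thesis using integral_exp_mu by linarith
qed

end

context wave_string begin

text \<open>One bound for the energies in time of slope, velocity and value on all lines
  \<open>s = const\<close> of the string. It becomes the constant \<open>N\<close> of
  \<open>edge_wave\<close>, and the norms of the controls are estimated by it.\<close>

definition time_bound :: real where
  "time_bound = 4 * energy p + 4 * energy g1 + 2 * ((B * L * (K + G))\<^sup>2 * exp (2 * lam * L) * exp (lam * Lam) * wt_mass)
     + (K + G)\<^sup>2 * exp (2 * lam * L) * exp (lam * Lam) * wt_mass"

lemma time_bounds:
  assumes s: "s \<in> {0..L}"
  shows "energy (slope s) \<le> time_bound" "energy (vel s) \<le> time_bound" "energy (\<lambda>t. U (s, t)) \<le> time_bound"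
proof -
  have e: "exp (2 * lam * s) \<le> exp (2 * lam * L)" using s lam_pos by simp
  have 1: "2 * ((B * L * (K + G))\<^sup>2 * exp (2 * lam * s) * exp (lam * Lam) * wt_mass)
     \<le> 2 * ((B * L * (K + G))\<^sup>2 * exp (2 * lam * L) * exp (lam * Lam) * wt_mass)"
    using e wt_mass_nonneg by (intro mult_left_mono mult_right_mono) auto
  have 2: "(K + G)\<^sup>2 * exp (2 * lam * \<bar>s\<bar>) * exp (lam * Lam) * wt_mass \<le> (K + G)\<^sup>2 * exp (2 * lam * L) * exp (lam * Lam) * wt_mass"
    using e s wt_mass_nonneg by (intro mult_left_mono mult_right_mono) auto
  have p: "0 \<le> 4 * energy p + 4 * energy g1 + 2 * ((B * L * (K + G))\<^sup>2 * exp (2 * lam * L) * exp (lam * Lam) * wt_mass)"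
    "0 \<le> (K + G)\<^sup>2 * exp (2 * lam * L) * exp (lam * Lam) * wt_mass"
    using wt_mass_nonneg by auto
  show "energy (slope s) \<le> time_bound" "energy (vel s) \<le> time_bound"
    using slope_energy[of s] vel_energy[of s] s 1 p(2) unfolding time_bound_def by auto
  show "energy (\<lambda>t. U (s, t)) \<le> time_bound"
    using weighted_slice_energy[OF U_w, of s] 2 p(1) unfolding time_bound_def by linarith
qed

lemma Y_start: "Y (0, t) = 0" using Y_space(1)[of 0 t] by simp

text \<open>The part of the string that the edge covers is parametrized by \<open>s = c + d x\<close>; the sign \<open>sg\<close> is \<open>-1\<close>
  on \<open>e\<^sub>1\<close>, and \<open>ka\<close> tells whether this part lies beyond the jump.\<close>

lemma edge_wave_sub:
  assumes l: "0 < l" and q: "continuous_on {0..l} q" and d: "d \<in> {1,-1}" and sg: "sg \<in> {1,-1}"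
    and m0: "\<And>x. x \<in> {0..l} \<Longrightarrow> c + d * x \<in> {0..L}"
    and m: "\<And>x. x \<in> {0<..<l} \<Longrightarrow> c + d * x \<in> {0<..<L}"
    and ka: "\<And>x. x \<in> {0<..<l} \<Longrightarrow> indicator {a<..} (c + d * x) = ka"
    and qQ: "\<And>x. x \<in> {0<..<l} \<Longrightarrow> q x = Q (c + d * x)"
  shows "edge_wave l q (\<lambda>t x. sg * (Y (c + d * x, t) + ka * g t)) (\<lambda>t x. sg * d * slope (c + d * x) t)
    (\<lambda>t x. sg * vel (c + d * x) t) time_bound"
proof -
  have dd: "d * d = 1" "d\<^sup>2 = 1" "sg * sg = 1" "sg\<^sup>2 = 1" "(sg * d)\<^sup>2 = 1" using d sg by auto
  have c0: "0 \<le> c" using m0[of 0] l by simp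
  have cx: "0 \<le> c + d * x" if "x \<in> {0..l}" for x using m0[OF that] by simp
  have cx': "c + d * x \<in> {0..L}" "0 \<le> c + d * x" if "x \<in> {0<..<l}" for x using m[OF that] by auto
  have uU: "sg * (Y (c + d * x, t) + ka * g t) = sg * U (c + d * x, t)" if "x \<in> {0<..<l}" for x t
    using ka[OF that] by (simp add: with_jump_def)
  show ?thesis
  proof
    show "0 < l" "continuous_on {0..l} q" by (rule l, rule q)
    show "continuous_on UNIV (\<lambda>p. sg * (Y (c + d * snd p, fst p) + ka * g (fst p)))"
      by (intro continuous_intros continuous_on_compose2[OF Y_cont] continuous_on_compose2[OF g_cont]) auto
    have slm: "(\<lambda>p. slope (c + d * snd p) (fst p)) \<in> borel_measurable (borel \<Otimes>\<^sub>M borel)"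
    proof -
      have "(\<lambda>p. (\<lambda>q. slope (fst q) (snd q)) (c + d * snd p, fst p)) \<in> borel_measurable (borel \<Otimes>\<^sub>M borel)"
        by (rule measurable_compose[OF _ slope_measurable]) measurable
      then show ?thesis by simp
    qed
    have vm: "(\<lambda>p. vel (c + d * snd p) (fst p)) \<in> borel_measurable (borel \<Otimes>\<^sub>M borel)"
    proof -
      have "(\<lambda>p. (\<lambda>q. vel (fst q) (snd q)) (c + d * snd p, fst p)) \<in> borel_measurable (borel \<Otimes>\<^sub>M borel)"
        by (rule measurable_compose[OF _ vel_measurable]) measurable
      then show ?thesis by simp
    qed
    show "(\<lambda>p. sg * d * slope (c + d * snd p) (fst p)) \<in> borel_measurable (borel \<Otimes>\<^sub>M borel)"
      using slm by measurable
    show "(\<lambda>p. sg * vel (c + d * snd p) (fst p)) \<in> borel_measurable (borel \<Otimes>\<^sub>M borel)"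
      using vm by measurable
    have sls: "square_integrable (\<lambda>x. indicator {0<..<l} x * slope (c + d * x) t)" for t
      by (rule square_integrable_sub[OF slope_space_square d m])
    have vs: "square_integrable (\<lambda>x. indicator {0<..<l} x * vel (c + d * x) t)" for t
      by (rule square_integrable_sub[OF vel_space_square d m])
    show "square_integrable (\<lambda>x. indicator {0<..<l} x * (sg * d * slope (c + d * x) t))" for t
      using square_integrable_cmult[OF sls[of t], of "sg * d"] by (simp add: mult_ac)
    show "square_integrable (\<lambda>x. indicator {0<..<l} x * (sg * vel (c + d * x) t))" for t
      using square_integrable_cmult[OF vs[of t], of sg] by (simp add: mult_ac)
    show "sg * (Y (c + d * x, t) + ka * g t) = sg * (Y (c + d * 0, t) + ka * g t) + prim (\<lambda>x. indicator {0<..<l} x * (sg * d * slope (c + d * x) t)) x"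
      if x: "x \<in> {0..l}" for x t
    proof -
      have Y1: "Y (s, t) = 0 + (LINT r|lborel. indicator {0<..<s} r * slope r t)" if "0 \<le> s" for s
        using Y_space(1)[OF that] by simp
      have D: "Y (c + d * x, t) - Y (c, t) = d * (LINT y|lborel. indicator {0<..<x} y * slope (c + d * y) t)"
        by (rule primitive_change(1)[where Phi="\<lambda>s. Y (s, t)", OF Y1 Y_space(2) c0 cx[OF x] _ d]) (use x in auto)
      have i: "integrable lborel (\<lambda>y. indicator {0<..<l} y * slope (c + d * y) t)"
        by (rule square_integrable_supported(1)[OF sls, of l]) auto
      have "prim (\<lambda>x. indicator {0<..<l} x * (sg * d * slope (c + d * x) t)) x = sg * d * prim (\<lambda>x. indicator {0<..<l} x * slope (c + d * x) t) x"
        unfolding prim_cmult[symmetric] by (simp add: mult_ac)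
      also have "\<dots> = sg * (Y (c + d * x, t) - Y (c, t))"
        unfolding D prim_indicator_interval[OF i x] by simp
      finally show ?thesis by (simp add: algebra_simps)
    qed
    show "integrable lborel (\<lambda>t. sg * vel (c + d * x) t)" if "x \<in> {0<..<l}" for x
      using vel_integrable[OF cx'(2)[OF that]] by simp
    show "sg * (Y (c + d * x, t) + ka * g t) = sg * (Y (c + d * x, 0) + ka * g 0)
        + (prim (\<lambda>t. sg * vel (c + d * x) t) t - prim (\<lambda>t. sg * vel (c + d * x) t) 0)"
      if x: "x \<in> {0<..<l}" for x t
      unfolding uU[OF x] prim_cmult using arg_cong[OF U_time[OF cx'(2)[OF x], of t], of "\<lambda>z. sg * z"]
      by (simp add: distrib_left right_diff_distrib)
    show "square_integrable (\<lambda>t. sg * (Y (c + d * x, t) + ka * g t))" if x: "x \<in> {0<..<l}" for x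
      unfolding uU[OF x] by (rule square_integrable_cmult[OF weighted_slice_square[OF U_w]])
    show "square_integrable (\<lambda>t. sg * d * slope (c + d * x) t)" if x: "x \<in> {0<..<l}" for x
      by (rule square_integrable_cmult[OF slope_square[OF cx'(2)[OF x]]])
    show "square_integrable (\<lambda>t. sg * vel (c + d * x) t)" if x: "x \<in> {0<..<l}" for x
      by (rule square_integrable_cmult[OF vel_square[OF cx'(2)[OF x]]])
    show "energy (\<lambda>t. sg * (Y (c + d * x, t) + ka * g t)) \<le> time_bound" if x: "x \<in> {0<..<l}" for x
      unfolding uU[OF x] energy_cmult dd using time_bounds(3)[OF cx'(1)[OF x]] by simp
    show "energy (\<lambda>t. sg * d * slope (c + d * x) t) \<le> time_bound" if x: "x \<in> {0<..<l}" for x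
      unfolding energy_cmult dd using time_bounds(1)[OF cx'(1)[OF x]] by simp
    show "energy (\<lambda>t. sg * vel (c + d * x) t) \<le> time_bound" if x: "x \<in> {0<..<l}" for x
      unfolding energy_cmult dd using time_bounds(2)[OF cx'(1)[OF x]] by simp
    show "((\<lambda>t. energy (\<lambda>x. indicator {0<..<l} x * (sg * d * slope (c + d * x) t - sg * d * slope (c + d * x) t0))) \<longlongrightarrow> 0) (at t0)" for t0
    proof (rule tendsto_sandwich[OF _ _ tendsto_const slope_tendsto[of t0]])
      show "\<forall>\<^sub>F t in at t0. energy (\<lambda>x. indicator {0<..<l} x * (sg * d * slope (c + d * x) t - sg * d * slope (c + d * x) t0))
         \<le> energy (\<lambda>s. indicator {0<..<L} s * (slope s t - slope s t0))"
      proof (intro always_eventually allI)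
        fix t
        have "energy (\<lambda>x. indicator {0<..<l} x * (sg * d * slope (c + d * x) t - sg * d * slope (c + d * x) t0))
           = energy (\<lambda>x. (sg * d) * (indicator {0<..<l} x * (slope (c + d * x) t - slope (c + d * x) t0)))"
          by (simp add: algebra_simps)
        also have "\<dots> = energy (\<lambda>x. indicator {0<..<l} x * (slope (c + d * x) t - slope (c + d * x) t0))"
          unfolding energy_cmult dd by simp
        also have "\<dots> \<le> energy (\<lambda>s. indicator {0<..<L} s * (slope s t - slope s t0))"
        proof (rule energy_sub[where f="\<lambda>s. slope s t - slope s t0", OF _ d m])
          show "square_integrable (\<lambda>s. indicator {0<..<L} s * (slope s t - slope s t0))"
            using square_integrable_diff[OF slope_space_square[of t] slope_space_square[of t0]] by (simp add: right_diff_distrib)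
        qed
        finally show "energy (\<lambda>x. indicator {0<..<l} x * (sg * d * slope (c + d * x) t - sg * d * slope (c + d * x) t0))
         \<le> energy (\<lambda>s. indicator {0<..<L} s * (slope s t - slope s t0))" .
      qed
    qed simp
    show "((\<lambda>t. energy (\<lambda>x. indicator {0<..<l} x * (sg * vel (c + d * x) t - sg * vel (c + d * x) t0))) \<longlongrightarrow> 0) (at t0)" for t0
    proof (rule tendsto_sandwich[OF _ _ tendsto_const vel_tendsto[of t0]])
      show "\<forall>\<^sub>F t in at t0. energy (\<lambda>x. indicator {0<..<l} x * (sg * vel (c + d * x) t - sg * vel (c + d * x) t0))
         \<le> energy (\<lambda>s. indicator {0<..<L} s * (vel s t - vel s t0))"
      proof (intro always_eventually allI)
        fix t
        have "energy (\<lambda>x. indicator {0<..<l} x * (sg * vel (c + d * x) t - sg * vel (c + d * x) t0))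
           = energy (\<lambda>x. sg * (indicator {0<..<l} x * (vel (c + d * x) t - vel (c + d * x) t0)))"
          by (simp add: algebra_simps)
        also have "\<dots> = energy (\<lambda>x. indicator {0<..<l} x * (vel (c + d * x) t - vel (c + d * x) t0))"
          unfolding energy_cmult dd by simp
        also have "\<dots> \<le> energy (\<lambda>s. indicator {0<..<L} s * (vel s t - vel s t0))"
        proof (rule energy_sub[where f="\<lambda>s. vel s t - vel s t0", OF _ d m])
          show "square_integrable (\<lambda>s. indicator {0<..<L} s * (vel s t - vel s t0))"
            using square_integrable_diff[OF vel_space_square[of t] vel_space_square[of t0]] by (simp add: right_diff_distrib)
        qed
        finally show "energy (\<lambda>x. indicator {0<..<l} x * (sg * vel (c + d * x) t - sg * vel (c + d * x) t0))
         \<le> energy (\<lambda>s. indicator {0<..<L} s * (vel s t - vel s t0))" .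
      qed
    qed simp
    fix k :: "real \<Rightarrow> real" and M
    assume k: "integrable lborel k" and kb: "\<And>y. \<bar>k y\<bar> \<le> M"
    define n where "n r = Q r * (LINT t|lborel. U (r, t) * prim k t) - (LINT t|lborel. vel r t * k t)" for r
    have ne: "indicator {0<..<l} y * (q y * (LINT t|lborel. sg * (Y (c + d * y, t) + ka * g t) * prim k t) - (LINT t|lborel. sg * vel (c + d * y) t * k t))
       = sg * (indicator {0<..<l} y * n (c + d * y))" for y
    proof (cases "y \<in> {0<..<l}")
      case True
      have "(LINT t|lborel. sg * (Y (c + d * y, t) + ka * g t) * prim k t) = sg * (LINT t|lborel. U (c + d * y, t) * prim k t)"
        unfolding uU[OF True] by (simp add: mult.assoc)
      moreover have "(LINT t|lborel. sg * vel (c + d * y) t * k t) = sg * (LINT t|lborel. vel (c + d * y) t * k t)"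
        by (simp add: mult.assoc)
      ultimately show ?thesis using True qQ[OF True] by (simp add: n_def algebra_simps)
    qed simp
    have W1: "(LINT t|lborel. slope s t * prim k t) = (LINT t|lborel. p t * prim k t) + (LINT r|lborel. indicator {0<..<s} r * n r)" if "0 \<le> s" for s
      unfolding n_def by (rule slope_weak(1)[OF that k kb])
    have W2: "integrable lborel (\<lambda>r. indicator {0<..<s} r * n r)" if "0 \<le> s" for s
      unfolding n_def by (rule slope_weak(2)[OF that k kb])
    note P = primitive_change[where Phi="\<lambda>s. LINT t|lborel. slope s t * prim k t", OF W1 W2 c0 cx _ d]
    have il: "integrable lborel (\<lambda>y. indicator {0<..<l} y * n (c + d * y))"
      by (rule P(2)) (use l in auto)
    show "integrable lborel (\<lambda>y. indicator {0<..<l} y * (q y * (LINT t|lborel. sg * (Y (c + d * y, t) + ka * g t) * prim k t) - (LINT t|lborel. sg * vel (c + d * y) t * k t)))"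
      unfolding ne using il by simp
    fix x assume x: "x \<in> {0..l}"
    \<comment> \<open>The slope on the edge carries the factor \<open>sg * d\<close>, and its
      derivative in \<open>x\<close> another \<open>d\<close>; as \<open>d * d = 1\<close>, the sign
      \<open>sg\<close> of value and velocity is left.\<close>
    have "(LINT t|lborel. slope (c + d * x) t * prim k t) - (LINT t|lborel. slope c t * prim k t)
       = d * (LINT y|lborel. indicator {0<..<x} y * n (c + d * y))"
      by (rule P(1)) (use x in auto)
    then have "sg * d * (LINT t|lborel. slope (c + d * x) t * prim k t) = sg * d * (LINT t|lborel. slope c t * prim k t)
       + sg * (d * d) * (LINT y|lborel. indicator {0<..<x} y * n (c + d * y))" by (simp add: algebra_simps)
    then show "(LINT t|lborel. sg * d * slope (c + d * x) t * prim k t) = (LINT t|lborel. sg * d * slope (c + d * 0) t * prim k t)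
       + prim (\<lambda>y. indicator {0<..<l} y * (q y * (LINT t|lborel. sg * (Y (c + d * y, t) + ka * g t) * prim k t) - (LINT t|lborel. sg * vel (c + d * y) t * k t))) x"
      unfolding ne prim_cmult prim_indicator_interval[OF il x] dd(1) by (simp add: mult.assoc)
  qed
qed

end

context wave_weight begin

text \<open>The two states amount to values of \<open>ray 1\<close> and \<open>ray (-1)\<close> at
  the times 0 and \<open>T\<close>. Since \<open>ray e s t0\<close> contains \<open>p\<close> only
  at \<open>t0 + e * s\<close>, each condition fixes \<open>p\<close> on one half window, up to the
  transported term of the unknown solution, which \<open>control_fixpoint\<close> takes care of. The
  numerical constants collect the factors 2 of \<open>sum_sq_le\<close> and
  \<open>energy_add_le\<close>.\<close>

lemma string_exists:
  assumes F: "square_integrable F" and S: "square_integrable S"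
    and g1: "square_integrable g1" "integrable lborel g1" and gp: "\<And>t. g t = g 0 + (prim g1 t - prim g1 0)"
    and g: "\<And>t. \<bar>g t\<bar> \<le> G * exp (lam * mu t)" and a: "0 \<le> a"
  defines "D \<equiv> energy F + energy S + energy g1 + G\<^sup>2"
  obtains p Y K where "wave_string L B Lam lam T Q a G K p g g1 Y"
    "K\<^sup>2 \<le> (128 * L + 50) * D"
    "energy p \<le> 16 * (8 + 2 * ((B * L * exp (lam * (L + Lam)))\<^sup>2 * (256 * L + 102) * L)) * D"
    "\<And>s. s \<in> {0<..<L} \<Longrightarrow> wave_string.slope Q a p g g1 Y s T = F s"
    "\<And>s. s \<in> {0<..<L} \<Longrightarrow> wave_string.vel Q a p g g1 Y s T = S s"
    "\<And>s. s \<in> {0<..<L} \<Longrightarrow> wave_string.slope Q a p g g1 Y s 0 = 0"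
    "\<And>s. s \<in> {0<..<L} \<Longrightarrow> wave_string.vel Q a p g g1 Y s 0 = 0"
proof -
  define D' where "D' = energy F + energy S + energy g1"
  have D': "0 \<le> D'" by (simp add: D'_def)
  have D: "D = D' + G\<^sup>2" by (simp add: D_def D'_def)
  \<comment> \<open>The prescribed value of \<open>U_s + e U_t\<close>: that of the target at
    \<open>T\<close> and that of rest at 0. The part due to the jump is known and is subtracted in
    \<open>E\<close>.\<close>
  define H where "H t0 e x = (if t0 = T then F x + e * S x else 0)" for t0 e x :: real
  define E where "E t0 e x = H t0 e x - e * (indicator {a<..} x * g1 (t0 + e * (x - a)))" for t0 e x
  have Esq: "square_integrable (on_window (E t0 e))" "energy (on_window (E t0 e)) \<le> 4 * D'" if e: "e \<in> {1,-1}" for t0 e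
  proof -
    have e0: "e \<noteq> 0" "\<bar>e\<bar> = 1" "e\<^sup>2 = 1" using e by auto
    have Hs: "square_integrable (H t0 e)"
      unfolding H_def by (cases "t0 = T") (auto intro!: square_integrable_add square_integrable_cmult F S)
    have He: "energy (H t0 e) \<le> 2 * energy F + 2 * energy S"
      unfolding H_def using energy_add_le[OF F square_integrable_cmult[OF S, of e]] energy_nonneg[of F] energy_nonneg[of S]
      by (cases "t0 = T") (auto simp: energy_cmult e0)
    have gs: "square_integrable (\<lambda>x. g1 ((t0 - e * a) + e * x))" by (rule square_integrable_affine[OF g1(1) e0(1)])
    let ?g = "\<lambda>x. e * (indicator {a<..} x * g1 ((t0 - e * a) + e * x))"
    have gi: "square_integrable ?g" by (intro square_integrable_cmult square_integrable_indicator(1) gs) auto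
    have ge: "energy ?g \<le> energy g1"
    proof -
      have "energy ?g \<le> energy (\<lambda>x. g1 ((t0 - e * a) + e * x))"
        unfolding energy_cmult e0 using square_integrable_indicator(2)[OF gs, of "{a<..}"] by simp
      also have "\<dots> = energy g1" by (subst energy_affine[OF e0(1)]) (simp add: e0)
      finally show ?thesis .
    qed
    have Eeq: "E t0 e = (\<lambda>x. H t0 e x - ?g x)" by (simp add: E_def fun_eq_iff algebra_simps)
    have Es: "square_integrable (E t0 e)" unfolding Eeq by (rule square_integrable_diff[OF Hs gi])
    show "square_integrable (on_window (E t0 e))"
      unfolding on_window_def[abs_def] by (rule square_integrable_indicator(1)[OF Es]) simp
    have "energy (on_window (E t0 e)) \<le> energy (E t0 e)"
      unfolding on_window_def[abs_def] by (rule square_integrable_indicator(2)[OF Es]) simp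
    also have "\<dots> \<le> 2 * energy (H t0 e) + 2 * energy ?g" unfolding Eeq by (rule energy_diff_le[OF Hs gi])
    also have "\<dots> \<le> 4 * D'" using He ge energy_nonneg[of g1] unfolding D'_def by argo
    finally show "energy (on_window (E t0 e)) \<le> 4 * D'" .
  qed
  \<comment> \<open>On a window of length \<open>L\<close> the integral of the modulus is at most
    the square root of \<open>L\<close> times the energy, and this energy is at most
    \<open>4 * D'\<close>.\<close>
  define M where "M = sqrt (L * (4 * D'))"
  have M2: "M\<^sup>2 = L * (4 * D')" using L_pos D' by (simp add: M_def)
  have Ei: "integrable lborel (on_window (E t0 e))" "(LINT x|lborel. \<bar>on_window (E t0 e) x\<bar>) \<le> M" if e: "e \<in> {1,-1}" for t0 e
  proof -
    have z: "on_window (E t0 e) x = 0" if "x \<notin> {0<..<L}" for x using that by (simp add: on_window_def)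
    show "integrable lborel (on_window (E t0 e))" by (rule square_integrable_supported(1)[OF Esq(1)[OF e] z])
    have "(\<lambda>x. \<bar>on_window (E t0 e) x\<bar>) = (\<lambda>x. \<bar>indicator {0..L} x * on_window (E t0 e) x\<bar>)"
      using z by (auto simp: fun_eq_iff on_window_def indicator_def)
    then have "(LINT x|lborel. \<bar>on_window (E t0 e) x\<bar>) = (LINT x|lborel. \<bar>indicator {0..L} x * on_window (E t0 e) x\<bar>)" by simp
    also have "\<dots> \<le> sqrt (energy (indicator {0..L}) * energy (on_window (E t0 e)))"
      by (rule abs_product_integral_le[OF square_integrable_indicator_interval Esq(1)[OF e]])
    also have "\<dots> \<le> M"
      unfolding M_def using Esq(2)[OF e] L_pos by (intro real_sqrt_le_mono mult_mono) (auto simp: energy_indicator_interval)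
    finally show "(LINT x|lborel. \<bar>on_window (E t0 e) x\<bar>) \<le> M" .
  qed
  have gc: "continuous_on UNIV g"
  proof -
    have "continuous_on UNIV (\<lambda>t. g 0 + (prim g1 t - prim g1 0))"
      by (intro continuous_intros prim_continuous g1)
    moreover have "(\<lambda>t. g 0 + (prim g1 t - prim g1 0)) = g" by (intro ext) (rule gp[symmetric])
    ultimately show ?thesis by (simp only:)
  qed
  obtain Y where Yw: "weighted Y (4 * M + 5 * G)" and Yc: "continuous_on UNIV Y"
    and Yeq: "\<And>s t. Y (s, t) = jump g a s t
      + half_diff (window (\<lambda>t0 e x. E t0 e x - transp Q (with_jump Y g a) e x t0)) s t
      + duhamel Q (with_jump Y g a) s t"
    using control_fixpoint[of E M g G a] Ei gc g a by blast
  define U where "U = with_jump Y g a"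
  define K where "K = 4 * M + 5 * G"
  have gm: "g \<in> borel_measurable borel" by (rule borel_measurable_continuous_onI[OF gc])
  have Uw: "weighted U (K + G)" unfolding U_def K_def by (rule weighted_with_jump[OF Yw g gm])
  define J where "J t0 e x = E t0 e x - transp Q U e x t0" for t0 e x
  define p where "p = window J"
  \<comment> \<open>Twice the squares of 4 and 5, together with
    \<open>M\<^sup>2 = 4 * L * D'\<close>, give 128 and 50.\<close>
  have K2: "K\<^sup>2 \<le> (128 * L + 50) * D"
  proof -
    have "K\<^sup>2 \<le> 2 * (4 * M)\<^sup>2 + 2 * (5 * G)\<^sup>2" unfolding K_def by (rule sum_sq_le)
    also have "\<dots> = 32 * M\<^sup>2 + 50 * G\<^sup>2" by (simp add: power_mult_distrib)
    also have "\<dots> = 128 * L * D' + 50 * G\<^sup>2" unfolding M2 by simp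
    also have "\<dots> \<le> (128 * L + 50) * D" unfolding D using L_pos D' by (simp add: algebra_simps)
    finally show ?thesis .
  qed
  have KG: "(K + G)\<^sup>2 \<le> (256 * L + 102) * D"
  proof -
    have "(K + G)\<^sup>2 \<le> 2 * K\<^sup>2 + 2 * G\<^sup>2" by (rule sum_sq_le)
    also have "\<dots> \<le> 2 * ((128 * L + 50) * D) + 2 * D" using K2 D' unfolding D by simp
    also have "\<dots> = (256 * L + 102) * D" by (simp add: algebra_simps)
    finally show ?thesis .
  qed
  define W where "W = B * L * (K + G) * exp (lam * (L + Lam))"
  have W2: "W\<^sup>2 \<le> (B * L * exp (lam * (L + Lam)))\<^sup>2 * ((256 * L + 102) * D)"
  proof -
    have "W\<^sup>2 = (B * L * exp (lam * (L + Lam)))\<^sup>2 * (K + G)\<^sup>2" by (simp add: W_def power_mult_distrib mult_ac)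
    also have "\<dots> \<le> (B * L * exp (lam * (L + Lam)))\<^sup>2 * ((256 * L + 102) * D)" by (rule mult_left_mono[OF KG]) simp
    finally show ?thesis .
  qed
  have Js: "square_integrable (on_window (J t0 e))" "energy (on_window (J t0 e)) \<le> 8 * D' + 2 * (W\<^sup>2 * L)" if e: "e \<in> {1,-1}" for t0 e
  proof -
    have tw: "on_window (\<lambda>x. transp Q U e x t0) = (\<lambda>s. indicator {0<..<L} s * transp Q U e s t0)"
      by (simp add: on_window_def fun_eq_iff)
    have ts: "square_integrable (on_window (\<lambda>x. transp Q U e x t0))" unfolding tw by (rule transp_space_square[OF Uw e])
    have te: "energy (on_window (\<lambda>x. transp Q U e x t0)) \<le> W\<^sup>2 * (L - 0)"
    proof (rule square_integrable_bounded_support(2))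
      show "on_window (\<lambda>x. transp Q U e x t0) \<in> borel_measurable borel" by (rule square_integrable_measurable[OF ts])
      have W0: "0 \<le> W" using B_nonneg L_pos weightedD(2)[OF Uw] by (simp add: W_def)
      show "\<bar>on_window (\<lambda>x. transp Q U e x t0) x\<bar> \<le> W" for x
      proof (cases "x \<in> {0<..<L}")
        case True
        then show ?thesis using transp_space_bound[OF Uw e True, of t0] by (simp add: on_window_def W_def)
      qed (use W0 in \<open>simp add: on_window_def\<close>)
    qed (use L_pos in \<open>auto simp: on_window_def\<close>)
    have Jeq: "on_window (J t0 e) = (\<lambda>x. on_window (E t0 e) x - on_window (\<lambda>x. transp Q U e x t0) x)"
      by (simp add: on_window_def J_def fun_eq_iff right_diff_distrib)
    show "square_integrable (on_window (J t0 e))" unfolding Jeq by (rule square_integrable_diff[OF Esq(1)[OF e] ts])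
    have "energy (on_window (J t0 e)) \<le> 2 * energy (on_window (E t0 e)) + 2 * energy (on_window (\<lambda>x. transp Q U e x t0))"
      unfolding Jeq by (rule energy_diff_le[OF Esq(1)[OF e] ts])
    then show "energy (on_window (J t0 e)) \<le> 8 * D' + 2 * (W\<^sup>2 * L)" using Esq(2)[OF e, of t0] te by simp
  qed
  define R where "R = 8 * D' + 2 * (W\<^sup>2 * L)"
  have ps: "square_integrable (piece t0 e (J t0 e))" "energy (piece t0 e (J t0 e)) \<le> R" if e: "e \<in> {1,-1}" for t0 e
  proof -
    have e0: "e \<noteq> 0" "\<bar>e\<bar> = 1" using e by auto
    have pe: "piece t0 e (J t0 e) = (\<lambda>t. on_window (J t0 e) (- e * t0 + e * t))" by (rule ext) (rule piece_eq)
    show "square_integrable (piece t0 e (J t0 e))" unfolding pe by (rule square_integrable_affine[OF Js(1)[OF e] e0(1)])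
    show "energy (piece t0 e (J t0 e)) \<le> R"
      unfolding pe R_def by (subst energy_affine[OF e0(1)]) (use Js(2)[OF e] in \<open>simp add: e0\<close>)
  qed
  have e1: "(1::real) \<in> {1,-1}" "(-1::real) \<in> {1,-1}" by auto
  have peq: "p = (\<lambda>t. (piece 0 1 (J 0 1) t + piece 0 (-1) (J 0 (-1)) t) + (piece T 1 (J T 1) t + piece T (-1) (J T (-1)) t))"
    unfolding p_def window_def sum4 ..
  note s1 = square_integrable_add[OF ps(1)[OF e1(1), of 0] ps(1)[OF e1(2), of 0]]
  note s2 = square_integrable_add[OF ps(1)[OF e1(1), of T] ps(1)[OF e1(2), of T]]
  have psq: "square_integrable p" unfolding peq by (rule square_integrable_add[OF s1 s2])
  \<comment> \<open>Four pieces added in two rounds of \<open>energy_add_le\<close>: a factor 4 from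
    the rounds and 4 from the number of pieces.\<close>
  have pen: "energy p \<le> 16 * R"
  proof -
    have "energy p \<le> 2 * energy (\<lambda>t. piece 0 1 (J 0 1) t + piece 0 (-1) (J 0 (-1)) t) + 2 * energy (\<lambda>t. piece T 1 (J T 1) t + piece T (-1) (J T (-1)) t)"
      unfolding peq by (rule energy_add_le[OF s1 s2])
    also have "\<dots> \<le> 2 * (2 * R + 2 * R) + 2 * (2 * R + 2 * R)"
      by (intro add_mono mult_left_mono order_trans[OF energy_add_le[OF ps(1)[OF e1(1)] ps(1)[OF e1(2)]]] ps(2) e1) auto
    finally show ?thesis by simp
  qed
  have pen': "energy p \<le> 16 * (8 + 2 * ((B * L * exp (lam * (L + Lam)))\<^sup>2 * (256 * L + 102) * L)) * D"
  proof -
    have "R \<le> 8 * D + 2 * (((B * L * exp (lam * (L + Lam)))\<^sup>2 * ((256 * L + 102) * D)) * L)"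
      unfolding R_def using L_pos by (intro add_mono mult_left_mono mult_right_mono W2) (auto simp: D)
    also have "\<dots> = (8 + 2 * ((B * L * exp (lam * (L + Lam)))\<^sup>2 * (256 * L + 102) * L)) * D"
      by (simp add: algebra_simps)
    finally have "16 * R \<le> 16 * ((8 + 2 * ((B * L * exp (lam * (L + Lam)))\<^sup>2 * (256 * L + 102) * L)) * D)" by simp
    then show ?thesis using pen unfolding mult.assoc by (rule order_trans[rotated])
  qed
  have pint: "integrable lborel p"
    unfolding p_def by (rule window_integrable) (use Js(1) in \<open>auto intro!: square_integrable_supported(1)[where l=L] simp: on_window_def\<close>)
  have ws: "wave_string L B Lam lam T Q a G K p g g1 Y"
  proof
    show "weighted Y K" using Yw by (simp add: K_def)
    show "Y (s, t) = jump g a s t + half_diff p s t + duhamel Q (with_jump Y g a) s t" for s t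
      using Yeq[of s t] by (simp only: p_def J_def[abs_def] U_def)
  qed (rule a psq pint g1 gp g Yc)+
  interpret ws: wave_string L B Lam lam T Q a G K p g g1 Y by (rule ws)
  \<comment> \<open>By the choice of \<open>J\<close> the jump part and the transported term in
    \<open>ray\<close> are compensated, and the prescribed value remains.\<close>
  have ray: "ws.ray e x t0 = H t0 e x" if "t0 \<in> {0,T}" "e \<in> {1,-1}" "x \<in> {0<..<L}" for t0 e x
  proof -
    have "p (t0 + e * x) = J t0 e x" unfolding p_def using that by (intro window_at) auto
    then show ?thesis by (simp add: ws.ray_def J_def E_def U_def)
  qed
  show ?thesis
  proof (rule that[OF ws K2 pen'])
    fix s assume s: "s \<in> {0<..<L}"
    show "ws.slope s T = F s" "ws.vel s T = S s" "ws.slope s 0 = 0" "ws.vel s 0 = 0"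
      using ray[of T 1 s] ray[of T "-1" s] ray[of 0 1 s] ray[of 0 "-1" s] s T_pos
      by (simp_all add: ws.slope_def ws.vel_def H_def)
  qed
qed

end

subsection \<open>The star graph\<close>

lemma sum3: "(\<Sum>j\<in>{1,2,3::nat}. (f j :: real)) = f 1 + f 2 + f 3"
  by simp

text \<open>Sums the edge identities. At the boundary vertices the boundary terms vanish with
  \<open>\<eta>\<close>; at the centre the coupling conditions leave only the control term. The edge
  functions live on the whole time axis, so the limits within \<open>{0..T}\<close> are restrictions
  of unrestricted ones.\<close>

lemma weak_solution_edges:
  fixes l :: "nat \<Rightarrow> real" and U W V :: "nat \<Rightarrow> real \<Rightarrow> real \<Rightarrow> real"
  assumes E: "\<And>j. j \<in> {1,2,3} \<Longrightarrow> edge_wave (l j) (q j) (U j) (W j) (V j) (N j)"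
    and U0: "\<And>j x. j \<in> {1,2,3} \<Longrightarrow> x \<in> {0..l j} \<Longrightarrow> U j 0 x = 0"
    and V0: "\<And>j x. j \<in> {1,2,3} \<Longrightarrow> x \<in> {0<..<l j} \<Longrightarrow> V j 0 x = 0"
    and bc: "\<And>t. U 1 t (l 1) = f1 t" "\<And>t. U 2 t (l 2) = 0" "\<And>t. U 3 t (l 3) = 0"
      "\<And>t. U 1 t 0 + U 2 t 0 + U 3 t 0 = 0"
    and vertex: "\<And>t. W 3 t 0 = W 1 t 0" "\<And>t. f2 t = W 2 t 0 - W 1 t 0"
    and sq: "square_integrable (\<lambda>t. W 1 t 0)" "square_integrable (\<lambda>t. W 2 t 0)"
  shows "weak_solution l q T f1 f2 (\<lambda>t j. U j t) (\<lambda>t j. V j t)"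
  unfolding weak_solution_def
proof (intro conjI ballI)
  fix t
  show "(\<lambda>j. U j t) \<in> graph_H1 l" "(\<lambda>j. V j t) \<in> graph_L2 l"
    using edge_wave.u_H1[OF E] edge_wave.v_L2[OF E] by (auto simp: graph_H1_def graph_L2_def)
  show "U 1 t (l 1) = f1 t" "U 2 t (l 2) = 0" "U 3 t (l 3) = 0" by (rule bc)+
  show "(\<Sum>j\<in>{1,2,3}. U j t 0) = 0" using bc(4) unfolding sum3 by simp
next
  fix s
  have "((\<lambda>t. sqrt (\<Sum>j\<in>{1,2,3}. (L2_norm (l j) (weak_deriv (l j) (\<lambda>x. U j t x - U j s x)))\<^sup>2 + (L2_norm (l j) (\<lambda>x. U j t x - U j s x))\<^sup>2)) \<longlongrightarrow> sqrt (\<Sum>j\<in>{1,2,3::nat}. 0)) (at s)"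
    by (intro tendsto_real_sqrt tendsto_sum edge_wave.H1_lim[OF E])
  then show "((\<lambda>t. graph_H1_norm l (\<lambda>j x. U j t x - U j s x)) \<longlongrightarrow> 0) (at s within {0..T})"
    unfolding graph_H1_norm_def by (auto intro: tendsto_within_subset)
  have "((\<lambda>t. sqrt (\<Sum>j\<in>{1,2,3}. (L2_norm (l j) (\<lambda>x. (U j t x - U j s x) / (t - s) - V j s x))\<^sup>2)) \<longlongrightarrow> sqrt (\<Sum>j\<in>{1,2,3::nat}. 0)) (at s)"
    by (intro tendsto_real_sqrt tendsto_sum edge_wave.quotient_lim[OF E])
  then show "((\<lambda>t. graph_L2_norm l (\<lambda>j x. (U j t x - U j s x) / (t - s) - V j s x)) \<longlongrightarrow> 0) (at s within {0..T})"
    unfolding graph_L2_norm_def by (auto intro: tendsto_within_subset)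
  have "((\<lambda>t. sqrt (\<Sum>j\<in>{1,2,3}. (L2_norm (l j) (\<lambda>x. V j t x - V j s x))\<^sup>2)) \<longlongrightarrow> sqrt (\<Sum>j\<in>{1,2,3::nat}. 0)) (at s)"
    by (intro tendsto_real_sqrt tendsto_sum edge_wave.L2_lim[OF E])
  then show "((\<lambda>t. graph_L2_norm l (\<lambda>j x. V j t x - V j s x)) \<longlongrightarrow> 0) (at s within {0..T})"
    unfolding graph_L2_norm_def by (auto intro: tendsto_within_subset)
next
  fix j :: nat assume j: "j \<in> {1,2,3}"
  show "U j 0 x = 0" if "x \<in> {0..l j}" for x by (rule U0[OF j that])
  show "AE x in lebesgue. x \<in> {0<..<l j} \<longrightarrow> V j 0 x = 0" using V0[OF j] by (intro AE_I2) auto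
next
  fix \<eta> assume eta: "\<eta> \<in> graph_H10 l"
  have l_pos: "0 < l j" if "j \<in> {1,2,3}" for j using edge_wave.l_pos[OF E[OF that]] .
  have "\<exists>h. ac_rep (l j) (\<eta> j) h" if j: "j \<in> {1,2,3}" for j
  proof -
    have "\<eta> j \<in> H1_space (l j)" using eta j unfolding graph_H10_def graph_H1_def by blast
    from H1_space_ac[OF l_pos[OF j] this] show ?thesis by blast
  qed
  then obtain h where h: "\<And>j. j \<in> {1,2,3} \<Longrightarrow> ac_rep (l j) (\<eta> j) (h j)" by metis
  have eta_l: "\<eta> j (l j) = 0" if "j \<in> {1,2,3}" for j using eta that by (auto simp: graph_H10_def)
  have "(\<Sum>j\<in>{1,2,3}. \<eta> j 0) = 0" using eta unfolding graph_H10_def by blast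
  then have eta_0: "\<eta> 1 0 + \<eta> 2 0 + \<eta> 3 0 = 0" unfolding sum3 .
  define A where "A j t = (LINT x:{0<..<l j}|lebesgue. V j t x * \<eta> j x)" for j t
  define Bw where "Bw j t = (LINT x:{0<..<l j}|lebesgue. weak_deriv (l j) (U j t) x * weak_deriv (l j) (\<eta> j) x)" for j t
  define Cu where "Cu j t = (LINT x:{0<..<l j}|lebesgue. q j x * U j t x * \<eta> j x)" for j t
  have iA: "integrable lborel (\<lambda>t. A j t * k t)" and iB: "integrable lborel (\<lambda>t. Bw j t * k t)"
    and iC: "integrable lborel (\<lambda>t. Cu j t * k t)" if j: "j \<in> {1,2,3}" and k: "square_integrable k" for j k
    unfolding A_def Bw_def Cu_def
    by (rule edge_wave.v_pairing_integrable[OF E[OF j] h[OF j] k] edge_wave.w_pairing_integrable[OF E[OF j] h[OF j] k]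
        edge_wave.u_pairing_integrable[OF E[OF j] h[OF j] k])+
  define At where "At t = A 1 t + A 2 t + A 3 t" for t
  define Rt where "Rt t = - ((Bw 1 t + Bw 2 t + Bw 3 t) + (Cu 1 t + Cu 2 t + Cu 3 t) + f2 t * \<eta> 2 0)" for t
  have At: "graph_L2_inner l (\<lambda>j. V j t) \<eta> = At t" for t
    unfolding graph_L2_inner_def sum3 At_def A_def ..
  have Rt: "- (graph_L2_inner l (graph_weak_deriv l (\<lambda>j. U j t)) (graph_weak_deriv l \<eta>) +
      graph_L2_inner l (\<lambda>j x. q j x * U j t x) \<eta> + f2 t * \<eta> 2 0) = Rt t" for t
    unfolding graph_L2_inner_def graph_weak_deriv_def sum3 Rt_def Bw_def Cu_def ..
  have j3: "(1::nat) \<in> {1,2,3}" "(2::nat) \<in> {1,2,3}" "(3::nat) \<in> {1,2,3}" by auto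
  have f2_sq: "square_integrable f2"
  proof -
    have "f2 = (\<lambda>t. W 2 t 0 - W 1 t 0)" by (rule ext) (rule vertex(2))
    then show ?thesis using square_integrable_diff[OF sq(2,1)] by (simp only:)
  qed
  have iAt: "integrable lborel (\<lambda>t. At t * k t)" if k: "square_integrable k" for k
    unfolding At_def distrib_right by (intro Bochner_Integration.integrable_add iA[OF _ k] j3)
  have iRt: "integrable lborel (\<lambda>t. Rt t * k t)" if k: "square_integrable k" for k
  proof -
    have "integrable lborel (\<lambda>t. - ((Bw 1 t * k t + Bw 2 t * k t + Bw 3 t * k t) + (Cu 1 t * k t + Cu 2 t * k t + Cu 3 t * k t) + \<eta> 2 0 * (f2 t * k t)))"
      by (intro Bochner_Integration.integrable_minus Bochner_Integration.integrable_add iB[OF _ k] iC[OF _ k] integrable_mult_right square_integrable_product f2_sq k j3)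
    then show ?thesis unfolding Rt_def by (simp add: algebra_simps)
  qed
  show "has_weak_deriv T (\<lambda>t. graph_L2_inner l (\<lambda>j. V j t) \<eta>)
      (\<lambda>t. - (graph_L2_inner l (graph_weak_deriv l (\<lambda>j. U j t)) (graph_weak_deriv l \<eta>) +
          graph_L2_inner l (\<lambda>j x. q j x * U j t x) \<eta> + f2 t * \<eta> 2 0))"
    unfolding At Rt has_weak_deriv_def
  proof (intro conjI allI impI)
    fix a b :: real
    have "set_integrable lebesgue {a..b} At \<longleftrightarrow> integrable lborel (\<lambda>t. At t * indicator {a..b} t)"
      using borel_measurable_integrable[OF iAt[OF square_integrable_indicator_interval]]
      by (intro set_integrable_lebesgue_iff) auto
    then show "set_integrable lebesgue {a..b} At" using iAt[OF square_integrable_indicator_interval] by simp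
    have "set_integrable lebesgue {a..b} Rt \<longleftrightarrow> integrable lborel (\<lambda>t. Rt t * indicator {a..b} t)"
      using borel_measurable_integrable[OF iRt[OF square_integrable_indicator_interval]]
      by (intro set_integrable_lebesgue_iff) auto
    then show "set_integrable lebesgue {a..b} Rt" using iRt[OF square_integrable_indicator_interval] by simp
  next
    fix \<psi> assume tf: "test_function T \<psi>"
    obtain k a b where k: "deriv \<psi> = k" "\<psi> = prim k" "integrable lborel k" "square_integrable k"
      "0 < a" "b < T" "\<And>x. x \<notin> {a..b} \<Longrightarrow> \<psi> x = 0" "\<And>x. x \<notin> {a..b} \<Longrightarrow> k x = 0" "continuous_on UNIV k"
      using test_function_prim[OF tf] by metis
    obtain M where M: "\<And>x. \<bar>k x\<bar> \<le> M" using test_function_bounded[OF k(9,8)] by metis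
    have pc: "continuous_on UNIV \<psi>" unfolding k(2) by (rule prim_continuous[OF k(3)])
    obtain M' where M': "\<And>x. \<bar>\<psi> x\<bar> \<le> M'" using test_function_bounded[OF pc k(7)] by metis
    have psq: "square_integrable \<psi>"
      by (rule square_integrable_bounded_support(1)[OF borel_measurable_continuous_onI[OF pc] M' k(7)])
    have psq': "square_integrable (prim k)" using psq by (simp add: k(2))
    have k0: "k x = 0" "\<psi> x = 0" if "x \<notin> {0<..<T}" for x using k(5-8) that by auto
    have L: "(LINT t:{0<..<T}|lebesgue. At t * deriv \<psi> t) = (LINT t|lborel. At t * k t)"
      unfolding k(1)
    proof (rule set_integral_lebesgue_eq)
      show "(\<lambda>t. At t * k t) \<in> borel_measurable borel" using borel_measurable_integrable[OF iAt[OF k(4)]] by simp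
      show "AE x in lebesgue. indicator {0<..<T} x *\<^sub>R (At x * k x) = At x * k x"
        using k0(1) by (intro AE_I2) (auto simp: indicator_def)
    qed
    have R: "(LINT t:{0<..<T}|lebesgue. Rt t * \<psi> t) = (LINT t|lborel. Rt t * \<psi> t)"
    proof (rule set_integral_lebesgue_eq)
      show "(\<lambda>t. Rt t * \<psi> t) \<in> borel_measurable borel" using borel_measurable_integrable[OF iRt[OF psq]] by simp
      show "AE x in lebesgue. indicator {0<..<T} x *\<^sub>R (Rt x * \<psi> x) = Rt x * \<psi> x"
        using k0(2) by (intro AE_I2) (auto simp: indicator_def)
    qed
    define m where "m j = (LINT t|lborel. W j t 0 * \<psi> t)" for j
    have id: "(LINT t|lborel. A j t * k t) = (LINT t|lborel. Bw j t * \<psi> t) + (LINT t|lborel. Cu j t * \<psi> t) + \<eta> j 0 * m j"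
      if j: "j \<in> {1,2,3}" for j
      unfolding A_def Bw_def Cu_def m_def
      using edge_wave.edge_identity[OF E[OF j] h[OF j] k(4) k(3) M psq'] unfolding eta_l[OF j] k(2)[symmetric] by simp
    have "(LINT t|lborel. At t * k t) = (LINT t|lborel. A 1 t * k t) + (LINT t|lborel. A 2 t * k t) + (LINT t|lborel. A 3 t * k t)"
      unfolding At_def distrib_right using iA[OF _ k(4)] by simp
    also have "\<dots> = ((LINT t|lborel. Bw 1 t * \<psi> t) + (LINT t|lborel. Bw 2 t * \<psi> t) + (LINT t|lborel. Bw 3 t * \<psi> t))
       + ((LINT t|lborel. Cu 1 t * \<psi> t) + (LINT t|lborel. Cu 2 t * \<psi> t) + (LINT t|lborel. Cu 3 t * \<psi> t))
       + (\<eta> 1 0 * m 1 + \<eta> 2 0 * m 2 + \<eta> 3 0 * m 3)"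
      unfolding id[OF j3(1)] id[OF j3(2)] id[OF j3(3)] by simp
    \<comment> \<open>Equal tested slopes on the edges 1 and 3, combined with the vanishing sum of
      the values of \<open>\<eta>\<close> at the centre, leave
      \<open>\<eta> 2 0 * (m 2 - m 1)\<close>.\<close>
    also have "\<eta> 1 0 * m 1 + \<eta> 2 0 * m 2 + \<eta> 3 0 * m 3 = \<eta> 2 0 * (LINT t|lborel. f2 t * \<psi> t)"
    proof -
      have m3: "m 3 = m 1" unfolding m_def vertex(1) ..
      have "(LINT t|lborel. f2 t * \<psi> t) = (LINT t|lborel. W 2 t 0 * \<psi> t - W 1 t 0 * \<psi> t)"
        by (simp add: vertex(2) left_diff_distrib)
      also have "\<dots> = m 2 - m 1"
        unfolding m_def using square_integrable_product[OF sq(1) psq] square_integrable_product[OF sq(2) psq] by simp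
      finally have f: "(LINT t|lborel. f2 t * \<psi> t) = m 2 - m 1" .
      have e3: "\<eta> 3 0 = - \<eta> 1 0 - \<eta> 2 0" using eta_0 by simp
      show ?thesis unfolding f m3 e3 by (simp add: algebra_simps)
    qed
    also have "((LINT t|lborel. Bw 1 t * \<psi> t) + (LINT t|lborel. Bw 2 t * \<psi> t) + (LINT t|lborel. Bw 3 t * \<psi> t))
       + ((LINT t|lborel. Cu 1 t * \<psi> t) + (LINT t|lborel. Cu 2 t * \<psi> t) + (LINT t|lborel. Cu 3 t * \<psi> t))
       + \<eta> 2 0 * (LINT t|lborel. f2 t * \<psi> t) = - (LINT t|lborel. Rt t * \<psi> t)"
    proof -
      have "(LINT t|lborel. Rt t * \<psi> t) = (LINT t|lborel. - ((Bw 1 t * \<psi> t + Bw 2 t * \<psi> t + Bw 3 t * \<psi> t) + (Cu 1 t * \<psi> t + Cu 2 t * \<psi> t + Cu 3 t * \<psi> t) + \<eta> 2 0 * (f2 t * \<psi> t)))"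
        by (intro Bochner_Integration.integral_cong refl) (simp add: Rt_def algebra_simps)
      then show ?thesis using iB[OF _ psq] iC[OF _ psq] square_integrable_product[OF f2_sq psq] by simp
    qed
    finally show "(LINT t:{0<..<T}|lebesgue. At t * deriv \<psi> t) = - (LINT t:{0<..<T}|lebesgue. Rt t * \<psi> t)"
      unfolding L R .
  qed
qed

text \<open>The bounds on \<open>K\<close> and on \<open>time_bound\<close> are the estimates that
  are passed on: from the first string to the jump of the second, and from both to the
  controls.\<close>

definition controlled_string where
  "controlled_string L B Lam lam T Q a g g1 F S G C p Y K \<longleftrightarrow>
     wave_string L B Lam lam T Q a G K p g g1 Y \<and>
     K\<^sup>2 \<le> C * (energy F + energy S + energy g1 + G\<^sup>2) \<and>
     wave_string.time_bound L B Lam lam G K p g1 \<le> C * (energy F + energy S + energy g1 + G\<^sup>2) \<and>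
     (\<forall>s\<in>{0<..<L}. wave_string.slope Q a p g g1 Y s T = F s \<and> wave_string.vel Q a p g g1 Y s T = S s \<and>
        wave_string.slope Q a p g g1 Y s 0 = 0 \<and> wave_string.vel Q a p g g1 Y s 0 = 0)"

text \<open>Fixes the order of the quantifiers: \<open>C\<close> comes before the time, the
  potential and the data, so that it can depend only on \<open>L\<close>, \<open>B\<close>,
  \<open>Lam\<close> and \<open>lam\<close>.\<close>

definition string_controllable where
  "string_controllable L B Lam lam C \<longleftrightarrow>
     (\<forall>T Q a g g1 F S G. wave_weight L B Lam lam T Q \<longrightarrow> square_integrable F \<longrightarrow> square_integrable S \<longrightarrow>
        square_integrable g1 \<longrightarrow> integrable lborel g1 \<longrightarrow> (\<forall>t. g t = g 0 + (prim g1 t - prim g1 0)) \<longrightarrow>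
        (\<forall>t. \<bar>g t\<bar> \<le> G * exp (lam * wave_weight.mu Lam T t)) \<longrightarrow> 0 \<le> a \<longrightarrow>
        (\<exists>p Y K. controlled_string L B Lam lam T Q a g g1 F S G C p Y K))"

lemma string_control:
  fixes L B Lam lam :: real
  assumes L: "0 < L"
  obtains C where "0 \<le> C" "string_controllable L B Lam lam C"
proof -
  \<comment> \<open>That \<open>wt_mass\<close> is nonnegative is known under the assumptions of
    \<open>wave_weight\<close>, which involve a time and a potential that are not yet given.\<close>
  define m where "m = max 0 (wave_weight.wt_mass Lam lam)"
  define cK where "cK = 128 * L + 50"
  define cP where "cP = 16 * (8 + 2 * ((B * L * exp (lam * (L + Lam)))\<^sup>2 * (256 * L + 102) * L))"
  define X where "X = exp (2 * lam * L) * exp (lam * Lam) * m"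
  \<comment> \<open>The terms of \<open>time_bound\<close> with \<open>energy p\<close> and the
    square of \<open>K + G\<close> replaced by their bounds; the latter gives
    \<open>2 * cK + 2\<close>.\<close>
  define cT where "cT = 4 * cP + 4 + 2 * ((B * L)\<^sup>2 * (2 * cK + 2) * X) + (2 * cK + 2) * X"
  have c0: "0 \<le> cK" "0 \<le> cP" "0 \<le> X" using L by (auto simp: cK_def cP_def X_def m_def)
  then have cT0: "0 \<le> cT" by (simp add: cT_def)
  show ?thesis
  proof (rule that[of "cK + cT"])
    show "0 \<le> cK + cT" using c0 cT0 by simp
    show "string_controllable L B Lam lam (cK + cT)"
      unfolding string_controllable_def
    proof (intro allI impI)
      fix T :: real and Q :: "real \<Rightarrow> real" and a :: real and g g1 F S :: "real \<Rightarrow> real" and G :: real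
      assume ww: "wave_weight L B Lam lam T Q" and F: "square_integrable F" and S: "square_integrable S"
        and g1: "square_integrable g1" "integrable lborel g1" and gp': "\<forall>t. g t = g 0 + (prim g1 t - prim g1 0)"
        and g': "\<forall>t. \<bar>g t\<bar> \<le> G * exp (lam * wave_weight.mu Lam T t)" and a: "0 \<le> a"
      have gp: "\<And>t. g t = g 0 + (prim g1 t - prim g1 0)" using gp' by blast
      have g: "\<And>t. \<bar>g t\<bar> \<le> G * exp (lam * wave_weight.mu Lam T t)" using g' by blast
      define D where "D = energy F + energy S + energy g1 + G\<^sup>2"
      have D: "0 \<le> D" by (simp add: D_def)
      obtain p Y K where ws: "wave_string L B Lam lam T Q a G K p g g1 Y"
        and K: "K\<^sup>2 \<le> cK * D" and p: "energy p \<le> cP * D"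
        and tg: "\<And>s. s \<in> {0<..<L} \<Longrightarrow> wave_string.slope Q a p g g1 Y s T = F s"
          "\<And>s. s \<in> {0<..<L} \<Longrightarrow> wave_string.vel Q a p g g1 Y s T = S s"
          "\<And>s. s \<in> {0<..<L} \<Longrightarrow> wave_string.slope Q a p g g1 Y s 0 = 0"
          "\<And>s. s \<in> {0<..<L} \<Longrightarrow> wave_string.vel Q a p g g1 Y s 0 = 0"
        using wave_weight.string_exists[OF ww F S g1 gp g a] unfolding cK_def cP_def D_def by metis
      have m: "wave_weight.wt_mass Lam lam = m" using wave_weight.wt_mass_nonneg[OF ww] by (simp add: m_def)
      have KG: "(K + G)\<^sup>2 \<le> (2 * cK + 2) * D"
      proof -
        have "(K + G)\<^sup>2 \<le> 2 * K\<^sup>2 + 2 * G\<^sup>2" by (rule sum_sq_le)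
        also have "\<dots> \<le> 2 * (cK * D) + 2 * D" using K by (intro add_mono mult_left_mono) (auto simp: D_def)
        finally show ?thesis by (simp add: algebra_simps)
      qed
      have "wave_string.time_bound L B Lam lam G K p g1
         = 4 * energy p + 4 * energy g1 + 2 * ((B * L)\<^sup>2 * (K + G)\<^sup>2 * X) + (K + G)\<^sup>2 * X"
        unfolding wave_string.time_bound_def[OF ws] m X_def by (simp add: power_mult_distrib mult_ac)
      also have "\<dots> \<le> 4 * (cP * D) + 4 * D + 2 * ((B * L)\<^sup>2 * ((2 * cK + 2) * D) * X) + ((2 * cK + 2) * D) * X"
        using p KG c0(3) by (intro add_mono mult_left_mono mult_right_mono) (auto simp: D_def)
      also have "\<dots> = cT * D" by (simp add: cT_def algebra_simps)
      finally have tb: "wave_string.time_bound L B Lam lam G K p g1 \<le> cT * D" .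
      have "cK * D \<le> (cK + cT) * D" "cT * D \<le> (cK + cT) * D" using c0 cT0 D by (auto intro: mult_right_mono)
      then have "K\<^sup>2 \<le> (cK + cT) * D" "wave_string.time_bound L B Lam lam G K p g1 \<le> (cK + cT) * D"
        using K tb by linarith+
      then show "\<exists>p Y K. controlled_string L B Lam lam T Q a g g1 F S G (cK + cT) p Y K"
        using ws tg unfolding controlled_string_def D_def by blast
    qed
  qed
qed


text \<open>A string is steered through the derivative of the first state and through the second
  state, so the part of \<open>graph_H1_norm\<close> without derivatives is dropped. The rest is
  that a sum of squares is at most the square of the sum.\<close>

lemma graph_energy_le:
  assumes l: "\<And>j. j \<in> {1,2,3} \<Longrightarrow> 0 < l j"
    and h: "\<And>j. j \<in> {1,2,3} \<Longrightarrow> ac_rep (l j) (\<phi> j) (h j)"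
    and k: "\<And>j. j \<in> {1,2,3} \<Longrightarrow> interval_rep (l j) (\<psi> j) (k j)"
  shows "(\<Sum>j\<in>{1,2,3::nat}. energy (h j) + energy (k j)) \<le> (graph_H1_norm l \<phi> + graph_L2_norm l \<psi>)\<^sup>2"
proof -
  have hn: "(L2_norm (l j) (weak_deriv (l j) (\<phi> j)))\<^sup>2 = energy (h j)" if "j \<in> {1,2,3}" for j
    using L2_norm_rep[OF weak_deriv_rep[OF l[OF that] h[OF that]]] by simp
  have kn: "(L2_norm (l j) (\<psi> j))\<^sup>2 = energy (k j)" if "j \<in> {1,2,3}" for j
    using L2_norm_rep[OF k[OF that]] by simp
  have H: "(\<Sum>j\<in>{1,2,3::nat}. energy (h j)) \<le> (graph_H1_norm l \<phi>)\<^sup>2"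
  proof -
    have "(\<Sum>j\<in>{1,2,3::nat}. energy (h j)) \<le> (\<Sum>j\<in>{1,2,3::nat}. (L2_norm (l j) (weak_deriv (l j) (\<phi> j)))\<^sup>2 + (L2_norm (l j) (\<phi> j))\<^sup>2)"
      by (rule sum_mono) (simp only: hn, simp)
    moreover have "0 \<le> (\<Sum>j\<in>{1,2,3::nat}. (L2_norm (l j) (weak_deriv (l j) (\<phi> j)))\<^sup>2 + (L2_norm (l j) (\<phi> j))\<^sup>2)"
      by (intro sum_nonneg) auto
    ultimately show ?thesis unfolding graph_H1_norm_def by (simp only: real_sqrt_pow2)
  qed
  have K: "(\<Sum>j\<in>{1,2,3::nat}. energy (k j)) = (graph_L2_norm l \<psi>)\<^sup>2"
  proof -
    have "(\<Sum>j\<in>{1,2,3::nat}. energy (k j)) = (\<Sum>j\<in>{1,2,3::nat}. (L2_norm (l j) (\<psi> j))\<^sup>2)"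
      by (rule sum.cong[OF refl]) (simp only: kn)
    moreover have "0 \<le> (\<Sum>j\<in>{1,2,3::nat}. (L2_norm (l j) (\<psi> j))\<^sup>2)" by (intro sum_nonneg) auto
    ultimately show ?thesis unfolding graph_L2_norm_def by (simp only: real_sqrt_pow2)
  qed
  have n: "0 \<le> graph_H1_norm l \<phi>" "0 \<le> graph_L2_norm l \<psi>"
    unfolding graph_H1_norm_def graph_L2_norm_def by (auto intro!: sum_nonneg)
  have "(graph_H1_norm l \<phi>)\<^sup>2 + (graph_L2_norm l \<psi>)\<^sup>2 \<le> (graph_H1_norm l \<phi> + graph_L2_norm l \<psi>)\<^sup>2"
    using mult_nonneg_nonneg[OF n] by (simp add: power2_sum)
  then show ?thesis using H K by (simp only: sum.distrib)
qed

lemma ac_rep_eqI: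
  assumes f: "ac_rep l f h" and f': "ac_rep l f' h" and y: "y \<in> {0..l}" "f y = f' y" and x: "x \<in> {0..l}"
  shows "f x = f' x"
  using ac_repD(3)[OF f x] ac_repD(3)[OF f' x] ac_repD(3)[OF f y(1)] ac_repD(3)[OF f' y(1)] y(2) by linarith

theorem theorem4:
  fixes l :: "nat \<Rightarrow> real" and q :: "nat \<Rightarrow> real \<Rightarrow> real"
  assumes "\<forall>j\<in>{1,2,3}. 0 < l j"
    and "l 3 \<le> l 2"
    and "\<forall>j\<in>{1,2,3}. continuous_on {0..l j} (q j)"
  shows "\<exists>C. \<forall>T \<ge> 2 * max (l 2) (l 1 + l 3). \<forall>\<phi>1 \<in> graph_H10 l. \<forall>\<phi>2 \<in> graph_L2 l.
           \<exists>f1 \<in> H10_space T. \<exists>f2 \<in> L2_space T. \<exists>u v.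
             weak_solution l q T f1 f2 u v \<and>
             (\<forall>j\<in>{1,2,3}. (\<forall>x\<in>{0..l j}. u T j x = \<phi>1 j x) \<and>
                           (AE x in lebesgue. x \<in> {0<..<l j} \<longrightarrow> v T j x = \<phi>2 j x)) \<and>
             H1_norm T f1 + L2_norm T f2 \<le> C * (graph_H1_norm l \<phi>1 + graph_L2_norm l \<phi>2)"
proof -
  have j3: "(1::nat) \<in> {1,2,3}" "(2::nat) \<in> {1,2,3}" "(3::nat) \<in> {1,2,3}" by auto
  have lp: "\<And>j. j \<in> {1,2,3} \<Longrightarrow> 0 < l j" using assms(1) by blast
  have qc: "\<And>j. j \<in> {1,2,3} \<Longrightarrow> continuous_on {0..l j} (q j)" using assms(3) by blast
  have l: "0 < l 1" "0 < l 2" "0 < l 3" using lp[OF j3(1)] lp[OF j3(2)] lp[OF j3(3)] by auto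
  have "\<exists>M. \<forall>x\<in>{0..l j}. \<bar>q j x\<bar> \<le> M" if "j \<in> {1,2,3}" for j
    by (rule continuous_interval_bounded[OF qc[OF that]])
  then obtain M where M: "\<And>j x. j \<in> {1,2,3} \<Longrightarrow> x \<in> {0..l j} \<Longrightarrow> \<bar>q j x\<bar> \<le> M j" by metis
  define B where "B = \<bar>M 1\<bar> + \<bar>M 2\<bar> + \<bar>M 3\<bar>"
  have B0: "0 \<le> B" by (simp add: B_def)
  have MB: "M j \<le> B" if "j \<in> {1,2,3}" for j using that by (auto simp: B_def)
  \<comment> \<open>Cut off to the open edge, so that the potentials of two edges can be added along
    one string without overlap.\<close>
  define Qb where "Qb j x = indicator {0<..<l j} x * q j x" for j x
  have Qb_m [measurable]: "Qb j \<in> borel_measurable borel" if "j \<in> {1,2,3}" for j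
    unfolding Qb_def[abs_def] by (rule interval_rep_measurable[OF interval_rep_continuous[OF qc[OF that]]])
  have Qb_b: "\<bar>Qb j x\<bar> \<le> B" if "j \<in> {1,2,3}" for j x
    using M[OF that, of x] MB[OF that] B0 by (cases "x \<in> {0<..<l j}") (auto simp: Qb_def)
  have Qb_z: "Qb j x = 0" if "x \<notin> {0<..<l j}" for j x using that by (simp add: Qb_def)
  \<comment> \<open>The total length bounds both strings, so they share one weight. The summand 1 in
    \<open>lam\<close> gives the strict inequality \<open>lam_ge\<close> and also
    \<open>lam_ge1\<close>.\<close>
  define Lam where "Lam = l 1 + l 2 + l 3"
  define lam where "lam = 6 * B * Lam + 1"
  define L where "L = l 3 + l 1"
  have Lp: "0 < L" using l by (simp add: L_def)
  have lam1: "1 \<le> lam" using B0 l by (simp add: lam_def Lam_def)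
  obtain C2 where C2: "0 \<le> C2" "string_controllable (l 2) B Lam lam C2" using string_control[OF l(2)] by metis
  obtain C3 where C3: "0 \<le> C3" "string_controllable L B Lam lam C3" using string_control[OF Lp] by metis
  \<comment> \<open>\<open>c\<close> bounds the data of the second string by the energy of the
    target: 2 for the states on the edges 1 and 3, \<open>C2\<close> for the velocity
    \<open>g1\<close> of the trace, and the last term for its weighted bound \<open>G\<close>.
    \<open>R\<close> bounds the squared norm of either control by the same energy.\<close>
  define c where "c = 2 + C2 + C2 * (exp (lam * l 2))\<^sup>2"
  define R where "R = 2 * (C2 + C3 * c)"
  have c0: "0 \<le> c" using C2 by (simp add: c_def)
  have R0: "0 \<le> R" using C2(1) C3(1) c0 by (simp add: R_def)
  show ?thesis
  proof (intro exI allI ballI impI)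
    fix T :: real and \<phi> \<psi> :: graph_fun
    assume T: "2 * max (l 2) (l 1 + l 3) \<le> T" and phi: "\<phi> \<in> graph_H10 l" and psi: "\<psi> \<in> graph_L2 l"
    have T2: "2 * l 2 \<le> T" and T3: "2 * L \<le> T" using T by (auto simp: L_def max_def split: if_splits)
    have Tp: "0 < T" using T2 l by linarith
    have "\<exists>h. ac_rep (l j) (\<phi> j) h" if j: "j \<in> {1,2,3}" for j
    proof -
      have "\<phi> j \<in> H1_space (l j)" using phi j unfolding graph_H10_def graph_H1_def by blast
      from H1_space_ac[OF lp[OF j] this] show ?thesis by blast
    qed
    then obtain h where h: "\<And>j. j \<in> {1,2,3} \<Longrightarrow> ac_rep (l j) (\<phi> j) (h j)" by metis
    have "\<exists>k. interval_rep (l j) (\<psi> j) k \<and> square_integrable k" if j: "j \<in> {1,2,3}" for j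
    proof -
      have "\<psi> j \<in> L2_space (l j)" using psi j unfolding graph_L2_def by blast
      from L2_space_obtain[OF this] show ?thesis by blast
    qed
    then obtain k where k: "\<And>j. j \<in> {1,2,3} \<Longrightarrow> interval_rep (l j) (\<psi> j) (k j)"
      and ks: "\<And>j. j \<in> {1,2,3} \<Longrightarrow> square_integrable (k j)" by metis
    have hs: "square_integrable (h j)" if "j \<in> {1,2,3}" for j by (rule ac_repD(1)[OF h[OF that]])
    have hz: "h j x = 0" if "j \<in> {1,2,3}" "x \<notin> {0<..<l j}" for j x by (rule ac_repD(2)[OF h[OF that(1)] that(2)])
    have kz: "k j x = 0" if "j \<in> {1,2,3}" "x \<notin> {0<..<l j}" for j x by (rule interval_rep_zero[OF k[OF that(1)] that(2)])
    have phi_l: "\<phi> j (l j) = 0" if "j \<in> {1,2,3}" for j using phi that by (auto simp: graph_H10_def)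
    have "(\<Sum>j\<in>{1,2,3}. \<phi> j 0) = 0" using phi unfolding graph_H10_def by blast
    then have phi_0: "\<phi> 1 0 + \<phi> 2 0 + \<phi> 3 0 = 0" unfolding sum3 .
    define NN where "NN = graph_H1_norm l \<phi> + graph_L2_norm l \<psi>"
    define EE where "EE = (\<Sum>j\<in>{1,2,3::nat}. energy (h j) + energy (k j))"
    have EE: "EE = energy (h 1) + energy (k 1) + (energy (h 2) + energy (k 2)) + (energy (h 3) + energy (k 3))"
      unfolding EE_def sum3 ..
    have EN: "EE \<le> NN\<^sup>2" unfolding EE_def NN_def by (rule graph_energy_le[OF lp h k])
    have NN0: "0 \<le> NN" unfolding NN_def graph_H1_norm_def graph_L2_norm_def by (auto intro!: add_nonneg_nonneg sum_nonneg)

    \<comment> \<open>The string runs from \<open>s = 0\<close> at the boundary vertex 2 to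
      \<open>s = l 2\<close> at the centre, against the coordinate of the edge; hence the sign of
      \<open>F2\<close>.\<close>
    define Q2 where "Q2 s = Qb 2 (l 2 - s)" for s
    define F2 where "F2 s = - h 2 (l 2 - s)" for s
    define S2 where "S2 s = k 2 (l 2 - s)" for s
    have ww2: "wave_weight (l 2) B Lam lam T Q2"
    proof
      show "Q2 \<in> borel_measurable borel" unfolding Q2_def using Qb_m[OF j3(2)] by measurable
      show "\<bar>Q2 y\<bar> \<le> B" for y unfolding Q2_def by (rule Qb_b[OF j3(2)])
      show "Q2 y = 0" if "y \<notin> {0..l 2}" for y unfolding Q2_def by (rule Qb_z) (use that in auto)
    qed (use l T2 lam1 in \<open>auto simp: Lam_def lam_def\<close>)
    have F2s: "square_integrable F2" and S2s: "square_integrable S2"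
      unfolding F2_def S2_def by (intro square_integrable_uminus square_integrable_shift hs ks j3)+
    have F2e: "energy F2 = energy (h 2)" and S2e: "energy S2 = energy (k 2)"
      unfolding F2_def S2_def by (simp_all add: energy_shift)
    \<comment> \<open>No jump on this string: \<open>g = 0\<close>, placed formally at its
      end.\<close>
    obtain p2 Y2 K2 where c2: "controlled_string (l 2) B Lam lam T Q2 (l 2) (\<lambda>_. 0) (\<lambda>_. 0) F2 S2 0 C2 p2 Y2 K2"
      using C2(2)[unfolded string_controllable_def, rule_format, of T Q2 F2 S2 "\<lambda>_. 0" "\<lambda>_. 0" 0 "l 2"] ww2 F2s S2s l by (auto simp: prim_def)
    then have ws2: "wave_string (l 2) B Lam lam T Q2 (l 2) 0 K2 p2 (\<lambda>_. 0) (\<lambda>_. 0) Y2"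
      by (simp add: controlled_string_def)
    interpret s2: wave_string "l 2" B Lam lam T Q2 "l 2" 0 K2 p2 "\<lambda>_. 0" "\<lambda>_. 0" Y2 by (rule ws2)
    have D2: "energy F2 + energy S2 + energy (\<lambda>_. 0) + 0\<^sup>2 \<le> EE"
      unfolding F2e S2e EE by simp
    have K2: "K2\<^sup>2 \<le> C2 * EE" and tb2: "s2.time_bound \<le> C2 * EE"
      using c2 mult_left_mono[OF D2 C2(1)] unfolding controlled_string_def by linarith+
    have tg2: "s2.slope s T = F2 s" "s2.vel s T = S2 s" "s2.slope s 0 = 0" "s2.vel s 0 = 0" if "s \<in> {0<..<l 2}" for s
      using c2 that unfolding controlled_string_def by blast+

    define g where "g t = Y2 (l 2, t)" for t
    define g1 where "g1 = s2.vel (l 2)"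
    \<comment> \<open>The weighted bound on \<open>Y2\<close> at \<open>s = l 2\<close>. Both
      strings have the same function \<open>mu\<close>, so this is an admissible bound for a jump of
      the second string.\<close>
    define G where "G = K2 * exp (lam * l 2)"
    have gU: "s2.U (l 2, t) = g t" for t by (simp add: s2.with_jump_def g_def)
    have g1s: "square_integrable g1" "integrable lborel g1"
      unfolding g1_def using l by (auto intro: s2.vel_square s2.vel_integrable)
    have gp: "g t = g 0 + (prim g1 t - prim g1 0)" for t
      unfolding g1_def gU[symmetric] by (rule s2.U_time) (use l in simp)
    have gle: "\<bar>g t\<bar> \<le> G * exp (lam * s2.mu t)" for t
      using s2.weightedD(1)[OF s2.Y_w, of "l 2" t] l by (simp add: g_def G_def s2.wt_eq)
    have g1e: "energy g1 \<le> C2 * EE"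
      using s2.time_bounds(2)[of "l 2"] tb2 l unfolding g1_def by simp
    have G2: "G\<^sup>2 \<le> C2 * (exp (lam * l 2))\<^sup>2 * EE"
    proof -
      have "G\<^sup>2 = K2\<^sup>2 * (exp (lam * l 2))\<^sup>2" by (simp add: G_def power_mult_distrib)
      also have "\<dots> \<le> (C2 * EE) * (exp (lam * l 2))\<^sup>2" by (rule mult_right_mono[OF K2]) simp
      finally show ?thesis by (simp add: mult_ac)
    qed

    \<comment> \<open>The string starts at the boundary vertex 3, passes the centre at
      \<open>s = l 3\<close> and ends at the boundary vertex 1. Beyond the centre it carries
      \<open>- u1\<close>, hence the minus signs there in \<open>F3\<close> and \<open>S3\<close>;
      before the centre the sign in \<open>F3\<close> comes from the reversed direction.\<close>
    define Q3 where "Q3 s = Qb 3 (l 3 - s) + Qb 1 (s - l 3)" for s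
    define F3 where "F3 s = - h 3 (l 3 - s) - h 1 (s - l 3)" for s
    define S3 where "S3 s = k 3 (l 3 - s) - k 1 (s - l 3)" for s
    have ww3: "wave_weight L B Lam lam T Q3"
    proof
      show "Q3 \<in> borel_measurable borel" unfolding Q3_def using Qb_m[OF j3(1)] Qb_m[OF j3(3)] by measurable
      show "\<bar>Q3 y\<bar> \<le> B" for y
        using Qb_b[OF j3(1), of "y - l 3"] Qb_b[OF j3(3), of "l 3 - y"] Qb_z[of "y - l 3" 1] Qb_z[of "l 3 - y" 3]
        by (cases "y < l 3") (auto simp: Q3_def)
      show "Q3 y = 0" if "y \<notin> {0..L}" for y unfolding Q3_def using that l by (subst (1 2) Qb_z) (auto simp: L_def)
    qed (use l T3 lam1 in \<open>auto simp: Lam_def lam_def L_def\<close>)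
    have F3s: "square_integrable F3" and S3s: "square_integrable S3"
      unfolding F3_def S3_def by (intro square_integrable_diff square_integrable_uminus square_integrable_shift hs ks j3)+
    have F3e: "energy F3 \<le> 2 * energy (h 3) + 2 * energy (h 1)"
      unfolding F3_def using energy_diff_le[OF square_integrable_uminus[OF square_integrable_shift(4)[OF hs[OF j3(3)], of "l 3"]] square_integrable_shift(3)[OF hs[OF j3(1)], of "l 3"]]
      by (simp add: energy_shift)
    have S3e: "energy S3 \<le> 2 * energy (k 3) + 2 * energy (k 1)"
      unfolding S3_def using energy_diff_le[OF square_integrable_shift(4)[OF ks[OF j3(3)], of "l 3"] square_integrable_shift(3)[OF ks[OF j3(1)], of "l 3"]]
      by (simp add: energy_shift)
    obtain p3 Y3 K3 where c3: "controlled_string L B Lam lam T Q3 (l 3) g g1 F3 S3 G C3 p3 Y3 K3"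
      using C3(2)[unfolded string_controllable_def, rule_format, OF ww3 F3s S3s g1s gp gle] l by fastforce
    then have ws3: "wave_string L B Lam lam T Q3 (l 3) G K3 p3 g g1 Y3"
      by (simp add: controlled_string_def)
    interpret s3: wave_string L B Lam lam T Q3 "l 3" G K3 p3 g g1 Y3 by (rule ws3)
    have D3: "energy F3 + energy S3 + energy g1 + G\<^sup>2 \<le> c * EE"
    proof -
      have "2 * energy (h 3) + 2 * energy (h 1) + (2 * energy (k 3) + 2 * energy (k 1)) \<le> 2 * EE"
        unfolding EE using energy_nonneg[of "h 2"] energy_nonneg[of "k 2"] by simp
      then have "energy F3 + energy S3 + energy g1 + G\<^sup>2 \<le> 2 * EE + C2 * EE + C2 * (exp (lam * l 2))\<^sup>2 * EE"
        using F3e S3e g1e G2 by linarith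
      then show ?thesis by (simp add: c_def distrib_right)
    qed
    have tb3: "s3.time_bound \<le> C3 * c * EE"
      using c3 mult_left_mono[OF D3 C3(1)] unfolding controlled_string_def mult.assoc by linarith
    have tg3: "s3.slope s T = F3 s" "s3.vel s T = S3 s" "s3.slope s 0 = 0" "s3.vel s 0 = 0" if "s \<in> {0<..<L}" for s
      using c3 that unfolding controlled_string_def by blast+

    \<comment> \<open>factors \<open>1\<close> and \<open>0\<close> are kept so that the terms match \<open>edge_wave_sub\<close>\<close>
    define u1 where "u1 = (\<lambda>t x. (-1) * (Y3 (l 3 + 1 * x, t) + 1 * g t))"
    define w1 where "w1 = (\<lambda>t x. (-1) * 1 * s3.slope (l 3 + 1 * x) t)"
    define v1 where "v1 = (\<lambda>t x. (-1) * s3.vel (l 3 + 1 * x) t)"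
    define u2 where "u2 = (\<lambda>t x. 1 * (Y2 (l 2 + (-1) * x, t) + 0 * (0::real)))"
    define w2 where "w2 = (\<lambda>t x. 1 * (-1) * s2.slope (l 2 + (-1) * x) t)"
    define v2 where "v2 = (\<lambda>t x. 1 * s2.vel (l 2 + (-1) * x) t)"
    define u3 where "u3 = (\<lambda>t x. 1 * (Y3 (l 3 + (-1) * x, t) + 0 * g t))"
    define w3 where "w3 = (\<lambda>t x. 1 * (-1) * s3.slope (l 3 + (-1) * x) t)"
    define v3 where "v3 = (\<lambda>t x. 1 * s3.vel (l 3 + (-1) * x) t)"
    have e1: "edge_wave (l 1) (q 1) u1 w1 v1 s3.time_bound"
      unfolding u1_def w1_def v1_def
      by (rule s3.edge_wave_sub[OF l(1) qc[OF j3(1)]]) (use l in \<open>auto simp: L_def Q3_def Qb_def\<close>)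
    have e2: "edge_wave (l 2) (q 2) u2 w2 v2 s2.time_bound"
      unfolding u2_def w2_def v2_def
      by (rule s2.edge_wave_sub[OF l(2) qc[OF j3(2)]]) (use l in \<open>auto simp: Q2_def Qb_def\<close>)
    have e3: "edge_wave (l 3) (q 3) u3 w3 v3 s3.time_bound"
      unfolding u3_def w3_def v3_def
      by (rule s3.edge_wave_sub[OF l(3) qc[OF j3(3)]]) (use l in \<open>auto simp: L_def Q3_def Qb_def\<close>)

    \<comment> \<open>\<open>F3\<close> adds the contributions of two edges; at an interior point of
      one edge that of the other is evaluated outside its interval, where it is 0.\<close>
    have W_T: "indicator {0<..<l 1} x * w1 T x = h 1 x" "indicator {0<..<l 2} x * w2 T x = h 2 x"
      "indicator {0<..<l 3} x * w3 T x = h 3 x" for x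
    proof -
      show "indicator {0<..<l 1} x * w1 T x = h 1 x"
        using tg3(1)[of "l 3 + x"] hz[OF j3(1), of x] hz[OF j3(3), of "- x"] l
        by (cases "x \<in> {0<..<l 1}") (auto simp: w1_def F3_def L_def)
      show "indicator {0<..<l 2} x * w2 T x = h 2 x"
        using tg2(1)[of "l 2 - x"] hz[OF j3(2), of x] l
        by (cases "x \<in> {0<..<l 2}") (auto simp: w2_def F2_def)
      show "indicator {0<..<l 3} x * w3 T x = h 3 x"
        using tg3(1)[of "l 3 - x"] hz[OF j3(3), of x] hz[OF j3(1), of "- x"] l
        by (cases "x \<in> {0<..<l 3}") (auto simp: w3_def F3_def L_def)
    qed
    have V_T: "v1 T x = k 1 x" if "x \<in> {0<..<l 1}" for x
      using tg3(2)[of "l 3 + x"] kz[OF j3(3), of "- x"] l that by (auto simp: v1_def S3_def L_def)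
    have V_T2: "v2 T x = k 2 x" if "x \<in> {0<..<l 2}" for x
      using tg2(2)[of "l 2 - x"] l that by (auto simp: v2_def S2_def)
    have V_T3: "v3 T x = k 3 x" if "x \<in> {0<..<l 3}" for x
      using tg3(2)[of "l 3 - x"] kz[OF j3(1), of "- x"] l that by (auto simp: v3_def S3_def L_def)
    have W_0: "indicator {0<..<l 1} x * w1 0 x = 0" "indicator {0<..<l 2} x * w2 0 x = 0"
      "indicator {0<..<l 3} x * w3 0 x = 0" for x
    proof -
      show "indicator {0<..<l 1} x * w1 0 x = 0"
        using tg3(3)[of "l 3 + x"] l by (cases "x \<in> {0<..<l 1}") (auto simp: w1_def L_def)
      show "indicator {0<..<l 2} x * w2 0 x = 0"
        using tg2(3)[of "l 2 - x"] l by (cases "x \<in> {0<..<l 2}") (auto simp: w2_def)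
      show "indicator {0<..<l 3} x * w3 0 x = 0"
        using tg3(3)[of "l 3 - x"] l by (cases "x \<in> {0<..<l 3}") (auto simp: w3_def L_def)
    qed
    have V_0: "v1 0 x = 0" if "x \<in> {0<..<l 1}" for x
      using tg3(4)[of "l 3 + x"] l that by (auto simp: v1_def L_def)
    have V_02: "v2 0 x = 0" if "x \<in> {0<..<l 2}" for x
      using tg2(4)[of "l 2 - x"] l that by (auto simp: v2_def)
    have V_03: "v3 0 x = 0" if "x \<in> {0<..<l 3}" for x
      using tg3(4)[of "l 3 - x"] l that by (auto simp: v3_def L_def)

    have end2: "u2 t (l 2) = 0" and end3: "u3 t (l 3) = 0" for t
      by (simp_all add: u2_def u3_def s2.Y_start s3.Y_start)
    have kirchhoff: "u1 t 0 + u2 t 0 + u3 t 0 = 0" for t by (simp add: u1_def u2_def u3_def g_def)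

    have a1: "ac_rep (l 1) (u1 T) (h 1)" and a2: "ac_rep (l 2) (u2 T) (h 2)" and a3: "ac_rep (l 3) (u3 T) (h 3)"
      using edge_wave.u_ac[OF e1, of T] edge_wave.u_ac[OF e2, of T] edge_wave.u_ac[OF e3, of T] unfolding W_T by simp_all
    \<comment> \<open>Equal derivatives leave one value to compare: on the edges 2 and 3 that at the
      boundary vertex, where both functions vanish.\<close>
    have U_T2: "u2 T x = \<phi> 2 x" if "x \<in> {0..l 2}" for x
      by (rule ac_rep_eqI[OF a2 h[OF j3(2)] _ _ that, of "l 2"]) (use l end2 phi_l[OF j3(2)] in auto)
    have U_T3: "u3 T x = \<phi> 3 x" if "x \<in> {0..l 3}" for x
      by (rule ac_rep_eqI[OF a3 h[OF j3(3)] _ _ that, of "l 3"]) (use l end3 phi_l[OF j3(3)] in auto)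
    \<comment> \<open>At the boundary vertex 1 the value is not prescribed in advance, as the
      control is read off there. The comparison starts at the centre instead, where the vanishing
      sum, valid for both states, gives the value.\<close>
    have U_T1: "u1 T x = \<phi> 1 x" if "x \<in> {0..l 1}" for x
    proof (rule ac_rep_eqI[OF a1 h[OF j3(1)] _ _ that, of 0])
      show "u1 T 0 = \<phi> 1 0" using kirchhoff[of T] phi_0 U_T2[of 0] U_T3[of 0] l by simp
    qed (use l in simp)
    have z0: "ac_rep b (\<lambda>_. 0) (\<lambda>_. 0)" for b by (simp add: ac_rep_def prim_def)
    have b1: "ac_rep (l 1) (u1 0) (\<lambda>_. 0)" and b2: "ac_rep (l 2) (u2 0) (\<lambda>_. 0)" and b3: "ac_rep (l 3) (u3 0) (\<lambda>_. 0)"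
      using edge_wave.u_ac[OF e1, of 0] edge_wave.u_ac[OF e2, of 0] edge_wave.u_ac[OF e3, of 0] unfolding W_0 by simp_all
    have U_02: "u2 0 x = 0" if "x \<in> {0..l 2}" for x
      by (rule ac_rep_eqI[OF b2 z0 _ _ that, of "l 2"]) (use l end2 in auto)
    have U_03: "u3 0 x = 0" if "x \<in> {0..l 3}" for x
      by (rule ac_rep_eqI[OF b3 z0 _ _ that, of "l 3"]) (use l end3 in auto)
    have U_01: "u1 0 x = 0" if "x \<in> {0..l 1}" for x
    proof (rule ac_rep_eqI[OF b1 z0 _ _ that, of 0])
      show "u1 0 0 = 0" using kirchhoff[of 0] U_02[of 0] U_03[of 0] l by simp
    qed (use l in simp)

    define f1 where "f1 t = u1 t (l 1)" for t
    define f2 where "f2 t = w2 t 0 - w1 t 0" for t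
    define U where "U j = (if j = 1 then u1 else if j = 2 then u2 else u3)" for j :: nat
    define W where "W j = (if j = 1 then w1 else if j = 2 then w2 else w3)" for j :: nat
    define V where "V j = (if j = 1 then v1 else if j = 2 then v2 else v3)" for j :: nat
    define N where "N j = (if j = 2 then s2.time_bound else s3.time_bound)" for j :: nat
    have w1s: "square_integrable (\<lambda>t. w1 t 0)" "energy (\<lambda>t. w1 t 0) \<le> s3.time_bound"
      using s3.slope_square[of "l 3"] s3.time_bounds(1)[of "l 3"] l square_integrable_uminus[of "s3.slope (l 3)"]
      by (simp_all add: w1_def L_def)
    have w2s: "square_integrable (\<lambda>t. w2 t 0)" "energy (\<lambda>t. w2 t 0) \<le> s2.time_bound"
      using s2.slope_square[of "l 2"] s2.time_bounds(1)[of "l 2"] l square_integrable_uminus[of "s2.slope (l 2)"]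
      by (simp_all add: w2_def)
    have sol: "weak_solution l q T f1 f2 (\<lambda>t j. U j t) (\<lambda>t j. V j t)"
    proof (rule weak_solution_edges[where W=W and N=N])
      show "edge_wave (l j) (q j) (U j) (W j) (V j) (N j)" if "j \<in> {1,2,3}" for j
        using that e1 e2 e3 by (auto simp: U_def W_def V_def N_def)
      show "U j 0 x = 0" if "j \<in> {1,2,3}" "x \<in> {0..l j}" for j x
        using that U_01 U_02 U_03 by (auto simp: U_def)
      show "V j 0 x = 0" if "j \<in> {1,2,3}" "x \<in> {0<..<l j}" for j x
        using that V_0 V_02 V_03 by (auto simp: V_def)
      show "W 3 t 0 = W 1 t 0" for t by (simp add: W_def w1_def w3_def)
    qed (use end2 end3 kirchhoff w1s w2s in \<open>simp_all add: U_def W_def f1_def f2_def\<close>)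

    let ?I = "indicator {0<..<T} :: real \<Rightarrow> real"
    \<comment> \<open>\<open>L\<close> lies beyond the jump, so the trace of \<open>u1\<close> is
      that of \<open>- U\<close> and not of \<open>- Y\<close>; its derivative is the velocity on
      the line \<open>s = L\<close>, whose energy is bounded uniformly in \<open>T\<close>.\<close>
    have f1U: "f1 t = - s3.U (L, t)" for t using l by (simp add: f1_def u1_def s3.with_jump_def L_def)
    have f1_ac: "ac_rep T f1 (\<lambda>t. ?I t * (- s3.vel L t))"
      unfolding ac_rep_def
    proof (intro conjI allI impI ballI)
      show "square_integrable (\<lambda>t. ?I t * (- s3.vel L t))"
        by (intro square_integrable_indicator(1) square_integrable_uminus s3.vel_square) (use Lp in auto)
      fix t assume t: "t \<in> {0..T}"
      have vi: "integrable lborel (s3.vel L)" by (rule s3.vel_integrable) (use Lp in simp)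
      have "prim (\<lambda>t. ?I t * (- s3.vel L t)) t = (LINT y|lborel. indicator {0<..<t} y * (- s3.vel L y))"
        by (rule prim_indicator_interval[OF _ t]) (use vi in \<open>auto intro!: integrable_indicator\<close>)
      also have "\<dots> = - (prim (s3.vel L) t - prim (s3.vel L) 0)"
        using prim_diff_open[OF vi, of 0 t] t by simp
      finally have pv: "prim (\<lambda>t. ?I t * (- s3.vel L t)) t = - (prim (s3.vel L) t - prim (s3.vel L) 0)" .
      have ut: "s3.U (L, t) = s3.U (L, 0) + (prim (s3.vel L) t - prim (s3.vel L) 0)"
        by (rule s3.U_time) (use Lp in simp)
      show "f1 t = f1 0 + prim (\<lambda>t. ?I t * (- s3.vel L t)) t"
        unfolding pv f1U using ut by linarith
    qed simp
    \<comment> \<open>Both endpoint conditions come from the states: rest at time 0, and at time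
      \<open>T\<close> a target that vanishes at the boundary vertex 1.\<close>
    have f1_space: "f1 \<in> H10_space T"
    proof -
      have "f1 0 = 0" unfolding f1_def using U_01[of "l 1"] l by simp
      moreover have "f1 T = 0" unfolding f1_def using U_T1[of "l 1"] phi_l[OF j3(1)] l by simp
      ultimately show ?thesis using ac_rep_has_weak_deriv(2)[OF Tp f1_ac] by (simp add: H10_space_def)
    qed
    have f2s: "square_integrable f2"
      using square_integrable_diff[OF w2s(1) w1s(1)] by (simp add: f2_def[abs_def])
    have f2_rep: "interval_rep T f2 (\<lambda>t. ?I t * f2 t)"
      by (rule interval_rep_indicator) (rule square_integrable_measurable[OF square_integrable_indicator(1)[OF f2s]], simp)
    have f2_space: "f2 \<in> L2_space T"
      using L2_space_rep[OF f2_rep] square_integrable_indicator(1)[OF f2s, of "{0<..<T}"] by simp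
    have f2_norm: "L2_norm T f2 \<le> sqrt R * NN"
    proof -
      have "energy (\<lambda>t. ?I t * f2 t) \<le> energy f2" by (rule square_integrable_indicator(2)[OF f2s]) simp
      also have "\<dots> \<le> 2 * energy (\<lambda>t. w2 t 0) + 2 * energy (\<lambda>t. w1 t 0)"
        unfolding f2_def by (rule energy_diff_le[OF w2s(1) w1s(1)])
      also have "\<dots> \<le> 2 * (C2 * EE) + 2 * (C3 * c * EE)" using w2s(2) w1s(2) tb2 tb3 by linarith
      also have "\<dots> = R * EE" by (simp add: R_def algebra_simps)
      also have "\<dots> \<le> R * NN\<^sup>2" by (rule mult_left_mono[OF EN R0])
      finally have "sqrt (energy (\<lambda>t. ?I t * f2 t)) \<le> sqrt (R * NN\<^sup>2)" by (rule real_sqrt_le_mono)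
      then show ?thesis unfolding L2_norm_rep[OF f2_rep] using NN0 by (simp add: real_sqrt_mult)
    qed
    have f1_norm: "H1_norm T f1 \<le> sqrt R * NN"
    proof -
      have v: "square_integrable (s3.vel L)" "energy (s3.vel L) \<le> s3.time_bound"
        using s3.vel_square[of L] s3.time_bounds(2)[of L] Lp by auto
      have uu: "square_integrable (\<lambda>t. s3.U (L, t))" "energy (\<lambda>t. s3.U (L, t)) \<le> s3.time_bound"
        using s3.weighted_slice_square[OF s3.U_w, of L] s3.time_bounds(3)[of L] Lp by auto
      have 1: "(L2_norm T (weak_deriv T f1))\<^sup>2 \<le> s3.time_bound"
      proof -
        have "(L2_norm T (weak_deriv T f1))\<^sup>2 = energy (\<lambda>t. ?I t * (- s3.vel L t))"
          using L2_norm_rep[OF weak_deriv_rep[OF Tp f1_ac]] by simp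
        also have "\<dots> \<le> energy (\<lambda>t. - s3.vel L t)"
          by (rule square_integrable_indicator(2)[OF square_integrable_uminus[OF v(1)]]) simp
        finally show ?thesis using v(2) by simp
      qed
      have 2: "(L2_norm T f1)\<^sup>2 \<le> s3.time_bound"
      proof -
        have "(L2_norm T f1)\<^sup>2 = energy (\<lambda>t. ?I t * f1 t)"
          using L2_norm_rep[OF interval_rep_continuous[OF ac_rep_continuous[OF f1_ac]]] by simp
        also have "\<dots> \<le> energy f1"
          by (rule square_integrable_indicator(2)) (use square_integrable_uminus[OF uu(1)] in \<open>simp_all add: f1U[abs_def]\<close>)
        also have "\<dots> = energy (\<lambda>t. s3.U (L, t))" unfolding f1U[abs_def] by simp
        finally show ?thesis using uu(2) by simp
      qed
      have "(L2_norm T (weak_deriv T f1))\<^sup>2 + (L2_norm T f1)\<^sup>2 \<le> 2 * (C3 * c * EE)" using 1 2 tb3 by linarith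
      \<comment> \<open>Enlarged in order to have one constant \<open>R\<close> for both
        controls.\<close>
      also have "\<dots> \<le> 2 * (C2 * EE) + 2 * (C3 * c * EE)"
        using C2(1) EE energy_nonneg[of "h 1"] energy_nonneg[of "h 2"] energy_nonneg[of "h 3"]
          energy_nonneg[of "k 1"] energy_nonneg[of "k 2"] energy_nonneg[of "k 3"] by simp
      also have "\<dots> = R * EE" by (simp add: R_def algebra_simps)
      also have "\<dots> \<le> R * NN\<^sup>2" by (rule mult_left_mono[OF EN R0])
      finally have "H1_norm T f1 \<le> sqrt (R * NN\<^sup>2)" unfolding H1_norm_def by (rule real_sqrt_le_mono)
      then show ?thesis using NN0 by (simp add: real_sqrt_mult)
    qed
    have target: "\<forall>j\<in>{1,2,3}. (\<forall>x\<in>{0..l j}. U j T x = \<phi> j x) \<and> (AE x in lebesgue. x \<in> {0<..<l j} \<longrightarrow> V j T x = \<psi> j x)"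
    proof (intro ballI conjI)
      fix j :: nat assume j: "j \<in> {1,2,3}"
      show "U j T x = \<phi> j x" if "x \<in> {0..l j}" for x using j that U_T1 U_T2 U_T3 by (auto simp: U_def)
      have "V j T x = k j x" if "x \<in> {0<..<l j}" for x using j that V_T V_T2 V_T3 by (auto simp: V_def)
      then show "AE x in lebesgue. x \<in> {0<..<l j} \<longrightarrow> V j T x = \<psi> j x"
        using interval_rep_AE[OF k[OF j]] by (auto elim!: eventually_mono)
    qed
    have "H1_norm T f1 + L2_norm T f2 \<le> 2 * sqrt R * NN" using f1_norm f2_norm by linarith
    then have norm: "H1_norm T f1 + L2_norm T f2 \<le> 2 * sqrt R * (graph_H1_norm l \<phi> + graph_L2_norm l \<psi>)"
      by (simp only: NN_def)
    show "\<exists>f1 \<in> H10_space T. \<exists>f2 \<in> L2_space T. \<exists>u v.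
             weak_solution l q T f1 f2 u v \<and>
             (\<forall>j\<in>{1,2,3}. (\<forall>x\<in>{0..l j}. u T j x = \<phi> j x) \<and>
                           (AE x in lebesgue. x \<in> {0<..<l j} \<longrightarrow> v T j x = \<psi> j x)) \<and>
             H1_norm T f1 + L2_norm T f2 \<le> 2 * sqrt R * (graph_H1_norm l \<phi> + graph_L2_norm l \<psi>)"
      by (rule bexI[OF _ f1_space], rule bexI[OF _ f2_space], rule exI[of _ "\<lambda>t j. U j t"],
          rule exI[of _ "\<lambda>t j. V j t"], intro conjI, rule sol, rule target, rule norm)
  qed
qed
end
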